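(* Let $\Lambda$ be a ring with involution over which the rank of finitely generated free modules is well-defined, and let $n\ge 0$. The cobordism group $L_{2n+1}(\Lambda)$ of $(2n+1)$-complexes over $\Lambda$ is naturally isomorphic (via the correspondence sending a $(2n+1)$-complex $(C,\psi)$ to the $(-1)^n$-quadratic formation $(H_{(-1)^n}(C_{n+1});C_{n+1},\mathrm{im}(\binom{\psi_0}{d^*}:C^n\to C_{n+1}\oplus C^{n+1}))$) to the abelian group of equivalence classes of $(-1)^n$-quadratic formations over $\Lambda$, subject to the equivalence relation: $(Q,\phi;F,G)\sim(Q',\phi';F',G')$ if there exists a stable isomorphism $$[f]:(Q,\phi;F,G)\oplus(Q',-\phi';F',G')\cong\partial(K,\lambda,\mu)$$ for some $(-1)^{n+1}$-quadratic form $(K,\lambda,\mu)$ over $\Lambda$ with $K$ finitely generated free; here addition and inverses are given by $$(Q,\phi;F,G)+(Q',\phi';F',G')=(Q\oplus Q',\phi\oplus\phi';F\oplus F',G\oplus G'),\qquad -(Q,\phi;F,G)=(Q,-\phi;F,G).$$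
   Context: Rings and duals: $\Lambda$ is an associative ring with $1$ and an involution $a\mapsto\bar a$ (additive, $\overline{ab}=\bar b\,\bar a$, $\bar{\bar a}=a$, $\bar 1=1$). Modules are left modules. $K^*=\mathrm{Hom}_\Lambda(K,\Lambda)$ is a left module by $(af)(x)=f(x)\bar a$; $f^*$ is the dual of a morphism $f$; $K^{**}=K$ for $K$ f.g. projective via $x\mapsto(f\mapsto\overline{f(x)})$. f.g. = finitely generated. Forms ($\epsilon=\pm1$): $S(K)=\mathrm{Hom}_\Lambda(K,K^* )$, where $\psi\in S(K)$ is also the pairing $\psi(x,y)=\psi(x)(y)$, with $\psi(ax,by)=b\psi(x,y)\bar a$; $Q_\epsilon(K)=S(K)/\{\chi-\epsilon\chi^*\}$; $Q_\epsilon(\Lambda)=\Lambda/\{a-\epsilon\bar a\}$. An $\epsilon$-quadratic form $(K,\lambda,\mu)$ on a f.g. projective $K$: $\lambda\in S(K)$ with $\lambda(x,y)=\epsilon\overline{\lambda(y,x)}$ and $\mu:K\to Q_\epsilon(\Lambda)$ with $\mu(x+y)-\mu(x)-\mu(y)=\lambda(x,y)\in Q_\epsilon(\Lambda)$, $\mu(x)+\epsilon\overline{\mu(x)}=\lambda(x,x)\in\Lambda$, $\mu(ax)=a\mu(x)\bar a$. Equivalently it is a class $\phi\in Q_\epsilon(K)$, via $\lambda=\phi+\epsilon\phi^*$, $\mu(x)=\phi(x,x)$. It is nonsingular if $\lambda:K\to K^*$ is an isomorphism. Isomorphisms of forms are module isomorphisms preserving $\lambda$ and $\mu$. $H_\epsilon(L)$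 is the hyperbolic form on $L\oplus L^*$ with $\lambda((x,f),(y,g))=f(y)+\epsilon\overline{g(x)}$, $\mu(x,f)=f(x)$. A lagrangian of a nonsingular form $(K,\lambda,\mu)$ is a direct summand $L\subseteq K$ with $\mu(L)=0$ and $L=L^\perp=\{x\in K:\lambda(x,y)=0\ \forall y\in L\}$. Formations: an $\epsilon$-quadratic formation $(Q,\phi;F,G)$ is a nonsingular $\epsilon$-quadratic form $(Q,\phi)$ with an ordered pair of lagrangians $F,G$, where $Q,F,G$ are f.g. free. An isomorphism is an isomorphism of forms carrying $F$ to $F'$ and $G$ to $G'$. A formation is trivial if isomorphic to $(H_\epsilon(L);L,L^* )$ with $L$ f.g. free. A stable isomorphism of formations is an isomorphism after adding (by $\oplus$) a trivial formation to each side. The boundary of a $(-\epsilon)$-quadratic form $(K,\lambda,\mu)$ (possibly singular), $K$ f.g. free, is $\partial(K,\lambda,\mu)=(H_\epsilon(K);K,\Gamma_{(K,\lambda)})$ with $\Gamma_{(K,\lambda)}=\{(x,\lambda(x)):x\in K\}\subset K\oplus K^*$. Complexes: a $(2n+1)$-complex $(C,\psi)$ over $\Lambda$ is a chain complex $d:C_{n+1}\to C_n$ of f.g. free modules ($C_r=0$ for $r\neq n,n+1$; $C^r=(C_r)^*$) with morphisms $\psi_0:C^n\to C_{n+1}$, $\psi_1:C^n\to C_n$ such that $d\psi_0+\psi_1+(-1)^{n+1}\psi_1^*=0$ and such that the chain map given by $\psi_0:C^n\to C_{n+1}$, $\psi_0^*:C^{n+1}\to C_n$ from $((-1)^{n+1}d^*:C^n\to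 C^{n+1})$ to $(d:C_{n+1}\to C_n)$ is a chain equivalence. Cobordism: a cobordism from $(C,\psi)$ to $(C',\psi')$ is $((j\ j'):C\oplus C'\to D,(\delta\psi,\psi\oplus-\psi'))$ with $D_{n+1}$ f.g. free ($D_r=0$ for $r\ne n+1$, $D^{n+1}=(D_{n+1})^*$), morphisms $j:C_{n+1}\to D_{n+1}$, $j':C'_{n+1}\to D_{n+1}$, $\delta\psi_0:D^{n+1}\to D_{n+1}$, such that $$\begin{pmatrix}d&0&\psi_0^*j^*\\0&d'^*&j'^*\\(-1)^{n+1}j&-j'\psi'_0&\delta\psi_0+(-1)^{n+1}\delta\psi_0^*\end{pmatrix}:C_{n+1}\oplus C'^n\oplus D^{n+1}\to C_n\oplus C'^{n+1}\oplus D_{n+1}$$ is an isomorphism. Cobordism is an equivalence relation; $L_{2n+1}(\Lambda)$ is the abelian group of cobordism classes, with $(C,\psi)+(C',\psi')=(C\oplus C',\psi\oplus\psi')$ and $-(C,\psi)=(C,-\psi)$. *)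

theory Defs
  imports "HOL-Algebra.Group" "HOL-Library.Function_Algebras" "HOL-Library.Product_Plus"
begin

section \<open>Rings with involution, left modules, duals\<close>

class ring_involution = ring_1 +
  fixes bar :: "'a \<Rightarrow> 'a"
  assumes bar_add: "bar (a + b) = bar a + bar b"
    and bar_mult: "bar (a * b) = bar b * bar a"
    and bar_bar: "bar (bar a) = a"
    and bar_one: "bar 1 = 1"

text \<open>A module is a carrier in an ambient abelian group (the addition of the module is the ambient
  one) together with a scalar multiplication, which is only meaningful on the carrier. The modules
  of HOL and of HOL-Algebra have commutative scalars, so they cannot be used here.\<close>

record ('r, 'm) lmodule = "'m partial_object" +
  scale :: "'r \<Rightarrow> 'm \<Rightarrow> 'm"

locale left_module =
  fixes M :: "('r::ring_1, 'm::ab_group_add) lmodule"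
  assumes zero_closed: "0 \<in> carrier M"
    and add_closed: "\<lbrakk>x \<in> carrier M; y \<in> carrier M\<rbrakk> \<Longrightarrow> x + y \<in> carrier M"
    and scale_closed: "x \<in> carrier M \<Longrightarrow> scale M a x \<in> carrier M"
    and scale_add_right: "\<lbrakk>x \<in> carrier M; y \<in> carrier M\<rbrakk> \<Longrightarrow>
          scale M a (x + y) = scale M a x + scale M a y"
    and scale_add_left: "x \<in> carrier M \<Longrightarrow> scale M (a + b) x = scale M a x + scale M b x"
    and scale_scale: "x \<in> carrier M \<Longrightarrow> scale M a (scale M b x) = scale M (a * b) x"
    and scale_one: "x \<in> carrier M \<Longrightarrow> scale M 1 x = x"

definition is_basis :: "('r::ring_1, 'm::ab_group_add) lmodule \<Rightarrow> 'm set \<Rightarrow> bool" where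
  "is_basis M B \<longleftrightarrow> finite B \<and> B \<subseteq> carrier M \<and>
     (\<forall>x\<in>carrier M. \<exists>!c. (\<forall>b. b \<notin> B \<longrightarrow> c b = 0) \<and> x = (\<Sum>b\<in>B. scale M (c b) b))"

definition fg_free :: "('r::ring_1, 'm::ab_group_add) lmodule \<Rightarrow> bool" where
  "fg_free M \<longleftrightarrow> left_module M \<and> (\<exists>B. is_basis M B)"

text \<open>Every f.g. free module is isomorphic to one whose carrier lies in \<open>nat \<Rightarrow> 'r\<close>, namely to some
  module of functions vanishing outside \<open>{..<k}\<close>. This type is therefore used wherever
  a type has to be chosen to quantify over all f.g. free modules, or to form the set of all
  complexes or formations.\<close>

type_synonym 'r univ = "nat \<Rightarrow> 'r"

definition rank_well_defined :: "'r::ring_1 itself \<Rightarrow> bool" where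
  "rank_well_defined (_ :: 'r itself) \<longleftrightarrow>
     (\<forall>(M :: ('r, 'r univ) lmodule) B B'.
        left_module M \<longrightarrow> is_basis M B \<longrightarrow> is_basis M B' \<longrightarrow> card B = card B')"

text \<open>Morphisms are only meaningful on the carrier of their domain, and are compared only there.\<close>

definition is_hom :: "('r::ring_1, 'm::ab_group_add) lmodule \<Rightarrow> ('r, 'n::ab_group_add) lmodule
    \<Rightarrow> ('m \<Rightarrow> 'n) \<Rightarrow> bool" where
  "is_hom M N f \<longleftrightarrow> (\<forall>x\<in>carrier M. f x \<in> carrier N) \<and>
     (\<forall>x\<in>carrier M. \<forall>y\<in>carrier M. f (x + y) = f x + f y) \<and>
     (\<forall>a. \<forall>x\<in>carrier M. f (scale M a x) = scale N a (f x))"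

definition is_iso :: "('r::ring_1, 'm::ab_group_add) lmodule \<Rightarrow> ('r, 'n::ab_group_add) lmodule
    \<Rightarrow> ('m \<Rightarrow> 'n) \<Rightarrow> bool" where
  "is_iso M N f \<longleftrightarrow> is_hom M N f \<and> bij_betw f (carrier M) (carrier N)"

definition ring_module :: "('r::ring_1, 'r) lmodule" where
  "ring_module = \<lparr>carrier = UNIV, scale = (*)\<rparr>"

definition zero_module :: "('r::ring_1, 'm::ab_group_add) lmodule" where
  "zero_module = \<lparr>carrier = {0}, scale = (\<lambda>a x. 0)\<rparr>"

definition dsum :: "('r::ring_1, 'm::ab_group_add) lmodule \<Rightarrow> ('r, 'n::ab_group_add) lmodule
    \<Rightarrow> ('r, 'm \<times> 'n) lmodule" (infixr \<open>\<boxplus>\<close> 65) where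
  "M \<boxplus> N = \<lparr>carrier = carrier M \<times> carrier N, scale = (\<lambda>a (x, y). (scale M a x, scale N a y))\<rparr>"

definition submod :: "('r::ring_1, 'm::ab_group_add) lmodule \<Rightarrow> 'm set \<Rightarrow> ('r, 'm) lmodule" where
  "submod M S = \<lparr>carrier = S, scale = scale M\<rparr>"

definition is_submodule :: "('r::ring_1, 'm::ab_group_add) lmodule \<Rightarrow> 'm set \<Rightarrow> bool" where
  "is_submodule M S \<longleftrightarrow> S \<subseteq> carrier M \<and> left_module (submod M S)"

definition direct_summand :: "('r::ring_1, 'm::ab_group_add) lmodule \<Rightarrow> 'm set \<Rightarrow> bool" where
  "direct_summand M S \<longleftrightarrow> is_submodule M S \<and>
     (\<exists>T. is_submodule M T \<and> S \<inter> T = {0} \<and> (\<forall>x\<in>carrier M. \<exists>s\<in>S. \<exists>t\<in>T. x = s + t))"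

definition zero_outside :: "'m set \<Rightarrow> ('m \<Rightarrow> 'b::zero) \<Rightarrow> 'm \<Rightarrow> 'b" where
  "zero_outside S f = (\<lambda>x. if x \<in> S then f x else 0)"

text \<open>Elements of a dual module vanish outside the carrier, so that equality in the dual module is
  equality of functions.\<close>

definition dual :: "('r::ring_involution, 'm::ab_group_add) lmodule \<Rightarrow> ('r, 'm \<Rightarrow> 'r) lmodule" where
  "dual M = \<lparr>carrier = {f. is_hom M ring_module f \<and> (\<forall>x. x \<notin> carrier M \<longrightarrow> f x = 0)},
             scale = (\<lambda>a f x. f x * bar a)\<rparr>"

definition dual_map :: "('r::ring_involution, 'm::ab_group_add) lmodule \<Rightarrow> ('m \<Rightarrow> 'n)
    \<Rightarrow> ('n \<Rightarrow> 'r) \<Rightarrow> ('m \<Rightarrow> 'r)" where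
  "dual_map M f = (\<lambda>g. zero_outside (carrier M) (g \<circ> f))"

definition eval_bidual :: "('r::ring_involution, 'm::ab_group_add) lmodule
    \<Rightarrow> 'm \<Rightarrow> ('m \<Rightarrow> 'r) \<Rightarrow> 'r" where
  "eval_bidual M x = zero_outside (carrier (dual M)) (\<lambda>f. bar (f x))"

text \<open>For \<open>f : M\<^sup>* \<rightarrow> N\<close> this is the dual \<open>f\<^sup>* : N\<^sup>* \<rightarrow> M\<^sup>*\<^sup>*\<close> followed by the identification of
  \<open>M\<^sup>*\<^sup>*\<close> with \<open>M\<close>, for f.g. free \<open>M\<close>.\<close>

definition codual_map :: "('r::ring_involution, 'm::ab_group_add) lmodule
    \<Rightarrow> (('m \<Rightarrow> 'r) \<Rightarrow> 'n) \<Rightarrow> ('n \<Rightarrow> 'r) \<Rightarrow> 'm" where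
  "codual_map M f = (\<lambda>g. inv_into (carrier M) (eval_bidual M) (dual_map (dual M) f g))"


section \<open>Quadratic forms\<close>

text \<open>The class of \<open>a\<close> in \<open>Q\<^sub>\<epsilon>(\<Lambda>)\<close>, as a coset. The sign \<open>\<epsilon>\<close> is always a ring element \<open>1\<close> or \<open>-1\<close>.\<close>

definition Qcls :: "'r::ring_involution \<Rightarrow> 'r \<Rightarrow> 'r set" where
  "Qcls \<epsilon> a = {a + (c - \<epsilon> * bar c) | c. True}"

record ('r, 'm) qform =
  fmod :: "('r, 'm) lmodule"
  lam :: "'m \<Rightarrow> 'm \<Rightarrow> 'r"
  mu :: "'m \<Rightarrow> 'r set"

text \<open>Only forms on f.g. free modules are needed for formations and their boundaries.\<close>

definition quadratic_form :: "'r::ring_involution \<Rightarrow> ('r, 'm::ab_group_add) qform \<Rightarrow> bool" where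
  "quadratic_form \<epsilon> K \<longleftrightarrow> fg_free (fmod K) \<and> is_hom (fmod K) (dual (fmod K)) (lam K) \<and>
     (\<forall>x\<in>carrier (fmod K). \<forall>y\<in>carrier (fmod K). lam K x y = \<epsilon> * bar (lam K y x)) \<and>
     (\<forall>x\<in>carrier (fmod K). mu K x \<in> range (Qcls \<epsilon>)) \<and>
     (\<forall>x\<in>carrier (fmod K). \<forall>y\<in>carrier (fmod K). \<forall>a\<in>mu K x. \<forall>b\<in>mu K y.
        mu K (x + y) = Qcls \<epsilon> (a + b + lam K x y)) \<and>
     (\<forall>x\<in>carrier (fmod K). \<forall>a\<in>mu K x. a + \<epsilon> * bar a = lam K x x) \<and>
     (\<forall>x\<in>carrier (fmod K). \<forall>a. \<forall>b\<in>mu K x. mu K (scale (fmod K) a x) = Qcls \<epsilon> (a * b * bar a))"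

definition nonsingular :: "('r::ring_involution, 'm::ab_group_add) qform \<Rightarrow> bool" where
  "nonsingular K \<longleftrightarrow> is_iso (fmod K) (dual (fmod K)) (lam K)"

definition form_iso :: "('r::ring_involution, 'm::ab_group_add) qform
    \<Rightarrow> ('r, 'n::ab_group_add) qform \<Rightarrow> ('m \<Rightarrow> 'n) \<Rightarrow> bool" where
  "form_iso K K' f \<longleftrightarrow> is_iso (fmod K) (fmod K') f \<and>
     (\<forall>x\<in>carrier (fmod K). \<forall>y\<in>carrier (fmod K). lam K' (f x) (f y) = lam K x y) \<and>
     (\<forall>x\<in>carrier (fmod K). mu K' (f x) = mu K x)"

definition form_sum :: "('r::ring_involution, 'm::ab_group_add) qform
    \<Rightarrow> ('r, 'n::ab_group_add) qform \<Rightarrow> ('r, 'm \<times> 'n) qform" where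
  "form_sum K K' = \<lparr>fmod = fmod K \<boxplus> fmod K',
     lam = (\<lambda>(x, x'). zero_outside (carrier (fmod K \<boxplus> fmod K'))
              (\<lambda>(y, y'). lam K x y + lam K' x' y')),
     mu = (\<lambda>(x, x'). {a + a' | a a'. a \<in> mu K x \<and> a' \<in> mu K' x'})\<rparr>"

definition form_neg :: "('r::ring_involution, 'm::ab_group_add) qform \<Rightarrow> ('r, 'm) qform" where
  "form_neg K = \<lparr>fmod = fmod K, lam = (\<lambda>x y. - lam K x y), mu = (\<lambda>x. uminus ` mu K x)\<rparr>"

definition hyperbolic :: "'r::ring_involution \<Rightarrow> ('r, 'm::ab_group_add) lmodule
    \<Rightarrow> ('r, 'm \<times> ('m \<Rightarrow> 'r)) qform" where
  "hyperbolic \<epsilon> L = \<lparr>fmod = L \<boxplus> dual L,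
     lam = (\<lambda>(x, f). zero_outside (carrier (L \<boxplus> dual L)) (\<lambda>(y, g). f y + \<epsilon> * bar (g x))),
     mu = (\<lambda>(x, f). Qcls \<epsilon> (f x))\<rparr>"

definition lagrangian :: "'r::ring_involution \<Rightarrow> ('r, 'm::ab_group_add) qform \<Rightarrow> 'm set \<Rightarrow> bool" where
  "lagrangian \<epsilon> K L \<longleftrightarrow> direct_summand (fmod K) L \<and> (\<forall>x\<in>L. mu K x = Qcls \<epsilon> 0) \<and>
     L = {x \<in> carrier (fmod K). \<forall>y\<in>L. lam K x y = 0}"


section \<open>Formations\<close>

record ('r, 'm) formation =
  qf :: "('r, 'm) qform"
  lag1 :: "'m set"
  lag2 :: "'m set"

definition is_formation :: "'r::ring_involution \<Rightarrow> ('r, 'm::ab_group_add) formation \<Rightarrow> bool" where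
  "is_formation \<epsilon> X \<longleftrightarrow> quadratic_form \<epsilon> (qf X) \<and> nonsingular (qf X) \<and>
     lagrangian \<epsilon> (qf X) (lag1 X) \<and> lagrangian \<epsilon> (qf X) (lag2 X) \<and>
     fg_free (fmod (qf X)) \<and>
     fg_free (submod (fmod (qf X)) (lag1 X)) \<and> fg_free (submod (fmod (qf X)) (lag2 X))"

definition formation_isomorphic :: "('r::ring_involution, 'm::ab_group_add) formation
    \<Rightarrow> ('r, 'n::ab_group_add) formation \<Rightarrow> bool" where
  "formation_isomorphic X Y \<longleftrightarrow>
     (\<exists>f. form_iso (qf X) (qf Y) f \<and> f ` lag1 X = lag1 Y \<and> f ` lag2 X = lag2 Y)"

definition formation_sum :: "('r::ring_involution, 'm::ab_group_add) formation
    \<Rightarrow> ('r, 'n::ab_group_add) formation \<Rightarrow> ('r, 'm \<times> 'n) formation" where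
  "formation_sum X Y =
     \<lparr>qf = form_sum (qf X) (qf Y), lag1 = lag1 X \<times> lag1 Y, lag2 = lag2 X \<times> lag2 Y\<rparr>"

definition formation_neg :: "('r::ring_involution, 'm::ab_group_add) formation
    \<Rightarrow> ('r, 'm) formation" where
  "formation_neg X = X\<lparr>qf := form_neg (qf X)\<rparr>"

definition trivial_formation :: "'r::ring_involution \<Rightarrow> ('r, 'm::ab_group_add) formation \<Rightarrow> bool" where
  "trivial_formation \<epsilon> X \<longleftrightarrow> is_formation \<epsilon> X \<and>
     (\<exists>L :: ('r, 'r univ) lmodule. fg_free L \<and>
        formation_isomorphic X
          \<lparr>qf = hyperbolic \<epsilon> L, lag1 = carrier L \<times> {0}, lag2 = {0} \<times> carrier (dual L)\<rparr>)"

definition stably_isomorphic :: "'r::ring_involution \<Rightarrow> ('r, 'm::ab_group_add) formation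
    \<Rightarrow> ('r, 'n::ab_group_add) formation \<Rightarrow> bool" where
  "stably_isomorphic \<epsilon> X Y \<longleftrightarrow>
     (\<exists>(T :: ('r, 'r univ) formation) (T' :: ('r, 'r univ) formation).
        trivial_formation \<epsilon> T \<and> trivial_formation \<epsilon> T' \<and>
        formation_isomorphic (formation_sum X T) (formation_sum Y T'))"

text \<open>The boundary of a \<open>(-\<epsilon>)\<close>-quadratic form, an \<open>\<epsilon>\<close>-quadratic formation.\<close>

definition boundary :: "'r::ring_involution \<Rightarrow> ('r, 'm::ab_group_add) qform
    \<Rightarrow> ('r, 'm \<times> ('m \<Rightarrow> 'r)) formation" where
  "boundary \<epsilon> K = \<lparr>qf = hyperbolic \<epsilon> (fmod K), lag1 = carrier (fmod K) \<times> {0},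
     lag2 = {(x, lam K x) | x. x \<in> carrier (fmod K)}\<rparr>"

definition formation_equiv :: "'r::ring_involution \<Rightarrow> ('r, 'm::ab_group_add) formation
    \<Rightarrow> ('r, 'n::ab_group_add) formation \<Rightarrow> bool" where
  "formation_equiv \<epsilon> X Y \<longleftrightarrow>
     (\<exists>K :: ('r, 'r univ) qform. quadratic_form (- \<epsilon>) K \<and>
        stably_isomorphic \<epsilon> (formation_sum X (formation_neg Y)) (boundary \<epsilon> K))"

definition zero_formation :: "'r::ring_involution \<Rightarrow> ('r, 'r univ) formation" where
  "zero_formation \<epsilon> = \<lparr>qf = \<lparr>fmod = zero_module, lam = (\<lambda>x y. 0), mu = (\<lambda>x. Qcls \<epsilon> 0)\<rparr>,
     lag1 = {0}, lag2 = {0}\<rparr>"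

definition formation_rel :: "'r::ring_involution
    \<Rightarrow> (('r, 'r univ) formation \<times> ('r, 'r univ) formation) set" where
  "formation_rel \<epsilon> = {(X, Y). is_formation \<epsilon> X \<and> is_formation \<epsilon> Y \<and> formation_equiv \<epsilon> X Y}"

text \<open>The class of a formation over an arbitrary type, such as a direct sum of two formations.\<close>

definition formation_class :: "'r::ring_involution \<Rightarrow> ('r, 'm::ab_group_add) formation
    \<Rightarrow> ('r, 'r univ) formation set" where
  "formation_class \<epsilon> X = {Y. is_formation \<epsilon> Y \<and> formation_equiv \<epsilon> X Y}"

definition formation_group :: "'r::ring_involution \<Rightarrow> ('r, 'r univ) formation set monoid" where
  "formation_group \<epsilon> = \<lparr>carrier = Collect (is_formation \<epsilon>) // formation_rel \<epsilon>,
     mult = (\<lambda>A B. \<Union>X\<in>A. \<Union>Y\<in>B. formation_class \<epsilon> (formation_sum X Y)),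
     one = formation_class \<epsilon> (zero_formation \<epsilon>)\<rparr>"


section \<open>Odd-dimensional complexes and their cobordism\<close>

text \<open>For chain complexes \<open>dA : A1 \<rightarrow> A0\<close> and \<open>dB : B1 \<rightarrow> B0\<close>.\<close>

definition is_chain_map where
  "is_chain_map A1 A0 dA B1 B0 dB f1 f0 \<longleftrightarrow> is_hom A1 B1 f1 \<and> is_hom A0 B0 f0 \<and>
     (\<forall>x\<in>carrier A1. dB (f1 x) = f0 (dA x))"

definition is_chain_equivalence where
  "is_chain_equivalence A1 A0 dA B1 B0 dB f1 f0 \<longleftrightarrow> is_chain_map A1 A0 dA B1 B0 dB f1 f0 \<and>
     (\<exists>g1 g0 h k. is_chain_map B1 B0 dB A1 A0 dA g1 g0 \<and> is_hom A0 A1 h \<and> is_hom B0 B1 k \<and>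
        (\<forall>x\<in>carrier A1. g1 (f1 x) - x = h (dA x)) \<and> (\<forall>x\<in>carrier A0. g0 (f0 x) - x = dA (h x)) \<and>
        (\<forall>y\<in>carrier B1. f1 (g1 y) - y = k (dB y)) \<and> (\<forall>y\<in>carrier B0. f0 (g0 y) - y = dB (k y)))"

text \<open>\<open>ctop\<close> is \<open>C\<^sub>n\<^sub>+\<^sub>1\<close> and \<open>cbot\<close> is \<open>C\<^sub>n\<close>.\<close>

record ('r, 'm) qcomplex =
  ctop :: "('r, 'm) lmodule"
  cbot :: "('r, 'm) lmodule"
  cd :: "'m \<Rightarrow> 'm"
  psi0 :: "('m \<Rightarrow> 'r) \<Rightarrow> 'm"
  psi1 :: "('m \<Rightarrow> 'r) \<Rightarrow> 'm"

definition is_qcomplex :: "nat \<Rightarrow> ('r::ring_involution, 'm::ab_group_add) qcomplex \<Rightarrow> bool" where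
  "is_qcomplex n C \<longleftrightarrow> fg_free (ctop C) \<and> fg_free (cbot C) \<and> is_hom (ctop C) (cbot C) (cd C) \<and>
     is_hom (dual (cbot C)) (ctop C) (psi0 C) \<and> is_hom (dual (cbot C)) (cbot C) (psi1 C) \<and>
     (\<forall>f\<in>carrier (dual (cbot C)).
        cd C (psi0 C f) + psi1 C f
          + scale (cbot C) ((-1) ^ (n + 1)) (codual_map (cbot C) (psi1 C) f) = 0) \<and>
     is_chain_equivalence
       (dual (cbot C)) (dual (ctop C))
       (\<lambda>f. scale (dual (ctop C)) ((-1) ^ (n + 1)) (dual_map (ctop C) (cd C) f))
       (ctop C) (cbot C) (cd C)
       (psi0 C) (codual_map (cbot C) (psi0 C))"

text \<open>The functions \<open>\<lambda>x. f (x, 0)\<close> and \<open>\<lambda>y. f (0, y)\<close> are the components of \<open>f\<close> under the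
  identification of the dual of a direct sum with the direct sum of the duals.\<close>

definition qcomplex_sum :: "('r::ring_involution, 'm::ab_group_add) qcomplex
    \<Rightarrow> ('r, 'n::ab_group_add) qcomplex \<Rightarrow> ('r, 'm \<times> 'n) qcomplex" where
  "qcomplex_sum C C' = \<lparr>ctop = ctop C \<boxplus> ctop C', cbot = cbot C \<boxplus> cbot C',
     cd = (\<lambda>(x, y). (cd C x, cd C' y)),
     psi0 = (\<lambda>f. (psi0 C (\<lambda>x. f (x, 0)), psi0 C' (\<lambda>y. f (0, y)))),
     psi1 = (\<lambda>f. (psi1 C (\<lambda>x. f (x, 0)), psi1 C' (\<lambda>y. f (0, y))))\<rparr>"

definition qcomplex_neg :: "('r::ring_involution, 'm::ab_group_add) qcomplex
    \<Rightarrow> ('r, 'm) qcomplex" where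
  "qcomplex_neg C = C\<lparr>psi0 := (\<lambda>f. - psi0 C f), psi1 := (\<lambda>f. - psi1 C f)\<rparr>"

definition cobordism_map :: "nat \<Rightarrow> ('r::ring_involution, 'a::ab_group_add) qcomplex
    \<Rightarrow> ('r, 'b::ab_group_add) qcomplex \<Rightarrow> ('r, 'd::ab_group_add) lmodule
    \<Rightarrow> ('a \<Rightarrow> 'd) \<Rightarrow> ('b \<Rightarrow> 'd) \<Rightarrow> (('d \<Rightarrow> 'r) \<Rightarrow> 'd)
    \<Rightarrow> 'a \<times> ('b \<Rightarrow> 'r) \<times> ('d \<Rightarrow> 'r) \<Rightarrow> 'a \<times> ('b \<Rightarrow> 'r) \<times> 'd" where
  "cobordism_map n C C' D j j' \<delta>\<psi> = (\<lambda>(x, f, g).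
     (cd C x + codual_map (cbot C) (psi0 C) (dual_map (ctop C) j g),
      dual_map (ctop C') (cd C') f + dual_map (ctop C') j' g,
      scale D ((-1) ^ (n + 1)) (j x) - j' (psi0 C' f)
        + (\<delta>\<psi> g + scale D ((-1) ^ (n + 1)) (codual_map D \<delta>\<psi> g))))"

definition is_cobordism :: "nat \<Rightarrow> ('r::ring_involution, 'a::ab_group_add) qcomplex
    \<Rightarrow> ('r, 'b::ab_group_add) qcomplex \<Rightarrow> ('r, 'd::ab_group_add) lmodule
    \<Rightarrow> ('a \<Rightarrow> 'd) \<Rightarrow> ('b \<Rightarrow> 'd) \<Rightarrow> (('d \<Rightarrow> 'r) \<Rightarrow> 'd) \<Rightarrow> bool" where
  "is_cobordism n C C' D j j' \<delta>\<psi> \<longleftrightarrow> fg_free D \<and>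
     is_hom (ctop C) D j \<and> is_hom (ctop C') D j' \<and> is_hom (dual D) D \<delta>\<psi> \<and>
     is_iso (ctop C \<boxplus> dual (cbot C') \<boxplus> dual D) (cbot C \<boxplus> dual (ctop C') \<boxplus> D)
       (cobordism_map n C C' D j j' \<delta>\<psi>)"

definition cobordant :: "nat \<Rightarrow> ('r::ring_involution, 'a::ab_group_add) qcomplex
    \<Rightarrow> ('r, 'b::ab_group_add) qcomplex \<Rightarrow> bool" where
  "cobordant n C C' \<longleftrightarrow> (\<exists>(D :: ('r, 'r univ) lmodule) j j' \<delta>\<psi>. is_cobordism n C C' D j j' \<delta>\<psi>)"

definition zero_qcomplex :: "('r::ring_involution, 'r univ) qcomplex" where
  "zero_qcomplex = \<lparr>ctop = zero_module, cbot = zero_module, cd = (\<lambda>x. 0),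
     psi0 = (\<lambda>f. 0), psi1 = (\<lambda>f. 0)\<rparr>"

definition cobordism_rel :: "nat
    \<Rightarrow> (('r::ring_involution, 'r univ) qcomplex \<times> ('r, 'r univ) qcomplex) set" where
  "cobordism_rel n = {(C, C'). is_qcomplex n C \<and> is_qcomplex n C' \<and> cobordant n C C'}"

text \<open>The class of a complex over an arbitrary type, such as a direct sum of two complexes.\<close>

definition cobordism_class :: "nat \<Rightarrow> ('r::ring_involution, 'm::ab_group_add) qcomplex
    \<Rightarrow> ('r, 'r univ) qcomplex set" where
  "cobordism_class n C = {C'. is_qcomplex n C' \<and> cobordant n C C'}"

text \<open>\<open>L\<^sub>2\<^sub>n\<^sub>+\<^sub>1(\<Lambda>)\<close>\<close>

definition L_odd :: "nat \<Rightarrow> ('r::ring_involution, 'r univ) qcomplex set monoid" where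
  "L_odd n = \<lparr>carrier = Collect (is_qcomplex n) // cobordism_rel n,
     mult = (\<lambda>A B. \<Union>C\<in>A. \<Union>C'\<in>B. cobordism_class n (qcomplex_sum C C')),
     one = cobordism_class n zero_qcomplex\<rparr>"


section \<open>From complexes to formations\<close>

definition formation_of :: "nat \<Rightarrow> ('r::ring_involution, 'm::ab_group_add) qcomplex
    \<Rightarrow> ('r, 'm \<times> ('m \<Rightarrow> 'r)) formation" where
  "formation_of n C = \<lparr>qf = hyperbolic ((-1) ^ n) (ctop C), lag1 = carrier (ctop C) \<times> {0},
     lag2 = (\<lambda>f. (psi0 C f, dual_map (ctop C) (cd C) f)) ` carrier (dual (cbot C))\<rparr>"

text \<open>The map on classes; the classes in the union are all equal when the correspondence respects
  the equivalence relations.\<close>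

definition formation_class_map :: "nat \<Rightarrow> ('r::ring_involution, 'r univ) qcomplex set
    \<Rightarrow> ('r, 'r univ) formation set" where
  "formation_class_map n A = (\<Union>C\<in>A. formation_class ((-1) ^ n) (formation_of n C))"

end

theory Submission
  imports Defs
begin

text \<open>A formation is null if, after adding a trivial formation, its two lagrangians have a common
  complementary lagrangian; a common complement turns the second lagrangian into the graph of a form
  over the first, so the null formations are exactly those stably isomorphic to boundaries. All
  relations among formations follow from one move: on an orthogonal summand a lagrangian may be
  replaced by any complementary one, at the price of a trivial formation. The diagonal of
  \<open>X \<oplus> -X\<close> is complementary to \<open>F \<oplus> F'\<close> and \<open>G \<oplus> G'\<close> for complements \<open>F'\<close>, \<open>G'\<close> of \<open>F\<close>, \<open>G\<close>, so
  two moves make \<open>X \<oplus> -X\<close> null; and if \<open>X \<oplus> Y\<close> and \<open>Y\<close> are null, replacing the second lagrangian of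
  \<open>Y\<close> by a common complement of \<open>Y\<close> shows that \<open>X\<close> is null. On the side of complexes, the duality of
  \<open>C'\<close> turns a cobordism from \<open>C\<close> to \<open>C'\<close> into one from \<open>C \<oplus> -C'\<close> to zero, and such a cobordism is a
  common complement for the formation of \<open>C \<oplus> -C'\<close>, again up to one move.\<close>

section \<open>Modules and homomorphisms\<close>

text \<open>The relation on formations is not visibly transitive: two stable isomorphisms with
  boundaries do not compose, and the middle formation has to be cancelled. Common complements are
  stable under sums, sign change and exchange of the two lagrangians, so that the difficulty moves
  into one computation, \<open>common_complement_swap\<close>. Likewise cobordisms are never glued:
  cobordism is shown to be equality of formation classes, and the group structure on
  \<open>L_odd\<close> is pulled back along the resulting bijection. The bridge to complexes is the
  mapping cone of the duality map, from \<open>dual (cbot C)\<close> to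
  \<open>ctop C \<boxplus> dual (ctop C)\<close> to \<open>cbot C\<close>. Its two maps are adjoint
  for the hyperbolic form, so exactness in the middle says that the image is its own orthogonal, and
  the relation for \<open>psi1\<close> says that the quadratic function vanishes on it. Direct sums
  leave the type over which the groups are formed, so constructions are stated for arbitrary types
  and returned to \<open>'r univ\<close> by transport of structure.\<close>

lemma bar_zero [simp]: "bar (0::'r::ring_involution) = 0"
  using bar_add[of "0::'r" 0] by simp

lemma bar_minus: "bar (- a) = - bar (a::'r::ring_involution)"
  using bar_add[of a "- a"] by (simp add: minus_unique)

lemma bar_diff: "bar (a - b) = bar a - bar (b::'r::ring_involution)"
  using bar_add[of a "- b"] by (simp add: bar_minus)

lemma bar_sum: "bar (sum f A) = (\<Sum>x\<in>A. bar (f x :: 'r::ring_involution))"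
  by (induction A rule: infinite_finite_induct) (simp_all add: bar_add)

lemmas bar_simps = bar_add bar_mult bar_bar bar_one bar_minus bar_diff

lemma bar_eq_0_iff [simp]: "bar a = 0 \<longleftrightarrow> a = (0::'r::ring_involution)"
  by (metis bar_bar bar_zero)

text \<open>Signs enter only through being central, self-conjugate and of square 1, so forms and
  formations are treated for an arbitrary sign, and the results are applied to
  \<open>\<epsilon>\<close> and \<open>- \<epsilon>\<close> alike.\<close>

definition is_sign :: "'r::ring_1 \<Rightarrow> bool" where
  "is_sign \<epsilon> \<longleftrightarrow> \<epsilon> = 1 \<or> \<epsilon> = - 1"

lemma is_sign_minus: "is_sign \<epsilon> \<Longrightarrow> is_sign (- \<epsilon>)"
  by (auto simp: is_sign_def)

lemma is_sign_power: "is_sign ((- 1) ^ n :: 'r::ring_1)"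
  by (cases "even n") (auto simp: is_sign_def)

lemma sign_square: "is_sign \<epsilon> \<Longrightarrow> \<epsilon> * \<epsilon> = 1" "is_sign \<epsilon> \<Longrightarrow> \<epsilon> * (\<epsilon> * x) = x"
  by (auto simp: is_sign_def)

context left_module
begin

lemma scale_zero_left [simp]: "x \<in> carrier M \<Longrightarrow> scale M 0 x = 0"
  using scale_add_left[of x 0 0] by simp

lemma scale_minus_left: "x \<in> carrier M \<Longrightarrow> scale M (- a) x = - scale M a x"
  using scale_add_left[of x a "- a"] by (simp add: minus_unique)

lemma scale_minus_one: "x \<in> carrier M \<Longrightarrow> scale M (- 1) x = - x"
  by (simp add: scale_minus_left scale_one)

lemma uminus_closed: "x \<in> carrier M \<Longrightarrow> - x \<in> carrier M"
  by (metis scale_closed scale_minus_one)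

lemma diff_closed: "\<lbrakk>x \<in> carrier M; y \<in> carrier M\<rbrakk> \<Longrightarrow> x - y \<in> carrier M"
  using add_closed[of x "- y"] by (simp add: uminus_closed)

lemma scale_zero_right [simp]: "scale M a 0 = 0"
  using scale_add_right[of 0 0 a] by (simp add: zero_closed)

lemma scale_minus_right: "x \<in> carrier M \<Longrightarrow> scale M a (- x) = - scale M a x"
  using scale_add_right[of x "- x" a] by (simp add: uminus_closed minus_unique)

lemma scale_diff_right: "\<lbrakk>x \<in> carrier M; y \<in> carrier M\<rbrakk> \<Longrightarrow>
    scale M a (x - y) = scale M a x - scale M a y"
  using scale_add_right[of x "- y" a] by (simp add: uminus_closed scale_minus_right)

lemma sum_closed: "(\<And>i. i \<in> A \<Longrightarrow> f i \<in> carrier M) \<Longrightarrow> sum f A \<in> carrier M"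
  by (induction A rule: infinite_finite_induct) (simp_all add: zero_closed add_closed)

lemma scale_sum: "(\<And>i. i \<in> A \<Longrightarrow> f i \<in> carrier M) \<Longrightarrow>
    scale M a (sum f A) = (\<Sum>i\<in>A. scale M a (f i))"
  by (induction A rule: infinite_finite_induct) (simp_all add: scale_add_right sum_closed)

lemmas closed = zero_closed add_closed scale_closed uminus_closed diff_closed

end

section \<open>Homomorphisms and isomorphisms\<close>

lemma is_homI:
  assumes "\<And>x. x \<in> carrier M \<Longrightarrow> f x \<in> carrier N"
    and "\<And>x y. x \<in> carrier M \<Longrightarrow> y \<in> carrier M \<Longrightarrow> f (x + y) = f x + f y"
    and "\<And>a x. x \<in> carrier M \<Longrightarrow> f (scale M a x) = scale N a (f x)"
  shows "is_hom M N f"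
  using assms by (simp add: is_hom_def)

lemma hom_closed: "is_hom M N f \<Longrightarrow> x \<in> carrier M \<Longrightarrow> f x \<in> carrier N"
  and hom_add: "is_hom M N f \<Longrightarrow> x \<in> carrier M \<Longrightarrow> y \<in> carrier M \<Longrightarrow> f (x + y) = f x + f y"
  and hom_scale: "is_hom M N f \<Longrightarrow> x \<in> carrier M \<Longrightarrow> f (scale M a x) = scale N a (f x)"
  by (simp_all add: is_hom_def)

lemma hom_zero: "left_module M \<Longrightarrow> is_hom M N f \<Longrightarrow> f 0 = 0"
  using hom_add[of M N f 0 0] by (simp add: left_module.zero_closed)

lemma hom_minus: "left_module M \<Longrightarrow> is_hom M N f \<Longrightarrow> x \<in> carrier M \<Longrightarrow> f (- x) = - f x"
  using hom_add[of M N f x "- x"]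
  by (simp add: left_module.uminus_closed hom_zero minus_unique)

lemma hom_diff: "left_module M \<Longrightarrow> is_hom M N f \<Longrightarrow> x \<in> carrier M \<Longrightarrow> y \<in> carrier M \<Longrightarrow>
    f (x - y) = f x - f y"
  using hom_add[of M N f x "- y"] by (simp add: left_module.uminus_closed hom_minus)

lemma hom_sum:
  assumes "left_module M" "is_hom M N f" "\<And>i. i \<in> A \<Longrightarrow> g i \<in> carrier M"
  shows "f (sum g A) = (\<Sum>i\<in>A. f (g i))"
  using assms(3)
  by (induction A rule: infinite_finite_induct)
    (simp_all add: hom_zero[OF assms(1,2)] hom_add[OF assms(2)] left_module.sum_closed[OF assms(1)])

lemma hom_cong: "is_hom M N f \<Longrightarrow> left_module M \<Longrightarrow> (\<And>x. x \<in> carrier M \<Longrightarrow> f x = g x) \<Longrightarrow> is_hom M N g"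
  by (auto simp: is_hom_def left_module.closed)

lemma hom_comp: "is_hom M N f \<Longrightarrow> is_hom N P g \<Longrightarrow> is_hom M P (\<lambda>x. g (f x))"
  by (simp add: is_hom_def)

lemma hom_plus: "left_module N \<Longrightarrow> is_hom M N f \<Longrightarrow> is_hom M N g \<Longrightarrow> is_hom M N (\<lambda>x. f x + g x)"
  by (simp add: is_hom_def left_module.closed left_module.scale_add_right algebra_simps)

lemma hom_uminus: "left_module N \<Longrightarrow> is_hom M N f \<Longrightarrow> is_hom M N (\<lambda>x. - f x)"
  by (simp add: is_hom_def left_module.closed left_module.scale_minus_right)

lemma hom_subtract: "left_module N \<Longrightarrow> is_hom M N f \<Longrightarrow> is_hom M N g \<Longrightarrow> is_hom M N (\<lambda>x. f x - g x)"
  by (simp add: is_hom_def left_module.closed left_module.scale_diff_right algebra_simps)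

text \<open>Multiplication by a general scalar is not linear over a noncommutative ring; by a sign
  it is the identity or negation.\<close>

lemma hom_sign:
  assumes "left_module N" "is_sign \<epsilon>" "is_hom M N f"
  shows "is_hom M N (\<lambda>x. scale N \<epsilon> (f x))"
  using assms(2) unfolding is_sign_def
proof
  assume "\<epsilon> = 1"
  with assms show ?thesis
    by (auto simp: is_hom_def left_module.closed left_module.scale_one)
next
  assume "\<epsilon> = - 1"
  with assms hom_uminus[OF assms(1,3)] show ?thesis
    by (auto simp: is_hom_def left_module.closed left_module.scale_minus_one)
qed

lemma iso_hom: "is_iso M N f \<Longrightarrow> is_hom M N f"
  and iso_bij: "is_iso M N f \<Longrightarrow> bij_betw f (carrier M) (carrier N)"
  by (simp_all add: is_iso_def)

lemma iso_inj: "is_iso M N f \<Longrightarrow> x \<in> carrier M \<Longrightarrow> y \<in> carrier M \<Longrightarrow> f x = f y \<longleftrightarrow> x = y"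
  by (auto simp: is_iso_def bij_betw_def inj_on_eq_iff)

lemma iso_surj: "is_iso M N f \<Longrightarrow> y \<in> carrier N \<Longrightarrow> \<exists>x\<in>carrier M. f x = y"
  by (force simp: is_iso_def bij_betw_def)

lemma is_isoI:
  assumes "left_module M" "is_hom M N f"
    and "\<And>x. x \<in> carrier M \<Longrightarrow> f x = 0 \<Longrightarrow> x = 0"
    and "\<And>y. y \<in> carrier N \<Longrightarrow> \<exists>x\<in>carrier M. f x = y"
  shows "is_iso M N f"
proof -
  have "inj_on f (carrier M)"
    by (rule inj_onI) (metis assms(1-3) hom_diff left_module.diff_closed eq_iff_diff_eq_0)
  then show ?thesis
    using assms by (force simp: is_iso_def bij_betw_def dest: hom_closed)
qed

lemma iso_cong:
  assumes "is_iso M N f" "left_module M" "\<And>x. x \<in> carrier M \<Longrightarrow> f x = g x"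
  shows "is_iso M N g"
  unfolding is_iso_def
  using hom_cong[OF iso_hom[OF assms(1)] assms(2,3)] iffD1[OF bij_betw_cong[OF assms(3)] iso_bij[OF assms(1)]]
  by blast

lemma iso_kernel: "left_module M \<Longrightarrow> is_iso M N f \<Longrightarrow> x \<in> carrier M \<Longrightarrow> f x = 0 \<Longrightarrow> x = 0"
  by (metis hom_zero iso_hom iso_inj left_module.zero_closed)

lemma iso_comp: "is_iso M N f \<Longrightarrow> is_iso N P g \<Longrightarrow> is_iso M P (\<lambda>x. g (f x))"
  unfolding is_iso_def using hom_comp bij_betw_trans[of f _ _ g] by (fastforce simp: comp_def)

lemma iso_inv:
  assumes "left_module M" "is_iso M N f"
  shows "is_iso N M (inv_into (carrier M) f)"
proof -
  let ?g = "inv_into (carrier M) f"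
  have b: "bij_betw f (carrier M) (carrier N)" and h: "is_hom M N f"
    using assms(2) by (auto simp: is_iso_def)
  have g: "?g y \<in> carrier M" "f (?g y) = y" if "y \<in> carrier N" for y
    using b that by (auto simp: bij_betw_def inv_into_into f_inv_into_f)
  have gf: "?g (f x) = x" if "x \<in> carrier M" for x
    using b that by (auto simp: bij_betw_def)
  have "is_hom N M ?g"
  proof (rule is_homI)
    fix x y assume "x \<in> carrier N" "y \<in> carrier N"
    then show "?g (x + y) = ?g x + ?g y"
      using gf[of "?g x + ?g y"] g h assms(1) by (simp add: hom_add left_module.closed)
  next
    fix a x assume "x \<in> carrier N"
    then show "?g (scale N a x) = scale M a (?g x)"
      using gf[of "scale M a (?g x)"] g h assms(1) by (simp add: hom_scale left_module.closed)
  qed (use g in auto)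
  then show ?thesis
    using b bij_betw_inv_into by (auto simp: is_iso_def)
qed

section \<open>Direct sums, submodules and dual modules\<close>

lemma carrier_dsum [simp]: "carrier (M \<boxplus> N) = carrier M \<times> carrier N"
  and scale_dsum [simp]: "scale (M \<boxplus> N) a (x, y) = (scale M a x, scale N a y)"
  by (simp_all add: dsum_def)

lemma carrier_submod [simp]: "carrier (submod M S) = S"
  and scale_submod [simp]: "scale (submod M S) = scale M"
  by (simp_all add: submod_def)

lemma carrier_ring_module [simp]: "carrier ring_module = UNIV"
  and scale_ring_module [simp]: "scale ring_module = (*)"
  by (simp_all add: ring_module_def)

lemma carrier_zero_module [simp]: "carrier zero_module = {0}"
  and scale_zero_module [simp]: "scale zero_module a x = 0"
  by (simp_all add: zero_module_def)

lemma left_module_dsum: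
  assumes "left_module M" "left_module N"
  shows "left_module (M \<boxplus> N)"
proof -
  interpret M: left_module M by fact
  interpret N: left_module N by fact
  show ?thesis
    by unfold_locales
      (auto simp: zero_prod_def M.closed N.closed M.scale_add_right N.scale_add_right
        M.scale_add_left N.scale_add_left M.scale_scale N.scale_scale M.scale_one N.scale_one)
qed

lemma carrier_dual: "f \<in> carrier (dual M) \<longleftrightarrow> is_hom M ring_module f \<and> (\<forall>x. x \<notin> carrier M \<longrightarrow> f x = 0)"
  and scale_dual [simp]: "scale (dual M) a f x = f x * bar a"
  by (simp_all add: dual_def)

lemma left_module_dual:
  fixes M :: "('r::ring_involution, 'm::ab_group_add) lmodule"
  assumes "left_module M"
  shows "left_module (dual M)"
  by unfold_locales
    (auto simp: carrier_dual is_hom_def algebra_simps bar_simps fun_eq_iff)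

lemma dual_add: "f \<in> carrier (dual M) \<Longrightarrow> x \<in> carrier M \<Longrightarrow> y \<in> carrier M \<Longrightarrow> f (x + y) = f x + f y"
  and dual_scale: "f \<in> carrier (dual M) \<Longrightarrow> x \<in> carrier M \<Longrightarrow> f (scale M a x) = a * f x"
  and dual_outside: "f \<in> carrier (dual M) \<Longrightarrow> x \<notin> carrier M \<Longrightarrow> f x = 0"
  by (auto simp: carrier_dual is_hom_def)

lemma dual_hom: "f \<in> carrier (dual M) \<Longrightarrow> is_hom M ring_module f"
  by (simp add: carrier_dual)

lemma dual_eqI: "f \<in> carrier (dual M) \<Longrightarrow> g \<in> carrier (dual M) \<Longrightarrow>
    (\<And>x. x \<in> carrier M \<Longrightarrow> f x = g x) \<Longrightarrow> f = g"
  by (metis dual_outside ext)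

lemma dual_zero: "left_module M \<Longrightarrow> f \<in> carrier (dual M) \<Longrightarrow> f 0 = 0"
  using hom_zero dual_hom by blast

lemma dual_minus: "left_module M \<Longrightarrow> f \<in> carrier (dual M) \<Longrightarrow> x \<in> carrier M \<Longrightarrow> f (- x) = - f x"
  using hom_minus dual_hom by blast

lemma zero_outside_in [simp]: "x \<in> S \<Longrightarrow> zero_outside S f x = f x"
  and zero_outside_out [simp]: "x \<notin> S \<Longrightarrow> zero_outside S f x = 0"
  by (simp_all add: zero_outside_def)

lemma zero_outside_dual:
  assumes "left_module M" "is_hom M ring_module f"
  shows "zero_outside (carrier M) f \<in> carrier (dual M)"
  using assms by (auto simp: carrier_dual is_hom_def left_module.closed)

lemma dual_map_closed:
  assumes "left_module M" "is_hom M N f" "g \<in> carrier (dual N)"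
  shows "dual_map M f g \<in> carrier (dual M)"
  unfolding dual_map_def
  by (rule zero_outside_dual[OF assms(1)])
    (use hom_comp[OF assms(2) dual_hom[OF assms(3)]] in \<open>simp add: comp_def\<close>)

lemma dual_map_apply [simp]: "x \<in> carrier M \<Longrightarrow> dual_map M f g x = g (f x)"
  by (simp add: dual_map_def)

lemma dual_map_hom:
  fixes M :: "('r::ring_involution, 'm::ab_group_add) lmodule" and N :: "('r, 'n::ab_group_add) lmodule"
  assumes "left_module M" "is_hom M N f"
  shows "is_hom (dual N) (dual M) (dual_map M f)"
proof (rule is_homI)
  fix x y :: "'n \<Rightarrow> 'r" show "dual_map M f (x + y) = dual_map M f x + dual_map M f y"
    by (auto simp: dual_map_def zero_outside_def)
next
  fix a and x :: "'n \<Rightarrow> 'r" show "dual_map M f (scale (dual N) a x) = scale (dual M) a (dual_map M f x)"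
    by (rule ext) (auto simp: dual_map_def zero_outside_def)
qed (rule dual_map_closed[OF assms])

lemma is_submodule_iff:
  assumes "left_module M"
  shows "is_submodule M S \<longleftrightarrow> S \<subseteq> carrier M \<and> 0 \<in> S \<and> (\<forall>x\<in>S. \<forall>y\<in>S. x + y \<in> S) \<and>
    (\<forall>a. \<forall>x\<in>S. scale M a x \<in> S)"
proof -
  interpret left_module M by fact
  show ?thesis
    unfolding is_submodule_def left_module_def carrier_submod scale_submod
    by (auto simp: scale_add_right scale_add_left scale_scale scale_one subset_iff)
qed

section \<open>Coordinates\<close>

text \<open>A basis \<open>b\<close> indexed by the numbers below \<open>k\<close>, together with
  its dual basis \<open>c\<close>. Taking the coordinates as elements of \<open>dual M\<close>
  builds in their linearity, and exchanging the roles of \<open>b\<close> and \<open>c\<close> gives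
  coordinates on \<open>dual M\<close>.\<close>

definition coords :: "('r::ring_involution, 'm::ab_group_add) lmodule \<Rightarrow> nat \<Rightarrow> (nat \<Rightarrow> 'm)
    \<Rightarrow> (nat \<Rightarrow> 'm \<Rightarrow> 'r) \<Rightarrow> bool" where
  "coords M k b c \<longleftrightarrow> (\<forall>i<k. b i \<in> carrier M) \<and> (\<forall>i<k. c i \<in> carrier (dual M)) \<and>
     (\<forall>x\<in>carrier M. x = (\<Sum>i<k. scale M (c i x) (b i))) \<and>
     (\<forall>i<k. \<forall>j<k. c i (b j) = (if i = j then 1 else 0))"

lemma coords_basis:
  assumes "left_module M" "coords M k b c"
  shows "is_basis M (b ` {..<k})"
proof -
  interpret left_module M by fact
  have b: "b i \<in> carrier M" and c: "c i \<in> carrier (dual M)" if "i < k" for i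
    using assms that by (auto simp: coords_def)
  have x: "(\<Sum>i<k. scale M (c i x) (b i)) = x" if "x \<in> carrier M" for x
    using assms that by (simp add: coords_def)
  have cb: "c i (b j) = (if i = j then 1 else 0)" if "i < k" "j < k" for i j
    using assms that by (simp add: coords_def)
  have inj: "inj_on b {..<k}"
    by (rule inj_onI) (metis cb lessThan_iff zero_neq_one)
  have "\<exists>!d. (\<forall>y. y \<notin> b ` {..<k} \<longrightarrow> d y = 0) \<and> x = (\<Sum>y\<in>b ` {..<k}. scale M (d y) y)"
    if xM: "x \<in> carrier M" for x
  proof (rule ex1I)
    let ?d = "\<lambda>y. if y \<in> b ` {..<k} then c (inv_into {..<k} b y) x else 0"
    have "(\<Sum>y\<in>b ` {..<k}. scale M (?d y) y) = (\<Sum>i<k. scale M (c i x) (b i))"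
      by (subst sum.reindex[OF inj]) (auto intro!: sum.cong simp: inv_into_f_f[OF inj])
    with x[OF xM] show "(\<forall>y. y \<notin> b ` {..<k} \<longrightarrow> ?d y = 0) \<and> x = (\<Sum>y\<in>b ` {..<k}. scale M (?d y) y)"
      by simp
  next
    fix d assume d: "(\<forall>y. y \<notin> b ` {..<k} \<longrightarrow> d y = 0) \<and> x = (\<Sum>y\<in>b ` {..<k}. scale M (d y) y)"
    have "d (b i) = c i x" if i: "i < k" for i
    proof -
      have "x = (\<Sum>j<k. scale M (d (b j)) (b j))"
        using d sum.reindex[OF inj, of "\<lambda>y. scale M (d y) y"] by simp
      then have "c i x = (\<Sum>j<k. c i (scale M (d (b j)) (b j)))"
        using hom_sum[OF assms(1) dual_hom[OF c[OF i]], of "{..<k}" "\<lambda>j. scale M (d (b j)) (b j)"]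
        by (simp add: b closed)
      also have "\<dots> = (\<Sum>j<k. if j = i then d (b j) else 0)"
        by (rule sum.cong) (auto simp: dual_scale[OF c[OF i]] b cb i)
      finally show ?thesis using i by simp
    qed
    then show "d = (\<lambda>y. if y \<in> b ` {..<k} then c (inv_into {..<k} b y) x else 0)"
      using d by (auto simp: fun_eq_iff inv_into_f_f[OF inj])
  qed
  then show ?thesis
    using b by (auto simp: is_basis_def)
qed

text \<open>Uniqueness of the coefficients forces them to be additive and homogeneous in
  \<open>x\<close>: a sum or multiple of expansions is again an expansion, hence the one. So each
  coordinate is a functional.\<close>

lemma basis_coords:
  fixes M :: "('r::ring_involution, 'm::ab_group_add) lmodule"
  assumes "left_module M" "is_basis M B"
  obtains k b c where "coords M k b c"
proof -
  interpret left_module M by fact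
  obtain b where bij: "bij_betw b {..<card B} B"
    using ex_bij_betw_nat_finite[of B] assms(2) by (auto simp: is_basis_def atLeast0LessThan)
  let ?P = "\<lambda>x d. (\<forall>y. y \<notin> B \<longrightarrow> d y = 0) \<and> x = (\<Sum>y\<in>B. scale M (d y) y)"
  define d where "d x = (THE d. ?P x d)" for x
  have B: "y \<in> carrier M" if "y \<in> B" for y
    using assms(2) that by (auto simp: is_basis_def)
  have ex: "\<exists>!d. ?P x d" if "x \<in> carrier M" for x
    using assms(2) that by (auto simp: is_basis_def)
  have P: "?P x (d x)" if "x \<in> carrier M" for x
    unfolding d_def by (rule theI'[OF ex[OF that]])
  have uniq: "d x = e" if "x \<in> carrier M" "?P x e" for x e
    using ex[OF that(1)] P[OF that(1)] that(2) by blast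
  have dadd: "d (x + y) = d x + d y" if "x \<in> carrier M" "y \<in> carrier M" for x y
  proof (rule uniq)
    have "x + y = (\<Sum>z\<in>B. scale M (d x z) z) + (\<Sum>z\<in>B. scale M (d y z) z)"
      using P[OF that(1)] P[OF that(2)] by metis
    also have "\<dots> = (\<Sum>z\<in>B. scale M ((d x + d y) z) z)"
      by (subst sum.distrib[symmetric]) (auto intro!: sum.cong simp: scale_add_left B)
    finally show "?P (x + y) (d x + d y)"
      using P[OF that(1)] P[OF that(2)] by auto
  qed (simp add: closed that)
  have dscale: "d (scale M a x) = (\<lambda>y. a * d x y)" if "x \<in> carrier M" for x a
  proof (rule uniq)
    have "scale M a x = scale M a (\<Sum>z\<in>B. scale M (d x z) z)"
      using P[OF that(1)] by metis
    also have "\<dots> = (\<Sum>z\<in>B. scale M (a * d x z) z)"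
      by (subst scale_sum) (auto intro!: sum.cong simp: scale_scale B closed)
    finally show "?P (scale M a x) (\<lambda>y. a * d x y)"
      using P[OF that(1)] by auto
  qed (simp add: closed that)
  have dB: "d y = (\<lambda>z. if z = y then 1 else 0)" if "y \<in> B" for y
  proof (rule uniq)
    have "(\<Sum>z\<in>B. scale M (if z = y then 1 else 0) z) = (\<Sum>z\<in>B. if z = y then y else 0)"
      by (rule sum.cong) (auto simp: scale_one B)
    then show "?P y (\<lambda>z. if z = y then 1 else 0)"
      using that assms(2) by (auto simp: is_basis_def)
  qed (simp add: B that)
  let ?c = "\<lambda>i. zero_outside (carrier M) (\<lambda>x. d x (b i))"
  have bB: "b i \<in> B" if "i < card B" for i
    using bij that by (auto simp: bij_betw_def)
  have "coords M (card B) b ?c"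
    unfolding coords_def
  proof (intro conjI allI impI ballI)
    fix x assume x: "x \<in> carrier M"
    have "x = (\<Sum>y\<in>B. scale M (d x y) y)"
      using P[OF x] by blast
    also have "\<dots> = (\<Sum>i<card B. scale M (?c i x) (b i))"
      using x by (simp add: sum.reindex_bij_betw[OF bij, symmetric])
    finally show "x = \<dots>" .
  next
    fix i j assume "i < card B" "j < card B"
    then show "?c i (b j) = (if i = j then 1 else 0)"
      using bij by (auto simp: dB bB B bij_betw_def inj_on_eq_iff)
  next
    fix i show "?c i \<in> carrier (dual M)"
      by (rule zero_outside_dual[OF assms(1)], rule is_homI) (auto simp: dadd dscale)
  qed (use B bB in auto)
  then show ?thesis by (rule that)
qed

lemma fg_free_iff_coords: "fg_free M \<longleftrightarrow> left_module M \<and> (\<exists>k b c. coords M k b c)"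
  unfolding fg_free_def using basis_coords coords_basis by metis

lemma fg_free_module: "fg_free M \<Longrightarrow> left_module M"
  by (simp add: fg_free_def)

lemma fg_free_coords:
  assumes "fg_free M"
  obtains k b c where "coords M k b c"
  using assms fg_free_iff_coords by blast

lemma coordsD:
  assumes "coords M k b c"
  shows "i < k \<Longrightarrow> b i \<in> carrier M" "i < k \<Longrightarrow> c i \<in> carrier (dual M)"
    "x \<in> carrier M \<Longrightarrow> (\<Sum>i<k. scale M (c i x) (b i)) = x"
    "i < k \<Longrightarrow> j < k \<Longrightarrow> c i (b j) = (if i = j then 1 else 0)"
  using assms by (auto simp: coords_def)

lemma coords_iso:
  fixes M :: "('r::ring_involution, 'm::ab_group_add) lmodule"
    and N :: "('r, 'n::ab_group_add) lmodule"
  assumes M: "left_module M" and N: "left_module N" and iso: "is_iso M N f" and kbc: "coords M k b c"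
  shows "coords N k (\<lambda>i. f (b i)) (\<lambda>i. dual_map N (inv_into (carrier M) f) (c i))"
proof -
  note K = coordsD[OF kbc]
  let ?g = "inv_into (carrier M) f"
  have g: "is_iso N M ?g" by (rule iso_inv[OF M iso])
  have f: "is_hom M N f" using iso by (rule iso_hom)
  have gf: "?g (f x) = x" if "x \<in> carrier M" for x
    using iso_bij[OF iso] that by (auto simp: bij_betw_def)
  have fg: "f (?g x) = x" if "x \<in> carrier N" for x
    using iso_bij[OF iso] that by (auto simp: bij_betw_def f_inv_into_f)
  have gN: "?g x \<in> carrier M" if "x \<in> carrier N" for x
    using hom_closed[OF iso_hom[OF g] that] .
  show ?thesis
    unfolding coords_def
  proof (intro conjI allI impI ballI)
    fix x assume x: "x \<in> carrier N"
    have "x = f (\<Sum>i<k. scale M (c i (?g x)) (b i))"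
      using K(3)[OF gN[OF x]] fg[OF x] by simp
    also have "\<dots> = (\<Sum>i<k. scale N (c i (?g x)) (f (b i)))"
      by (subst hom_sum[OF M f]) (auto simp: K left_module.closed[OF M] hom_scale[OF f])
    finally show "x = (\<Sum>i<k. scale N (dual_map N ?g (c i) x) (f (b i)))"
      using x by simp
  qed (use K hom_closed[OF f] gf in
      \<open>auto intro!: dual_map_closed[OF N iso_hom[OF g]]\<close>)
qed

lemma fg_free_iso:
  fixes M :: "('r::ring_involution, 'm::ab_group_add) lmodule"
    and N :: "('r, 'n::ab_group_add) lmodule"
  assumes "fg_free M" "left_module N" "is_iso M N f"
  shows "fg_free N"
  using coords_iso[OF fg_free_module[OF assms(1)] assms(2,3)] assms(1,2) fg_free_iff_coords by metis

lemma sum_lessThan_add: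
  fixes k l :: nat
  shows "(\<Sum>i<k + l. f i) = (\<Sum>i<k. f i) + (\<Sum>i<l. f (k + i) :: 'a::comm_monoid_add)"
  by (induction l) (simp_all add: add.assoc)

lemma sum_Pair: "(\<Sum>i\<in>A. (f i, g i)) = (sum f A, sum g A)"
  by (induction A rule: infinite_finite_induct) (simp_all add: zero_prod_def)

lemma fg_free_dsum:
  fixes M :: "('r::ring_involution, 'm::ab_group_add) lmodule"
    and N :: "('r, 'n::ab_group_add) lmodule"
  assumes "fg_free M" "fg_free N"
  shows "fg_free (M \<boxplus> N)"
proof -
  obtain k b c where kbc: "coords M k b c"
    using fg_free_coords[OF assms(1)] .
  obtain k' b' c' where kbc': "coords N k' b' c'"
    using fg_free_coords[OF assms(2)] .
  note K = coordsD[OF kbc] and K' = coordsD[OF kbc']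
  interpret M: left_module M using assms fg_free_module by blast
  interpret N: left_module N using assms fg_free_module by blast
  have M: "left_module M" and N: "left_module N" by unfold_locales
  have MN: "left_module (M \<boxplus> N)" by (rule left_module_dsum[OF M N])
  let ?b = "\<lambda>i. if i < k then (b i, 0) else (0, b' (i - k))"
  let ?c = "\<lambda>i. zero_outside (carrier (M \<boxplus> N)) (\<lambda>(x, y). if i < k then c i x else c' (i - k) y)"
  have "coords (M \<boxplus> N) (k + k') ?b ?c"
    unfolding coords_def
  proof (intro conjI allI impI ballI)
    fix z assume z: "z \<in> carrier (M \<boxplus> N)"
    obtain x y where [simp]: "z = (x, y)" by force
    have "z = (\<Sum>i<k. scale M (c i x) (b i), \<Sum>i<k'. scale N (c' i y) (b' i))"
      using z K K' by simp
    also have "\<dots> = (\<Sum>i<k. (scale M (c i x) (b i), 0)) + (\<Sum>i<k'. (0, scale N (c' i y) (b' i)))"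
      by (simp add: sum_Pair)
    also have "\<dots> = (\<Sum>i<k + k'. scale (M \<boxplus> N) (?c i z) (?b i))"
      using z by (simp add: sum_lessThan_add)
    finally show "z = \<dots>" .
  next
    fix i assume i: "i < k + k'"
    show "?c i \<in> carrier (dual (M \<boxplus> N))"
      by (rule zero_outside_dual[OF MN], rule is_homI)
        (use i in \<open>auto simp: dual_add[OF K(2)] dual_add[OF K'(2)] dual_scale[OF K(2)] dual_scale[OF K'(2)]\<close>)
  next
    fix i j assume "i < k + k'" "j < k + k'"
    then show "?c i (?b j) = (if i = j then 1 else 0)"
      by (auto simp: K K' M.closed N.closed dual_zero[OF M K(2)] dual_zero[OF N K'(2)])
  qed (auto simp: K K' M.closed N.closed)
  then show ?thesis
    using MN fg_free_iff_coords by blast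
qed

lemma sum_fun_apply: "(\<Sum>i\<in>A. f i) x = (\<Sum>i\<in>A. f i x)"
  by (induction A rule: infinite_finite_induct) simp_all

text \<open>The bar comes from the action on the dual: the scalar \<open>a\<close> multiplies values
  on the right by \<open>bar a\<close>, so the coefficient of \<open>c i\<close> must be
  \<open>bar (f (b i))\<close> for the value at \<open>b i\<close> to be
  \<open>f (b i)\<close>.\<close>

lemma dual_coords:
  fixes M :: "('r::ring_involution, 'm::ab_group_add) lmodule"
  assumes "left_module M" "coords M k b c" "f \<in> carrier (dual M)"
  shows "f = (\<Sum>i<k. scale (dual M) (bar (f (b i))) (c i))"
proof -
  note K = coordsD[OF assms(2)]
  interpret M: left_module M by fact
  interpret D: left_module "dual M" by (rule left_module_dual[OF assms(1)])
  show ?thesis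
  proof (rule dual_eqI[OF assms(3)])
    fix x assume x: "x \<in> carrier M"
    have "f x = f (\<Sum>i<k. scale M (c i x) (b i))"
      by (simp add: K x)
    also have "\<dots> = (\<Sum>i<k. c i x * f (b i))"
      by (subst hom_sum[OF assms(1) dual_hom[OF assms(3)]])
        (auto simp: dual_scale[OF assms(3)] K M.closed)
    finally show "f x = (\<Sum>i<k. scale (dual M) (bar (f (b i))) (c i)) x"
      by (simp add: sum_fun_apply bar_bar)
  qed (auto intro!: D.sum_closed D.scale_closed simp: K)
qed

lemma coords_dual:
  fixes M :: "('r::ring_involution, 'm::ab_group_add) lmodule"
  assumes M: "left_module M" and kbc: "coords M k b c"
  shows "coords (dual M) k c (\<lambda>i. zero_outside (carrier (dual M)) (\<lambda>f. bar (f (b i))))"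
proof -
  note K = coordsD[OF kbc]
  have D: "left_module (dual M)" by (rule left_module_dual[OF M])
  show ?thesis
    unfolding coords_def
  proof (intro conjI allI impI ballI)
    fix f assume "f \<in> carrier (dual M)"
    then show "f = (\<Sum>i<k. scale (dual M) (zero_outside (carrier (dual M)) (\<lambda>f. bar (f (b i))) f) (c i))"
      using dual_coords[OF M kbc] by simp
  next
    fix i assume i: "i < k"
    show "zero_outside (carrier (dual M)) (\<lambda>f. bar (f (b i))) \<in> carrier (dual (dual M))"
      by (rule zero_outside_dual[OF D], rule is_homI) (auto simp: bar_simps)
  qed (auto simp: K bar_simps)
qed

lemma fg_free_dual:
  fixes M :: "('r::ring_involution, 'm::ab_group_add) lmodule"
  assumes "fg_free M"
  shows "fg_free (dual M)"
  using assms coords_dual left_module_dual fg_free_iff_coords by metis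

lemma fg_free_zero: "fg_free (zero_module :: ('r::ring_involution, 'm::ab_group_add) lmodule)"
proof -
  have "left_module (zero_module :: ('r, 'm) lmodule)"
    by unfold_locales simp_all
  moreover have "coords (zero_module :: ('r, 'm) lmodule) 0 b c" for b c
    by (simp add: coords_def)
  ultimately show ?thesis
    using fg_free_iff_coords by blast
qed

text \<open>The free module of rank \<open>k\<close> inside \<open>'r univ\<close>. It replaces free
  modules over product or function types wherever a definition quantifies over
  \<open>'r univ\<close>.\<close>

definition std_module :: "nat \<Rightarrow> ('r::ring_1, 'r univ) lmodule" where
  "std_module k = \<lparr>carrier = {x. \<forall>i\<ge>k. x i = 0}, scale = (\<lambda>a x i. a * x i)\<rparr>"

lemma left_module_std: "left_module (std_module k :: ('r::ring_1, 'r univ) lmodule)"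
  by unfold_locales (auto simp: std_module_def algebra_simps fun_eq_iff)

lemma coords_std_module:
  fixes M :: "('r::ring_involution, 'm::ab_group_add) lmodule"
  assumes M: "left_module M" and kbc: "coords M k b c"
  shows "is_iso M (std_module k) (\<lambda>x i. if i < k then c i x else 0)"
proof -
  note K = coordsD[OF kbc]
  interpret M: left_module M by fact
  let ?g = "\<lambda>x i. if i < k then c i x else 0"
  show ?thesis
  proof (rule is_isoI[OF M])
    show "is_hom M (std_module k) ?g"
      by (rule is_homI) (auto simp: std_module_def dual_add[OF K(2)] dual_scale[OF K(2)])
  next
    fix x assume x: "x \<in> carrier M" and 0: "?g x = 0"
    have "c i x = 0" if "i < k" for i
      using 0 that by (auto simp: fun_eq_iff split: if_splits)
    then show "x = 0" using K(3)[OF x] by (simp add: K)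
  next
    fix y :: "'r univ" assume y: "y \<in> carrier (std_module k)"
    let ?x = "\<Sum>j<k. scale M (y j) (b j)"
    have "c i ?x = y i" if i: "i < k" for i
    proof -
      have "c i ?x = (\<Sum>j<k. y j * c i (b j))"
        by (subst hom_sum[OF M dual_hom[OF K(2)[OF i]]])
          (auto simp del: K(4) simp: dual_scale[OF K(2)[OF i]] K(1) M.closed i)
      also have "\<dots> = (\<Sum>j<k. if j = i then y j else 0)"
        by (rule sum.cong) (auto simp: K i)
      finally have "c i ?x = (\<Sum>j<k. if j = i then y j else 0)" .
      then show ?thesis using i by simp
    qed
    then have "?g ?x = y"
      using y by (auto simp: std_module_def fun_eq_iff)
    moreover have "?x \<in> carrier M"
      by (auto intro!: M.sum_closed M.scale_closed simp: K)
    ultimately show "\<exists>x\<in>carrier M. ?g x = y" by blast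
  qed
qed

lemma iso_std_module:
  fixes M :: "('r::ring_involution, 'm::ab_group_add) lmodule"
  assumes "fg_free M"
  obtains k f where "is_iso (std_module k :: ('r, 'r univ) lmodule) M f"
    "fg_free (std_module k :: ('r, 'r univ) lmodule)"
proof -
  have M: "left_module M" using assms fg_free_module by blast
  obtain k b c where kbc: "coords M k b c"
    using fg_free_coords[OF assms(1)] .
  note g = coords_std_module[OF M kbc]
  show ?thesis
    by (rule that[OF iso_inv[OF M g] fg_free_iso[OF assms left_module_std g]])
qed

text \<open>Presents a free module as a dual: the second lagrangian of a complex is parametrised by
  \<open>dual (cbot C)\<close>, so the bottom module of a complex has to be found as a
  predual.\<close>

lemma dual_std_module_iso:
  fixes M :: "('r::ring_involution, 'm::ab_group_add) lmodule"
  assumes "fg_free M"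
  obtains k f where "is_iso (dual (std_module k :: ('r, 'r univ) lmodule)) M f"
    "fg_free (std_module k :: ('r, 'r univ) lmodule)"
proof -
  have M: "left_module M" using assms fg_free_module by blast
  obtain k b c where kbc: "coords M k b c"
    using fg_free_coords[OF assms(1)] .
  note g = coords_std_module[OF M kbc]
  let ?S = "std_module k :: ('r, 'r univ) lmodule"
  have D: "left_module (dual ?S)" by (rule left_module_dual[OF left_module_std])
  note h = coords_std_module[OF D coords_dual[OF left_module_std coords_iso[OF M left_module_std g kbc]]]
  show ?thesis
    by (rule that[OF iso_comp[OF h iso_inv[OF M g]] fg_free_iso[OF assms left_module_std g]])
qed

text \<open>The coordinates already separate points. Equations between elements known only through a
  pairing are proved by testing against all functionals.\<close>

lemma dual_separates:
  fixes M :: "('r::ring_involution, 'm::ab_group_add) lmodule"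
  assumes "fg_free M" "x \<in> carrier M" "y \<in> carrier M"
    and "\<And>f. f \<in> carrier (dual M) \<Longrightarrow> f x = f y"
  shows "x = y"
proof -
  obtain k b c where kbc: "coords M k b c"
    using fg_free_coords[OF assms(1)] .
  note K = coordsD[OF kbc]
  have "(\<Sum>i<k. scale M (c i x) (b i)) = (\<Sum>i<k. scale M (c i y) (b i))"
    by (rule sum.cong) (simp_all add: assms(4)[OF K(2)])
  then show ?thesis using K(3)[OF assms(2)] K(3)[OF assms(3)] by simp
qed

text \<open>Reflexivity: \<open>p\<close> is evaluation at the element with coordinates
  \<open>bar (p (c i))\<close>. The conjugate is the one in the identification of a module with its
  bidual.\<close>

lemma bidual_represent:
  fixes M :: "('r::ring_involution, 'm::ab_group_add) lmodule"
  assumes "fg_free M" "is_hom (dual M) ring_module p"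
  shows "\<exists>x\<in>carrier M. \<forall>f\<in>carrier (dual M). f x = bar (p f)"
proof -
  obtain k b c where kbc: "coords M k b c"
    using fg_free_coords[OF assms(1)] .
  note K = coordsD[OF kbc]
  interpret M: left_module M using assms fg_free_module by blast
  interpret D: left_module "dual M" using left_module_dual M.left_module_axioms .
  let ?x = "\<Sum>i<k. scale M (bar (p (c i))) (b i)"
  have "f ?x = bar (p f)" if f: "f \<in> carrier (dual M)" for f
  proof -
    have "f ?x = (\<Sum>i<k. bar (p (c i)) * f (b i))"
      by (subst hom_sum[OF M.left_module_axioms dual_hom[OF f]])
        (auto simp: dual_scale[OF f] K M.closed)
    also have "\<dots> = bar (p (\<Sum>i<k. scale (dual M) (bar (f (b i))) (c i)))"
      by (subst hom_sum[OF D.left_module_axioms assms(2)])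
        (auto simp: hom_scale[OF assms(2)] K D.closed bar_sum bar_simps)
    also have "\<dots> = bar (p f)"
      using dual_coords[OF M.left_module_axioms kbc f] by simp
    finally show ?thesis .
  qed
  moreover have "?x \<in> carrier M"
    by (auto intro!: M.sum_closed M.scale_closed simp: K)
  ultimately show ?thesis by blast
qed

text \<open>\<open>codual_map\<close> inverts the evaluation map, which is injective by
  \<open>dual_separates\<close> and attains the functional in question by
  \<open>bidual_represent\<close>. Later arguments use only the adjunction formula, which determines
  the value.\<close>

lemma codual_map:
  fixes M :: "('r::ring_involution, 'm::ab_group_add) lmodule" and N :: "('r, 'n::ab_group_add) lmodule"
  assumes "fg_free M" "is_hom (dual M) N p" "g \<in> carrier (dual N)"
  shows codual_map_closed: "codual_map M p g \<in> carrier M"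
    and codual_map_apply: "f \<in> carrier (dual M) \<Longrightarrow> f (codual_map M p g) = bar (g (p f))"
proof -
  have "is_hom (dual M) ring_module (\<lambda>f. g (p f))"
    using hom_comp[OF assms(2) dual_hom[OF assms(3)]] .
  then obtain x where x: "x \<in> carrier M" "\<And>f. f \<in> carrier (dual M) \<Longrightarrow> f x = bar (g (p f))"
    using bidual_represent[OF assms(1)] by meson
  have ev: "eval_bidual M x = dual_map (dual M) p g"
    by (rule ext) (simp add: eval_bidual_def dual_map_def zero_outside_def x bar_bar)
  have "inj_on (eval_bidual M) (carrier M)"
  proof (rule inj_onI)
    fix y z assume y: "y \<in> carrier M" and z: "z \<in> carrier M" and eq: "eval_bidual M y = eval_bidual M z"
    have "f y = f z" if "f \<in> carrier (dual M)" for f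
    proof -
      have "bar (f y) = bar (f z)"
        using fun_cong[OF eq, of f] that by (simp add: eval_bidual_def)
      then show ?thesis by (metis bar_bar)
    qed
    then show "y = z" by (rule dual_separates[OF assms(1) y z])
  qed
  then have "codual_map M p g = x"
    using x(1) by (simp add: codual_map_def ev[symmetric])
  with x show "codual_map M p g \<in> carrier M"
    "f \<in> carrier (dual M) \<Longrightarrow> f (codual_map M p g) = bar (g (p f))" by auto
qed

lemma codual_map_eqI:
  fixes M :: "('r::ring_involution, 'm::ab_group_add) lmodule" and N :: "('r, 'n::ab_group_add) lmodule"
  assumes "fg_free M" "is_hom (dual M) N p" "g \<in> carrier (dual N)" "y \<in> carrier M"
    and "\<And>f. f \<in> carrier (dual M) \<Longrightarrow> f y = bar (g (p f))"
  shows "codual_map M p g = y"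
  by (rule dual_separates[OF assms(1)])
    (simp_all add: codual_map_closed[OF assms(1-3)] codual_map_apply[OF assms(1-3)] assms)

lemma codual_map_hom:
  fixes M :: "('r::ring_involution, 'm::ab_group_add) lmodule" and N :: "('r, 'n::ab_group_add) lmodule"
  assumes "fg_free M" "left_module N" "is_hom (dual M) N p"
  shows "is_hom (dual N) M (codual_map M p)"
proof -
  interpret M: left_module M using assms fg_free_module by blast
  interpret D: left_module "dual N" using left_module_dual assms(2) .
  note cl = codual_map_closed[OF assms(1,3)] and ap = codual_map_apply[OF assms(1,3)]
  show ?thesis
  proof (rule is_homI)
    fix g h assume g: "g \<in> carrier (dual N)" and h: "h \<in> carrier (dual N)"
    show "codual_map M p (g + h) = codual_map M p g + codual_map M p h"
      by (rule codual_map_eqI[OF assms(1,3)])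
        (use g h in \<open>auto simp: D.closed M.closed cl ap dual_add bar_simps\<close>)
  next
    fix a g assume g: "g \<in> carrier (dual N)"
    show "codual_map M p (scale (dual N) a g) = scale M a (codual_map M p g)"
      by (rule codual_map_eqI[OF assms(1,3)])
        (use g in \<open>auto simp: D.closed M.closed cl ap dual_scale bar_simps\<close>)
  qed (rule cl)
qed

text \<open>A free module is projective: the basis elements are lifted and the lifts extended
  linearly.\<close>

lemma hom_section:
  fixes M :: "('r::ring_involution, 'm::ab_group_add) lmodule" and N :: "('r, 'n::ab_group_add) lmodule"
  assumes "left_module M" "fg_free N" "is_hom M N p" "\<And>y. y \<in> carrier N \<Longrightarrow> \<exists>x\<in>carrier M. p x = y"
  obtains s where "is_hom N M s" "\<And>y. y \<in> carrier N \<Longrightarrow> p (s y) = y"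
proof -
  obtain k b c where kbc: "coords N k b c"
    using fg_free_coords[OF assms(2)] .
  note K = coordsD[OF kbc]
  interpret M: left_module M by fact
  interpret N: left_module N using assms fg_free_module by blast
  obtain w where w: "\<And>i. i < k \<Longrightarrow> w i \<in> carrier M \<and> p (w i) = b i"
    using assms(4)[OF K(1)] by metis
  let ?s = "\<lambda>y. \<Sum>i<k. scale M (c i y) (w i)"
  have "is_hom N M ?s"
  proof (rule is_homI)
    fix x y assume "x \<in> carrier N" "y \<in> carrier N"
    then show "?s (x + y) = ?s x + ?s y"
      by (simp add: dual_add[OF K(2)] M.scale_add_left w sum.distrib)
  next
    fix a x assume "x \<in> carrier N"
    then show "?s (scale N a x) = scale M a (?s x)"
      by (subst M.scale_sum) (auto intro!: sum.cong simp: dual_scale[OF K(2)] M.scale_scale w M.closed)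
  qed (auto intro!: M.sum_closed M.scale_closed simp: w)
  moreover have "p (?s y) = y" if "y \<in> carrier N" for y
    by (subst hom_sum[OF assms(1,3)]) (auto simp: w M.closed hom_scale[OF assms(3)] K that)
  ultimately show ?thesis by (rule that)
qed

section \<open>Sesquilinear and quadratic forms\<close>

lemma Qcls_eq_iff: "Qcls \<epsilon> a = Qcls \<epsilon> b \<longleftrightarrow> (\<exists>c. a - b = c - \<epsilon> * bar c)"
proof
  assume "Qcls \<epsilon> a = Qcls \<epsilon> b"
  moreover have "a \<in> Qcls \<epsilon> a"
    unfolding Qcls_def by (rule CollectI, rule exI[of _ 0]) simp
  ultimately obtain c where "a = b + (c - \<epsilon> * bar c)"
    by (auto simp: Qcls_def)
  then show "\<exists>c. a - b = c - \<epsilon> * bar c" by auto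
next
  assume "\<exists>c. a - b = c - \<epsilon> * bar c"
  then obtain c where c: "a = b + (c - \<epsilon> * bar c)"
    by (metis add.commute diff_add_cancel)
  have "b + (c - \<epsilon> * bar c) + (d - \<epsilon> * bar d) = b + ((c + d) - \<epsilon> * bar (c + d))" for d
    by (simp add: bar_simps algebra_simps)
  moreover have "b + (d - \<epsilon> * bar d) = b + (c - \<epsilon> * bar c) + ((d - c) - \<epsilon> * bar (d - c))" for d
    by (simp add: bar_simps algebra_simps)
  ultimately show "Qcls \<epsilon> a = Qcls \<epsilon> b"
    unfolding c Qcls_def by blast
qed

lemma Qcls_refl: "a \<in> Qcls \<epsilon> a"
  unfolding Qcls_def by (rule CollectI, rule exI[of _ 0]) simp

lemma Qcls_mem: "a \<in> Qcls \<epsilon> b \<longleftrightarrow> Qcls \<epsilon> a = Qcls \<epsilon> b"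
  unfolding Qcls_eq_iff by (auto simp: Qcls_def algebra_simps)

lemma Qcls_add: "{x + y | x y. x \<in> Qcls \<epsilon> a \<and> y \<in> Qcls \<epsilon> b} = Qcls \<epsilon> (a + b)"
proof (intro equalityI subsetI)
  fix z assume "z \<in> {x + y | x y. x \<in> Qcls \<epsilon> a \<and> y \<in> Qcls \<epsilon> b}"
  then obtain c d where "z = a + (c - \<epsilon> * bar c) + (b + (d - \<epsilon> * bar d))"
    by (auto simp: Qcls_def)
  then have "z = (a + b) + ((c + d) - \<epsilon> * bar (c + d))"
    by (simp add: bar_simps algebra_simps)
  then show "z \<in> Qcls \<epsilon> (a + b)" by (auto simp: Qcls_def)
next
  fix z assume "z \<in> Qcls \<epsilon> (a + b)"
  then obtain c where "z = a + (c - \<epsilon> * bar c) + b"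
    by (auto simp: Qcls_def algebra_simps)
  moreover have "a + (c - \<epsilon> * bar c) \<in> Qcls \<epsilon> a" by (auto simp: Qcls_def)
  ultimately show "z \<in> {x + y | x y. x \<in> Qcls \<epsilon> a \<and> y \<in> Qcls \<epsilon> b}"
    using Qcls_refl[of b \<epsilon>] by blast
qed

lemma Qcls_uminus: "uminus ` Qcls \<epsilon> a = Qcls \<epsilon> (- a)"
proof (intro equalityI subsetI)
  fix z assume "z \<in> uminus ` Qcls \<epsilon> a"
  then obtain c where "z = - (a + (c - \<epsilon> * bar c))"
    by (auto simp: Qcls_def)
  then have "z = - a + ((- c) - \<epsilon> * bar (- c))"
    by (simp add: bar_simps algebra_simps)
  then show "z \<in> Qcls \<epsilon> (- a)" by (auto simp: Qcls_def)
next
  fix z assume "z \<in> Qcls \<epsilon> (- a)"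
  then obtain c where "z = - a + (c - \<epsilon> * bar c)"
    by (auto simp: Qcls_def)
  then have "z = - (a + ((- c) - \<epsilon> * bar (- c)))"
    by (simp add: bar_simps algebra_simps)
  moreover have "a + ((- c) - \<epsilon> * bar (- c)) \<in> Qcls \<epsilon> a"
    unfolding Qcls_def by blast
  ultimately show "z \<in> uminus ` Qcls \<epsilon> a" by blast
qed

text \<open>Conjugation \<open>x \<mapsto> a * x * bar a\<close> carries
  \<open>c - \<epsilon> * bar c\<close> to an element of the same shape, so it acts on
  classes.\<close>

lemma Qcls_conj:
  assumes "is_sign \<epsilon>" "Qcls \<epsilon> x = Qcls \<epsilon> y"
  shows "Qcls \<epsilon> (a * x * bar a) = Qcls \<epsilon> (a * y * bar a)"
proof -
  obtain c where "x - y = c - \<epsilon> * bar c" using assms(2) Qcls_eq_iff by blast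
  then have "a * x * bar a - a * y * bar a = a * (c - \<epsilon> * bar c) * bar a"
    by (metis left_diff_distrib right_diff_distrib)
  also have "\<dots> = a * c * bar a - \<epsilon> * bar (a * c * bar a)"
    using assms(1) by (auto simp: is_sign_def bar_simps algebra_simps)
  finally show ?thesis unfolding Qcls_eq_iff by blast
qed

text \<open>The pairing view of a homomorphism to the dual, with values outside the carrier left
  arbitrary; \<open>sesquilinear_hom_dual\<close> adds the truncation.\<close>

definition sesquilinear :: "('r::ring_involution, 'm::ab_group_add) lmodule \<Rightarrow> ('m \<Rightarrow> 'm \<Rightarrow> 'r) \<Rightarrow> bool" where
  "sesquilinear M \<chi> \<longleftrightarrow>
     (\<forall>x\<in>carrier M. \<forall>y\<in>carrier M. \<forall>z\<in>carrier M. \<chi> (x + y) z = \<chi> x z + \<chi> y z) \<and>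
     (\<forall>x\<in>carrier M. \<forall>y\<in>carrier M. \<forall>z\<in>carrier M. \<chi> z (x + y) = \<chi> z x + \<chi> z y) \<and>
     (\<forall>a. \<forall>x\<in>carrier M. \<forall>y\<in>carrier M. \<chi> (scale M a x) y = \<chi> x y * bar a) \<and>
     (\<forall>a. \<forall>x\<in>carrier M. \<forall>y\<in>carrier M. \<chi> x (scale M a y) = a * \<chi> x y)"

lemma sesquilinearD:
  assumes "sesquilinear M \<chi>"
  shows "x \<in> carrier M \<Longrightarrow> y \<in> carrier M \<Longrightarrow> z \<in> carrier M \<Longrightarrow> \<chi> (x + y) z = \<chi> x z + \<chi> y z"
    "x \<in> carrier M \<Longrightarrow> y \<in> carrier M \<Longrightarrow> z \<in> carrier M \<Longrightarrow> \<chi> z (x + y) = \<chi> z x + \<chi> z y"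
    "x \<in> carrier M \<Longrightarrow> y \<in> carrier M \<Longrightarrow> \<chi> (scale M a x) y = \<chi> x y * bar a"
    "x \<in> carrier M \<Longrightarrow> y \<in> carrier M \<Longrightarrow> \<chi> x (scale M a y) = a * \<chi> x y"
  using assms by (simp_all add: sesquilinear_def)

lemma hom_dual_sesquilinear:
  assumes "is_hom M (dual M) \<chi>"
  shows "sesquilinear M \<chi>"
  unfolding sesquilinear_def
  by (simp add: hom_add[OF assms] hom_scale[OF assms] dual_add[OF hom_closed[OF assms]]
      dual_scale[OF hom_closed[OF assms]])

lemma sesquilinear_hom_dual:
  fixes M :: "('r::ring_involution, 'm::ab_group_add) lmodule"
  assumes "left_module M" "sesquilinear M \<chi>"
  shows "is_hom M (dual M) (\<lambda>x. zero_outside (carrier M) (\<chi> x))"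
proof (rule is_homI)
  fix x assume "x \<in> carrier M"
  then show "zero_outside (carrier M) (\<chi> x) \<in> carrier (dual M)"
    by (intro zero_outside_dual[OF assms(1)] is_homI) (simp_all add: sesquilinearD[OF assms(2)])
next
  fix x y assume "x \<in> carrier M" "y \<in> carrier M"
  then show "zero_outside (carrier M) (\<chi> (x + y)) = zero_outside (carrier M) (\<chi> x) + zero_outside (carrier M) (\<chi> y)"
    by (auto simp: fun_eq_iff zero_outside_def sesquilinearD[OF assms(2)])
next
  fix a x assume "x \<in> carrier M"
  then show "zero_outside (carrier M) (\<chi> (scale M a x)) = scale (dual M) a (zero_outside (carrier M) (\<chi> x))"
    by (auto simp: fun_eq_iff zero_outside_def sesquilinearD[OF assms(2)])
qed

lemma sesquilinear_zero:
  assumes "left_module M" "sesquilinear M \<chi>" "x \<in> carrier M"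
  shows "\<chi> 0 x = 0" "\<chi> x 0 = 0"
  using sesquilinearD(1)[OF assms(2), of 0 0 x] sesquilinearD(2)[OF assms(2), of 0 0 x]
    left_module.zero_closed[OF assms(1)] assms(3) by simp_all

lemma sesquilinear_sum_left:
  assumes M: "left_module M" and \<chi>: "sesquilinear M \<chi>" and "\<And>i. i \<in> A \<Longrightarrow> f i \<in> carrier M" "x \<in> carrier M"
  shows "\<chi> (sum f A) x = (\<Sum>i\<in>A. \<chi> (f i) x)"
  using assms(3,4)
  by (induction A rule: infinite_finite_induct)
    (simp_all add: sesquilinear_zero[OF M \<chi>] sesquilinearD[OF \<chi>] left_module.sum_closed[OF M])

lemma sesquilinear_sum_right:
  assumes M: "left_module M" and \<chi>: "sesquilinear M \<chi>" and "\<And>i. i \<in> A \<Longrightarrow> f i \<in> carrier M" "x \<in> carrier M"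
  shows "\<chi> x (sum f A) = (\<Sum>i\<in>A. \<chi> x (f i))"
  using assms(3,4)
  by (induction A rule: infinite_finite_induct)
    (simp_all add: sesquilinear_zero[OF M \<chi>] sesquilinearD[OF \<chi>] left_module.sum_closed[OF M])

text \<open>The matrix of \<open>\<chi>\<close> is the upper triangle of the matrix of \<open>l\<close>, with \<open>d\<close> on the diagonal.\<close>

lemma triangular_splitting:
  fixes M :: "('r::ring_involution, 'm::ab_group_add) lmodule"
  assumes M: "left_module M" and K: "coords M k b c" and l: "sesquilinear M l" and \<eta>: "is_sign \<eta>"
    and sym: "\<And>x y. x \<in> carrier M \<Longrightarrow> y \<in> carrier M \<Longrightarrow> l x y = \<eta> * bar (l y x)"
    and d: "\<And>i. i < k \<Longrightarrow> l (b i) (b i) = d i + \<eta> * bar (d i)"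
  obtains \<chi> where "sesquilinear M \<chi>"
    "\<And>x y. x \<in> carrier M \<Longrightarrow> y \<in> carrier M \<Longrightarrow> l x y = \<chi> x y + \<eta> * bar (\<chi> y x)"
    "\<And>i. i < k \<Longrightarrow> \<chi> (b i) (b i) = d i"
proof -
  note K = coordsD[OF K]
  interpret left_module M by fact
  let ?T = "\<lambda>i j. if i < j then l (b i) (b j) else if i = j then d i else 0"
  let ?\<chi> = "\<lambda>x y. \<Sum>i<k. \<Sum>j<k. c j y * ?T i j * bar (c i x)"
  \<comment> \<open>Above the diagonal only the first summand is nonzero, below it only the second,
    which is \<open>l (b i) (b j)\<close> by symmetry; on the diagonal this is the hypothesis on
    \<open>d\<close>.\<close>
  have T: "l (b i) (b j) = ?T i j + \<eta> * bar (?T j i)" if "i < k" "j < k" for i j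
    using that d[of i] sym[of "b i" "b j"] by (auto simp: K)
  have split: "l x y = ?\<chi> x y + \<eta> * bar (?\<chi> y x)" if x: "x \<in> carrier M" and y: "y \<in> carrier M" for x y
  proof -
    have "l x y = l (\<Sum>i<k. scale M (c i x) (b i)) (\<Sum>j<k. scale M (c j y) (b j))"
      by (simp add: K x y)
    also have "\<dots> = (\<Sum>i<k. l (scale M (c i x) (b i)) (\<Sum>j<k. scale M (c j y) (b j)))"
      by (rule sesquilinear_sum_left[OF M l]) (auto simp: K closed intro!: sum_closed)
    also have "\<dots> = (\<Sum>i<k. \<Sum>j<k. c j y * l (b i) (b j) * bar (c i x))"
    proof (rule sum.cong[OF refl])
      fix i assume "i \<in> {..<k}"
      then show "l (scale M (c i x) (b i)) (\<Sum>j<k. scale M (c j y) (b j)) =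
          (\<Sum>j<k. c j y * l (b i) (b j) * bar (c i x))"
        by (subst sesquilinear_sum_right[OF M l])
          (auto simp: K closed sesquilinearD[OF l] mult.assoc)
    qed
    also have "\<dots> = (\<Sum>i<k. \<Sum>j<k. c j y * ?T i j * bar (c i x) + c j y * (\<eta> * bar (?T j i)) * bar (c i x))"
    proof (intro sum.cong refl)
      fix i j assume "i \<in> {..<k}" "j \<in> {..<k}"
      then have "l (b i) (b j) = ?T i j + \<eta> * bar (?T j i)"
        using T by blast
      from arg_cong[OF this, of "\<lambda>z. c j y * z * bar (c i x)"]
      show "c j y * l (b i) (b j) * bar (c i x)
          = c j y * ?T i j * bar (c i x) + c j y * (\<eta> * bar (?T j i)) * bar (c i x)"
        by (simp only: distrib_left distrib_right)
    qed
    also have "\<dots> = ?\<chi> x y + (\<Sum>i<k. \<Sum>j<k. c j y * (\<eta> * bar (?T j i)) * bar (c i x))"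
      by (simp only: sum.distrib)
    also have "(\<Sum>i<k. \<Sum>j<k. c j y * (\<eta> * bar (?T j i)) * bar (c i x))
        = (\<Sum>i<k. \<Sum>j<k. \<eta> * bar (c i x * ?T j i * bar (c j y)))"
      using \<eta> by (auto simp: is_sign_def bar_simps mult.assoc)
    also have "\<dots> = \<eta> * bar (?\<chi> y x)"
      by (subst sum.swap) (simp only: bar_sum sum_distrib_left)
    finally show ?thesis .
  qed
  have sesq: "sesquilinear M ?\<chi>"
    unfolding sesquilinear_def
  proof (intro conjI allI ballI)
    fix x y z assume "x \<in> carrier M" "y \<in> carrier M" "z \<in> carrier M"
    then show "?\<chi> (x + y) z = ?\<chi> x z + ?\<chi> y z" "?\<chi> z (x + y) = ?\<chi> z x + ?\<chi> z y"
      by - ((subst sum.distrib[symmetric], intro sum.cong refl)+,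
          simp add: dual_add[OF K(2)] bar_add distrib_left distrib_right)+
  next
    fix a x y assume "x \<in> carrier M" "y \<in> carrier M"
    then show "?\<chi> (scale M a x) y = ?\<chi> x y * bar a" "?\<chi> x (scale M a y) = a * ?\<chi> x y"
      by (simp_all only: sum_distrib_left sum_distrib_right)
        (intro sum.cong refl, simp add: dual_scale[OF K(2)] bar_mult mult.assoc)+
  qed
  have diag: "?\<chi> (b i) (b i) = d i" if i: "i < k" for i
  proof -
    have "?\<chi> (b i) (b i) = (\<Sum>p<k. \<Sum>q<k. if q = i then (if p = i then d i else 0) else 0)"
      by (intro sum.cong refl) (auto simp: K i bar_simps)
    also have "\<dots> = d i" using i by simp
    finally show ?thesis .
  qed
  show ?thesis by (rule that[OF sesq split diag])
qed

text \<open>Evenness at the basis vectors supplies the diagonal for the triangular splitting. This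
  is how quadratic data are recovered from a symmetric even form: the quadratic function of a
  boundary, \<open>psi1\<close> of a complex and \<open>\<delta>\<psi>\<close> of a cobordism all
  come from such a \<open>\<chi>\<close>.\<close>

lemma even_splitting:
  fixes M :: "('r::ring_involution, 'm::ab_group_add) lmodule"
  assumes M: "fg_free M" and l: "sesquilinear M l" and \<eta>: "is_sign \<eta>"
    and sym: "\<And>x y. x \<in> carrier M \<Longrightarrow> y \<in> carrier M \<Longrightarrow> l x y = \<eta> * bar (l y x)"
    and even: "\<And>x. x \<in> carrier M \<Longrightarrow> \<exists>a. l x x = a + \<eta> * bar a"
  obtains \<chi> where "sesquilinear M \<chi>"
    "\<And>x y. x \<in> carrier M \<Longrightarrow> y \<in> carrier M \<Longrightarrow> l x y = \<chi> x y + \<eta> * bar (\<chi> y x)"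
proof -
  obtain k b c where kbc: "coords M k b c"
    using fg_free_coords[OF M] .
  have "\<forall>i\<in>{..<k}. \<exists>a. l (b i) (b i) = a + \<eta> * bar a"
    using even coordsD(1)[OF kbc] by blast
  from bchoice[OF this] obtain d where d: "\<And>i. i < k \<Longrightarrow> l (b i) (b i) = d i + \<eta> * bar (d i)"
    by auto
  show ?thesis
    by (rule triangular_splitting[OF fg_free_module[OF M] kbc l \<eta> sym d]) (use that in blast)+
qed

text \<open>The passage from the class of \<open>\<chi>\<close> in \<open>Q_\<epsilon>(K)\<close> to
  the pair of \<open>lam\<close> and \<open>mu\<close>. Building a form from a \<open>\<chi>\<close>
  settles the axioms for the coset-valued \<open>mu\<close> once for all constructions.\<close>

lemma quadratic_formI:
  assumes M: "fg_free (fmod K)" and lam: "is_hom (fmod K) (dual (fmod K)) (lam K)" and \<epsilon>: "is_sign \<epsilon>"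
    and \<chi>: "sesquilinear (fmod K) \<chi>"
    and l: "\<And>x y. x \<in> carrier (fmod K) \<Longrightarrow> y \<in> carrier (fmod K) \<Longrightarrow> lam K x y = \<chi> x y + \<epsilon> * bar (\<chi> y x)"
    and mu: "\<And>x. x \<in> carrier (fmod K) \<Longrightarrow> mu K x = Qcls \<epsilon> (\<chi> x x)"
  shows "quadratic_form \<epsilon> K"
proof -
  interpret left_module "fmod K" using M fg_free_module by blast
  note S = sesquilinearD[OF \<chi>]
  show ?thesis
    unfolding quadratic_form_def
  proof (intro conjI ballI allI M lam)
    fix x y assume "x \<in> carrier (fmod K)" "y \<in> carrier (fmod K)"
    then show "lam K x y = \<epsilon> * bar (lam K y x)"
      using \<epsilon> by (auto simp: l is_sign_def bar_simps)
  next
    fix x assume "x \<in> carrier (fmod K)"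
    then show "mu K x \<in> range (Qcls \<epsilon>)" by (simp add: mu)
  next
    fix x y a b assume x: "x \<in> carrier (fmod K)" and y: "y \<in> carrier (fmod K)"
      and "a \<in> mu K x" "b \<in> mu K y"
    then obtain c d where c: "a = \<chi> x x + (c - \<epsilon> * bar c)" and d: "b = \<chi> y y + (d - \<epsilon> * bar d)"
      by (auto simp: mu Qcls_def)
    \<comment> \<open>What remains is \<open>\<chi> y x\<close> against its conjugate in
      \<open>lam K x y\<close>, corrected by \<open>c\<close> and \<open>d\<close>, which record the
      representatives chosen in the two classes.\<close>
    have "\<chi> (x + y) (x + y) - (a + b + lam K x y)
        = (\<chi> y x - c - d) - \<epsilon> * bar (\<chi> y x - c - d)"
      by (simp add: c d l x y S closed bar_simps algebra_simps)
    then have "Qcls \<epsilon> (\<chi> (x + y) (x + y)) = Qcls \<epsilon> (a + b + lam K x y)"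
      unfolding Qcls_eq_iff by blast
    then show "mu K (x + y) = Qcls \<epsilon> (a + b + lam K x y)"
      by (simp add: mu x y closed)
  next
    fix x a assume x: "x \<in> carrier (fmod K)" and "a \<in> mu K x"
    then obtain c where c: "a = \<chi> x x + (c - \<epsilon> * bar c)"
      by (auto simp: mu Qcls_def)
    show "a + \<epsilon> * bar a = lam K x x"
      using \<epsilon> by (auto simp: c l x is_sign_def bar_simps algebra_simps)
  next
    fix x a b assume x: "x \<in> carrier (fmod K)" and b: "b \<in> mu K x"
    then have "Qcls \<epsilon> (\<chi> x x) = Qcls \<epsilon> b" by (simp add: mu Qcls_mem)
    then have "Qcls \<epsilon> (a * \<chi> x x * bar a) = Qcls \<epsilon> (a * b * bar a)"
      by (rule Qcls_conj[OF \<epsilon>])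
    then show "mu K (scale (fmod K) a x) = Qcls \<epsilon> (a * b * bar a)"
      by (simp add: mu x closed S mult.assoc)
  qed
qed

locale quadratic =
  fixes \<epsilon> :: "'r::ring_involution" and K :: "('r, 'm::ab_group_add) qform"
  assumes form: "quadratic_form \<epsilon> K" and sign: "is_sign \<epsilon>"
begin

lemma free: "fg_free (fmod K)"
  using form by (simp add: quadratic_form_def)

sublocale left_module "fmod K"
  using free fg_free_module by blast

lemma module: "left_module (fmod K)"
  by unfold_locales

lemma lam_hom: "is_hom (fmod K) (dual (fmod K)) (lam K)"
  using form by (simp add: quadratic_form_def)

lemma lam_sesquilinear: "sesquilinear (fmod K) (lam K)"
  by (rule hom_dual_sesquilinear[OF lam_hom])

lemmas lam_add_left = sesquilinearD(1)[OF lam_sesquilinear]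
  and lam_add_right = sesquilinearD(2)[OF lam_sesquilinear]
  and lam_scale_left = sesquilinearD(3)[OF lam_sesquilinear]
  and lam_scale_right = sesquilinearD(4)[OF lam_sesquilinear]

lemmas lam_zero = sesquilinear_zero[OF module lam_sesquilinear]

lemma lam_minus_left: "x \<in> carrier (fmod K) \<Longrightarrow> y \<in> carrier (fmod K) \<Longrightarrow> lam K (- x) y = - lam K x y"
  using lam_add_left[of x "- x" y] by (simp add: closed lam_zero minus_unique)

lemma lam_minus_right: "x \<in> carrier (fmod K) \<Longrightarrow> y \<in> carrier (fmod K) \<Longrightarrow> lam K x (- y) = - lam K x y"
  using lam_add_right[of y "- y" x] by (simp add: closed lam_zero minus_unique)

lemma lam_diff_left: "x \<in> carrier (fmod K) \<Longrightarrow> y \<in> carrier (fmod K) \<Longrightarrow> z \<in> carrier (fmod K) \<Longrightarrow>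
    lam K (x - y) z = lam K x z - lam K y z"
  using lam_add_left[of x "- y" z] by (simp add: closed lam_minus_left)

lemma lam_diff_right: "x \<in> carrier (fmod K) \<Longrightarrow> y \<in> carrier (fmod K) \<Longrightarrow> z \<in> carrier (fmod K) \<Longrightarrow>
    lam K z (x - y) = lam K z x - lam K z y"
  using lam_add_right[of x "- y" z] by (simp add: closed lam_minus_right)

lemmas lam_linear = lam_add_left lam_add_right lam_minus_left lam_minus_right lam_diff_left lam_diff_right

lemma lam_outside: "x \<in> carrier (fmod K) \<Longrightarrow> y \<notin> carrier (fmod K) \<Longrightarrow> lam K x y = 0"
  using dual_outside hom_closed[OF lam_hom] by blast

lemma lam_sym: "x \<in> carrier (fmod K) \<Longrightarrow> y \<in> carrier (fmod K) \<Longrightarrow> lam K x y = \<epsilon> * bar (lam K y x)"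
  using form unfolding quadratic_form_def by blast

lemma lam_sym_zero: "x \<in> carrier (fmod K) \<Longrightarrow> y \<in> carrier (fmod K) \<Longrightarrow> lam K y x = 0 \<Longrightarrow> lam K x y = 0"
  using lam_sym[of x y] by simp

lemma mu_class: "x \<in> carrier (fmod K) \<Longrightarrow> \<exists>a. mu K x = Qcls \<epsilon> a"
  using form unfolding quadratic_form_def by blast

lemma mu_rules:
  "\<forall>x\<in>carrier (fmod K). \<forall>y\<in>carrier (fmod K). \<forall>a\<in>mu K x. \<forall>b\<in>mu K y.
     mu K (x + y) = Qcls \<epsilon> (a + b + lam K x y)"
  "\<forall>x\<in>carrier (fmod K). \<forall>a\<in>mu K x. a + \<epsilon> * bar a = lam K x x"
  "\<forall>x\<in>carrier (fmod K). \<forall>a. \<forall>b\<in>mu K x. mu K (scale (fmod K) a x) = Qcls \<epsilon> (a * b * bar a)"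
  using form unfolding quadratic_form_def by blast+

lemma mu_mem: "mu K x = Qcls \<epsilon> a \<Longrightarrow> a \<in> mu K x"
  by (simp add: Qcls_refl)

lemma mu_add: "x \<in> carrier (fmod K) \<Longrightarrow> y \<in> carrier (fmod K) \<Longrightarrow> mu K x = Qcls \<epsilon> a \<Longrightarrow>
    mu K y = Qcls \<epsilon> b \<Longrightarrow> mu K (x + y) = Qcls \<epsilon> (a + b + lam K x y)"
  using mu_rules(1) mu_mem by meson

lemma mu_lam: "x \<in> carrier (fmod K) \<Longrightarrow> mu K x = Qcls \<epsilon> a \<Longrightarrow> lam K x x = a + \<epsilon> * bar a"
  using mu_rules(2) mu_mem[of x a] by simp

lemma mu_scale: "x \<in> carrier (fmod K) \<Longrightarrow> mu K x = Qcls \<epsilon> b \<Longrightarrow>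
    mu K (scale (fmod K) a x) = Qcls \<epsilon> (a * b * bar a)"
  using mu_rules(3) mu_mem by meson

lemma mu_zero: "mu K 0 = Qcls \<epsilon> 0"
proof -
  obtain b where "mu K 0 = Qcls \<epsilon> b" using mu_class zero_closed by blast
  from mu_scale[OF zero_closed this, of 0] show ?thesis by simp
qed

lemma mu_minus: "x \<in> carrier (fmod K) \<Longrightarrow> mu K x = Qcls \<epsilon> b \<Longrightarrow> mu K (- x) = Qcls \<epsilon> b"
  using mu_scale[of x b "- 1"] by (simp add: scale_minus_one bar_simps)

text \<open>The converse passage, from \<open>lam\<close> and \<open>mu\<close> to a representative
  \<open>\<chi>\<close>. The diagonal of \<open>\<chi>\<close> is chosen from values of
  \<open>mu\<close> at a basis; then \<open>mu\<close> and the diagonal values of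
  \<open>\<chi>\<close> obey the same rules for sums and multiples, so they agree on all
  combinations of basis vectors.\<close>

lemma splitting:
  obtains \<chi> where "sesquilinear (fmod K) \<chi>"
    "\<And>x y. x \<in> carrier (fmod K) \<Longrightarrow> y \<in> carrier (fmod K) \<Longrightarrow> lam K x y = \<chi> x y + \<epsilon> * bar (\<chi> y x)"
    "\<And>x. x \<in> carrier (fmod K) \<Longrightarrow> mu K x = Qcls \<epsilon> (\<chi> x x)"
proof -
  obtain k b c where kbc: "coords (fmod K) k b c"
    using fg_free_coords[OF free] .
  note K = coordsD[OF kbc]
  have "\<forall>i\<in>{..<k}. \<exists>a. mu K (b i) = Qcls \<epsilon> a"
    using mu_class[OF K(1)] by simp
  from bchoice[OF this] obtain d where d: "\<And>i. i < k \<Longrightarrow> mu K (b i) = Qcls \<epsilon> (d i)"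
    by auto
  have dl: "lam K (b i) (b i) = d i + \<epsilon> * bar (d i)" if "i < k" for i
    using mu_lam[OF K(1)[OF that] d[OF that]] .
  obtain \<chi> where \<chi>: "sesquilinear (fmod K) \<chi>"
    and l: "\<And>x y. x \<in> carrier (fmod K) \<Longrightarrow> y \<in> carrier (fmod K) \<Longrightarrow> lam K x y = \<chi> x y + \<epsilon> * bar (\<chi> y x)"
    and di: "\<And>i. i < k \<Longrightarrow> \<chi> (b i) (b i) = d i"
    by (rule triangular_splitting[OF module kbc lam_sesquilinear sign lam_sym dl]) blast+
  note S = sesquilinearD[OF \<chi>]
  let ?P = "\<lambda>x. x \<in> carrier (fmod K) \<and> mu K x = Qcls \<epsilon> (\<chi> x x)"
  have add: "?P (x + y)" if "?P x" "?P y" for x y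
  proof -
    have "mu K (x + y) = Qcls \<epsilon> (\<chi> x x + \<chi> y y + lam K x y)"
      using that mu_add by blast
    also have "(\<chi> x x + \<chi> y y + lam K x y) - \<chi> (x + y) (x + y) = (- \<chi> y x) - \<epsilon> * bar (- \<chi> y x)"
      using that by (simp add: l S closed bar_simps algebra_simps)
    then have "Qcls \<epsilon> (\<chi> x x + \<chi> y y + lam K x y) = Qcls \<epsilon> (\<chi> (x + y) (x + y))"
      unfolding Qcls_eq_iff by blast
    finally show ?thesis using that closed by simp
  qed
  have P: "?P (\<Sum>i\<in>A. scale (fmod K) (c i x) (b i))" if "A \<subseteq> {..<k}" for A x
    using finite_subset[OF that finite_lessThan] that
  proof (induction A rule: finite_induct)
    case empty
    then show ?case
      by (simp add: zero_closed mu_zero sesquilinear_zero[OF module \<chi>])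
  next
    case (insert i A)
    have "?P (scale (fmod K) (c i x) (b i))"
      using insert.prems K(1)[of i]
      by (simp add: closed mu_scale[OF _ d] S di mult.assoc)
    from add[OF this insert.IH] show ?case
      using insert.hyps insert.prems by simp
  qed
  have "mu K x = Qcls \<epsilon> (\<chi> x x)" if x: "x \<in> carrier (fmod K)" for x
    using P[OF subset_refl, of x] by (simp only: K(3)[OF x])
  with \<chi> l show ?thesis by (rule that)
qed

end

section \<open>Complementary submodules and lagrangians\<close>

definition complementary :: "('r::ring_1, 'm::ab_group_add) lmodule \<Rightarrow> 'm set \<Rightarrow> 'm set \<Rightarrow> bool" where
  "complementary M A B \<longleftrightarrow> is_submodule M A \<and> is_submodule M B \<and> A \<inter> B = {0} \<and>
     (\<forall>x\<in>carrier M. \<exists>a\<in>A. \<exists>b\<in>B. x = a + b)"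

lemma complementary_sym: "complementary M A B \<Longrightarrow> complementary M B A"
  unfolding complementary_def by (metis Int_commute add.commute)

lemma direct_summand_iff: "direct_summand M S \<longleftrightarrow> (\<exists>T. complementary M S T)"
  by (auto simp: direct_summand_def complementary_def)

lemma complementaryD:
  assumes "complementary M A B"
  shows "is_submodule M A" "is_submodule M B" "x \<in> A \<Longrightarrow> x \<in> B \<Longrightarrow> x = 0"
    "x \<in> carrier M \<Longrightarrow> \<exists>a\<in>A. \<exists>b\<in>B. x = a + b"
  using assms by (auto simp: complementary_def)

context left_module
begin

lemma submodule_subset: "is_submodule M S \<Longrightarrow> x \<in> S \<Longrightarrow> x \<in> carrier M"
  by (auto simp: is_submodule_def)

lemma submodule_zero: "is_submodule M S \<Longrightarrow> 0 \<in> S"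
  and submodule_add: "is_submodule M S \<Longrightarrow> x \<in> S \<Longrightarrow> y \<in> S \<Longrightarrow> x + y \<in> S"
  and submodule_scale: "is_submodule M S \<Longrightarrow> x \<in> S \<Longrightarrow> scale M a x \<in> S"
  by (auto simp: is_submodule_iff[OF left_module_axioms])

lemma submodule_minus: "is_submodule M S \<Longrightarrow> x \<in> S \<Longrightarrow> - x \<in> S"
  by (metis scale_minus_one submodule_scale submodule_subset)

lemma submodule_diff: "is_submodule M S \<Longrightarrow> x \<in> S \<Longrightarrow> y \<in> S \<Longrightarrow> x - y \<in> S"
  using submodule_add[of S x "- y"] submodule_minus by simp

lemma complementary_unique:
  assumes "complementary M A B" "a \<in> A" "b \<in> B" "a' \<in> A" "b' \<in> B" "a + b = a' + b'"
  shows "a = a'" "b = b'"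
proof -
  note C = complementaryD[OF assms(1)]
  have "a - a' = b' - b" using assms(6) by (metis add_diff_cancel_left' add_diff_cancel_right diff_add_eq diff_diff_eq2)
  moreover have "a - a' \<in> A" "b' - b \<in> B"
    using submodule_diff C assms by blast+
  ultimately have "a - a' = 0" using C(3) by metis
  then show "a = a'" "b = b'" using assms(6) by simp_all
qed

lemma complementary_projection:
  assumes "complementary M A B"
  obtains p where "is_hom M (submod M A) p" "\<And>x. x \<in> carrier M \<Longrightarrow> x - p x \<in> B"
    "\<And>a b. a \<in> A \<Longrightarrow> b \<in> B \<Longrightarrow> p (a + b) = a"
proof -
  note C = complementaryD[OF assms]
  define p where "p x = (THE a. a \<in> A \<and> x - a \<in> B)" for x
  have p: "p (a + b) = a" if "a \<in> A" "b \<in> B" for a b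
    unfolding p_def
  proof (rule the_equality)
    fix a' assume "a' \<in> A \<and> a + b - a' \<in> B"
    then show "a' = a"
      using complementary_unique(1)[OF assms that, of a' "a + b - a'"] by simp
  qed (use that in simp)
  have "is_hom M (submod M A) p"
  proof (rule is_homI)
    fix x assume "x \<in> carrier M"
    then obtain a b where "a \<in> A" "b \<in> B" "x = a + b" using C(4) by metis
    then show "p x \<in> carrier (submod M A)" using p by simp
  next
    fix x y assume "x \<in> carrier M" "y \<in> carrier M"
    then obtain a b a' b' where
      ab: "a \<in> A" "b \<in> B" "x = a + b" "a' \<in> A" "b' \<in> B" "y = a' + b'"
      using C(4) by metis
    then have "x + y = (a + a') + (b + b')" by simp
    then show "p (x + y) = p x + p y"
      using ab p submodule_add C(1,2) by metis
  next
    fix r x assume "x \<in> carrier M"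
    then obtain a b where ab: "a \<in> A" "b \<in> B" "x = a + b"
      using C(4) by metis
    then have "scale M r x = scale M r a + scale M r b"
      using scale_add_right submodule_subset C(1,2) by blast
    then show "p (scale M r x) = scale (submod M A) r (p x)"
      using ab p submodule_scale C(1,2) by (metis scale_submod)
  qed
  moreover have "x - p x \<in> B" if "x \<in> carrier M" for x
    using C(4)[OF that] p by force
  ultimately show ?thesis using that p by blast
qed

end

lemma nonsingular_represent:
  assumes "quadratic_form \<epsilon> K" "nonsingular K" "is_hom (fmod K) ring_module \<phi>"
  shows "\<exists>q\<in>carrier (fmod K). \<forall>y\<in>carrier (fmod K). lam K q y = \<phi> y"
proof -
  have "left_module (fmod K)"
    using assms(1) fg_free_module by (auto simp: quadratic_form_def)
  then have "zero_outside (carrier (fmod K)) \<phi> \<in> carrier (dual (fmod K))"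
    using zero_outside_dual assms(3) by blast
  then obtain q where q: "q \<in> carrier (fmod K)" "lam K q = zero_outside (carrier (fmod K)) \<phi>"
    using iso_surj assms(2) unfolding nonsingular_def by metis
  then have "\<forall>y\<in>carrier (fmod K). lam K q y = \<phi> y" by simp
  with q(1) show ?thesis by blast
qed

context quadratic
begin

lemma lagrangianD:
  assumes "lagrangian \<epsilon> K L"
  shows "is_submodule (fmod K) L" "x \<in> L \<Longrightarrow> mu K x = Qcls \<epsilon> 0"
    "x \<in> L \<Longrightarrow> y \<in> L \<Longrightarrow> lam K x y = 0"
    "x \<in> carrier (fmod K) \<Longrightarrow> (\<And>y. y \<in> L \<Longrightarrow> lam K x y = 0) \<Longrightarrow> x \<in> L"
    "x \<in> L \<Longrightarrow> x \<in> carrier (fmod K)"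
proof -
  have L: "L = {x \<in> carrier (fmod K). \<forall>y\<in>L. lam K x y = 0}"
    using assms by (simp add: lagrangian_def)
  show "x \<in> L \<Longrightarrow> y \<in> L \<Longrightarrow> lam K x y = 0"
    "x \<in> carrier (fmod K) \<Longrightarrow> (\<And>y. y \<in> L \<Longrightarrow> lam K x y = 0) \<Longrightarrow> x \<in> L"
    "x \<in> L \<Longrightarrow> x \<in> carrier (fmod K)"
    using L by blast+
qed (use assms in \<open>auto simp: lagrangian_def direct_summand_def\<close>)

lemma nonsingular_inj:
  assumes "nonsingular K" "x \<in> carrier (fmod K)" "\<And>y. y \<in> carrier (fmod K) \<Longrightarrow> lam K x y = 0"
  shows "x = 0"
proof -
  have "lam K x = lam K 0"
    by (rule ext) (metis assms(2,3) lam_outside lam_zero(1) zero_closed)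
  then show ?thesis
    using assms(1,2) iso_inj zero_closed unfolding nonsingular_def by metis
qed

text \<open>Write an element orthogonal to \<open>H\<close> as \<open>h + l\<close>. Then
  \<open>l\<close> is orthogonal to \<open>H\<close>, because \<open>x\<close> and \<open>h\<close>
  are, and to the isotropic \<open>L\<close>, hence to everything, so \<open>l = 0\<close>.
  Lagrangians are thus recognised by isotropy and a complement instead of by computing an
  orthogonal.\<close>

lemma isotropic_complement_lagrangian:
  assumes ns: "nonsingular K" and L: "\<And>x y. x \<in> L \<Longrightarrow> y \<in> L \<Longrightarrow> lam K x y = 0"
    and c: "complementary (fmod K) H L"
    and mu: "\<And>x. x \<in> H \<Longrightarrow> mu K x = Qcls \<epsilon> 0"
    and lam: "\<And>x y. x \<in> H \<Longrightarrow> y \<in> H \<Longrightarrow> lam K x y = 0"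
  shows "lagrangian \<epsilon> K H"
proof -
  note C = complementaryD[OF c]
  have sub: "x \<in> H \<Longrightarrow> x \<in> carrier (fmod K)" "x \<in> L \<Longrightarrow> x \<in> carrier (fmod K)" for x
    using C submodule_subset by blast+
  have "x \<in> H" if x: "x \<in> carrier (fmod K)" "\<forall>y\<in>H. lam K x y = 0" for x
  proof -
    obtain h l where hl: "h \<in> H" "l \<in> L" "x = h + l"
      using C(4)[OF x(1)] by blast
    have "lam K l z = 0" if z: "z \<in> carrier (fmod K)" for z
    proof -
      obtain h' l' where hl': "h' \<in> H" "l' \<in> L" "z = h' + l'"
        using C(4)[OF z] by blast
      have "lam K l h' = lam K x h' - lam K h h'"
        using hl hl' sub by (simp add: lam_add_left)
      then have "lam K l h' = 0"
        using x(2) hl' hl lam by simp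
      then show ?thesis
        using hl hl' sub L by (simp add: lam_add_right)
    qed
    then have "l = 0" using nonsingular_inj[OF ns] sub hl by blast
    with hl show ?thesis by simp
  qed
  then have "H = {x \<in> carrier (fmod K). \<forall>y\<in>H. lam K x y = 0}"
    using sub lam by blast
  then show ?thesis
    unfolding lagrangian_def direct_summand_iff using c mu by blast
qed

text \<open>Injective because an element of \<open>T\<close> orthogonal to \<open>L\<close> lies in
  \<open>L\<close>; onto because a functional on \<open>L\<close>, extended by zero on
  \<open>T\<close>, is represented by nonsingularity.\<close>

lemma complement_dual_iso:
  assumes ns: "nonsingular K" and L: "lagrangian \<epsilon> K L" and c: "complementary (fmod K) L T"
  shows "is_iso (submod (fmod K) T) (dual (submod (fmod K) L)) (\<lambda>t. zero_outside L (lam K t))"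
proof -
  note C = complementaryD[OF c] and LD = lagrangianD[OF L]
  have sub: "x \<in> T \<Longrightarrow> x \<in> carrier (fmod K)" for x
    using C submodule_subset by blast
  have mL: "left_module (submod (fmod K) L)" and mT: "left_module (submod (fmod K) T)"
    using C by (auto simp: is_submodule_def)
  show ?thesis
  proof (rule is_isoI[OF mT])
    show "is_hom (submod (fmod K) T) (dual (submod (fmod K) L)) (\<lambda>t. zero_outside L (lam K t))"
    proof (rule is_homI)
      fix t assume "t \<in> carrier (submod (fmod K) T)"
      then show "zero_outside L (lam K t) \<in> carrier (dual (submod (fmod K) L))"
        using zero_outside_dual[OF mL, of "lam K t"] sub LD(5)
        by (auto simp: is_hom_def lam_add_right lam_scale_right)
    next
      fix s t assume "s \<in> carrier (submod (fmod K) T)" "t \<in> carrier (submod (fmod K) T)"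
      then show "zero_outside L (lam K (s + t)) = zero_outside L (lam K s) + zero_outside L (lam K t)"
        using sub LD(5) by (auto simp: fun_eq_iff zero_outside_def lam_add_left)
    next
      fix a t assume "t \<in> carrier (submod (fmod K) T)"
      then show "zero_outside L (lam K (scale (submod (fmod K) T) a t)) =
          scale (dual (submod (fmod K) L)) a (zero_outside L (lam K t))"
        using sub LD(5) by (auto simp: fun_eq_iff zero_outside_def lam_scale_left)
    qed
  next
    fix t assume t: "t \<in> carrier (submod (fmod K) T)" and 0: "zero_outside L (lam K t) = 0"
    have "lam K t y = 0" if "y \<in> L" for y
      using fun_cong[OF 0, of y] that by simp
    then show "t = 0" using t LD(4) sub C(3) by simp
  next
    fix f assume f: "f \<in> carrier (dual (submod (fmod K) L))"
    obtain p where p: "is_hom (fmod K) (submod (fmod K) L) p"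
      and pl: "\<And>a b. a \<in> L \<Longrightarrow> b \<in> T \<Longrightarrow> p (a + b) = a"
      using complementary_projection[OF c] by metis
    obtain q where q: "q \<in> carrier (fmod K)" "\<And>y. y \<in> carrier (fmod K) \<Longrightarrow> lam K q y = f (p y)"
      using nonsingular_represent[OF form ns hom_comp[OF p dual_hom[OF f]]] by blast
    \<comment> \<open>The component of \<open>q\<close> in \<open>L\<close> pairs to zero with
      \<open>L\<close>, so the component in \<open>T\<close> represents \<open>f\<close> as
      well.\<close>
    obtain l t where lt: "l \<in> L" "t \<in> T" "q = l + t" using C(4)[OF q(1)] by blast
    have "lam K t y = f y" if y: "y \<in> L" for y
    proof -
      have "lam K q y = f y"
        using q(2)[of y] pl[OF y submodule_zero[OF C(2)]] y LD(5) by simp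
      then show ?thesis
        using lt y sub by (simp add: lam_add_left LD(3,5))
    qed
    moreover have "f y = 0" if "y \<notin> L" for y
      using dual_outside[OF f] that by simp
    ultimately have "zero_outside L (lam K t) = f"
      by (auto simp: fun_eq_iff zero_outside_def)
    then show "\<exists>t\<in>carrier (submod (fmod K) T). zero_outside L (lam K t) = f"
      using lt by auto
  qed
qed

text \<open>The complement is dual to the lagrangian. This is how a newly chosen complementary
  lagrangian is known to be free, as formations require.\<close>

lemma complement_free:
  assumes "nonsingular K" "lagrangian \<epsilon> K L" "complementary (fmod K) L T"
    and "fg_free (submod (fmod K) L)"
  shows "fg_free (submod (fmod K) T)"
proof -
  have "left_module (submod (fmod K) T)"
    using complementaryD[OF assms(3)] by (auto simp: is_submodule_def)
  then show ?thesis
    using fg_free_iso[OF fg_free_dual[OF assms(4)]] iso_inv complement_dual_iso[OF assms(1-3)] by blast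
qed

text \<open>A module complement \<open>T\<close> is made isotropic by subtracting from \<open>t \<in> T\<close> the element \<open>r t\<close> of
  the lagrangian that pairs with \<open>T\<close> like half of the form on \<open>T\<close>.\<close>

lemma complementary_lagrangian:
  assumes ns: "nonsingular K" and L: "lagrangian \<epsilon> K L" and Lf: "fg_free (submod (fmod K) L)"
  obtains T where "lagrangian \<epsilon> K T" "complementary (fmod K) L T"
proof -
  obtain T where c: "complementary (fmod K) L T"
    using L by (auto simp: lagrangian_def direct_summand_iff)
  note C = complementaryD[OF c] and LD = lagrangianD[OF L]
  have sub: "x \<in> T \<Longrightarrow> x \<in> carrier (fmod K)" for x
    using C submodule_subset by blast
  have Tf: "fg_free (submod (fmod K) T)"
    by (rule complement_free[OF ns L c Lf])
  \<comment> \<open>The restriction of the form to \<open>T\<close>, possibly singular; it is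
    packaged as a form in order to obtain its splitting \<open>\<chi>\<close>.\<close>
  define N where "N = \<lparr>fmod = submod (fmod K) T, lam = (\<lambda>t. zero_outside T (lam K t)), mu = mu K\<rparr>"
  have N: "fmod N = submod (fmod K) T" "\<And>x y. y \<in> T \<Longrightarrow> lam N x y = lam K x y" "mu N = mu K"
    by (simp_all add: N_def)
  have Nl: "is_hom (fmod N) (dual (fmod N)) (lam N)"
  proof -
    have "sesquilinear (submod (fmod K) T) (lam K)"
      using lam_sesquilinear sub by (simp add: sesquilinear_def)
    from sesquilinear_hom_dual[OF fg_free_module[OF Tf] this] show ?thesis
      by (simp add: N_def)
  qed
  have "quadratic_form \<epsilon> N"
    unfolding quadratic_form_def N(1,3) carrier_submod scale_submod
  proof (intro conjI ballI allI)
    fix x y assume "x \<in> T" "y \<in> T"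
    then show "lam N x y = \<epsilon> * bar (lam N y x)"
      using lam_sym[of x y] by (simp only: N sub)
  next
    fix x y a b assume "x \<in> T" "y \<in> T" "a \<in> mu K x" "b \<in> mu K y"
    then show "mu K (x + y) = Qcls \<epsilon> (a + b + lam N x y)"
      using mu_rules(1) sub by (simp add: N)
  next
    fix x a assume "x \<in> T" "a \<in> mu K x"
    then show "a + \<epsilon> * bar a = lam N x x"
      using mu_rules(2) sub by (simp add: N)
  next
    fix x assume "x \<in> T"
    then show "mu K x \<in> range (Qcls \<epsilon>)"
      using mu_class[OF sub] by (metis rangeI)
  qed (use Tf Nl[unfolded N(1)] mu_rules(3) sub in auto)
  then interpret N: quadratic \<epsilon> N by unfold_locales (auto simp: sign)
  obtain \<chi> where \<chi>: "sesquilinear (submod (fmod K) T) \<chi>"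
    and l: "\<And>x y. x \<in> T \<Longrightarrow> y \<in> T \<Longrightarrow> lam K x y = \<chi> x y + \<epsilon> * bar (\<chi> y x)"
    and m: "\<And>x. x \<in> T \<Longrightarrow> mu K x = Qcls \<epsilon> (\<chi> x x)"
  proof (rule N.splitting)
    fix \<chi> assume "sesquilinear (fmod N) \<chi>"
      and "\<And>x y. x \<in> carrier (fmod N) \<Longrightarrow> y \<in> carrier (fmod N) \<Longrightarrow> lam N x y = \<chi> x y + \<epsilon> * bar (\<chi> y x)"
      and "\<And>x. x \<in> carrier (fmod N) \<Longrightarrow> mu N x = Qcls \<epsilon> (\<chi> x x)"
    then show ?thesis
      by (intro that[of \<chi>]) (simp_all only: N carrier_submod)
  qed
  note S = sesquilinearD[OF \<chi>, simplified]
  have cT: "complementary (fmod K) T L" by (rule complementary_sym[OF c])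
  obtain p where p: "is_hom (fmod K) (submod (fmod K) T) p"
    and pl: "\<And>a b. a \<in> T \<Longrightarrow> b \<in> L \<Longrightarrow> p (a + b) = a"
    using complementary_projection[OF cT] by metis
  have pT: "p a = a" if "a \<in> T" for a
    using pl[OF that submodule_zero[OF LD(1)]] by simp
  have pL: "p a = 0" if "a \<in> L" for a
    using pl[OF submodule_zero[OF C(2)] that] by simp
  have pC: "p y \<in> T" if "y \<in> carrier (fmod K)" for y
    using hom_closed[OF p that] by simp
  \<comment> \<open>The functional \<open>y \<mapsto> \<epsilon> * bar (\<chi> (p y) t)\<close>
    vanishes on \<open>L\<close>, so the element representing it is orthogonal to \<open>L\<close>
    and therefore lies in \<open>L\<close>.\<close>
  have "\<exists>q\<in>L. \<forall>y\<in>T. lam K q y = \<epsilon> * bar (\<chi> y t)" if t: "t \<in> T" for t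
  proof -
    have "is_hom (fmod K) ring_module (\<lambda>y. \<epsilon> * bar (\<chi> (p y) t))"
      using t pC sign
      by (intro is_homI)
        (auto simp: hom_add[OF p] hom_scale[OF p] S bar_simps is_sign_def)
    then obtain q where q: "q \<in> carrier (fmod K)"
      "\<And>y. y \<in> carrier (fmod K) \<Longrightarrow> lam K q y = \<epsilon> * bar (\<chi> (p y) t)"
      using nonsingular_represent[OF form ns] by meson
    have "\<chi> 0 t = 0"
      using sesquilinear_zero(1)[OF fg_free_module[OF Tf] \<chi>] t by simp
    then have "q \<in> L"
      using q LD(4,5) pL by simp
    then show ?thesis using q(2) sub pT by metis
  qed
  then obtain r where r: "\<And>t. t \<in> T \<Longrightarrow> r t \<in> L"
    "\<And>t y. t \<in> T \<Longrightarrow> y \<in> T \<Longrightarrow> lam K (r t) y = \<epsilon> * bar (\<chi> y t)"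
    by metis
  \<comment> \<open>An element of \<open>L\<close> pairs to zero with \<open>L\<close>, so it is
    determined by its pairing with \<open>T\<close>; this makes \<open>r\<close> linear.\<close>
  have uniq: "q = q'" if q: "q \<in> L" "q' \<in> L" "\<And>y. y \<in> T \<Longrightarrow> lam K q y = lam K q' y" for q q'
  proof -
    have 0: "lam K (q - q') y = 0" if y: "y \<in> carrier (fmod K)" for y
    proof -
      obtain a b where ab: "a \<in> L" "b \<in> T" "y = a + b" using C(4)[OF y] by blast
      have "lam K (q - q') y = (lam K q a + lam K q b) - (lam K q' a + lam K q' b)"
        using ab q(1,2) sub by (simp add: LD(5) lam_diff_left lam_add_right closed)
      then show ?thesis
        using ab q(1,2) by (simp add: LD(3) q(3))
    qed
    have "q - q' = 0"
      by (rule nonsingular_inj[OF ns _ 0]) (simp_all add: q(1,2) LD(5) closed)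
    then show ?thesis by simp
  qed
  have radd: "r (s + t) = r s + r t" if "s \<in> T" "t \<in> T" for s t
    by (rule uniq)
      (use that C(2) in \<open>simp_all add: r LD(1,5) submodule_add lam_add_left sub S bar_add distrib_left\<close>)
  have rscale: "r (scale (fmod K) a t) = scale (fmod K) a (r t)" if "t \<in> T" for a t
    by (rule uniq)
      (use that C(2) in \<open>simp_all add: r LD(1,5) submodule_scale lam_scale_left sub S bar_mult mult.assoc\<close>)
  let ?H = "(\<lambda>t. t - r t) ` T"
  have Hsub: "is_submodule (fmod K) ?H"
    unfolding is_submodule_iff[OF module]
  proof (intro conjI ballI allI subsetI)
    fix x assume "x \<in> ?H"
    then show "x \<in> carrier (fmod K)" using r LD(5) sub closed by auto
  next
    have "r 0 = 0"
      using radd[of 0 0] submodule_zero[OF C(2)] by simp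
    then show "0 \<in> ?H"
      by (intro image_eqI[of _ _ 0]) (simp_all add: submodule_zero[OF C(2)])
  next
    fix x y assume "x \<in> ?H" "y \<in> ?H"
    then obtain s t where st: "s \<in> T" "t \<in> T" "x = s - r s" "y = t - r t" by auto
    then have "x + y = (s + t) - r (s + t)" by (simp add: radd)
    then show "x + y \<in> ?H" using st submodule_add C(2) by blast
  next
    fix a x assume "x \<in> ?H"
    then obtain t where t: "t \<in> T" "x = t - r t" by auto
    then have "scale (fmod K) a x = scale (fmod K) a t - r (scale (fmod K) a t)"
      by (simp add: rscale scale_diff_right sub r LD(5))
    then show "scale (fmod K) a x \<in> ?H" using t submodule_scale C(2) by blast
  qed
  have comp: "complementary (fmod K) ?H L"
    unfolding complementary_def
  proof (intro conjI Hsub LD(1) ballI)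
    have "t - r t = 0" if t: "t \<in> T" "t - r t \<in> L" for t
    proof -
      have "t \<in> L" using submodule_add[OF LD(1) t(2) r(1)[OF t(1)]] by simp
      then have "t = 0" using C(3) t(1) by blast
      then show ?thesis using radd[of 0 0] submodule_zero[OF C(2)] by simp
    qed
    then show "?H \<inter> L = {0}"
      using submodule_zero[OF Hsub] submodule_zero[OF LD(1)] by blast
  next
    fix x assume "x \<in> carrier (fmod K)"
    then obtain l t where lt: "l \<in> L" "t \<in> T" "x = l + t" using C(4) by blast
    then have "x = (t - r t) + (l + r t)" "l + r t \<in> L"
      using submodule_add[OF LD(1)] r by auto
    then show "\<exists>a\<in>?H. \<exists>b\<in>L. x = a + b" using lt by blast
  qed
  have "lagrangian \<epsilon> K ?H"
  proof (rule isotropic_complement_lagrangian[OF ns LD(3) comp])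
    fix x assume "x \<in> ?H"
    then obtain t where t: "t \<in> T" "x = t + - r t" by auto
    have "mu K (t + - r t) = Qcls \<epsilon> (\<chi> t t + 0 + lam K t (- r t))"
      by (rule mu_add) (use t in \<open>simp_all add: r m sub LD(2,5) mu_minus closed\<close>)
    \<comment> \<open>The correction \<open>- r t\<close> cancels the representative
      \<open>\<chi> t t\<close> of \<open>mu K t\<close>.\<close>
    also have "lam K t (- r t) = - \<chi> t t"
      using t r LD(5) sub lam_sym[of t "r t"] sign
      by (auto simp: lam_minus_right bar_simps is_sign_def)
    finally show "mu K x = Qcls \<epsilon> 0" using t by simp
  next
    fix x y assume "x \<in> ?H" "y \<in> ?H"
    then obtain s t where st: "s \<in> T" "t \<in> T" "x = s - r s" "y = t - r t" by auto
    have "lam K s (r t) = \<chi> s t"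
      using st r LD(5) sub lam_sym[of s "r t"] sign by (auto simp: bar_simps is_sign_def)
    then show "lam K x y = 0"
      using st sub by (simp add: r LD(3,5) lam_diff_left lam_diff_right closed l)
  qed
  then show ?thesis using that complementary_sym[OF comp] by blast
qed

end

section \<open>Sums, negatives and hyperbolic forms\<close>

lemma form_sum_simps [simp]:
  "fmod (form_sum K K') = fmod K \<boxplus> fmod K'"
  "y \<in> carrier (fmod K) \<Longrightarrow> y' \<in> carrier (fmod K') \<Longrightarrow>
     lam (form_sum K K') (x, x') (y, y') = lam K x y + lam K' x' y'"
  "mu (form_sum K K') (x, x') = {a + a' | a a'. a \<in> mu K x \<and> a' \<in> mu K' x'}"
  by (simp_all add: form_sum_def)

lemma form_neg_simps [simp]:
  "fmod (form_neg K) = fmod K" "lam (form_neg K) x y = - lam K x y" "mu (form_neg K) x = uminus ` mu K x"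
  by (simp_all add: form_neg_def)

lemma hyperbolic_simps [simp]:
  "fmod (hyperbolic \<epsilon> L) = L \<boxplus> dual L"
  "y \<in> carrier L \<Longrightarrow> g \<in> carrier (dual L) \<Longrightarrow> lam (hyperbolic \<epsilon> L) (x, f) (y, g) = f y + \<epsilon> * bar (g x)"
  "mu (hyperbolic \<epsilon> L) (x, f) = Qcls \<epsilon> (f x)"
  by (simp_all add: hyperbolic_def)

lemma quadratic_form_sum:
  assumes "quadratic_form \<epsilon> K" "quadratic_form \<epsilon> K'" "is_sign \<epsilon>"
  shows "quadratic_form \<epsilon> (form_sum K K')"
proof -
  interpret K: quadratic \<epsilon> K by (unfold_locales) (use assms in auto)
  interpret K': quadratic \<epsilon> K' by (unfold_locales) (use assms in auto)
  let ?M = "fmod K \<boxplus> fmod K'"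
  have M: "left_module ?M" by (rule left_module_dsum[OF K.module K'.module])
  obtain \<chi> where \<chi>: "sesquilinear (fmod K) \<chi>"
    "\<And>x y. x \<in> carrier (fmod K) \<Longrightarrow> y \<in> carrier (fmod K) \<Longrightarrow> lam K x y = \<chi> x y + \<epsilon> * bar (\<chi> y x)"
    "\<And>x. x \<in> carrier (fmod K) \<Longrightarrow> mu K x = Qcls \<epsilon> (\<chi> x x)"
    by (rule K.splitting) blast
  obtain \<chi>' where \<chi>': "sesquilinear (fmod K') \<chi>'"
    "\<And>x y. x \<in> carrier (fmod K') \<Longrightarrow> y \<in> carrier (fmod K') \<Longrightarrow> lam K' x y = \<chi>' x y + \<epsilon> * bar (\<chi>' y x)"
    "\<And>x. x \<in> carrier (fmod K') \<Longrightarrow> mu K' x = Qcls \<epsilon> (\<chi>' x x)"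
    by (rule K'.splitting) blast
  have lam: "lam (form_sum K K') = (\<lambda>x. zero_outside (carrier ?M) (\<lambda>y. lam K (fst x) (fst y) + lam K' (snd x) (snd y)))"
    by (auto simp: form_sum_def fun_eq_iff zero_outside_def)
  show ?thesis
  proof (rule quadratic_formI)
    show "fg_free (fmod (form_sum K K'))"
      by (simp add: fg_free_dsum K.free K'.free)
    have "sesquilinear ?M (\<lambda>x y. lam K (fst x) (fst y) + lam K' (snd x) (snd y))"
      unfolding sesquilinear_def
      by (auto simp: K.lam_linear K'.lam_linear K.lam_scale_left K'.lam_scale_left
          K.lam_scale_right K'.lam_scale_right distrib_left distrib_right)
    from sesquilinear_hom_dual[OF M this]
    show "is_hom (fmod (form_sum K K')) (dual (fmod (form_sum K K'))) (lam (form_sum K K'))"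
      by (simp add: lam)
    show "sesquilinear (fmod (form_sum K K')) (\<lambda>x y. \<chi> (fst x) (fst y) + \<chi>' (snd x) (snd y))"
      unfolding sesquilinear_def
      by (auto simp: sesquilinearD[OF \<chi>(1)] sesquilinearD[OF \<chi>'(1)] distrib_left distrib_right)
  next
    fix x y assume "x \<in> carrier (fmod (form_sum K K'))" "y \<in> carrier (fmod (form_sum K K'))"
    then show "lam (form_sum K K') x y = \<chi> (fst x) (fst y) + \<chi>' (snd x) (snd y)
        + \<epsilon> * bar (\<chi> (fst y) (fst x) + \<chi>' (snd y) (snd x))"
      by (auto simp: \<chi>(2) \<chi>'(2) bar_add distrib_left)
  next
    fix x assume "x \<in> carrier (fmod (form_sum K K'))"
    then show "mu (form_sum K K') x = Qcls \<epsilon> (\<chi> (fst x) (fst x) + \<chi>' (snd x) (snd x))"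
      by (auto simp: \<chi>(3) \<chi>'(3) Qcls_add)
  qed (rule assms)
qed

lemma quadratic_form_neg:
  assumes "quadratic_form \<epsilon> K" "is_sign \<epsilon>"
  shows "quadratic_form \<epsilon> (form_neg K)"
proof -
  interpret K: quadratic \<epsilon> K by (unfold_locales) (use assms in auto)
  obtain \<chi> where \<chi>: "sesquilinear (fmod K) \<chi>"
    "\<And>x y. x \<in> carrier (fmod K) \<Longrightarrow> y \<in> carrier (fmod K) \<Longrightarrow> lam K x y = \<chi> x y + \<epsilon> * bar (\<chi> y x)"
    "\<And>x. x \<in> carrier (fmod K) \<Longrightarrow> mu K x = Qcls \<epsilon> (\<chi> x x)"
    by (rule K.splitting) blast
  show ?thesis
  proof (rule quadratic_formI)
    have "is_hom (fmod K) (dual (fmod K)) (\<lambda>x. - lam K x)"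
      by (rule hom_uminus[OF left_module_dual[OF K.module] K.lam_hom])
    then show "is_hom (fmod (form_neg K)) (dual (fmod (form_neg K))) (lam (form_neg K))"
      by (simp add: form_neg_def fun_Compl_def)
    show "sesquilinear (fmod (form_neg K)) (\<lambda>x y. - \<chi> x y)"
      using \<chi>(1) by (simp add: sesquilinear_def)
  qed (use assms(2) K.free \<chi>(2,3) in \<open>auto simp: Qcls_uminus bar_minus\<close>)
qed

lemma quadratic_form_hyperbolic:
  fixes L :: "('r::ring_involution, 'm::ab_group_add) lmodule"
  assumes L: "fg_free L" and \<epsilon>: "is_sign \<epsilon>"
  shows "quadratic_form \<epsilon> (hyperbolic \<epsilon> L)"
proof -
  have M: "left_module (L \<boxplus> dual L)"
    by (rule fg_free_module[OF fg_free_dsum[OF L fg_free_dual[OF L]]])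
  let ?\<chi> = "\<lambda>x y. snd x (fst y)"
  have \<chi>: "sesquilinear (L \<boxplus> dual L) ?\<chi>"
    by (auto simp: sesquilinear_def dual_add[of _ L] dual_scale[of _ L])
  have "sesquilinear (L \<boxplus> dual L) (\<lambda>x y. snd x (fst y) + \<epsilon> * bar (snd y (fst x)))"
    using \<epsilon> by (auto simp: sesquilinear_def is_sign_def dual_add[of _ L] dual_scale[of _ L] bar_simps
        distrib_left distrib_right)
  note hom = sesquilinear_hom_dual[OF M this]
  have "is_hom (L \<boxplus> dual L) (dual (L \<boxplus> dual L)) (lam (hyperbolic \<epsilon> L))"
  proof -
    have "lam (hyperbolic \<epsilon> L) =
        (\<lambda>x. zero_outside (carrier (L \<boxplus> dual L)) (\<lambda>y. snd x (fst y) + \<epsilon> * bar (snd y (fst x))))"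
      by (auto simp: fun_eq_iff zero_outside_def hyperbolic_def)
    then show ?thesis using hom by (simp only:)
  qed
  then show ?thesis
    by (intro quadratic_formI[where \<chi> = ?\<chi>])
      (use \<chi> \<epsilon> in \<open>auto simp: fg_free_dsum fg_free_dual L\<close>)
qed

lemma quadraticI: "quadratic_form \<epsilon> K \<Longrightarrow> is_sign \<epsilon> \<Longrightarrow> quadratic \<epsilon> K"
  by unfold_locales

lemma nonsingularI:
  assumes "quadratic_form \<epsilon> K" "is_sign \<epsilon>"
    and "\<And>x. x \<in> carrier (fmod K) \<Longrightarrow> (\<And>y. y \<in> carrier (fmod K) \<Longrightarrow> lam K x y = 0) \<Longrightarrow> x = 0"
    and "\<And>f. f \<in> carrier (dual (fmod K)) \<Longrightarrow>
      \<exists>x\<in>carrier (fmod K). \<forall>y\<in>carrier (fmod K). lam K x y = f y"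
  shows "nonsingular K"
proof -
  interpret quadratic \<epsilon> K using assms quadraticI by blast
  show ?thesis
    unfolding nonsingular_def
  proof (rule is_isoI[OF module lam_hom])
    fix x assume "x \<in> carrier (fmod K)" "lam K x = 0"
    then show "x = 0" using assms(3) by simp
  next
    fix f assume f: "f \<in> carrier (dual (fmod K))"
    then obtain x where x: "x \<in> carrier (fmod K)" "\<forall>y\<in>carrier (fmod K). lam K x y = f y"
      using assms(4) by blast
    have "lam K x = f"
      by (rule dual_eqI[OF hom_closed[OF lam_hom x(1)] f]) (use x in simp)
    with x show "\<exists>x\<in>carrier (fmod K). lam K x = f" by blast
  qed
qed

lemma nonsingular_sum:
  assumes K: "quadratic_form \<epsilon> K" "nonsingular K" and K': "quadratic_form \<epsilon> K'" "nonsingular K'"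
    and \<epsilon>: "is_sign \<epsilon>"
  shows "nonsingular (form_sum K K')"
proof (rule nonsingularI[OF quadratic_form_sum[OF K(1) K'(1) \<epsilon>] \<epsilon>])
  interpret K: quadratic \<epsilon> K using K \<epsilon> quadraticI by blast
  interpret K': quadratic \<epsilon> K' using K' \<epsilon> quadraticI by blast
  {
    fix z assume z: "z \<in> carrier (fmod (form_sum K K'))"
      and 0: "\<And>y. y \<in> carrier (fmod (form_sum K K')) \<Longrightarrow> lam (form_sum K K') z y = 0"
    obtain x x' where [simp]: "z = (x, x')" by force
    have "x = 0"
      by (rule K.nonsingular_inj[OF K(2)])
        (use z 0[of "(_, 0)"] in \<open>auto simp: K'.closed K'.lam_zero\<close>)
    moreover have "x' = 0"
      by (rule K'.nonsingular_inj[OF K'(2)])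
        (use z 0[of "(0, _)"] in \<open>auto simp: K.closed K.lam_zero\<close>)
    ultimately show "z = 0" by (simp add: zero_prod_def)
  }
  fix f assume f: "f \<in> carrier (dual (fmod (form_sum K K')))"
  have "is_hom (fmod K) ring_module (\<lambda>x. f (x, 0))"
    by (rule is_homI) (use dual_add[OF f, of "(_, 0)" "(_, 0)"] dual_scale[OF f, of "(_, 0)"] in
        \<open>simp_all add: K'.closed\<close>)
  then obtain x where x: "x \<in> carrier (fmod K)" "\<forall>y\<in>carrier (fmod K). lam K x y = f (y, 0)"
    using nonsingular_represent[OF K] by meson
  have "is_hom (fmod K') ring_module (\<lambda>x. f (0, x))"
    by (rule is_homI) (use dual_add[OF f, of "(0, _)" "(0, _)"] dual_scale[OF f, of "(0, _)"] in
        \<open>simp_all add: K.closed\<close>)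
  then obtain x' where x': "x' \<in> carrier (fmod K')" "\<forall>y\<in>carrier (fmod K'). lam K' x' y = f (0, y)"
    using nonsingular_represent[OF K'] by meson
  have "f (y, y') = f (y, 0) + f (0, y')" if "y \<in> carrier (fmod K)" "y' \<in> carrier (fmod K')" for y y'
    using dual_add[OF f, of "(y, 0)" "(0, y')"] that by (simp add: K.closed K'.closed)
  then have "\<forall>y\<in>carrier (fmod (form_sum K K')). lam (form_sum K K') (x, x') y = f y"
    using x x' by auto
  then show "\<exists>x\<in>carrier (fmod (form_sum K K')). \<forall>y\<in>carrier (fmod (form_sum K K')). lam (form_sum K K') x y = f y"
    using x x' by (intro bexI[of _ "(x, x')"]) simp_all
qed

lemma nonsingular_neg:
  assumes K: "quadratic_form \<epsilon> K" "nonsingular K" and \<epsilon>: "is_sign \<epsilon>"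
  shows "nonsingular (form_neg K)"
proof (rule nonsingularI[OF quadratic_form_neg[OF K(1) \<epsilon>] \<epsilon>])
  interpret K: quadratic \<epsilon> K using K \<epsilon> quadraticI by blast
  show "x = 0" if "x \<in> carrier (fmod (form_neg K))"
    "\<And>y. y \<in> carrier (fmod (form_neg K)) \<Longrightarrow> lam (form_neg K) x y = 0" for x
    by (rule K.nonsingular_inj[OF K(2)]) (use that in auto)
  fix f assume f: "f \<in> carrier (dual (fmod (form_neg K)))"
  then obtain x where x: "x \<in> carrier (fmod K)" "\<And>y. y \<in> carrier (fmod K) \<Longrightarrow> lam K x y = f y"
    using nonsingular_represent[OF K] dual_hom by fastforce
  show "\<exists>x\<in>carrier (fmod (form_neg K)). \<forall>y\<in>carrier (fmod (form_neg K)). lam (form_neg K) x y = f y"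
    by (rule bexI[of _ "- x"]) (use x in \<open>auto simp: K.lam_linear K.closed\<close>)
qed

lemma nonsingular_hyperbolic:
  fixes L :: "('r::ring_involution, 'm::ab_group_add) lmodule"
  assumes L: "fg_free L" and \<epsilon>: "is_sign \<epsilon>"
  shows "nonsingular (hyperbolic \<epsilon> L)"
proof (rule nonsingularI[OF quadratic_form_hyperbolic[OF L \<epsilon>] \<epsilon>])
  have L': "left_module L" by (rule fg_free_module[OF L])
  interpret L: left_module L by fact
  interpret D: left_module "dual L" by (rule left_module_dual[OF L'])
  {
    fix z assume z: "z \<in> carrier (fmod (hyperbolic \<epsilon> L))"
      and 0: "\<And>y. y \<in> carrier (fmod (hyperbolic \<epsilon> L)) \<Longrightarrow> lam (hyperbolic \<epsilon> L) z y = 0"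
    obtain x f where [simp]: "z = (x, f)" by force
    have x: "x \<in> carrier L" and f: "f \<in> carrier (dual L)" using z by auto
    have "f = 0"
      by (rule dual_eqI[OF f D.zero_closed]) (use 0[of "(_, 0)"] in \<open>simp add: D.zero_closed\<close>)
    moreover have "x = 0"
    proof (rule dual_separates[OF L x L.zero_closed])
      fix g assume g: "g \<in> carrier (dual L)"
      then have "\<epsilon> * bar (g x) = 0"
        using 0[of "(0, g)"] by (simp add: L.zero_closed dual_zero[OF L' f])
      then have "g x = 0" using \<epsilon> by (auto simp: is_sign_def)
      then show "g x = g 0" by (simp add: dual_zero[OF L' g])
    qed
    ultimately show "z = 0" by (simp add: zero_prod_def)
  }
  fix f assume f: "f \<in> carrier (dual (fmod (hyperbolic \<epsilon> L)))"
  have hL: "is_hom L ring_module (\<lambda>x. f (x, 0))"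
    by (rule is_homI) (use dual_add[OF f, of "(_, 0)" "(_, 0)"] dual_scale[OF f, of "(_, 0)"] in
        \<open>simp_all add: D.closed del: scale_dual\<close>)
  \<comment> \<open>Solves \<open>\<epsilon> * bar (g x) = f (0, g)\<close> for \<open>x\<close>; as
    \<open>\<epsilon>\<close> is its own inverse it reappears as a factor.\<close>
  have "is_hom (dual L) ring_module (\<lambda>x. f (0, x) * \<epsilon>)"
    by (rule is_homI) (use dual_add[OF f, of "(0, _)" "(0, _)"] dual_scale[OF f, of "(0, _)"] in
        \<open>simp_all add: L.closed distrib_right mult.assoc del: scale_dual\<close>)
  then obtain x where x: "x \<in> carrier L" "\<And>g. g \<in> carrier (dual L) \<Longrightarrow> g x = bar (f (0, g) * \<epsilon>)"
    using bidual_represent[OF L] by meson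
  have "lam (hyperbolic \<epsilon> L) (x, zero_outside (carrier L) (\<lambda>x. f (x, 0))) (y, g) = f (y, g)"
    if "y \<in> carrier L" "g \<in> carrier (dual L)" for y g
  proof -
    have "\<epsilon> * bar (g x) = f (0, g)"
      unfolding x(2)[OF that(2)] using \<epsilon> by (auto simp: bar_simps is_sign_def)
    then show ?thesis
      using dual_add[OF f, of "(y, 0)" "(0, g)"] that by (simp add: L.closed D.closed)
  qed
  then have "\<forall>y\<in>carrier (fmod (hyperbolic \<epsilon> L)).
      lam (hyperbolic \<epsilon> L) (x, zero_outside (carrier L) (\<lambda>x. f (x, 0))) y = f y"
    by auto
  then show "\<exists>x\<in>carrier (fmod (hyperbolic \<epsilon> L)). \<forall>y\<in>carrier (fmod (hyperbolic \<epsilon> L)). lam (hyperbolic \<epsilon> L) x y = f y"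
    using x(1) zero_outside_dual[OF L' hL]
    by (intro bexI[of _ "(x, zero_outside (carrier L) (\<lambda>x. f (x, 0)))"]) simp_all
qed

lemma submodule_dsum:
  assumes "left_module M" "left_module N" "is_submodule M A" "is_submodule N B"
  shows "is_submodule (M \<boxplus> N) (A \<times> B)"
  using assms by (auto simp: is_submodule_iff left_module_dsum zero_prod_def)

lemma complementary_dsum:
  assumes "left_module M" "left_module N" "complementary M A B" "complementary N A' B'"
  shows "complementary (M \<boxplus> N) (A \<times> A') (B \<times> B')"
  unfolding complementary_def
proof (intro conjI ballI)
  note C = complementaryD[OF assms(3)] and C' = complementaryD[OF assms(4)]
  show "is_submodule (M \<boxplus> N) (A \<times> A')" "is_submodule (M \<boxplus> N) (B \<times> B')"
    using submodule_dsum assms C C' by blast+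
  show "(A \<times> A') \<inter> (B \<times> B') = {0}"
    using assms(3,4) by (auto simp: complementary_def zero_prod_def)
  fix x assume "x \<in> carrier (M \<boxplus> N)"
  then obtain y z where yz: "x = (y, z)" "y \<in> carrier M" "z \<in> carrier N" by auto
  then obtain a b a' b' where "a \<in> A" "b \<in> B" "y = a + b" "a' \<in> A'" "b' \<in> B'" "z = a' + b'"
    using C(4) C'(4) by metis
  then show "\<exists>a\<in>A \<times> A'. \<exists>b\<in>B \<times> B'. x = a + b"
    using yz by (intro bexI[of _ "(a, a')"] bexI[of _ "(b, b')"]) simp_all
qed

lemma submodule_trivial:
  assumes "left_module M"
  shows "is_submodule M {0}" "is_submodule M (carrier M)"
proof -
  interpret left_module M by fact
  show "is_submodule M {0}" "is_submodule M (carrier M)"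
    by (auto simp: is_submodule_iff[OF assms] closed)
qed

lemma complementary_trivial:
  assumes "left_module M"
  shows "complementary M (carrier M) {0}" "complementary M {0} (carrier M)"
proof -
  interpret left_module M by fact
  show 1: "complementary M (carrier M) {0}"
    unfolding complementary_def using submodule_trivial[OF assms] zero_closed
    by (auto intro: bexI[of _ 0])
  show "complementary M {0} (carrier M)" by (rule complementary_sym[OF 1])
qed

lemma submodule_image:
  fixes M :: "('r::ring_1, 'm::ab_group_add) lmodule" and N :: "('r, 'n::ab_group_add) lmodule"
  assumes "left_module M" "left_module N" "is_hom M N f" "is_submodule M A"
  shows "is_submodule N (f ` A)"
proof -
  note A = assms(4)[unfolded is_submodule_iff[OF assms(1)]]
  show ?thesis
    unfolding is_submodule_iff[OF assms(2)]
  proof (intro conjI ballI allI)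
    show "f ` A \<subseteq> carrier N" using A hom_closed[OF assms(3)] by auto
    show "0 \<in> f ` A" using A hom_zero[OF assms(1,3)] by (metis imageI)
  next
    fix x y assume "x \<in> f ` A" "y \<in> f ` A"
    then obtain a b where "a \<in> A" "b \<in> A" "x = f a" "y = f b" by auto
    then have "a + b \<in> A" "x + y = f (a + b)" using A hom_add[OF assms(3)] by (auto simp: subset_iff)
    then show "x + y \<in> f ` A" by blast
  next
    fix r x assume "x \<in> f ` A"
    then obtain a where "a \<in> A" "x = f a" by auto
    then have "scale M r a \<in> A" "scale N r x = f (scale M r a)"
      using A hom_scale[OF assms(3)] by (auto simp: subset_iff)
    then show "scale N r x \<in> f ` A" by blast
  qed
qed

lemma complementary_image:
  fixes M :: "('r::ring_1, 'm::ab_group_add) lmodule" and N :: "('r, 'n::ab_group_add) lmodule"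
  assumes M: "left_module M" and N: "left_module N" and f: "is_iso M N f" and c: "complementary M A B"
  shows "complementary N (f ` A) (f ` B)"
  unfolding complementary_def
proof (intro conjI ballI)
  note C = complementaryD[OF c]
  have h: "is_hom M N f" by (rule iso_hom[OF f])
  have sub: "A \<subseteq> carrier M" "B \<subseteq> carrier M" using C by (auto simp: is_submodule_def)
  show s: "is_submodule N (f ` A)" "is_submodule N (f ` B)"
    using submodule_image[OF M N h] C by blast+
  have "x = 0" if x: "x \<in> f ` A" "x \<in> f ` B" for x
  proof -
    obtain a b where ab: "a \<in> A" "b \<in> B" "x = f a" "x = f b" using x by auto
    then have "a = b" using iso_inj[OF f, of a b] sub by auto
    then have "a = 0" using C(3) ab by blast
    then show ?thesis using ab hom_zero[OF M h] by simp
  qed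
  then show "f ` A \<inter> f ` B = {0}"
    using s by (auto simp: is_submodule_iff[OF N])
  fix y assume "y \<in> carrier N"
  then obtain x where x: "x \<in> carrier M" "f x = y" using iso_surj[OF f] by blast
  obtain a b where ab: "a \<in> A" "b \<in> B" "x = a + b" using C(4)[OF x(1)] by blast
  then have "y = f a + f b" using x hom_add[OF h, of a b] sub by auto
  then show "\<exists>a\<in>f ` A. \<exists>b\<in>f ` B. y = a + b" using ab by blast
qed

lemma lagrangianI:
  assumes "quadratic_form \<epsilon> K" "is_sign \<epsilon>" "nonsingular K" "complementary (fmod K) H L"
    and "\<And>x y. x \<in> L \<Longrightarrow> y \<in> L \<Longrightarrow> lam K x y = 0"
    and "\<And>x. x \<in> H \<Longrightarrow> mu K x = Qcls \<epsilon> 0" "\<And>x y. x \<in> H \<Longrightarrow> y \<in> H \<Longrightarrow> lam K x y = 0"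
  shows "lagrangian \<epsilon> K H"
  using quadratic.isotropic_complement_lagrangian[OF quadraticI] assms by blast

lemma lagrangian_sum:
  assumes K: "quadratic_form \<epsilon> K" and K': "quadratic_form \<epsilon> K'" and \<epsilon>: "is_sign \<epsilon>"
    and L: "lagrangian \<epsilon> K L" and L': "lagrangian \<epsilon> K' L'"
  shows "lagrangian \<epsilon> (form_sum K K') (L \<times> L')"
proof -
  interpret K: quadratic \<epsilon> K using K \<epsilon> quadraticI by blast
  interpret K': quadratic \<epsilon> K' using K' \<epsilon> quadraticI by blast
  note LD = K.lagrangianD[OF L] and LD' = K'.lagrangianD[OF L']
  have "direct_summand (fmod (form_sum K K')) (L \<times> L')"
    using L L' complementary_dsum[OF K.module K'.module]
    unfolding lagrangian_def direct_summand_iff form_sum_simps(1) by blast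
  moreover have "mu (form_sum K K') x = Qcls \<epsilon> 0" if "x \<in> L \<times> L'" for x
    using that LD(2) LD'(2) by (auto simp: Qcls_add)
  moreover have "L \<times> L' = {x \<in> carrier (fmod (form_sum K K')). \<forall>y\<in>L \<times> L'. lam (form_sum K K') x y = 0}"
  proof (intro equalityI subsetI)
    fix z assume "z \<in> {x \<in> carrier (fmod (form_sum K K')). \<forall>y\<in>L \<times> L'. lam (form_sum K K') x y = 0}"
    then obtain x x' where z: "z = (x, x')" "x \<in> carrier (fmod K)" "x' \<in> carrier (fmod K')"
      and 0: "\<And>y y'. y \<in> L \<Longrightarrow> y' \<in> L' \<Longrightarrow> lam (form_sum K K') z (y, y') = 0" by auto
    have "x \<in> L"
      by (rule LD(4)[OF z(2)]) (use 0[of _ 0] z LD(5) in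
          \<open>simp add: K'.closed K'.lam_zero K'.submodule_zero[OF LD'(1)]\<close>)
    moreover have "x' \<in> L'"
      by (rule LD'(4)[OF z(3)]) (use 0[of 0] z LD'(5) in
          \<open>simp add: K.closed K.lam_zero K.submodule_zero[OF LD(1)]\<close>)
    ultimately show "z \<in> L \<times> L'" using z by simp
  qed (use LD(3,5) LD'(3,5) in auto)
  ultimately show ?thesis unfolding lagrangian_def by blast
qed

lemma lagrangian_neg:
  "lagrangian \<epsilon> K L \<Longrightarrow> lagrangian \<epsilon> (form_neg K) L"
  by (simp add: lagrangian_def Qcls_uminus)

section \<open>Sums and negatives of formations, exchange of lagrangians\<close>

lemma is_formationD:
  assumes "is_formation \<epsilon> X"
  shows "quadratic_form \<epsilon> (qf X)" "nonsingular (qf X)" "lagrangian \<epsilon> (qf X) (lag1 X)"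
    "lagrangian \<epsilon> (qf X) (lag2 X)" "fg_free (fmod (qf X))"
    "fg_free (submod (fmod (qf X)) (lag1 X))" "fg_free (submod (fmod (qf X)) (lag2 X))"
  using assms by (simp_all add: is_formation_def)

lemma is_formation_form:
  "is_formation \<epsilon> \<lparr>qf = Q, lag1 = F, lag2 = G\<rparr> \<longleftrightarrow> quadratic_form \<epsilon> Q \<and> nonsingular Q \<and>
     lagrangian \<epsilon> Q F \<and> lagrangian \<epsilon> Q G \<and> fg_free (submod (fmod Q) F) \<and> fg_free (submod (fmod Q) G)"
  by (auto simp: is_formation_def quadratic_form_def)

lemma submod_dsum: "submod (M \<boxplus> N) (A \<times> B) = submod M A \<boxplus> submod N B"
  by (simp add: submod_def dsum_def)

lemma is_formation_sum:
  assumes X: "is_formation \<epsilon> X" and Y: "is_formation \<epsilon> Y" and \<epsilon>: "is_sign \<epsilon>"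
  shows "is_formation \<epsilon> (formation_sum X Y)"
  using is_formationD[OF X] is_formationD[OF Y] \<epsilon> unfolding formation_sum_def is_formation_form
  by (simp add: quadratic_form_sum nonsingular_sum lagrangian_sum submod_dsum fg_free_dsum)

lemma is_formation_neg:
  assumes X: "is_formation \<epsilon> X" and \<epsilon>: "is_sign \<epsilon>"
  shows "is_formation \<epsilon> (formation_neg X)"
  using is_formationD[OF X] \<epsilon> unfolding formation_neg_def is_formation_def
  by (simp add: quadratic_form_neg nonsingular_neg lagrangian_neg)

text \<open>Reduces statements about the second lagrangian to statements about the first.\<close>

definition flip :: "('r::ring_involution, 'm::ab_group_add) formation \<Rightarrow> ('r, 'm) formation" where
  "flip X = \<lparr>qf = qf X, lag1 = lag2 X, lag2 = lag1 X\<rparr>"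

lemma is_formation_flip: "is_formation \<epsilon> X \<Longrightarrow> is_formation \<epsilon> (flip X)"
  by (auto simp: is_formation_def flip_def)

lemma formation_sum_simps [simp]:
  "qf (formation_sum X Y) = form_sum (qf X) (qf Y)"
  "lag1 (formation_sum X Y) = lag1 X \<times> lag1 Y" "lag2 (formation_sum X Y) = lag2 X \<times> lag2 Y"
  by (simp_all add: formation_sum_def)

lemma formation_neg_simps [simp]:
  "qf (formation_neg X) = form_neg (qf X)"
  "lag1 (formation_neg X) = lag1 X" "lag2 (formation_neg X) = lag2 X"
  by (simp_all add: formation_neg_def)

lemma flip_simps [simp]: "qf (flip X) = qf X" "lag1 (flip X) = lag2 X" "lag2 (flip X) = lag1 X"
  by (simp_all add: flip_def)

lemma flip_sum: "flip (formation_sum X Y) = formation_sum (flip X) (flip Y)"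
  by (simp add: flip_def formation_sum_def)

section \<open>Isomorphisms of formations\<close>

lemma form_isoD:
  assumes "form_iso K K' f"
  shows "is_iso (fmod K) (fmod K') f"
    "x \<in> carrier (fmod K) \<Longrightarrow> y \<in> carrier (fmod K) \<Longrightarrow> lam K' (f x) (f y) = lam K x y"
    "x \<in> carrier (fmod K) \<Longrightarrow> mu K' (f x) = mu K x"
  using assms by (simp_all add: form_iso_def)

lemma formation_isomorphic_refl: "formation_isomorphic X X"
  unfolding formation_isomorphic_def form_iso_def is_iso_def is_hom_def
  by (intro exI[of _ id]) auto

lemma formation_isomorphic_trans:
  assumes "formation_isomorphic X Y" "formation_isomorphic Y Z"
  shows "formation_isomorphic X Z"
proof -
  obtain f where f: "form_iso (qf X) (qf Y) f" "f ` lag1 X = lag1 Y" "f ` lag2 X = lag2 Y"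
    using assms(1) by (auto simp: formation_isomorphic_def)
  obtain g where g: "form_iso (qf Y) (qf Z) g" "g ` lag1 Y = lag1 Z" "g ` lag2 Y = lag2 Z"
    using assms(2) by (auto simp: formation_isomorphic_def)
  have "form_iso (qf X) (qf Z) (\<lambda>x. g (f x))"
    using form_isoD[OF f(1)] form_isoD[OF g(1)] iso_comp hom_closed[OF iso_hom]
    unfolding form_iso_def by metis
  moreover have "(\<lambda>x. g (f x)) ` lag1 X = lag1 Z" "(\<lambda>x. g (f x)) ` lag2 X = lag2 Z"
    using f g by (auto simp: image_image[symmetric])
  ultimately show ?thesis
    unfolding formation_isomorphic_def by (intro exI[of _ "\<lambda>x. g (f x)"] conjI)
qed

lemma formation_isomorphic_sym:
  assumes "formation_isomorphic X Y" "left_module (fmod (qf X))"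
    "lag1 X \<subseteq> carrier (fmod (qf X))" "lag2 X \<subseteq> carrier (fmod (qf X))"
  shows "formation_isomorphic Y X"
proof -
  obtain f where f: "form_iso (qf X) (qf Y) f" "f ` lag1 X = lag1 Y" "f ` lag2 X = lag2 Y"
    using assms(1) by (auto simp: formation_isomorphic_def)
  note F = form_isoD[OF f(1)]
  let ?g = "inv_into (carrier (fmod (qf X))) f"
  have g: "is_iso (fmod (qf Y)) (fmod (qf X)) ?g" by (rule iso_inv[OF assms(2) F(1)])
  have gf: "?g (f x) = x" if "x \<in> carrier (fmod (qf X))" for x
    using iso_bij[OF F(1)] that by (auto simp: bij_betw_def)
  have fg: "f (?g x) = x" if "x \<in> carrier (fmod (qf Y))" for x
    using iso_bij[OF F(1)] that by (auto simp: bij_betw_def f_inv_into_f)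
  have "form_iso (qf Y) (qf X) ?g"
    unfolding form_iso_def
    using g F(2)[symmetric] F(3)[symmetric] by (simp add: fg hom_closed[OF iso_hom[OF g]])
  moreover have "?g ` f ` S = S" if "S \<subseteq> carrier (fmod (qf X))" for S
    using that gf by (force simp: image_image)
  ultimately show ?thesis
    unfolding formation_isomorphic_def
    using f(2,3) assms(3,4) by (metis (no_types, lifting))
qed

lemma lagrangian_subset: "lagrangian \<epsilon> K L \<Longrightarrow> L \<subseteq> carrier (fmod K)"
  by (auto simp: lagrangian_def)

lemma is_formation_isomorphic_sym:
  "formation_isomorphic X Y \<Longrightarrow> is_formation \<epsilon> X \<Longrightarrow> formation_isomorphic Y X"
  using formation_isomorphic_sym is_formationD lagrangian_subset fg_free_module by metis

lemma iso_dsum: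
  assumes "is_iso M N f" "is_iso M' N' g"
  shows "is_iso (M \<boxplus> M') (N \<boxplus> N') (\<lambda>(x, y). (f x, g y))"
proof -
  have "bij_betw (\<lambda>(x, y). (f x, g y)) (carrier M \<times> carrier M') (carrier N \<times> carrier N')"
    using bij_betw_map_prod[OF iso_bij[OF assms(1)] iso_bij[OF assms(2)]] by (simp add: map_prod_def)
  then show ?thesis
    using iso_hom[OF assms(1)] iso_hom[OF assms(2)] by (auto simp: is_iso_def is_hom_def)
qed

lemma formation_isomorphic_sum:
  assumes "formation_isomorphic X X'" "formation_isomorphic Y Y'"
  shows "formation_isomorphic (formation_sum X Y) (formation_sum X' Y')"
proof -
  obtain f where f: "form_iso (qf X) (qf X') f" "f ` lag1 X = lag1 X'" "f ` lag2 X = lag2 X'"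
    using assms(1) by (auto simp: formation_isomorphic_def)
  obtain g where g: "form_iso (qf Y) (qf Y') g" "g ` lag1 Y = lag1 Y'" "g ` lag2 Y = lag2 Y'"
    using assms(2) by (auto simp: formation_isomorphic_def)
  note F = form_isoD[OF f(1)] and G = form_isoD[OF g(1)]
  have cl: "f x \<in> carrier (fmod (qf X'))" if "x \<in> carrier (fmod (qf X))" for x
    using hom_closed[OF iso_hom[OF F(1)] that] .
  have cl': "g x \<in> carrier (fmod (qf Y'))" if "x \<in> carrier (fmod (qf Y))" for x
    using hom_closed[OF iso_hom[OF G(1)] that] .
  have "form_iso (form_sum (qf X) (qf Y)) (form_sum (qf X') (qf Y')) (\<lambda>(x, y). (f x, g y))"
    using iso_dsum[OF F(1) G(1)] by (auto simp: form_iso_def F G cl cl')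
  moreover have "(\<lambda>(x, y). (f x, g y)) ` (A \<times> B) = (f ` A) \<times> (g ` B)" for A B
    by auto
  ultimately show ?thesis
    unfolding formation_isomorphic_def formation_sum_simps using f g by metis
qed

lemma formation_isomorphic_neg:
  assumes "formation_isomorphic X Y"
  shows "formation_isomorphic (formation_neg X) (formation_neg Y)"
  using assms by (auto simp: formation_isomorphic_def form_iso_def)

lemma formation_neg_neg:
  assumes "is_formation \<epsilon> X"
  shows "formation_isomorphic (formation_neg (formation_neg X)) X"
  unfolding formation_isomorphic_def form_iso_def is_iso_def is_hom_def
  by (intro exI[of _ id]) (auto simp: image_image)

lemma formation_neg_sum:
  "formation_isomorphic (formation_neg (formation_sum X Y)) (formation_sum (formation_neg X) (formation_neg Y))"
proof -
  have "uminus ` {a + b | a b. a \<in> A \<and> b \<in> B} = {a + b | a b. a \<in> uminus ` A \<and> b \<in> uminus ` B}"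
    for A B :: "'a set"
  proof (intro equalityI subsetI)
    fix z assume "z \<in> uminus ` {a + b | a b. a \<in> A \<and> b \<in> B}"
    then obtain a b where "a \<in> A" "b \<in> B" "z = - a + - b" by auto
    then show "z \<in> {a + b | a b. a \<in> uminus ` A \<and> b \<in> uminus ` B}" by blast
  next
    fix z assume "z \<in> {a + b | a b. a \<in> uminus ` A \<and> b \<in> uminus ` B}"
    then obtain a b where "a \<in> A" "b \<in> B" "z = - (a + b)" by auto
    then show "z \<in> uminus ` {a + b | a b. a \<in> A \<and> b \<in> B}" by blast
  qed
  then show ?thesis
    unfolding formation_isomorphic_def form_iso_def is_iso_def is_hom_def
    by (intro exI[of _ id]) auto
qed

lemma formation_sum_commute:
  "formation_isomorphic (formation_sum X Y) (formation_sum Y X)"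
proof -
  have "is_iso (M \<boxplus> N) (N \<boxplus> M) (\<lambda>(x, y). (y, x))" for M :: "('s::ring_1, 'm1::ab_group_add) lmodule" and N :: "('s, 'm2::ab_group_add) lmodule"
    by (auto simp: is_iso_def is_hom_def bij_betw_def inj_on_def)
  moreover have "{a + b | a b. a \<in> A \<and> b \<in> B} = {b + a | b a. b \<in> B \<and> a \<in> A}" for A B :: "'a set"
    by (safe; (metis add.commute))
  ultimately have "form_iso (form_sum (qf X) (qf Y)) (form_sum (qf Y) (qf X)) (\<lambda>(x, y). (y, x))"
    by (auto simp: form_iso_def add.commute)
  then show ?thesis
    unfolding formation_isomorphic_def by (intro exI[of _ "\<lambda>(x, y). (y, x)"]) auto
qed

lemma formation_sum_assoc:
  "formation_isomorphic (formation_sum (formation_sum X Y) Z) (formation_sum X (formation_sum Y Z))"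
proof -
  let ?f = "\<lambda>((x, y), z). (x, (y, z))"
  have "is_iso ((M \<boxplus> N) \<boxplus> P) (M \<boxplus> (N \<boxplus> P)) ?f" for M :: "('s::ring_1, 'm1::ab_group_add) lmodule"
    and N :: "('s, 'm2::ab_group_add) lmodule" and P :: "('s, 'm3::ab_group_add) lmodule"
    by (auto simp: is_iso_def is_hom_def bij_betw_def inj_on_def image_def)
  moreover have "{a + b | a b. a \<in> A \<and> (\<exists>c d. b = c + d \<and> c \<in> B \<and> d \<in> C)}
      = {a + b | a b. (\<exists>c d. a = c + d \<and> c \<in> A \<and> d \<in> B) \<and> b \<in> C}" for A B C :: "'a set"
    by (safe; (metis add.assoc))
  ultimately have "form_iso (form_sum (form_sum (qf X) (qf Y)) (qf Z)) (form_sum (qf X) (form_sum (qf Y) (qf Z))) ?f"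
    by (auto simp: form_iso_def add.assoc)
  moreover have "?f ` ((A \<times> B) \<times> C) = A \<times> (B \<times> C)" for A B C
    by (auto simp: image_def)
  ultimately show ?thesis
    unfolding formation_isomorphic_def formation_sum_simps by metis
qed

lemma formation_sum_swap_right:
  "formation_isomorphic (formation_sum (formation_sum X Y) Z) (formation_sum (formation_sum X Z) Y)"
proof -
  let ?f = "\<lambda>((x, y), z). ((x, z), y)"
  have "is_iso ((M \<boxplus> N) \<boxplus> P) ((M \<boxplus> P) \<boxplus> N) ?f" for M :: "('s::ring_1, 'm1::ab_group_add) lmodule"
    and N :: "('s, 'm2::ab_group_add) lmodule" and P :: "('s, 'm3::ab_group_add) lmodule"
    by (auto simp: is_iso_def is_hom_def bij_betw_def inj_on_def image_def)
  moreover have "{a + b | a b. (\<exists>c d. a = c + d \<and> c \<in> A \<and> d \<in> C) \<and> b \<in> B}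
      = {a + b | a b. (\<exists>c d. a = c + d \<and> c \<in> A \<and> d \<in> B) \<and> b \<in> C}" for A B C :: "'a set"
    by (safe; (metis add.assoc add.commute))
  ultimately have "form_iso (form_sum (form_sum (qf X) (qf Y)) (qf Z)) (form_sum (form_sum (qf X) (qf Z)) (qf Y)) ?f"
    by (auto simp: form_iso_def algebra_simps)
  moreover have "?f ` ((A \<times> B) \<times> C) = (A \<times> C) \<times> B" for A B C
    by (auto simp: image_def)
  ultimately show ?thesis
    unfolding formation_isomorphic_def formation_sum_simps by metis
qed

lemma sumset_interchange:
  fixes A B C D :: "'a::ab_semigroup_add set"
  shows "{a + b | a b. (\<exists>c d. a = c + d \<and> c \<in> A \<and> d \<in> B) \<and> (\<exists>c d. b = c + d \<and> c \<in> C \<and> d \<in> D)}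
    \<subseteq> {a + b | a b. (\<exists>c d. a = c + d \<and> c \<in> A \<and> d \<in> C) \<and> (\<exists>c d. b = c + d \<and> c \<in> B \<and> d \<in> D)}"
proof
  fix z assume "z \<in> {a + b | a b. (\<exists>c d. a = c + d \<and> c \<in> A \<and> d \<in> B) \<and> (\<exists>c d. b = c + d \<and> c \<in> C \<and> d \<in> D)}"
  then obtain a b c d where "a \<in> A" "b \<in> B" "c \<in> C" "d \<in> D" "z = (a + b) + (c + d)" by blast
  moreover from this have "z = (a + c) + (b + d)" by (simp add: ac_simps)
  ultimately show "z \<in> {a + b | a b. (\<exists>c d. a = c + d \<and> c \<in> A \<and> d \<in> C) \<and> (\<exists>c d. b = c + d \<and> c \<in> B \<and> d \<in> D)}"
    by blast
qed

lemma formation_sum_interchange: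
  "formation_isomorphic (formation_sum (formation_sum X Y) (formation_sum Z W))
     (formation_sum (formation_sum X Z) (formation_sum Y W))"
proof -
  let ?f = "\<lambda>((x, y), (z, w)). ((x, z), (y, w))"
  have "is_iso ((M \<boxplus> N) \<boxplus> (P \<boxplus> R)) ((M \<boxplus> P) \<boxplus> (N \<boxplus> R)) ?f" for M :: "('s::ring_1, 'm1::ab_group_add) lmodule"
    and N :: "('s, 'm2::ab_group_add) lmodule" and P :: "('s, 'm3::ab_group_add) lmodule"
    and R :: "('s, 'm4::ab_group_add) lmodule"
    by (auto simp: is_iso_def is_hom_def bij_betw_def inj_on_def image_def)
  moreover have "{a + b | a b. (\<exists>c d. a = c + d \<and> c \<in> A \<and> d \<in> C) \<and> (\<exists>c d. b = c + d \<and> c \<in> B \<and> d \<in> D)}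
      = {a + b | a b. (\<exists>c d. a = c + d \<and> c \<in> A \<and> d \<in> B) \<and> (\<exists>c d. b = c + d \<and> c \<in> C \<and> d \<in> D)}"
    for A B C D :: "'a set"
    using sumset_interchange[of A C B D] sumset_interchange[of A B C D] by (rule subset_antisym)
  ultimately have "form_iso (form_sum (form_sum (qf X) (qf Y)) (form_sum (qf Z) (qf W)))
      (form_sum (form_sum (qf X) (qf Z)) (form_sum (qf Y) (qf W))) ?f"
    by (auto simp: form_iso_def algebra_simps)
  moreover have "?f ` ((A \<times> B) \<times> (C \<times> D)) = (A \<times> C) \<times> (B \<times> D)" for A B C D
    by (auto simp: image_def)
  ultimately show ?thesis
    unfolding formation_isomorphic_def formation_sum_simps by metis
qed

text \<open>Transport of structure: once the target carries a quadratic form, nonsingularity, the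
  lagrangians and their freeness follow from the isomorphism. A lagrangian is carried over together
  with a complementary one, so that \<open>lagrangianI\<close> applies to its image.\<close>

lemma form_iso_formation:
  assumes X: "is_formation \<epsilon> X" and i: "formation_isomorphic X Y"
    and Y: "quadratic_form \<epsilon> (qf Y)" and \<epsilon>: "is_sign \<epsilon>"
  shows "is_formation \<epsilon> Y"
proof -
  obtain f where f: "form_iso (qf X) (qf Y) f" "f ` lag1 X = lag1 Y" "f ` lag2 X = lag2 Y"
    using i by (auto simp: formation_isomorphic_def)
  note F = form_isoD[OF f(1)] and XD = is_formationD[OF X]
  interpret X: quadratic \<epsilon> "qf X" using XD \<epsilon> quadraticI by blast
  interpret Y: quadratic \<epsilon> "qf Y" using Y \<epsilon> quadraticI by blast
  have fh: "is_hom (fmod (qf X)) (fmod (qf Y)) f" by (rule iso_hom[OF F(1)])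
  have surj: "\<exists>x\<in>carrier (fmod (qf X)). f x = y" if "y \<in> carrier (fmod (qf Y))" for y
    using iso_surj[OF F(1) that] .
  have ns: "nonsingular (qf Y)"
  proof (rule nonsingularI[OF Y \<epsilon>])
    fix y assume y: "y \<in> carrier (fmod (qf Y))" and 0: "\<And>z. z \<in> carrier (fmod (qf Y)) \<Longrightarrow> lam (qf Y) y z = 0"
    obtain x where x: "x \<in> carrier (fmod (qf X))" "f x = y" using surj[OF y] by blast
    have "x = 0"
      by (rule X.nonsingular_inj[OF XD(2) x(1)]) (metis 0 F(2) hom_closed[OF fh] x)
    then show "y = 0" using x hom_zero[OF X.module fh] by simp
  next
    fix g assume g: "g \<in> carrier (dual (fmod (qf Y)))"
    obtain x where x: "x \<in> carrier (fmod (qf X))" "\<And>z. z \<in> carrier (fmod (qf X)) \<Longrightarrow> lam (qf X) x z = g (f z)"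
      using nonsingular_represent[OF XD(1,2) hom_comp[OF fh dual_hom[OF g]]] by blast
    have "lam (qf Y) (f x) y = g y" if y: "y \<in> carrier (fmod (qf Y))" for y
      using surj[OF y] F(2)[OF x(1)] x(2) by force
    then show "\<exists>x\<in>carrier (fmod (qf Y)). \<forall>y\<in>carrier (fmod (qf Y)). lam (qf Y) x y = g y"
      using hom_closed[OF fh x(1)] by blast
  qed
  have lag: "lagrangian \<epsilon> (qf Y) (f ` L) \<and> fg_free (submod (fmod (qf Y)) (f ` L))"
    if L: "lagrangian \<epsilon> (qf X) L" "fg_free (submod (fmod (qf X)) L)" for L
  proof
    note LD = X.lagrangianD[OF L(1)]
    obtain T where T: "lagrangian \<epsilon> (qf X) T" "complementary (fmod (qf X)) L T"
      using X.complementary_lagrangian[OF XD(2) L] .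
    note TD = X.lagrangianD[OF T(1)]
    show "lagrangian \<epsilon> (qf Y) (f ` L)"
      by (rule lagrangianI[OF Y \<epsilon> ns complementary_image[OF X.module Y.module F(1) T(2)]])
        (auto simp: F LD(2,3,5) TD(3,5))
    have m: "left_module (submod (fmod (qf Y)) (f ` L))"
      using submodule_image[OF X.module Y.module fh LD(1)] by (simp add: is_submodule_def)
    have "is_iso (submod (fmod (qf X)) L) (submod (fmod (qf Y)) (f ` L)) f"
      using F(1) lagrangian_subset[OF L(1)]
      by (auto simp: is_iso_def is_hom_def bij_betw_def subset_iff intro: inj_on_subset)
    then show "fg_free (submod (fmod (qf Y)) (f ` L))"
      using fg_free_iso[OF L(2) m] by blast
  qed
  show ?thesis
    using lag[OF XD(3,6)] lag[OF XD(4,7)] Y ns Y.free f by (simp add: is_formation_def)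
qed

text \<open>The form is pulled back to a standard module, and its axioms are checked on the
  pulled-back \<open>\<chi>\<close>. This brings a formation over any type into the type of the
  formation group.\<close>

lemma formation_transport:
  fixes X :: "('r::ring_involution, 'm::ab_group_add) formation"
  assumes X: "is_formation \<epsilon> X" and \<epsilon>: "is_sign \<epsilon>"
  obtains Y :: "('r, 'r univ) formation" where "is_formation \<epsilon> Y" "formation_isomorphic X Y"
proof -
  note XD = is_formationD[OF X]
  interpret X: quadratic \<epsilon> "qf X" using XD \<epsilon> quadraticI by blast
  obtain k f where f: "is_iso (std_module k :: ('r, 'r univ) lmodule) (fmod (qf X)) f"
    and free: "fg_free (std_module k :: ('r, 'r univ) lmodule)"
    using iso_std_module[OF XD(5)] .
  let ?M = "std_module k :: ('r, 'r univ) lmodule"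
  have M: "left_module ?M" by (rule left_module_std)
  note fh = iso_hom[OF f]
  define K where "K = \<lparr>fmod = ?M, lam = (\<lambda>x. zero_outside (carrier ?M) (\<lambda>y. lam (qf X) (f x) (f y))),
    mu = (\<lambda>x. mu (qf X) (f x))\<rparr>"
  have K: "fmod K = ?M" "y \<in> carrier ?M \<Longrightarrow> lam K x y = lam (qf X) (f x) (f y)" "mu K x = mu (qf X) (f x)" for x y
    by (simp_all add: K_def)
  have push: "sesquilinear ?M (\<lambda>x y. \<chi> (f x) (f y))" if "sesquilinear (fmod (qf X)) \<chi>" for \<chi>
    unfolding sesquilinear_def
    by (simp add: hom_add[OF fh] hom_scale[OF fh] hom_closed[OF fh] sesquilinearD[OF that])
  obtain \<chi> where \<chi>: "sesquilinear (fmod (qf X)) \<chi>"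
    "\<And>x y. x \<in> carrier (fmod (qf X)) \<Longrightarrow> y \<in> carrier (fmod (qf X)) \<Longrightarrow> lam (qf X) x y = \<chi> x y + \<epsilon> * bar (\<chi> y x)"
    "\<And>x. x \<in> carrier (fmod (qf X)) \<Longrightarrow> mu (qf X) x = Qcls \<epsilon> (\<chi> x x)"
    by (rule X.splitting) blast
  have KQ: "quadratic_form \<epsilon> K"
  proof (rule quadratic_formI)
    show "is_hom (fmod K) (dual (fmod K)) (lam K)"
      using sesquilinear_hom_dual[OF M push[OF X.lam_sesquilinear]] by (simp add: K_def)
    show "sesquilinear (fmod K) (\<lambda>x y. \<chi> (f x) (f y))"
      using push[OF \<chi>(1)] by (simp add: K)
  qed (use \<epsilon> free \<chi>(2,3) hom_closed[OF fh] in \<open>simp_all add: K\<close>)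
  let ?Y = "\<lparr>qf = K, lag1 = {x \<in> carrier ?M. f x \<in> lag1 X}, lag2 = {x \<in> carrier ?M. f x \<in> lag2 X}\<rparr>"
  have im: "f ` {x \<in> carrier ?M. f x \<in> L} = L" if "L \<subseteq> carrier (fmod (qf X))" for L
    using iso_surj[OF f] that by (auto simp: image_iff)
  have "form_iso K (qf X) f"
    using f by (simp add: form_iso_def K)
  then have i: "formation_isomorphic ?Y X"
    unfolding formation_isomorphic_def
    using im[OF lagrangian_subset[OF XD(3)]] im[OF lagrangian_subset[OF XD(4)]]
    by (intro exI[of _ f]) simp
  have i': "formation_isomorphic X ?Y"
    by (rule formation_isomorphic_sym[OF i]) (use M in \<open>auto simp: K\<close>)
  have "is_formation \<epsilon> ?Y"
    by (rule form_iso_formation[OF X i' _ \<epsilon>]) (use KQ in simp)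
  then show ?thesis using i' that by blast
qed

text \<open>The form splits as \<open>L\<close> plus its dual because \<open>H\<close> is dual to
  \<open>L\<close> by \<open>complement_dual_iso\<close>. The parametrisation \<open>u\<close>
  allows the hyperbolic model to live over \<open>'r univ\<close>; the last conclusion locates
  further elements, in particular those of a second lagrangian, in the model.\<close>

lemma hyperbolic_coordinates:
  fixes K :: "('r::ring_involution, 'm::ab_group_add) qform" and N :: "('r, 'n::ab_group_add) lmodule"
  assumes K: "quadratic_form \<epsilon> K" "nonsingular K" and \<epsilon>: "is_sign \<epsilon>"
    and L: "lagrangian \<epsilon> K L" and H: "lagrangian \<epsilon> K H" and c: "complementary (fmod K) L H"
    and N: "left_module N" and u: "is_iso N (submod (fmod K) L) u"
  obtains \<Phi> where "form_iso K (hyperbolic \<epsilon> N) \<Phi>" "\<Phi> ` L = carrier N \<times> {0}"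
    "\<Phi> ` H = {0} \<times> carrier (dual N)"
    "\<And>x h. x \<in> carrier N \<Longrightarrow> h \<in> H \<Longrightarrow>
       \<Phi> (u x + h) = (x, zero_outside (carrier N) (\<lambda>y. lam K h (u y)))"
proof -
  interpret quadratic \<epsilon> K using K \<epsilon> quadraticI by blast
  interpret N: left_module N by fact
  interpret D: left_module "dual N" by (rule left_module_dual[OF N])
  note LD = lagrangianD[OF L] and HD = lagrangianD[OF H] and C = complementaryD[OF c]
  note uh = iso_hom[OF u]
  have uL: "u x \<in> L" if "x \<in> carrier N" for x using hom_closed[OF uh that] by simp
  have uK: "u x \<in> carrier (fmod K)" if "x \<in> carrier N" for x using uL[OF that] LD(5) by blast
  have usurj: "\<exists>x\<in>carrier N. u x = l" if "l \<in> L" for l using iso_surj[OF u] that by simp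
  obtain p where p: "is_hom (fmod K) (submod (fmod K) L) p"
    and pH: "\<And>x. x \<in> carrier (fmod K) \<Longrightarrow> x - p x \<in> H"
    and pl: "\<And>a b. a \<in> L \<Longrightarrow> b \<in> H \<Longrightarrow> p (a + b) = a"
    by (rule complementary_projection[OF c]) blast
  have pL: "p x \<in> L" if "x \<in> carrier (fmod K)" for x using hom_closed[OF p that] by simp
  have pK: "p x \<in> carrier (fmod K)" if "x \<in> carrier (fmod K)" for x using pL[OF that] LD(5) by blast
  let ?v = "inv_into (carrier N) u"
  have vh: "is_hom (submod (fmod K) L) N ?v" by (rule iso_hom[OF iso_inv[OF N u]])
  have vu: "?v (u x) = x" if "x \<in> carrier N" for x
    using iso_bij[OF u] that by (auto simp: bij_betw_def)
  let ?h = "\<lambda>h. zero_outside (carrier N) (\<lambda>y. lam K h (u y))"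
  have hD: "?h h \<in> carrier (dual N)" if "h \<in> carrier (fmod K)" for h
    by (rule zero_outside_dual[OF N], rule is_homI)
      (use that in \<open>simp_all add: hom_add[OF uh] hom_scale[OF uh] uK lam_add_right lam_scale_right\<close>)
  define \<Phi> where "\<Phi> q = (?v (p q), ?h (q - p q))" for q
  have \<Phi>: "\<Phi> (u x + h) = (x, ?h h)" if "x \<in> carrier N" "h \<in> H" for x h
    using pl[OF uL[OF that(1)] that(2)] vu[OF that(1)] by (simp add: \<Phi>_def)
  have \<Phi>L: "\<Phi> (u x) = (x, 0)" if "x \<in> carrier N" for x
  proof -
    have "?h 0 = 0" by (auto simp: fun_eq_iff zero_outside_def lam_zero uK)
    then show ?thesis using \<Phi>[OF that submodule_zero[OF C(2)]] by simp
  qed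
  have \<Phi>H: "\<Phi> h = (0, ?h h)" if "h \<in> H" for h
    using \<Phi>[OF N.zero_closed that] hom_zero[OF N uh] by simp
  have dec: "\<exists>x\<in>carrier N. \<exists>h\<in>H. q = u x + h" if q: "q \<in> carrier (fmod K)" for q
    using C(4)[OF q] usurj by metis
  \<comment> \<open>A functional on \<open>N\<close> is transported to \<open>L\<close> and
    represented there by an element of \<open>H\<close>, using the duality of \<open>H\<close> with
    \<open>L\<close>.\<close>
  have hsurj: "\<exists>h\<in>H. ?h h = f" if f: "f \<in> carrier (dual N)" for f
  proof -
    have "dual_map (submod (fmod K) L) ?v f \<in> carrier (dual (submod (fmod K) L))"
      by (rule dual_map_closed[OF _ vh f]) (use LD(1) in \<open>simp add: is_submodule_def\<close>)
    then obtain t where t: "t \<in> H" "zero_outside L (lam K t) = dual_map (submod (fmod K) L) ?v f"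
      using iso_surj[OF complement_dual_iso[OF K(2) L c]] by auto
    have "lam K t (u y) = f y" if "y \<in> carrier N" for y
      using fun_cong[OF t(2), of "u y"] uL[OF that] vu[OF that] by simp
    then have "?h t = f"
      by (auto simp: fun_eq_iff zero_outside_def dual_outside[OF f])
    then show ?thesis using t(1) by blast
  qed
  have iso: "is_iso (fmod K) (N \<boxplus> dual N) \<Phi>"
  proof (rule is_isoI[OF module])
    have 1: "is_hom (fmod K) N (\<lambda>q. ?v (p q))" by (rule hom_comp[OF p vh])
    have 2: "?h (q - p q) \<in> carrier (dual N)" if "q \<in> carrier (fmod K)" for q
      by (rule hD) (use that pK closed in simp)
    show "is_hom (fmod K) (N \<boxplus> dual N) \<Phi>"
    proof (rule is_homI)
      fix x y assume "x \<in> carrier (fmod K)" "y \<in> carrier (fmod K)"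
      then show "\<Phi> (x + y) = \<Phi> x + \<Phi> y"
        by (auto simp: \<Phi>_def hom_add[OF vh] fun_eq_iff zero_outside_def hom_add[OF p] pL pK uK closed
            lam_add_left lam_diff_left)
    next
      fix a x assume "x \<in> carrier (fmod K)"
      then show "\<Phi> (scale (fmod K) a x) = scale (N \<boxplus> dual N) a (\<Phi> x)"
        by (auto simp: \<Phi>_def hom_scale[OF vh, simplified] fun_eq_iff zero_outside_def hom_scale[OF p] pL pK uK closed
            lam_diff_left lam_scale_left left_diff_distrib)
    qed (use hom_closed[OF 1] 2 in \<open>simp add: \<Phi>_def\<close>)
  next
    fix q assume q: "q \<in> carrier (fmod K)" "\<Phi> q = 0"
    obtain x h where xh: "x \<in> carrier N" "h \<in> H" "q = u x + h" using dec[OF q(1)] by blast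
    have x: "x = 0" and h: "?h h = 0" using \<Phi>[OF xh(1,2)] q(2) xh(3) by (simp_all add: zero_prod_def)
    have "h \<in> L"
    proof (rule LD(4))
      fix l assume "l \<in> L"
      then obtain y where "y \<in> carrier N" "u y = l" using usurj by blast
      then show "lam K h l = 0" using fun_cong[OF h, of y] by simp
    qed (use HD(5) xh in blast)
    then have "h = 0" using C(3) xh by blast
    then show "q = 0" using x xh hom_zero[OF N uh] by simp
  next
    fix y assume "y \<in> carrier (N \<boxplus> dual N)"
    then obtain x f where y: "y = (x, f)" "x \<in> carrier N" "f \<in> carrier (dual N)" by auto
    obtain h where h: "h \<in> H" "?h h = f" using hsurj[OF y(3)] by blast
    show "\<exists>q\<in>carrier (fmod K). \<Phi> q = y"
      by (rule bexI[of _ "u x + h"]) (use y h \<Phi> uK HD(5) closed in simp_all)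
  qed
  have "form_iso K (hyperbolic \<epsilon> N) \<Phi>"
    unfolding form_iso_def
  proof (intro conjI ballI)
    show "is_iso (fmod K) (fmod (hyperbolic \<epsilon> N)) \<Phi>" using iso by simp
  next
    fix q r assume q: "q \<in> carrier (fmod K)" and r: "r \<in> carrier (fmod K)"
    obtain x h where xh: "x \<in> carrier N" "h \<in> H" "q = u x + h" using dec[OF q] by blast
    obtain y g where yg: "y \<in> carrier N" "g \<in> H" "r = u y + g" using dec[OF r] by blast
    have "lam K q r = lam K (u x) g + lam K h (u y)"
      using xh yg uK uL HD(3,5) LD(3) by (simp add: lam_add_left lam_add_right closed)
    also have "lam K (u x) g = \<epsilon> * bar (lam K g (u x))"
      by (rule lam_sym) (use xh yg uK HD(5) in auto)
    finally show "lam (hyperbolic \<epsilon> N) (\<Phi> q) (\<Phi> r) = lam K q r"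
      using xh yg hD HD(5) by (simp add: \<Phi>)
  next
    fix q assume q: "q \<in> carrier (fmod K)"
    obtain x h where xh: "x \<in> carrier N" "h \<in> H" "q = u x + h" using dec[OF q] by blast
    have "mu K (h + u x) = Qcls \<epsilon> (0 + 0 + lam K h (u x))"
      by (rule mu_add) (use xh uK HD(2,5) LD(2) uL in auto)
    then show "mu (hyperbolic \<epsilon> N) (\<Phi> q) = mu K q"
      unfolding xh(3) \<Phi>[OF xh(1,2)] using xh(1) by (simp add: add.commute)
  qed
  moreover have "\<Phi> ` L = carrier N \<times> {0}"
    using \<Phi>L uL usurj by (force simp: image_iff)
  moreover have "\<Phi> ` H = {0} \<times> carrier (dual N)"
    using \<Phi>H hsurj hD HD(5) by (force simp: image_iff)
  ultimately show ?thesis using \<Phi> by (rule that)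
qed

lemma complementaryI:
  assumes "left_module M" "is_submodule M A" "is_submodule M B"
    and "\<And>x. x \<in> A \<Longrightarrow> x \<in> B \<Longrightarrow> x = 0"
    and "\<And>x. x \<in> carrier M \<Longrightarrow> \<exists>a\<in>A. \<exists>b\<in>B. x = a + b"
  shows "complementary M A B"
  using assms left_module.submodule_zero[OF assms(1)] unfolding complementary_def by blast

section \<open>Common complements and null formations\<close>

text \<open>Only isotropy of \<open>H\<close> is recorded; complementary to a lagrangian, such an
  \<open>H\<close> is itself a lagrangian by \<open>lagrangianI\<close>.\<close>

definition common_complement :: "'r::ring_involution \<Rightarrow> ('r, 'm::ab_group_add) formation \<Rightarrow> bool" where
  "common_complement \<epsilon> X \<longleftrightarrow> (\<exists>H. complementary (fmod (qf X)) H (lag1 X) \<and>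
     complementary (fmod (qf X)) H (lag2 X) \<and> (\<forall>x\<in>H. mu (qf X) x = Qcls \<epsilon> 0) \<and>
     (\<forall>x\<in>H. \<forall>y\<in>H. lam (qf X) x y = 0))"

lemma formation_quadratic: "is_formation \<epsilon> X \<Longrightarrow> is_sign \<epsilon> \<Longrightarrow> quadratic \<epsilon> (qf X)"
  using quadraticI is_formationD(1) by blast

lemma formation_module: "is_formation \<epsilon> X \<Longrightarrow> left_module (fmod (qf X))"
  using is_formationD(5) fg_free_module by blast

lemma common_complement_iso:
  assumes cc: "common_complement \<epsilon> X" and i: "formation_isomorphic X Y"
    and X: "is_formation \<epsilon> X" and Y: "is_formation \<epsilon> Y"
  shows "common_complement \<epsilon> Y"
proof -
  obtain H where H: "complementary (fmod (qf X)) H (lag1 X)" "complementary (fmod (qf X)) H (lag2 X)"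
    "\<And>x. x \<in> H \<Longrightarrow> mu (qf X) x = Qcls \<epsilon> 0" "\<And>x y. x \<in> H \<Longrightarrow> y \<in> H \<Longrightarrow> lam (qf X) x y = 0"
    using cc by (auto simp: common_complement_def)
  obtain f where f: "form_iso (qf X) (qf Y) f" "f ` lag1 X = lag1 Y" "f ` lag2 X = lag2 Y"
    using i by (auto simp: formation_isomorphic_def)
  note F = form_isoD[OF f(1)] and mX = formation_module[OF X] and mY = formation_module[OF Y]
  have sub: "x \<in> carrier (fmod (qf X))" if "x \<in> H" for x
    using complementaryD(1)[OF H(1)] that by (auto simp: is_submodule_def)
  show ?thesis
    unfolding common_complement_def
    using complementary_image[OF mX mY F(1) H(1)] complementary_image[OF mX mY F(1) H(2)] f(2,3)
    by (intro exI[of _ "f ` H"]) (auto simp: F(2,3) sub H(3,4))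
qed

lemma common_complement_flip: "common_complement \<epsilon> X \<Longrightarrow> common_complement \<epsilon> (flip X)"
  by (auto simp: common_complement_def)

lemma common_complement_neg: "common_complement \<epsilon> X \<Longrightarrow> common_complement \<epsilon> (formation_neg X)"
proof -
  assume "common_complement \<epsilon> X"
  then obtain H where "complementary (fmod (qf X)) H (lag1 X)" "complementary (fmod (qf X)) H (lag2 X)"
    "\<forall>x\<in>H. mu (qf X) x = Qcls \<epsilon> 0" "\<forall>x\<in>H. \<forall>y\<in>H. lam (qf X) x y = 0"
    by (auto simp: common_complement_def)
  then show ?thesis
    unfolding common_complement_def by (intro exI[of _ H]) (simp add: Qcls_uminus)
qed

lemma common_complement_sum:
  assumes X: "common_complement \<epsilon> X" "is_formation \<epsilon> X" and Y: "common_complement \<epsilon> Y" "is_formation \<epsilon> Y"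
  shows "common_complement \<epsilon> (formation_sum X Y)"
proof -
  obtain H where H: "complementary (fmod (qf X)) H (lag1 X)" "complementary (fmod (qf X)) H (lag2 X)"
    "\<And>x. x \<in> H \<Longrightarrow> mu (qf X) x = Qcls \<epsilon> 0" "\<And>x y. x \<in> H \<Longrightarrow> y \<in> H \<Longrightarrow> lam (qf X) x y = 0"
    using X by (auto simp: common_complement_def)
  obtain H' where H': "complementary (fmod (qf Y)) H' (lag1 Y)" "complementary (fmod (qf Y)) H' (lag2 Y)"
    "\<And>x. x \<in> H' \<Longrightarrow> mu (qf Y) x = Qcls \<epsilon> 0" "\<And>x y. x \<in> H' \<Longrightarrow> y \<in> H' \<Longrightarrow> lam (qf Y) x y = 0"
    using Y by (auto simp: common_complement_def)
  note mX = formation_module[OF X(2)] and mY = formation_module[OF Y(2)]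
  have "x \<in> carrier (fmod (qf X))" if "x \<in> H" for x
    using complementaryD(1)[OF H(1)] that by (auto simp: is_submodule_def)
  moreover have "x \<in> carrier (fmod (qf Y))" if "x \<in> H'" for x
    using complementaryD(1)[OF H'(1)] that by (auto simp: is_submodule_def)
  ultimately show ?thesis
    unfolding common_complement_def
    using complementary_dsum[OF mX mY H(1) H'(1)] complementary_dsum[OF mX mY H(2) H'(2)]
    by (intro exI[of _ "H \<times> H'"]) (auto simp: H(3,4) H'(3,4) Qcls_add)
qed

section \<open>Hyperbolic and trivial formations\<close>

lemma hyperbolic_complementary:
  assumes "left_module L"
  shows "complementary (L \<boxplus> dual L) (carrier L \<times> {0}) ({0} \<times> carrier (dual L))"
  using complementary_dsum[OF assms left_module_dual] complementary_trivial assms left_module_dual by blast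

lemma hyperbolic_lagrangians:
  fixes L :: "('r::ring_involution, 'm::ab_group_add) lmodule"
  assumes L: "fg_free L" and \<epsilon>: "is_sign \<epsilon>"
  shows "lagrangian \<epsilon> (hyperbolic \<epsilon> L) (carrier L \<times> {0})"
    "lagrangian \<epsilon> (hyperbolic \<epsilon> L) ({0} \<times> carrier (dual L))"
    "fg_free (submod (L \<boxplus> dual L) (carrier L \<times> {0}))"
    "fg_free (submod (L \<boxplus> dual L) ({0} \<times> carrier (dual L)))"
proof -
  note Q = quadratic_form_hyperbolic[OF L \<epsilon>] nonsingular_hyperbolic[OF L \<epsilon>]
  have L': "left_module L" by (rule fg_free_module[OF L])
  have D: "left_module (dual L)" by (rule left_module_dual[OF L'])
  interpret D: left_module "dual L" by fact
  interpret L: left_module L by fact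
  have c: "complementary (fmod (hyperbolic \<epsilon> L)) (carrier L \<times> {0}) ({0} \<times> carrier (dual L))"
    using hyperbolic_complementary[OF L'] by simp
  have d0: "f 0 = 0" if "f \<in> carrier (dual L)" for f by (rule dual_zero[OF L' that])
  have iso1: "lam (hyperbolic \<epsilon> L) x y = 0" if "x \<in> carrier L \<times> {0}" "y \<in> carrier L \<times> {0}" for x y
    using that by (auto simp: D.zero_closed)
  have iso2: "lam (hyperbolic \<epsilon> L) x y = 0"
    if "x \<in> {0} \<times> carrier (dual L)" "y \<in> {0} \<times> carrier (dual L)" for x y
    using that by (auto simp: L.zero_closed d0)
  show 1: "lagrangian \<epsilon> (hyperbolic \<epsilon> L) (carrier L \<times> {0})"
    by (rule lagrangianI[OF Q(1) \<epsilon> Q(2) c iso2 _ iso1]) auto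
  show 2: "lagrangian \<epsilon> (hyperbolic \<epsilon> L) ({0} \<times> carrier (dual L))"
    by (rule lagrangianI[OF Q(1) \<epsilon> Q(2) complementary_sym[OF c] iso1 _ iso2]) (auto simp: d0)
  have m: "left_module (submod (L \<boxplus> dual L) (carrier L \<times> {0}))"
    using c by (simp add: complementary_def is_submodule_def)
  have "is_iso L (submod (L \<boxplus> dual L) (carrier L \<times> {0})) (\<lambda>x. (x, 0))"
    by (rule is_isoI[OF L']) (auto simp: is_hom_def zero_prod_def fun_eq_iff)
  from fg_free_iso[OF L m this] show 3: "fg_free (submod (L \<boxplus> dual L) (carrier L \<times> {0}))" .
  show "fg_free (submod (L \<boxplus> dual L) ({0} \<times> carrier (dual L)))"
    using quadratic.complement_free[OF quadraticI[OF Q(1) \<epsilon>] Q(2) 1 c] 3 by simp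
qed

text \<open>The model in the definition of \<open>trivial_formation\<close>, here over modules of
  any type.\<close>

definition hyperbolic_formation :: "'r::ring_involution \<Rightarrow> ('r, 'm::ab_group_add) lmodule \<Rightarrow>
    ('r, 'm \<times> ('m \<Rightarrow> 'r)) formation" where
  "hyperbolic_formation \<epsilon> L =
     \<lparr>qf = hyperbolic \<epsilon> L, lag1 = carrier L \<times> {0}, lag2 = {0} \<times> carrier (dual L)\<rparr>"

lemma is_formation_hyperbolic:
  assumes "fg_free L" "is_sign \<epsilon>"
  shows "is_formation \<epsilon> (hyperbolic_formation \<epsilon> L)"
  unfolding hyperbolic_formation_def is_formation_form
  using hyperbolic_lagrangians[OF assms] quadratic_form_hyperbolic[OF assms] nonsingular_hyperbolic[OF assms]
  by simp

text \<open>The model has complementary lagrangians; conversely, complementary lagrangians give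
  hyperbolic coordinates. The right hand side mentions no model, so closure under sums, sign change
  and exchange of lagrangians is immediate from it.\<close>

lemma trivial_formation_iff:
  fixes X :: "('r::ring_involution, 'm::ab_group_add) formation"
  assumes \<epsilon>: "is_sign \<epsilon>"
  shows "trivial_formation \<epsilon> X \<longleftrightarrow>
    is_formation \<epsilon> X \<and> complementary (fmod (qf X)) (lag1 X) (lag2 X)"
proof
  assume "trivial_formation \<epsilon> X"
  then obtain L :: "('r, 'r univ) lmodule" where X: "is_formation \<epsilon> X" and L: "fg_free L"
    and i: "formation_isomorphic X (hyperbolic_formation \<epsilon> L)"
    by (auto simp: trivial_formation_def hyperbolic_formation_def)
  obtain f where f: "form_iso (hyperbolic \<epsilon> L) (qf X) f"
    "f ` (carrier L \<times> {0}) = lag1 X" "f ` ({0} \<times> carrier (dual L)) = lag2 X"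
    using is_formation_isomorphic_sym[OF i X]
    by (auto simp: formation_isomorphic_def hyperbolic_formation_def)
  have L': "left_module L" by (rule fg_free_module[OF L])
  have "complementary (fmod (qf X)) (f ` (carrier L \<times> {0})) (f ` ({0} \<times> carrier (dual L)))"
    by (rule complementary_image[OF _ formation_module[OF X] _ hyperbolic_complementary[OF L']])
      (use form_isoD(1)[OF f(1)] left_module_dsum[OF L' left_module_dual[OF L']] in auto)
  then show "is_formation \<epsilon> X \<and> complementary (fmod (qf X)) (lag1 X) (lag2 X)"
    using X f by simp
next
  assume "is_formation \<epsilon> X \<and> complementary (fmod (qf X)) (lag1 X) (lag2 X)"
  then have X: "is_formation \<epsilon> X" and c: "complementary (fmod (qf X)) (lag1 X) (lag2 X)" by auto
  note XD = is_formationD[OF X]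
  obtain k u where u: "is_iso (std_module k :: ('r, 'r univ) lmodule) (submod (fmod (qf X)) (lag1 X)) u"
    and free: "fg_free (std_module k :: ('r, 'r univ) lmodule)"
    using iso_std_module[OF XD(6)] .
  obtain \<Phi> where "form_iso (qf X) (hyperbolic \<epsilon> (std_module k :: ('r, 'r univ) lmodule)) \<Phi>"
    "\<Phi> ` lag1 X = carrier (std_module k) \<times> {0}"
    "\<Phi> ` lag2 X = {0} \<times> carrier (dual (std_module k))"
    by (rule hyperbolic_coordinates[OF XD(1,2) \<epsilon> XD(3,4) c fg_free_module[OF free] u]) blast
  then have "formation_isomorphic X \<lparr>qf = hyperbolic \<epsilon> (std_module k :: ('r, 'r univ) lmodule),
      lag1 = carrier (std_module k) \<times> {0}, lag2 = {0} \<times> carrier (dual (std_module k))\<rparr>"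
    unfolding formation_isomorphic_def by (intro exI[of _ \<Phi>]) simp
  then show "trivial_formation \<epsilon> X"
    unfolding trivial_formation_def using X free by blast
qed

lemma trivial_formation: "trivial_formation \<epsilon> X \<Longrightarrow> is_formation \<epsilon> X"
  by (simp add: trivial_formation_def)

lemma trivial_hyperbolic:
  assumes "fg_free L" "is_sign \<epsilon>"
  shows "trivial_formation \<epsilon> (hyperbolic_formation \<epsilon> L)"
  unfolding trivial_formation_iff[OF assms(2)]
  using is_formation_hyperbolic[OF assms] hyperbolic_complementary[OF fg_free_module[OF assms(1)]]
  by (simp add: hyperbolic_formation_def)

lemma trivial_sum:
  assumes "trivial_formation \<epsilon> X" "trivial_formation \<epsilon> Y" "is_sign \<epsilon>"
  shows "trivial_formation \<epsilon> (formation_sum X Y)"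
  using assms complementary_dsum[OF formation_module formation_module]
  by (auto simp: trivial_formation_iff is_formation_sum)

lemma trivial_flip: "is_sign \<epsilon> \<Longrightarrow> trivial_formation \<epsilon> X \<Longrightarrow> trivial_formation \<epsilon> (flip X)"
  by (simp add: trivial_formation_iff is_formation_flip complementary_sym)

lemma trivial_neg: "is_sign \<epsilon> \<Longrightarrow> trivial_formation \<epsilon> X \<Longrightarrow> trivial_formation \<epsilon> (formation_neg X)"
  by (simp add: trivial_formation_iff is_formation_neg)

lemma trivial_iso:
  assumes \<epsilon>: "is_sign \<epsilon>" and X: "trivial_formation \<epsilon> X" and i: "formation_isomorphic X Y"
    and Y: "is_formation \<epsilon> Y"
  shows "trivial_formation \<epsilon> Y"
proof -
  obtain L :: "('a, 'a univ) lmodule" where "fg_free L"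
    "formation_isomorphic X \<lparr>qf = hyperbolic \<epsilon> L, lag1 = carrier L \<times> {0}, lag2 = {0} \<times> carrier (dual L)\<rparr>"
    using X by (auto simp: trivial_formation_def)
  then show ?thesis
    unfolding trivial_formation_def
    using Y formation_isomorphic_trans[OF is_formation_isomorphic_sym[OF i trivial_formation[OF X]]] by blast
qed

lemma carrier_dual_zero: "carrier (dual (zero_module :: ('r::ring_involution, 'm::ab_group_add) lmodule)) = {0}"
proof -
  let ?M = "zero_module :: ('r, 'm) lmodule"
  have M: "left_module ?M" by (rule fg_free_module[OF fg_free_zero])
  have "f = 0" if f: "f \<in> carrier (dual ?M)" for f
  proof
    fix x show "f x = 0 x"
      using dual_zero[OF M f] dual_outside[OF f, of x] by (cases "x = 0") simp_all
  qed
  then show ?thesis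
    using left_module.zero_closed[OF left_module_dual[OF M]] by blast
qed

lemma is_formation_zero: "is_sign \<epsilon> \<Longrightarrow> is_formation \<epsilon> (zero_formation \<epsilon>)"
  and trivial_zero: "is_sign \<epsilon> \<Longrightarrow> trivial_formation \<epsilon> (zero_formation \<epsilon>)"
  and common_complement_zero: "is_sign \<epsilon> \<Longrightarrow> common_complement \<epsilon> (zero_formation \<epsilon>)"
proof -
  assume \<epsilon>: "is_sign \<epsilon>"
  let ?Q = "qf (zero_formation \<epsilon>)" and ?M = "zero_module :: ('a, 'a univ) lmodule"
  have Q: "fmod ?Q = ?M" "lam ?Q = (\<lambda>x y. 0)" "mu ?Q = (\<lambda>x. Qcls \<epsilon> 0)"
    "lag1 (zero_formation \<epsilon>) = {0}" "lag2 (zero_formation \<epsilon>) = {0}"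
    by (simp_all add: zero_formation_def)
  have M: "left_module ?M" by (rule fg_free_module[OF fg_free_zero])
  have z: "(\<lambda>y. 0) = (0 :: 'a univ \<Rightarrow> 'a)" by (simp add: fun_eq_iff)
  note D = carrier_dual_zero[where 'r = 'a and 'm = "'a univ"]
  have QF: "quadratic_form \<epsilon> ?Q"
    by (rule quadratic_formI[where \<chi> = "\<lambda>x y. 0"])
      (use \<epsilon> in \<open>auto simp: Q fg_free_zero sesquilinear_def is_hom_def D z\<close>)
  have NS: "nonsingular ?Q"
    by (rule nonsingularI[OF QF \<epsilon>]) (use D in \<open>auto simp: Q\<close>)
  have c: "complementary ?M {0} {0}"
    using complementary_trivial[OF M] by simp
  have L: "lagrangian \<epsilon> ?Q {0}"
    by (rule lagrangianI[OF QF \<epsilon> NS, of _ "{0}"]) (use c in \<open>simp_all add: Q\<close>)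
  have "submod ?M {0} = ?M" by (simp add: submod_def zero_module_def)
  then have "fg_free (submod ?M {0})" by (simp only: fg_free_zero)
  then show F: "is_formation \<epsilon> (zero_formation \<epsilon>)"
    using QF NS L by (simp add: is_formation_def Q fg_free_zero)
  then show "trivial_formation \<epsilon> (zero_formation \<epsilon>)"
    using c by (simp add: trivial_formation_iff[OF \<epsilon>] Q)
  show "common_complement \<epsilon> (zero_formation \<epsilon>)"
    unfolding common_complement_def using c by (intro exI[of _ "{0}"]) (simp add: Q)
qed

section \<open>Stable existence of common complements\<close>

definition null_formation :: "'r::ring_involution \<Rightarrow> ('r, 'm::ab_group_add) formation \<Rightarrow> bool" where
  "null_formation \<epsilon> X \<longleftrightarrow>
     (\<exists>T :: ('r, 'r univ) formation. trivial_formation \<epsilon> T \<and> common_complement \<epsilon> (formation_sum X T))"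

text \<open>The stabilising formation may live over any type; it is replaced by an isomorphic copy
  over \<open>'r univ\<close>.\<close>

lemma null_formationI:
  fixes T :: "('r::ring_involution, 't::ab_group_add) formation"
  assumes \<epsilon>: "is_sign \<epsilon>" and X: "is_formation \<epsilon> X" and T: "trivial_formation \<epsilon> T"
    and cc: "common_complement \<epsilon> (formation_sum X T)"
  shows "null_formation \<epsilon> X"
proof -
  obtain T' :: "('r, 'r univ) formation" where T': "is_formation \<epsilon> T'" "formation_isomorphic T T'"
    using formation_transport[OF trivial_formation[OF T] \<epsilon>] .
  have "common_complement \<epsilon> (formation_sum X T')"
    by (rule common_complement_iso[OF cc formation_isomorphic_sum[OF formation_isomorphic_refl T'(2)]])
      (simp_all add: is_formation_sum X trivial_formation[OF T] T' \<epsilon>)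
  then show ?thesis
    unfolding null_formation_def using trivial_iso[OF \<epsilon> T T'(2,1)] by blast
qed

lemma null_formation_iso:
  assumes "is_sign \<epsilon>" "null_formation \<epsilon> X" "formation_isomorphic X Y" "is_formation \<epsilon> X" "is_formation \<epsilon> Y"
  shows "null_formation \<epsilon> Y"
proof -
  obtain T :: "('a, 'a univ) formation" where T: "trivial_formation \<epsilon> T" "common_complement \<epsilon> (formation_sum X T)"
    using assms(2) by (auto simp: null_formation_def)
  have "common_complement \<epsilon> (formation_sum Y T)"
    by (rule common_complement_iso[OF T(2) formation_isomorphic_sum[OF assms(3) formation_isomorphic_refl]])
      (simp_all add: is_formation_sum assms trivial_formation[OF T(1)])
  then show ?thesis using T(1) by (auto simp: null_formation_def)
qed

lemma null_formation_cc:
  assumes "is_sign \<epsilon>" "is_formation \<epsilon> X" "common_complement \<epsilon> X"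
  shows "null_formation \<epsilon> X"
  by (rule null_formationI[OF assms(1,2) trivial_zero[OF assms(1)]
        common_complement_sum[OF assms(3,2) common_complement_zero[OF assms(1)] is_formation_zero[OF assms(1)]]])

lemma null_formation_flip:
  assumes "is_sign \<epsilon>" "null_formation \<epsilon> X"
  shows "null_formation \<epsilon> (flip X)"
proof -
  obtain T :: "('a, 'a univ) formation" where T: "trivial_formation \<epsilon> T" "common_complement \<epsilon> (formation_sum X T)"
    using assms(2) by (auto simp: null_formation_def)
  have "common_complement \<epsilon> (formation_sum (flip X) (flip T))"
    using common_complement_flip[OF T(2)] by (simp add: flip_sum)
  then show ?thesis using trivial_flip[OF assms(1) T(1)] by (auto simp: null_formation_def)
qed

lemma null_formation_neg:
  assumes \<epsilon>: "is_sign \<epsilon>" and X: "is_formation \<epsilon> X" "null_formation \<epsilon> X"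
  shows "null_formation \<epsilon> (formation_neg X)"
proof -
  obtain T :: "('a, 'a univ) formation" where T: "trivial_formation \<epsilon> T" "common_complement \<epsilon> (formation_sum X T)"
    using X(2) by (auto simp: null_formation_def)
  have "common_complement \<epsilon> (formation_sum (formation_neg X) (formation_neg T))"
    by (rule common_complement_iso[OF common_complement_neg[OF T(2)] formation_neg_sum])
      (simp_all add: is_formation_sum is_formation_neg X trivial_formation[OF T(1)] \<epsilon>)
  then show ?thesis using trivial_neg[OF \<epsilon> T(1)] by (auto simp: null_formation_def)
qed

lemma null_formation_sum:
  assumes \<epsilon>: "is_sign \<epsilon>" and X: "is_formation \<epsilon> X" "null_formation \<epsilon> X"
    and Y: "is_formation \<epsilon> Y" "null_formation \<epsilon> Y"
  shows "null_formation \<epsilon> (formation_sum X Y)"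
proof -
  obtain T :: "('a, 'a univ) formation" where T: "trivial_formation \<epsilon> T" "common_complement \<epsilon> (formation_sum X T)"
    using X(2) by (auto simp: null_formation_def)
  obtain T' :: "('a, 'a univ) formation" where T': "trivial_formation \<epsilon> T'" "common_complement \<epsilon> (formation_sum Y T')"
    using Y(2) by (auto simp: null_formation_def)
  note F = is_formation_sum[OF _ _ \<epsilon>] X(1) Y(1) trivial_formation[OF T(1)] trivial_formation[OF T'(1)]
  have "common_complement \<epsilon> (formation_sum (formation_sum X T) (formation_sum Y T'))"
    by (rule common_complement_sum[OF T(2) _ T'(2)]) (simp_all add: F)
  then have "common_complement \<epsilon> (formation_sum (formation_sum X Y) (formation_sum T T'))"
    by (rule common_complement_iso[OF _ formation_sum_interchange]) (simp_all add: F)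
  with trivial_sum[OF T(1) T'(1) \<epsilon>] show ?thesis
    by (intro null_formationI[OF \<epsilon>]) (simp_all add: F)
qed

lemma null_formation_cancel_trivial:
  assumes \<epsilon>: "is_sign \<epsilon>" and X: "is_formation \<epsilon> X" and T: "trivial_formation \<epsilon> T"
    and n: "null_formation \<epsilon> (formation_sum X T)"
  shows "null_formation \<epsilon> X"
proof -
  obtain T' :: "('a, 'a univ) formation" where T': "trivial_formation \<epsilon> T'"
    "common_complement \<epsilon> (formation_sum (formation_sum X T) T')"
    using n by (auto simp: null_formation_def)
  note F = is_formation_sum[OF _ _ \<epsilon>] X(1) trivial_formation[OF T(1)] trivial_formation[OF T'(1)]
  have "common_complement \<epsilon> (formation_sum X (formation_sum T T'))"
    by (rule common_complement_iso[OF T'(2) formation_sum_assoc]) (simp_all add: F)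
  with trivial_sum[OF T T'(1) \<epsilon>] show ?thesis
    by (intro null_formationI[OF \<epsilon> X])
qed

text \<open>Let \<open>p\<close> be the projection to \<open>A\<close> along \<open>B\<close>. Pairs
  \<open>(b, c)\<close> with the same \<open>B\<close>-component form a correspondence from two
  copies of \<open>Q\<close> to one, sending \<open>(b, c)\<close> to \<open>b + p c\<close>: the
  common \<open>B\<close>-component is kept and the \<open>A\<close>-components are added. The new
  complement \<open>H'\<close> is the preimage of \<open>H\<close> under it. Over
  \<open>B \<times> A\<close> the correspondence leaves just \<open>A\<close>, over
  \<open>N \<times> B\<close> just \<open>N\<close>, so both complementarities return to those of
  \<open>H\<close>. It preserves the form because the pairing between \<open>A\<close> and
  \<open>B\<close> is additive in the \<open>A\<close>-component.\<close>

lemma common_complement_swap: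
  fixes X :: "('r::ring_involution, 'm::ab_group_add) formation" and Q :: "('r, 'n::ab_group_add) qform"
  assumes \<epsilon>: "is_sign \<epsilon>" and X: "is_formation \<epsilon> X" and Q: "quadratic_form \<epsilon> Q"
    and A: "lagrangian \<epsilon> Q A" and B: "lagrangian \<epsilon> Q B" and AB: "complementary (fmod Q) A B"
    and cc: "common_complement \<epsilon> (formation_sum X \<lparr>qf = Q, lag1 = A, lag2 = N\<rparr>)"
  shows "common_complement \<epsilon> (formation_sum (formation_sum X \<lparr>qf = Q, lag1 = B, lag2 = N\<rparr>)
     \<lparr>qf = Q, lag1 = A, lag2 = B\<rparr>)"
proof -
  interpret X: quadratic \<epsilon> "qf X" using X \<epsilon> formation_quadratic by blast
  interpret Q: quadratic \<epsilon> Q using Q \<epsilon> quadraticI by blast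
  note AD = Q.lagrangianD[OF A] and BD = Q.lagrangianD[OF B]
  let ?XQ = "fmod (qf X) \<boxplus> fmod Q"
  have mXQ: "left_module ?XQ" by (rule left_module_dsum[OF X.module Q.module])
  have mXQQ: "left_module (?XQ \<boxplus> fmod Q)" by (rule left_module_dsum[OF mXQ Q.module])
  obtain H where H1: "complementary ?XQ H (lag1 X \<times> A)" and H2: "complementary ?XQ H (lag2 X \<times> N)"
    and Hmu: "\<forall>z\<in>H. mu (form_sum (qf X) Q) z = Qcls \<epsilon> 0"
    and Hlam: "\<forall>z\<in>H. \<forall>w\<in>H. lam (form_sum (qf X) Q) z w = 0"
    using cc by (auto simp: common_complement_def)
  have Hm: "mu (form_sum (qf X) Q) (x, y) = Qcls \<epsilon> 0" if "(x, y) \<in> H" for x y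
    using Hmu that by blast
  have Hl: "lam (form_sum (qf X) Q) (x, y) (x', y') = 0" if "(x, y) \<in> H" "(x', y') \<in> H" for x y x' y'
    using Hlam that by blast
  note C1 = complementaryD[OF H1] and C2 = complementaryD[OF H2]
  have XD: "is_submodule (fmod (qf X)) (lag1 X)" "is_submodule (fmod (qf X)) (lag2 X)"
    using X.lagrangianD(1) is_formationD[OF X] by blast+
  have HS: "H \<subseteq> carrier ?XQ" "0 \<in> H" "\<And>x y. x \<in> H \<Longrightarrow> y \<in> H \<Longrightarrow> x + y \<in> H"
    "\<And>a x. x \<in> H \<Longrightarrow> scale ?XQ a x \<in> H"
    using C1(1) is_submodule_iff[OF mXQ] by auto
  have NS: "n \<in> carrier (fmod (qf X)) \<and> m \<in> carrier (fmod Q)" if "(n, m) \<in> lag2 X \<times> N" for n m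
    using C2(2) that by (auto simp: is_submodule_def)
  obtain p where p: "is_hom (fmod Q) (submod (fmod Q) A) p"
    and pB: "\<And>x. x \<in> carrier (fmod Q) \<Longrightarrow> x - p x \<in> B"
    and pl: "\<And>a b. a \<in> A \<Longrightarrow> b \<in> B \<Longrightarrow> p (a + b) = a"
    by (rule Q.complementary_projection[OF AB]) blast
  have pA: "p x \<in> A" if "x \<in> carrier (fmod Q)" for x using hom_closed[OF p that] by simp
  have pQ: "p x \<in> carrier (fmod Q)" if "x \<in> carrier (fmod Q)" for x using pA[OF that] AD(5) by blast
  have pa: "p a = a" if "a \<in> A" for a using pl[OF that Q.submodule_zero[OF BD(1)]] by simp
  have pb: "p b = 0" if "b \<in> B" for b using pl[OF Q.submodule_zero[OF AD(1)] that] by simp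
  note padd = hom_add[OF p] and pscale = hom_scale[OF p, simplified]
    and pdiff = hom_diff[OF Q.module p]
  define H' where "H' = {((q, b), c) | q b c. b \<in> carrier (fmod Q) \<and> c \<in> carrier (fmod Q) \<and>
    b - p b = c - p c \<and> (q, b + p c) \<in> H}"
  have H'I: "((q, b), c) \<in> H'" if "b \<in> carrier (fmod Q)" "c \<in> carrier (fmod Q)" "b - p b = c - p c"
    "(q, b + p c) \<in> H" for q b c
    using that by (auto simp: H'_def)
  have H'E: "b \<in> carrier (fmod Q)" "c \<in> carrier (fmod Q)" "b - p b = c - p c" "(q, b + p c) \<in> H"
    "q \<in> carrier (fmod (qf X))" if "((q, b), c) \<in> H'" for q b c
    using that HS(1) by (auto simp: H'_def)
  have sub: "is_submodule (?XQ \<boxplus> fmod Q) H'"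
    unfolding is_submodule_iff[OF mXQQ]
  proof (intro conjI ballI allI subsetI)
    fix z assume "z \<in> H'" then show "z \<in> carrier (?XQ \<boxplus> fmod Q)"
      using H'E by (cases z) auto
  next
    show "0 \<in> H'"
      using H'I[of 0 0 0] HS(2) hom_zero[OF Q.module p] Q.zero_closed by (simp add: zero_prod_def)
  next
    fix z w assume "z \<in> H'" "w \<in> H'"
    then obtain q b c q' b' c' where zw: "z = ((q, b), c)" "w = ((q', b'), c')"
      "((q, b), c) \<in> H'" "((q', b'), c') \<in> H'"
      by (metis prod.exhaust)
    note E = H'E[OF zw(3)] and E' = H'E[OF zw(4)]
    have "b + b' - p (b + b') = (b - p b) + (b' - p b')"
      by (simp add: padd E(1) E'(1))
    also have "\<dots> = (c - p c) + (c' - p c')" by (simp only: E(3) E'(3))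
    also have "\<dots> = c + c' - p (c + c')" by (simp add: padd E(2) E'(2))
    finally have "b + b' - p (b + b') = c + c' - p (c + c')" .
    moreover have "(q + q', b + b' + p (c + c')) \<in> H"
      using HS(3)[OF E(4) E'(4)] by (simp add: padd E(2) E'(2) algebra_simps)
    ultimately show "z + w \<in> H'"
      unfolding zw by (simp add: H'I Q.closed E(1,2) E'(1,2))
  next
    fix a z assume "z \<in> H'"
    then obtain q b c where z: "z = ((q, b), c)" "((q, b), c) \<in> H'"
      by (metis prod.exhaust)
    note E = H'E[OF z(2)]
    have "scale (fmod Q) a (b - p b) = scale (fmod Q) a (c - p c)" using E(3) by simp
    moreover have "(scale (fmod (qf X)) a q, scale (fmod Q) a b + p (scale (fmod Q) a c)) \<in> H"
      using HS(4)[OF E(4), of a] by (simp add: pscale E(1,2) pQ Q.scale_add_right)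
    ultimately show "scale (?XQ \<boxplus> fmod Q) a z \<in> H'"
      unfolding z by (simp add: H'I Q.closed E(1,2) pQ pscale Q.scale_diff_right)
  qed
  have c1: "complementary (?XQ \<boxplus> fmod Q) H' ((lag1 X \<times> B) \<times> A)"
  proof (rule complementaryI[OF mXQQ sub])
    show "is_submodule (?XQ \<boxplus> fmod Q) ((lag1 X \<times> B) \<times> A)"
      by (intro submodule_dsum left_module_dsum X.module Q.module XD AD(1) BD(1))
    have "z = 0" if "z \<in> H'" "z \<in> (lag1 X \<times> B) \<times> A" for z
    proof -
      note zz = that
      obtain l s r where z: "z = ((l, s), r)" "l \<in> lag1 X" "s \<in> B" "r \<in> A" using zz(2) by auto
      note E = H'E[OF zz(1)[unfolded z]]
      have "s = 0" using E(3) pa[OF z(4)] pb[OF z(3)] by simp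
      then have "(l, r) \<in> H" using E(4) pa[OF z(4)] by simp
      then have "(l, r) = 0" using C1(3)[of "(l, r)"] z by simp
      then show ?thesis using \<open>s = 0\<close> z by (simp add: zero_prod_def)
    qed
    then show "\<And>x. x \<in> H' \<Longrightarrow> x \<in> (lag1 X \<times> B) \<times> A \<Longrightarrow> x = 0" .
  next
    fix z assume "z \<in> carrier (?XQ \<boxplus> fmod Q)"
    then obtain q b c where z: "z = ((q, b), c)" "q \<in> carrier (fmod (qf X))"
      "b \<in> carrier (fmod Q)" "c \<in> carrier (fmod Q)" by auto
    \<comment> \<open>Subtracting \<open>s\<close> from \<open>b\<close> equalises the
      \<open>B\<close>-components, as membership in \<open>H'\<close> demands; what is left is
      decomposed by the first complementarity of \<open>H\<close>.\<close>
    define s where "s = (b - p b) - (c - p c)"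
    have s: "s \<in> B" unfolding s_def using Q.submodule_diff[OF BD(1)] pB z by blast
    have "(q, p b + c) \<in> carrier ?XQ" using z pQ Q.closed by simp
    then obtain h l r where hlr: "h \<in> H" "l \<in> lag1 X" "r \<in> A" "(q, p b + c) = h + (l, r)"
      using C1(4) by blast
    have h: "h = (q - l, p b + c - r)" using hlr(4) by (cases h) auto
    note cl = Q.closed z pQ BD(5)[OF s] AD(5)[OF hlr(3)]
    have "((q - l, b - s), c - r) \<in> H'"
    proof (rule H'I)
      show "b - s - p (b - s) = c - r - p (c - r)"
        by (simp add: pdiff cl pa[OF hlr(3)] pb[OF s]) (simp add: s_def)
      have "b - s + p (c - r) = p b + c - r"
        by (simp add: pdiff cl pa[OF hlr(3)]) (simp add: s_def)
      then show "(q - l, b - s + p (c - r)) \<in> H" using hlr(1) h by simp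
    qed (simp_all add: cl)
    then show "\<exists>x\<in>H'. \<exists>y\<in>(lag1 X \<times> B) \<times> A. z = x + y"
      by (rule bexI[rotated]) (use z s hlr in \<open>intro bexI[of _ "((l, s), r)"], simp_all\<close>)
  qed
  have c2: "complementary (?XQ \<boxplus> fmod Q) H' ((lag2 X \<times> N) \<times> B)"
  proof (rule complementaryI[OF mXQQ sub])
    show "is_submodule (?XQ \<boxplus> fmod Q) ((lag2 X \<times> N) \<times> B)"
      by (intro submodule_dsum mXQ Q.module C2(2) BD(1))
    have "z = 0" if "z \<in> H'" "z \<in> (lag2 X \<times> N) \<times> B" for z
    proof -
      note zz = that
      obtain l s r where z: "z = ((l, s), r)" "l \<in> lag2 X" "s \<in> N" "r \<in> B" using zz(2) by auto
      note E = H'E[OF zz(1)[unfolded z]]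
      have "(l, s) \<in> H" using E(4) pb[OF z(4)] by simp
      then have ls: "(l, s) = 0" using C2(3)[of "(l, s)"] z by simp
      then have "r = 0" using E(3) pb[OF z(4)] hom_zero[OF Q.module p] by (simp add: zero_prod_def)
      then show ?thesis using ls z by (simp add: zero_prod_def)
    qed
    then show "\<And>x. x \<in> H' \<Longrightarrow> x \<in> (lag2 X \<times> N) \<times> B \<Longrightarrow> x = 0" .
  next
    fix z assume "z \<in> carrier (?XQ \<boxplus> fmod Q)"
    then obtain q b c where z: "z = ((q, b), c)" "q \<in> carrier (fmod (qf X))"
      "b \<in> carrier (fmod Q)" "c \<in> carrier (fmod Q)" by auto
    have "(q, b + p c) \<in> carrier ?XQ" using z pQ Q.closed by simp
    then obtain h l r where hlr: "h \<in> H" "l \<in> lag2 X" "r \<in> N" "(q, b + p c) = h + (l, r)"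
      using C2(4) by blast
    have h: "h = (q - l, b + p c - r)" using hlr(4) by (cases h) auto
    have r: "r \<in> carrier (fmod Q)" using NS hlr by blast
    \<comment> \<open>Here the \<open>B\<close>-component of \<open>c\<close> is adjusted to that of
      \<open>b - r\<close>; since \<open>p\<close> kills \<open>B\<close>, the element that has to
      lie in \<open>H\<close> does not change.\<close>
    define w where "w = (c - p c) - ((b - r) - p (b - r))"
    have w: "w \<in> B" unfolding w_def using Q.submodule_diff[OF BD(1)] pB z r Q.closed by simp
    note cl = Q.closed z pQ BD(5)[OF w] r
    have "((q - l, b - r), c - w) \<in> H'"
    proof (rule H'I)
      show "b - r - p (b - r) = c - w - p (c - w)"
        by (simp add: pdiff cl pb[OF w]) (simp add: w_def pdiff cl)
      have e: "b - r + p (c - w) = b + p c - r"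
        by (simp add: pdiff cl pb[OF w])
      show "(q - l, b - r + p (c - w)) \<in> H" using hlr(1) unfolding h e .
    qed (simp_all add: cl)
    then show "\<exists>x\<in>H'. \<exists>y\<in>(lag2 X \<times> N) \<times> B. z = x + y"
      by (rule bexI[rotated]) (use z w hlr in \<open>intro bexI[of _ "((l, r), w)"], simp_all\<close>)
  qed
  have split: "\<exists>t\<in>B. b = p b + t \<and> c = p c + t" if "((q, b), c) \<in> H'" for q b c
  proof (rule bexI[of _ "b - p b"])
    show "b - p b \<in> B" using pB H'E(1)[OF that] by blast
    have "c = p c + (b - p b)" unfolding H'E(3)[OF that] by simp
    then show "b = p b + (b - p b) \<and> c = p c + (b - p b)" by simp
  qed
  \<comment> \<open>On \<open>a + t\<close> the quadratic function is the class of the pairing,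
    because it vanishes on both lagrangians. Hence \<open>mu\<close> of \<open>b\<close> and of
    \<open>c\<close> add up to \<open>mu\<close> of \<open>b + p c\<close>.\<close>
  have mAB: "mu Q (a + t) = Qcls \<epsilon> (lam Q a t)" if "a \<in> A" "t \<in> B" for a t
    using Q.mu_add[of a t 0 0] that AD(2,5) BD(2,5) by simp
  have m: "mu (form_sum (form_sum (qf X) Q) Q) ((q, b), c) = Qcls \<epsilon> 0" if z: "((q, b), c) \<in> H'" for q b c
  proof -
    note E = H'E[OF z]
    obtain t where t: "t \<in> B" "b = p b + t" "c = p c + t" using split[OF z] by blast
    obtain m where m: "mu (qf X) q = Qcls \<epsilon> m" using X.mu_class[OF E(5)] by blast
    have pbc: "p b \<in> A" "p c \<in> A" "p b + p c \<in> A"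
      using pA E Q.submodule_add[OF AD(1)] by auto
    have "mu Q b = Qcls \<epsilon> (lam Q (p b) t)" "mu Q c = Qcls \<epsilon> (lam Q (p c) t)"
      using mAB[OF pbc(1) t(1)] mAB[OF pbc(2) t(1)] t by simp_all
    moreover have e: "b + p c = (p b + p c) + t" using t(2) by (metis add.assoc add.commute)
    have "mu Q (b + p c) = Qcls \<epsilon> (lam Q (p b) t + lam Q (p c) t)"
      unfolding e using mAB[OF pbc(3) t(1)] pbc AD(5) BD(5)[OF t(1)] by (simp add: Q.lam_add_left)
    then have "Qcls \<epsilon> (m + (lam Q (p b) t + lam Q (p c) t)) = Qcls \<epsilon> 0"
      using Hm[OF E(4)] m by (simp add: Qcls_add)
    ultimately show ?thesis using m by (simp add: Qcls_add add.assoc)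
  qed
  have l: "lam (form_sum (form_sum (qf X) Q) Q) ((q, b), c) ((q', b'), c') = 0"
    if z: "((q, b), c) \<in> H'" "((q', b'), c') \<in> H'" for q b c q' b' c'
  proof -
    note E = H'E[OF z(1)] and E' = H'E[OF z(2)]
    obtain t where t: "t \<in> B" "b = p b + t" "c = p c + t" using split[OF z(1)] by blast
    obtain t' where t': "t' \<in> B" "b' = p b' + t'" "c' = p c' + t'" using split[OF z(2)] by blast
    note cl = Q.closed pQ E E' BD(5)[OF t(1)] BD(5)[OF t'(1)]
    have A0: "lam Q (p x) (p y) = 0" if "x \<in> carrier (fmod Q)" "y \<in> carrier (fmod Q)" for x y
      using AD(3) pA that by blast
    have B0: "lam Q t t' = 0" using BD(3) t t' by blast
    have AB: "lam Q (p x + t) (p y + t') = lam Q (p x) t' + lam Q t (p y)"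
      if "x \<in> carrier (fmod Q)" "y \<in> carrier (fmod Q)" for x y
      using that by (simp add: Q.lam_linear cl A0 B0)
    have "lam Q b b' + lam Q c c' = lam Q (p b) t' + lam Q t (p b') + (lam Q (p c) t' + lam Q t (p c'))"
      using AB[of b b'] AB[of c c'] t t' E E' by simp
    also have "\<dots> = lam Q (p b + t + p c) (p b' + t' + p c')"
      by (simp add: Q.lam_linear cl A0 B0)
    also have "\<dots> = lam Q (b + p c) (b' + p c')"
      using t(2) t'(2) by simp
    finally have "lam (qf X) q q' + (lam Q b b' + lam Q c c') = 0"
      using Hl[OF E(4) E'(4)] cl by simp
    then show ?thesis using cl by (simp add: add.assoc)
  qed
  show ?thesis
    unfolding common_complement_def
  proof (intro exI[of _ H'] conjI ballI)
    fix z assume "z \<in> H'"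
    then show "mu (qf (formation_sum (formation_sum X \<lparr>qf = Q, lag1 = B, lag2 = N\<rparr>)
        \<lparr>qf = Q, lag1 = A, lag2 = B\<rparr>)) z = Qcls \<epsilon> 0"
      using m by (cases z) (metis formation.select_convs(1) formation_sum_simps(1) prod.exhaust)
  next
    fix z w assume "z \<in> H'" "w \<in> H'"
    then show "lam (qf (formation_sum (formation_sum X \<lparr>qf = Q, lag1 = B, lag2 = N\<rparr>)
        \<lparr>qf = Q, lag1 = A, lag2 = B\<rparr>)) z w = 0"
      using l by (cases z; cases w) (metis formation.select_convs(1) formation_sum_simps(1) prod.exhaust)
  qed (use c1 c2 in simp_all)
qed

text \<open>The formation with lagrangians \<open>A\<close> and \<open>B\<close> is trivial since
  they are complementary, so it is absorbed into the stabilising summand; \<open>B\<close> is free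
  as a complement of \<open>A\<close>.\<close>

lemma null_formation_swap1:
  assumes \<epsilon>: "is_sign \<epsilon>" and X: "is_formation \<epsilon> X" and Y: "is_formation \<epsilon> \<lparr>qf = Q, lag1 = A, lag2 = N\<rparr>"
    and B: "lagrangian \<epsilon> Q B" and AB: "complementary (fmod Q) A B"
    and n: "null_formation \<epsilon> (formation_sum X \<lparr>qf = Q, lag1 = A, lag2 = N\<rparr>)"
  shows "is_formation \<epsilon> \<lparr>qf = Q, lag1 = B, lag2 = N\<rparr>"
    "null_formation \<epsilon> (formation_sum X \<lparr>qf = Q, lag1 = B, lag2 = N\<rparr>)"
proof -
  let ?Y = "\<lparr>qf = Q, lag1 = A, lag2 = N\<rparr>" and ?Y' = "\<lparr>qf = Q, lag1 = B, lag2 = N\<rparr>"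
    and ?S = "\<lparr>qf = Q, lag1 = A, lag2 = B\<rparr>"
  note YD = is_formationD[OF Y, simplified]
  have Bf: "fg_free (submod (fmod Q) B)"
    by (rule quadratic.complement_free[OF quadraticI[OF YD(1) \<epsilon>] YD(2,3) AB YD(6)])
  show Y': "is_formation \<epsilon> ?Y'"
    using YD B Bf by (simp add: is_formation_form)
  have S: "trivial_formation \<epsilon> ?S"
    using YD B Bf AB by (simp add: trivial_formation_iff[OF \<epsilon>] is_formation_form)
  obtain T :: "('a, 'a univ) formation" where T: "trivial_formation \<epsilon> T"
    "common_complement \<epsilon> (formation_sum (formation_sum X ?Y) T)"
    using n by (auto simp: null_formation_def)
  note F = is_formation_sum[OF _ _ \<epsilon>] X Y Y' trivial_formation[OF S] trivial_formation[OF T(1)]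
  have "common_complement \<epsilon> (formation_sum (formation_sum X T) ?Y)"
    by (rule common_complement_iso[OF T(2) formation_sum_swap_right]) (simp_all add: F)
  then have "common_complement \<epsilon> (formation_sum (formation_sum (formation_sum X T) ?Y') ?S)"
    by (intro common_complement_swap[OF \<epsilon> _ YD(1) YD(3) B AB]) (simp_all add: F)
  then have "common_complement \<epsilon> (formation_sum (formation_sum (formation_sum X ?Y') T) ?S)"
    by (rule common_complement_iso[OF _ formation_isomorphic_sum[OF formation_sum_swap_right
            formation_isomorphic_refl]]) (simp_all add: F)
  then have cc: "common_complement \<epsilon> (formation_sum (formation_sum X ?Y') (formation_sum T ?S))"
    by (rule common_complement_iso[OF _ formation_sum_assoc]) (simp_all add: F)
  show "null_formation \<epsilon> (formation_sum X ?Y')"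
    by (rule null_formationI[OF \<epsilon> _ trivial_sum[OF T(1) S \<epsilon>] cc]) (simp add: F)
qed

lemma flip_flip: "flip (flip X) = (X :: ('r::ring_involution, 'm::ab_group_add) formation)"
  by (simp add: flip_def)

lemma null_formation_swap2:
  assumes \<epsilon>: "is_sign \<epsilon>" and X: "is_formation \<epsilon> X" and Y: "is_formation \<epsilon> \<lparr>qf = Q, lag1 = N, lag2 = A\<rparr>"
    and B: "lagrangian \<epsilon> Q B" and AB: "complementary (fmod Q) A B"
    and n: "null_formation \<epsilon> (formation_sum X \<lparr>qf = Q, lag1 = N, lag2 = A\<rparr>)"
  shows "is_formation \<epsilon> \<lparr>qf = Q, lag1 = N, lag2 = B\<rparr>"
    "null_formation \<epsilon> (formation_sum X \<lparr>qf = Q, lag1 = N, lag2 = B\<rparr>)"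
proof -
  have Y': "is_formation \<epsilon> \<lparr>qf = Q, lag1 = A, lag2 = N\<rparr>"
    using is_formation_flip[OF Y] by (simp add: flip_def)
  have "null_formation \<epsilon> (formation_sum (flip X) \<lparr>qf = Q, lag1 = A, lag2 = N\<rparr>)"
    using null_formation_flip[OF \<epsilon> n] by (simp add: flip_sum) (simp add: flip_def)
  note S = null_formation_swap1[OF \<epsilon> is_formation_flip[OF X] Y' B AB this]
  show "is_formation \<epsilon> \<lparr>qf = Q, lag1 = N, lag2 = B\<rparr>"
    using is_formation_flip[OF S(1)] by (simp add: flip_def)
  show "null_formation \<epsilon> (formation_sum X \<lparr>qf = Q, lag1 = N, lag2 = B\<rparr>)"
    using null_formation_flip[OF \<epsilon> S(2)] by (simp add: flip_sum flip_flip) (simp add: flip_def)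
qed

text \<open>With its first lagrangian taken twice, the formation has the second lagrangian of
  \<open>T\<close> as a common complement. The move then turns the second copy into that complement.
  The zero formation is the summand on which nothing happens.\<close>

lemma null_formation_trivial:
  assumes \<epsilon>: "is_sign \<epsilon>" and T: "trivial_formation \<epsilon> T"
  shows "null_formation \<epsilon> T"
proof -
  let ?T = "\<lparr>qf = qf T, lag1 = lag1 T, lag2 = lag1 T\<rparr>" and ?Z = "zero_formation \<epsilon>"
  have F: "is_formation \<epsilon> T" and c: "complementary (fmod (qf T)) (lag1 T) (lag2 T)"
    using T by (auto simp: trivial_formation_iff[OF \<epsilon>])
  note FD = is_formationD[OF F] and Z = is_formation_zero[OF \<epsilon>]
  have T': "is_formation \<epsilon> ?T" using FD by (simp add: is_formation_form)
  have "common_complement \<epsilon> ?T"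
    unfolding common_complement_def
    using complementary_sym[OF c] quadratic.lagrangianD(2,3)[OF quadraticI[OF FD(1) \<epsilon>] FD(4)]
    by (intro exI[of _ "lag2 T"]) simp
  then have "common_complement \<epsilon> (formation_sum ?Z ?T)"
    using common_complement_sum[OF common_complement_zero[OF \<epsilon>] Z _ T'] by blast
  then have "null_formation \<epsilon> (formation_sum ?Z ?T)"
    by (intro null_formation_cc[OF \<epsilon>]) (simp_all add: is_formation_sum \<epsilon> Z T')
  from null_formation_swap2(2)[OF \<epsilon> Z T' FD(4) c this]
  have n: "null_formation \<epsilon> (formation_sum ?Z T)" by (cases T) simp
  have "null_formation \<epsilon> (formation_sum T ?Z)"
    by (rule null_formation_iso[OF \<epsilon> n formation_sum_commute])
      (simp_all add: is_formation_sum \<epsilon> Z F)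
  then show ?thesis by (rule null_formation_cancel_trivial[OF \<epsilon> F trivial_zero[OF \<epsilon>]])
qed

lemma null_formation_sum_trivial_iff:
  assumes \<epsilon>: "is_sign \<epsilon>" and X: "is_formation \<epsilon> X" and T: "trivial_formation \<epsilon> T"
  shows "null_formation \<epsilon> (formation_sum X T) \<longleftrightarrow> null_formation \<epsilon> X"
  using null_formation_cancel_trivial[OF assms]
    null_formation_sum[OF \<epsilon> X _ trivial_formation[OF T] null_formation_trivial[OF \<epsilon> T]] by blast

section \<open>The diagonal and cancellation of null summands\<close>

lemma null_formation_diagonal:
  assumes \<epsilon>: "is_sign \<epsilon>" and X: "is_formation \<epsilon> X"
  shows "null_formation \<epsilon> (formation_sum X (formation_neg X))"
proof -
  let ?Q = "qf X"
  note XD = is_formationD[OF X]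
  interpret quadratic \<epsilon> ?Q using X \<epsilon> formation_quadratic by blast
  have mQQ: "left_module (fmod ?Q \<boxplus> fmod ?Q)" by (rule left_module_dsum[OF module module])
  obtain A where A: "lagrangian \<epsilon> ?Q A" "complementary (fmod ?Q) (lag1 X) A"
    using complementary_lagrangian[OF XD(2,3,6)] .
  obtain B where B: "lagrangian \<epsilon> ?Q B" "complementary (fmod ?Q) (lag2 X) B"
    using complementary_lagrangian[OF XD(2,4,7)] .
  have free: "fg_free (submod (fmod ?Q) A)" "fg_free (submod (fmod ?Q) B)"
    using complement_free[OF XD(2,3) A(2) XD(6)] complement_free[OF XD(2,4) B(2) XD(7)] by auto
  let ?D = "(\<lambda>x. (x, x)) ` carrier (fmod ?Q)"
  have D: "is_submodule (fmod ?Q \<boxplus> fmod ?Q) ?D"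
    unfolding is_submodule_iff[OF mQQ] by (auto simp: closed zero_prod_def)
  have c: "complementary (fmod ?Q \<boxplus> fmod ?Q) ?D (P \<times> R)" if PR: "complementary (fmod ?Q) P R" for P R
  proof (rule complementaryI[OF mQQ D])
    note C = complementaryD[OF PR]
    show "is_submodule (fmod ?Q \<boxplus> fmod ?Q) (P \<times> R)"
      by (rule submodule_dsum[OF module module C(1,2)])
    show "x = 0" if "x \<in> ?D" "x \<in> P \<times> R" for x
      using that C(3) by (auto simp: zero_prod_def)
    fix z assume "z \<in> carrier (fmod ?Q \<boxplus> fmod ?Q)"
    then obtain x y where z: "z = (x, y)" "x \<in> carrier (fmod ?Q)" "y \<in> carrier (fmod ?Q)" by auto
    \<comment> \<open>Decomposing \<open>x - y\<close> along \<open>P\<close> and \<open>R\<close>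
      makes \<open>x - p\<close> equal to \<open>y + r\<close>; this common value is the diagonal
      component of \<open>(x, y)\<close>.\<close>
    obtain p r where pr: "p \<in> P" "r \<in> R" "x - y = p + r" using C(4)[OF diff_closed[OF z(2,3)]] by blast
    have "p \<in> carrier (fmod ?Q)" using pr(1) C(1) submodule_subset by blast
    then have "(x - p, x - p) \<in> ?D" using diff_closed[OF z(2)] by blast
    moreover have "z = (x - p, x - p) + (p, - r)"
      using pr(3) z by (simp add: algebra_simps)
    moreover have "(p, - r) \<in> P \<times> R" using pr submodule_minus[OF C(2)] by simp
    ultimately show "\<exists>a\<in>?D. \<exists>b\<in>P \<times> R. z = a + b" by blast
  qed
  let ?N = "form_neg ?Q"
  have N: "quadratic_form \<epsilon> ?N" "nonsingular ?N" "lagrangian \<epsilon> ?N (lag1 X)" "lagrangian \<epsilon> ?N (lag2 X)"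
    "lagrangian \<epsilon> ?N A" "lagrangian \<epsilon> ?N B"
    using XD A B by (auto simp: quadratic_form_neg nonsingular_neg lagrangian_neg \<epsilon>)
  let ?Y = "\<lambda>L M. \<lparr>qf = ?N, lag1 = L, lag2 = M\<rparr>"
  have YAB: "is_formation \<epsilon> (?Y A B)"
    using N free by (simp add: is_formation_form)
  have "mu (form_sum ?Q ?N) (x, x) = Qcls \<epsilon> 0" if x: "x \<in> carrier (fmod ?Q)" for x
  proof -
    obtain a where "mu ?Q x = Qcls \<epsilon> a" using mu_class[OF x] by blast
    then show ?thesis by (simp add: Qcls_uminus Qcls_add)
  qed
  then have "common_complement \<epsilon> (formation_sum X (?Y A B))"
    unfolding common_complement_def using c[OF A(2)] c[OF B(2)]
    by (intro exI[of _ ?D]) auto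
  then have "null_formation \<epsilon> (formation_sum X (?Y A B))"
    by (intro null_formation_cc[OF \<epsilon>]) (simp_all add: is_formation_sum \<epsilon> X YAB)
  note S1 = null_formation_swap1[OF \<epsilon> X YAB N(3) _ this]
  have "complementary (fmod ?N) A (lag1 X)" "complementary (fmod ?N) B (lag2 X)"
    using A B by (simp_all add: complementary_sym)
  from null_formation_swap2(2)[OF \<epsilon> X S1(1)[OF this(1)] N(4) this(2) S1(2)[OF this(1)]]
  show ?thesis by (cases X) (simp add: formation_neg_def)
qed

lemma null_formation_cancel:
  assumes \<epsilon>: "is_sign \<epsilon>" and X: "is_formation \<epsilon> X" and Y: "is_formation \<epsilon> Y"
    and n: "null_formation \<epsilon> (formation_sum X Y)" and nY: "null_formation \<epsilon> Y"
  shows "null_formation \<epsilon> X"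
proof -
  obtain T :: "('a, 'a univ) formation" where T: "trivial_formation \<epsilon> T" "common_complement \<epsilon> (formation_sum Y T)"
    using nY by (auto simp: null_formation_def)
  let ?Z = "formation_sum Y T"
  have Z: "is_formation \<epsilon> ?Z" by (simp add: is_formation_sum \<epsilon> Y trivial_formation[OF T(1)])
  note F = is_formation_sum[OF _ _ \<epsilon>] X Y Z trivial_formation[OF T(1)]
  note ZD = is_formationD[OF Z]
  have "null_formation \<epsilon> (formation_sum (formation_sum X Y) T)"
    using null_formation_sum_trivial_iff[OF \<epsilon> _ T(1), of "formation_sum X Y"] n by (simp add: F)
  then have n1: "null_formation \<epsilon> (formation_sum X ?Z)"
    by (rule null_formation_iso[OF \<epsilon> _ formation_sum_assoc]) (simp_all add: F)
  obtain H where H: "complementary (fmod (qf ?Z)) H (lag1 ?Z)" "complementary (fmod (qf ?Z)) H (lag2 ?Z)"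
    and Hm: "\<forall>x\<in>H. mu (qf ?Z) x = Qcls \<epsilon> 0" and Hl: "\<forall>x\<in>H. \<forall>y\<in>H. lam (qf ?Z) x y = 0"
    using T(2) unfolding common_complement_def by blast
  interpret Z: quadratic \<epsilon> "qf ?Z" using Z \<epsilon> formation_quadratic by blast
  have HL: "lagrangian \<epsilon> (qf ?Z) H"
    by (rule lagrangianI[OF ZD(1) \<epsilon> ZD(2) H(1) Z.lagrangianD(3)[OF ZD(3)]]) (use Hm Hl in blast)+
  have Z': "\<lparr>qf = qf ?Z, lag1 = lag1 ?Z, lag2 = lag2 ?Z\<rparr> = ?Z" by simp
  note S = null_formation_swap2[OF \<epsilon> X _ HL complementary_sym[OF H(2)], of "lag1 ?Z", unfolded Z', OF Z n1]
  have "trivial_formation \<epsilon> \<lparr>qf = qf ?Z, lag1 = lag1 ?Z, lag2 = H\<rparr>"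
    unfolding trivial_formation_iff[OF \<epsilon>] using S(1) complementary_sym[OF H(1)] by simp
  from null_formation_cancel_trivial[OF \<epsilon> X this S(2)] show ?thesis .
qed

section \<open>Boundaries\<close>

text \<open>The dual module is a complement both of the first lagrangian and of the graph. The graph
  is isotropic for the bilinear form because \<open>lam K\<close> is
  \<open>- \<epsilon>\<close>-symmetric, and for the quadratic function because
  \<open>lam K x x\<close> has the form \<open>a - \<epsilon> * bar a\<close>, which is where
  \<open>mu K\<close> enters.\<close>

lemma is_formation_boundary:
  assumes \<epsilon>: "is_sign \<epsilon>" and K: "quadratic_form (- \<epsilon>) K"
  shows "is_formation \<epsilon> (boundary \<epsilon> K)" "common_complement \<epsilon> (boundary \<epsilon> K)"
proof -
  interpret quadratic "- \<epsilon>" K using K \<epsilon> quadraticI is_sign_minus by blast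
  let ?M = "fmod K" and ?Q = "hyperbolic \<epsilon> (fmod K)"
  let ?G = "{(x, lam K x) | x. x \<in> carrier ?M}" and ?H = "{0} \<times> carrier (dual ?M)"
  note Q = quadratic_form_hyperbolic[OF free \<epsilon>] nonsingular_hyperbolic[OF free \<epsilon>]
    and L = hyperbolic_lagrangians[OF free \<epsilon>]
  interpret D: left_module "dual ?M" by (rule left_module_dual[OF module])
  have mM: "left_module (?M \<boxplus> dual ?M)" by (rule left_module_dsum[OF module D.left_module_axioms])
  have lD: "lam K x \<in> carrier (dual ?M)" if "x \<in> carrier ?M" for x
    using hom_closed[OF lam_hom that] .
  have c: "complementary (?M \<boxplus> dual ?M) ?H ?G"
  proof (rule complementaryI[OF mM])
    show "is_submodule (?M \<boxplus> dual ?M) ?H"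
      by (rule submodule_dsum[OF module D.left_module_axioms submodule_trivial(1)[OF module]
            submodule_trivial(2)[OF D.left_module_axioms]])
    show "is_submodule (?M \<boxplus> dual ?M) ?G"
      unfolding is_submodule_iff[OF mM]
      using hom_add[OF lam_hom] hom_scale[OF lam_hom] hom_zero[OF module lam_hom]
      by (auto simp: lD closed zero_prod_def fun_eq_iff)
    show "x = 0" if "x \<in> ?H" "x \<in> ?G" for x
      using that hom_zero[OF module lam_hom] by (auto simp: zero_prod_def)
    fix z assume "z \<in> carrier (?M \<boxplus> dual ?M)"
    then obtain x f where z: "z = (x, f)" "x \<in> carrier ?M" "f \<in> carrier (dual ?M)" by auto
    then have "z = (0, f - lam K x) + (x, lam K x)" "f - lam K x \<in> carrier (dual ?M)"
      using D.diff_closed lD by auto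
    then show "\<exists>a\<in>?H. \<exists>b\<in>?G. z = a + b" using z by blast
  qed
  have c': "complementary (fmod ?Q) ?G ?H" using complementary_sym[OF c] by simp
  interpret Q: quadratic \<epsilon> ?Q using Q \<epsilon> quadraticI by blast
  note HD = Q.lagrangianD[OF L(2)]
  have GL: "lagrangian \<epsilon> ?Q ?G"
  proof (rule lagrangianI[OF Q(1) \<epsilon> Q(2) c' HD(3)])
    fix z assume "z \<in> ?G"
    then obtain x where x: "z = (x, lam K x)" "x \<in> carrier ?M" by auto
    obtain a where "mu K x = Qcls (- \<epsilon>) a" using mu_class x by blast
    from mu_lam[OF x(2) this] have "lam K x x - 0 = a - \<epsilon> * bar a" by simp
    then show "mu ?Q z = Qcls \<epsilon> 0" using x Qcls_eq_iff[of \<epsilon> "lam K x x" 0] by auto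
  next
    fix z w assume "z \<in> ?G" "w \<in> ?G"
    then obtain x y where xy: "z = (x, lam K x)" "w = (y, lam K y)" "x \<in> carrier ?M" "y \<in> carrier ?M"
      by auto
    then show "lam ?Q z w = 0" using lam_sym[OF xy(3,4)] lD by simp
  qed
  have "fg_free (submod (fmod ?Q) ?G)"
    using Q.complement_free[OF Q(2) L(2) complementary_sym[OF c']] L(4) by simp
  with GL L Q show "is_formation \<epsilon> (boundary \<epsilon> K)"
    unfolding boundary_def is_formation_form by simp
  show "common_complement \<epsilon> (boundary \<epsilon> K)"
    unfolding common_complement_def boundary_def
    using c complementary_sym[OF hyperbolic_complementary[OF module]] HD(2,3)
    by (intro exI[of _ ?H]) simp
qed

text \<open>In hyperbolic coordinates \<open>H\<close> is the dual of the first lagrangian, and a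
  complement of \<open>H\<close> is a graph. That the bilinear form and the quadratic function
  vanish on the graph says that its map is \<open>- \<epsilon>\<close>-symmetric and even;
  \<open>even_splitting\<close> then supplies the quadratic function of \<open>K\<close>.\<close>

lemma common_complement_boundary:
  fixes X :: "('r::ring_involution, 'm::ab_group_add) formation"
  assumes \<epsilon>: "is_sign \<epsilon>" and X: "is_formation \<epsilon> X" and cc: "common_complement \<epsilon> X"
  obtains K :: "('r, 'r univ) qform" where "quadratic_form (- \<epsilon>) K" "formation_isomorphic X (boundary \<epsilon> K)"
proof -
  note XD = is_formationD[OF X]
  let ?Q = "qf X" and ?M = "fmod (qf X)"
  interpret quadratic \<epsilon> ?Q using X \<epsilon> formation_quadratic by blast
  obtain H where H: "complementary ?M H (lag1 X)" "complementary ?M H (lag2 X)"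
    and Hm: "\<forall>x\<in>H. mu ?Q x = Qcls \<epsilon> 0" and Hl: "\<forall>x\<in>H. \<forall>y\<in>H. lam ?Q x y = 0"
    using cc unfolding common_complement_def by blast
  note FD = lagrangianD[OF XD(3)] and GD = lagrangianD[OF XD(4)]
  have HL: "lagrangian \<epsilon> ?Q H"
    by (rule lagrangianI[OF XD(1) \<epsilon> XD(2) H(1) FD(3)]) (use Hm Hl in blast)+
  note HD = lagrangianD[OF HL]
  obtain k u where u: "is_iso (std_module k :: ('r, 'r univ) lmodule) (submod ?M (lag1 X)) u"
    and Nf: "fg_free (std_module k :: ('r, 'r univ) lmodule)"
    using iso_std_module[OF XD(6)] .
  let ?N = "std_module k :: ('r, 'r univ) lmodule"
  have N: "left_module ?N" by (rule left_module_std)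
  interpret N: left_module ?N by fact
  note uh = iso_hom[OF u]
  have uF: "u x \<in> lag1 X" if "x \<in> carrier ?N" for x using hom_closed[OF uh that] by simp
  have uM: "u x \<in> carrier ?M" if "x \<in> carrier ?N" for x using uF[OF that] FD(5) by blast
  obtain p where p: "is_hom ?M (submod ?M H) p" and pG: "\<And>x. x \<in> carrier ?M \<Longrightarrow> x - p x \<in> lag2 X"
    and pl: "\<And>a b. a \<in> H \<Longrightarrow> b \<in> lag2 X \<Longrightarrow> p (a + b) = a"
    by (rule complementary_projection[OF H(2)]) blast
  have pH: "p x \<in> H" if "x \<in> carrier ?M" for x using hom_closed[OF p that] by simp
  have pM: "p x \<in> carrier ?M" if "x \<in> carrier ?M" for x using pH[OF that] HD(5) by blast
  \<comment> \<open>The element of \<open>H\<close> that brings \<open>u x\<close> into the second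
    lagrangian. The sums \<open>u x + h x\<close> make up that lagrangian, and pairing
    \<open>h x\<close> with the first lagrangian defines \<open>lam K\<close>.\<close>
  define h where "h x = - p (u x)" for x
  have hH: "h x \<in> H" if "x \<in> carrier ?N" for x
    unfolding h_def by (rule submodule_minus[OF HD(1) pH[OF uM[OF that]]])
  have hM: "h x \<in> carrier ?M" if "x \<in> carrier ?N" for x using hH[OF that] HD(5) by blast
  have g: "u x + h x \<in> lag2 X" if "x \<in> carrier ?N" for x using pG[OF uM[OF that]] by (simp add: h_def)
  have hom: "is_hom ?N ?M h"
    by (rule is_homI)
      (use hM in \<open>simp_all add: h_def hom_add[OF uh] hom_scale[OF uh] hom_add[OF p] hom_scale[OF p] uM pM scale_minus_right\<close>)
  let ?l = "\<lambda>x y. lam ?Q (h x) (u y)"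
  have l: "sesquilinear ?N ?l"
    unfolding sesquilinear_def
  proof (intro conjI ballI allI)
    fix x y z assume "x \<in> carrier ?N" "y \<in> carrier ?N" "z \<in> carrier ?N"
    then show "?l (x + y) z = ?l x z + ?l y z" "?l z (x + y) = ?l z x + ?l z y"
      by (simp_all only: hom_add[OF hom] hom_add[OF uh] lam_add_left lam_add_right hM uM)
  next
    fix a x y assume "x \<in> carrier ?N" "y \<in> carrier ?N"
    then show "?l (scale ?N a x) y = ?l x y * bar a" "?l x (scale ?N a y) = a * ?l x y"
      by (simp_all only: hom_scale[OF hom] hom_scale[OF uh, unfolded scale_submod] lam_scale_left lam_scale_right hM uM)
  qed
  have sym: "?l x y = - \<epsilon> * bar (?l y x)" if x: "x \<in> carrier ?N" and y: "y \<in> carrier ?N" for x y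
  proof -
    have "0 = lam ?Q (u x + h x) (u y + h y)"
      using GD(3)[OF g[OF x] g[OF y]] by simp
    also have "\<dots> = lam ?Q (u x) (h y) + ?l x y"
      using FD(3)[OF uF[OF x] uF[OF y]] HD(3)[OF hH[OF x] hH[OF y]] uM hM x y
      by (simp add: lam_add_left lam_add_right closed)
    also have "lam ?Q (u x) (h y) = \<epsilon> * bar (?l y x)"
      by (rule lam_sym[OF uM[OF x] hM[OF y]])
    finally show ?thesis by (simp add: eq_neg_iff_add_eq_0 add.commute)
  qed
  \<comment> \<open>The quadratic function vanishes on \<open>u x\<close>, on \<open>h x\<close> and
    on their sum, so their pairing is zero in the quotient.\<close>
  have even: "\<exists>a. ?l x x = a + - \<epsilon> * bar a" if x: "x \<in> carrier ?N" for x
  proof -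
    have "mu ?Q (h x + u x) = Qcls \<epsilon> (0 + 0 + ?l x x)"
      by (rule mu_add[OF hM[OF x] uM[OF x] HD(2)[OF hH[OF x]] FD(2)[OF uF[OF x]]])
    moreover have "mu ?Q (h x + u x) = Qcls \<epsilon> 0"
      using GD(2)[OF g[OF x]] by (simp only: add.commute)
    ultimately have "Qcls \<epsilon> (?l x x) = Qcls \<epsilon> 0" by simp
    then show ?thesis by (auto simp: Qcls_eq_iff)
  qed
  obtain \<chi> where \<chi>: "sesquilinear ?N \<chi>"
    "\<And>x y. x \<in> carrier ?N \<Longrightarrow> y \<in> carrier ?N \<Longrightarrow> ?l x y = \<chi> x y + - \<epsilon> * bar (\<chi> y x)"
    by (rule even_splitting[OF Nf l is_sign_minus[OF \<epsilon>] sym even]) blast+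
  define K where "K = \<lparr>fmod = ?N, lam = (\<lambda>x. zero_outside (carrier ?N) (?l x)), mu = (\<lambda>x. Qcls (- \<epsilon>) (\<chi> x x))\<rparr>"
  have K: "fmod K = ?N" "lam K x = zero_outside (carrier ?N) (?l x)" for x
    by (simp_all add: K_def)
  have KQ: "quadratic_form (- \<epsilon>) K"
    by (rule quadratic_formI[where \<chi> = \<chi>])
      (use Nf sesquilinear_hom_dual[OF N l] is_sign_minus[OF \<epsilon>] \<chi> in \<open>simp_all add: K_def\<close>)
  obtain \<Phi> where \<Phi>: "form_iso ?Q (hyperbolic \<epsilon> ?N) \<Phi>" "\<Phi> ` lag1 X = carrier ?N \<times> {0}"
    "\<And>x h. x \<in> carrier ?N \<Longrightarrow> h \<in> H \<Longrightarrow>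
       \<Phi> (u x + h) = (x, zero_outside (carrier ?N) (\<lambda>y. lam ?Q h (u y)))"
    by (rule hyperbolic_coordinates[OF XD(1,2) \<epsilon> XD(3) HL complementary_sym[OF H(1)] N u]) blast
  have \<Phi>g: "\<Phi> (u x + h x) = (x, lam K x)" if "x \<in> carrier ?N" for x
    using \<Phi>(3)[OF that hH[OF that]] by (simp only: K)
  have "\<Phi> ` lag2 X = {(x, lam K x) | x. x \<in> carrier ?N}"
  proof (intro equalityI subsetI)
    fix z assume "z \<in> \<Phi> ` lag2 X"
    then obtain y where y: "y \<in> lag2 X" "z = \<Phi> y" by blast
    obtain e f where hf: "e \<in> H" "f \<in> lag1 X" "y = e + f"
      using complementaryD(4)[OF H(1) GD(5)[OF y(1)]] by blast
    obtain x where x: "x \<in> carrier ?N" "u x = f" using iso_surj[OF u] hf(2) by auto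
    have "f = (- e) + y" using hf(3) by simp
    then have "p f = - e" using pl[OF submodule_minus[OF HD(1) hf(1)] y(1)] by simp
    then have "y = u x + h x" using x hf(3) by (simp add: h_def)
    then show "z \<in> {(x, lam K x) | x. x \<in> carrier ?N}" using \<Phi>g[OF x(1)] x(1) y(2) by auto
  next
    fix z assume "z \<in> {(x, lam K x) | x. x \<in> carrier ?N}"
    then obtain x where x: "x \<in> carrier ?N" "z = (x, lam K x)" by blast
    show "z \<in> \<Phi> ` lag2 X"
      by (rule image_eqI[OF _ g[OF x(1)]]) (simp only: x(2) \<Phi>g[OF x(1)])
  qed
  then have "formation_isomorphic X (boundary \<epsilon> K)"
    unfolding formation_isomorphic_def boundary_def using \<Phi>(1,2) by (intro exI[of _ \<Phi>]) (simp add: K(1))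
  with KQ show ?thesis by (rule that)
qed

lemma formation_sum_zero:
  assumes \<epsilon>: "is_sign \<epsilon>" and X: "is_formation \<epsilon> X"
  shows "formation_isomorphic X (formation_sum X (zero_formation \<epsilon>))"
proof -
  interpret quadratic \<epsilon> "qf X" using X \<epsilon> formation_quadratic by blast
  have Z: "fmod (qf (zero_formation \<epsilon>)) = zero_module" "lam (qf (zero_formation \<epsilon>)) = (\<lambda>x y. 0)"
    "mu (qf (zero_formation \<epsilon>)) = (\<lambda>x. Qcls \<epsilon> 0)"
    "lag1 (zero_formation \<epsilon>) = {0}" "lag2 (zero_formation \<epsilon>) = {0}"
    by (simp_all add: zero_formation_def)
  have "form_iso (qf X) (form_sum (qf X) (qf (zero_formation \<epsilon>))) (\<lambda>x. (x, 0))"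
    unfolding form_iso_def
  proof (intro conjI ballI)
    show "is_iso (fmod (qf X)) (fmod (form_sum (qf X) (qf (zero_formation \<epsilon>)))) (\<lambda>x. (x, 0))"
      by (auto simp: Z is_iso_def is_hom_def bij_betw_def inj_on_def)
  next
    fix x assume "x \<in> carrier (fmod (qf X))"
    then obtain a where "mu (qf X) x = Qcls \<epsilon> a" using mu_class by blast
    then show "mu (form_sum (qf X) (qf (zero_formation \<epsilon>))) (x, 0) = mu (qf X) x"
      by (simp add: Z Qcls_add)
  qed (simp add: Z)
  then show ?thesis
    unfolding formation_isomorphic_def by (intro exI[of _ "\<lambda>x. (x, 0)"]) (auto simp: Z)
qed

text \<open>A boundary has a common complement, and nullity is unaffected by trivial summands.
  Conversely the stabilised formation is itself isomorphic to a boundary; the zero formation serves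
  as the trivial summand on the other side.\<close>

lemma stably_boundary_iff_null:
  fixes X :: "('r::ring_involution, 'm::ab_group_add) formation"
  assumes \<epsilon>: "is_sign \<epsilon>" and X: "is_formation \<epsilon> X"
  shows "(\<exists>K :: ('r, 'r univ) qform. quadratic_form (- \<epsilon>) K \<and> stably_isomorphic \<epsilon> X (boundary \<epsilon> K))
    \<longleftrightarrow> null_formation \<epsilon> X"
proof
  assume "\<exists>K :: ('r, 'r univ) qform. quadratic_form (- \<epsilon>) K \<and> stably_isomorphic \<epsilon> X (boundary \<epsilon> K)"
  then obtain K :: "('r, 'r univ) qform" and T T' :: "('r, 'r univ) formation" where
    K: "quadratic_form (- \<epsilon>) K" and T: "trivial_formation \<epsilon> T" "trivial_formation \<epsilon> T'"
    and i: "formation_isomorphic (formation_sum X T) (formation_sum (boundary \<epsilon> K) T')"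
    by (auto simp: stably_isomorphic_def)
  note B = is_formation_boundary[OF \<epsilon> K]
  note F = is_formation_sum[OF _ _ \<epsilon>] X B(1) trivial_formation[OF T(1)] trivial_formation[OF T(2)]
  have n: "null_formation \<epsilon> (formation_sum (boundary \<epsilon> K) T')"
    by (rule null_formation_sum[OF \<epsilon> B(1) null_formation_cc[OF \<epsilon> B] trivial_formation[OF T(2)]
          null_formation_trivial[OF \<epsilon> T(2)]])
  have "formation_isomorphic (formation_sum (boundary \<epsilon> K) T') (formation_sum X T)"
    by (rule is_formation_isomorphic_sym[OF i, of \<epsilon>]) (simp add: F)
  from null_formation_iso[OF \<epsilon> n this] have "null_formation \<epsilon> (formation_sum X T)"
    by (simp add: F)
  then show "null_formation \<epsilon> X" by (rule null_formation_cancel_trivial[OF \<epsilon> X T(1)])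
next
  assume "null_formation \<epsilon> X"
  then obtain T :: "('r, 'r univ) formation" where T: "trivial_formation \<epsilon> T" "common_complement \<epsilon> (formation_sum X T)"
    by (auto simp: null_formation_def)
  have F: "is_formation \<epsilon> (formation_sum X T)"
    by (rule is_formation_sum[OF X trivial_formation[OF T(1)] \<epsilon>])
  obtain K :: "('r, 'r univ) qform" where K: "quadratic_form (- \<epsilon>) K"
    "formation_isomorphic (formation_sum X T) (boundary \<epsilon> K)"
    using common_complement_boundary[OF \<epsilon> F T(2)] .
  have "formation_isomorphic (formation_sum X T) (formation_sum (boundary \<epsilon> K) (zero_formation \<epsilon>))"
    by (rule formation_isomorphic_trans[OF K(2) formation_sum_zero[OF \<epsilon> is_formation_boundary(1)[OF \<epsilon> K(1)]]])
  then show "\<exists>K :: ('r, 'r univ) qform. quadratic_form (- \<epsilon>) K \<and> stably_isomorphic \<epsilon> X (boundary \<epsilon> K)"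
    unfolding stably_isomorphic_def using K(1) T(1) trivial_zero[OF \<epsilon>] by blast
qed

section \<open>The group of formations\<close>

lemma formation_equiv_iff_null:
  assumes "is_sign \<epsilon>" "is_formation \<epsilon> X" "is_formation \<epsilon> Y"
  shows "formation_equiv \<epsilon> X Y \<longleftrightarrow> null_formation \<epsilon> (formation_sum X (formation_neg Y))"
  unfolding formation_equiv_def
  by (rule stably_boundary_iff_null) (simp_all add: assms is_formation_sum is_formation_neg)

lemma formation_equiv_refl: "is_sign \<epsilon> \<Longrightarrow> is_formation \<epsilon> X \<Longrightarrow> formation_equiv \<epsilon> X X"
  by (simp add: formation_equiv_iff_null null_formation_diagonal)

lemma formation_equiv_sym:
  assumes \<epsilon>: "is_sign \<epsilon>" and X: "is_formation \<epsilon> X" and Y: "is_formation \<epsilon> Y"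
    and e: "formation_equiv \<epsilon> X Y"
  shows "formation_equiv \<epsilon> Y X"
proof -
  note F = is_formation_sum[OF _ _ \<epsilon>] is_formation_neg[OF _ \<epsilon>] X Y
  have n: "null_formation \<epsilon> (formation_neg (formation_sum X (formation_neg Y)))"
    using e by (intro null_formation_neg[OF \<epsilon>]) (simp_all add: formation_equiv_iff_null[OF \<epsilon> X Y] F)
  have "formation_isomorphic (formation_neg (formation_sum X (formation_neg Y)))
      (formation_sum Y (formation_neg X))"
    by (rule formation_isomorphic_trans[OF formation_isomorphic_trans[OF formation_neg_sum
            formation_isomorphic_sum[OF formation_isomorphic_refl formation_neg_neg[OF Y]]]
          formation_sum_commute])
  from null_formation_iso[OF \<epsilon> n this] show ?thesis
    by (simp add: formation_equiv_iff_null[OF \<epsilon> Y X] F)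
qed

text \<open>\<open>X - Y + Y - Z\<close> is rearranged into the sum of \<open>X - Z\<close> and the
  null formation \<open>Y - Y\<close>, which is then cancelled.\<close>

lemma formation_equiv_trans:
  assumes \<epsilon>: "is_sign \<epsilon>" and X: "is_formation \<epsilon> X" and Y: "is_formation \<epsilon> Y" and Z: "is_formation \<epsilon> Z"
    and XY: "formation_equiv \<epsilon> X Y" and YZ: "formation_equiv \<epsilon> Y Z"
  shows "formation_equiv \<epsilon> X Z"
proof -
  note F = is_formation_sum[OF _ _ \<epsilon>] is_formation_neg[OF _ \<epsilon>] X Y Z
  let ?A = "formation_sum (formation_sum X (formation_neg Y)) (formation_sum Y (formation_neg Z))"
  have n: "null_formation \<epsilon> ?A"
    by (rule null_formation_sum[OF \<epsilon>])
      (use XY YZ in \<open>simp_all add: formation_equiv_iff_null[OF \<epsilon> X Y] formation_equiv_iff_null[OF \<epsilon> Y Z] F\<close>)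
  have i: "formation_isomorphic ?A
      (formation_sum (formation_sum X (formation_neg Z)) (formation_sum Y (formation_neg Y)))"
    by (rule formation_isomorphic_trans[OF formation_isomorphic_trans[OF
            formation_isomorphic_sum[OF formation_isomorphic_refl formation_sum_commute]
            formation_sum_interchange]
          formation_isomorphic_sum[OF formation_isomorphic_refl formation_sum_commute]])
  have "null_formation \<epsilon>
      (formation_sum (formation_sum X (formation_neg Z)) (formation_sum Y (formation_neg Y)))"
    by (rule null_formation_iso[OF \<epsilon> n i]) (simp_all add: F)
  then have "null_formation \<epsilon> (formation_sum X (formation_neg Z))"
    by (rule null_formation_cancel[OF \<epsilon>, rotated 2])
      (simp_all add: F null_formation_diagonal[OF \<epsilon> Y])
  then show ?thesis by (simp add: formation_equiv_iff_null[OF \<epsilon> X Z])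
qed

lemma formation_equiv_iso:
  assumes \<epsilon>: "is_sign \<epsilon>" and X: "is_formation \<epsilon> X" and Y: "is_formation \<epsilon> Y"
    and i: "formation_isomorphic X Y"
  shows "formation_equiv \<epsilon> X Y"
proof -
  note F = is_formation_sum[OF _ _ \<epsilon>] is_formation_neg[OF _ \<epsilon>] X Y
  have "null_formation \<epsilon> (formation_sum X (formation_neg Y))"
    by (rule null_formation_iso[OF \<epsilon> null_formation_diagonal[OF \<epsilon> X]
          formation_isomorphic_sum[OF formation_isomorphic_refl formation_isomorphic_neg[OF i]]])
      (simp_all add: F)
  then show ?thesis by (simp add: formation_equiv_iff_null[OF \<epsilon> X Y])
qed

lemma formation_equiv_sum:
  assumes \<epsilon>: "is_sign \<epsilon>" and X: "is_formation \<epsilon> X" "is_formation \<epsilon> X'" "formation_equiv \<epsilon> X X'"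
    and Y: "is_formation \<epsilon> Y" "is_formation \<epsilon> Y'" "formation_equiv \<epsilon> Y Y'"
  shows "formation_equiv \<epsilon> (formation_sum X Y) (formation_sum X' Y')"
proof -
  note F = is_formation_sum[OF _ _ \<epsilon>] is_formation_neg[OF _ \<epsilon>] X(1,2) Y(1,2)
  let ?A = "formation_sum (formation_sum X (formation_neg X')) (formation_sum Y (formation_neg Y'))"
  have n: "null_formation \<epsilon> ?A"
    by (rule null_formation_sum[OF \<epsilon>])
      (use X(3) Y(3) in \<open>simp_all add: formation_equiv_iff_null[OF \<epsilon>] F\<close>)
  have 1: "formation_isomorphic (formation_sum (formation_neg X') (formation_neg Y')) (formation_neg (formation_sum X' Y'))"
    by (rule is_formation_isomorphic_sym[OF formation_neg_sum, of \<epsilon>]) (simp add: F)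
  have i: "formation_isomorphic ?A (formation_sum (formation_sum X Y) (formation_neg (formation_sum X' Y')))"
    by (rule formation_isomorphic_trans[OF formation_sum_interchange
          formation_isomorphic_sum[OF formation_isomorphic_refl 1]])
  have "null_formation \<epsilon> (formation_sum (formation_sum X Y) (formation_neg (formation_sum X' Y')))"
    by (rule null_formation_iso[OF \<epsilon> n i]) (simp_all add: F)
  then show ?thesis by (simp add: formation_equiv_iff_null[OF \<epsilon>] F)
qed

lemma formation_equiv_zero:
  assumes \<epsilon>: "is_sign \<epsilon>" and X: "is_formation \<epsilon> X" "null_formation \<epsilon> X"
  shows "formation_equiv \<epsilon> X (zero_formation \<epsilon>)"
  using null_formation_sum[OF \<epsilon> X is_formation_neg[OF is_formation_zero[OF \<epsilon>] \<epsilon>]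
      null_formation_trivial[OF \<epsilon> trivial_neg[OF \<epsilon> trivial_zero[OF \<epsilon>]]]]
  by (simp add: formation_equiv_iff_null[OF \<epsilon> X(1) is_formation_zero[OF \<epsilon>]])

lemma equiv_formation_rel:
  assumes \<epsilon>: "is_sign \<epsilon>"
  shows "equiv (Collect (is_formation \<epsilon>)) (formation_rel \<epsilon>)"
proof (rule equivI)
  show "refl_on (Collect (is_formation \<epsilon>)) (formation_rel \<epsilon>)"
    by (auto simp: refl_on_def formation_rel_def formation_equiv_refl \<epsilon>)
  show "sym (formation_rel \<epsilon>)"
    by (auto simp: sym_def formation_rel_def intro: formation_equiv_sym[OF \<epsilon>])
  show "trans (formation_rel \<epsilon>)"
    by (auto simp: trans_def formation_rel_def intro: formation_equiv_trans[OF \<epsilon>])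
qed (auto simp: formation_rel_def)

text \<open>\<open>X\<close> need not be an element of its class, as it may live over another type;
  an isomorphic copy over \<open>'r univ\<close> is one, and equality of classes relates this copy
  to \<open>Y\<close>.\<close>

lemma formation_class_eq_iff:
  fixes X :: "('r::ring_involution, 'm::ab_group_add) formation" and Y :: "('r, 'n::ab_group_add) formation"
  assumes \<epsilon>: "is_sign \<epsilon>" and X: "is_formation \<epsilon> X" and Y: "is_formation \<epsilon> Y"
  shows "formation_class \<epsilon> X = formation_class \<epsilon> Y \<longleftrightarrow> formation_equiv \<epsilon> X Y"
proof
  assume eq: "formation_class \<epsilon> X = formation_class \<epsilon> Y"
  obtain Z :: "('r, 'r univ) formation" where Z: "is_formation \<epsilon> Z" "formation_isomorphic X Z"
    using formation_transport[OF X \<epsilon>] .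
  have XZ: "formation_equiv \<epsilon> X Z" by (rule formation_equiv_iso[OF \<epsilon> X Z])
  then have "Z \<in> formation_class \<epsilon> Y" unfolding eq[symmetric] by (simp add: formation_class_def Z)
  then have "formation_equiv \<epsilon> Y Z" by (simp add: formation_class_def)
  from formation_equiv_trans[OF \<epsilon> X Z(1) Y XZ formation_equiv_sym[OF \<epsilon> Y Z(1) this]]
  show "formation_equiv \<epsilon> X Y" .
next
  assume e: "formation_equiv \<epsilon> X Y"
  note e' = formation_equiv_sym[OF \<epsilon> X Y e]
  show "formation_class \<epsilon> X = formation_class \<epsilon> Y"
    unfolding formation_class_def
    using formation_equiv_trans[OF \<epsilon> Y X _ e'] formation_equiv_trans[OF \<epsilon> X Y _ e] by blast
qed

lemma formation_representative:
  fixes X :: "('r::ring_involution, 'm::ab_group_add) formation"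
  assumes \<epsilon>: "is_sign \<epsilon>" and X: "is_formation \<epsilon> X"
  obtains Z :: "('r, 'r univ) formation" where "is_formation \<epsilon> Z" "formation_isomorphic X Z"
    "formation_class \<epsilon> X = formation_class \<epsilon> Z" "Z \<in> formation_class \<epsilon> X"
proof -
  obtain Z :: "('r, 'r univ) formation" where Z: "is_formation \<epsilon> Z" "formation_isomorphic X Z"
    using formation_transport[OF X \<epsilon>] .
  have "formation_equiv \<epsilon> X Z" by (rule formation_equiv_iso[OF \<epsilon> X Z])
  then show ?thesis
    using that[OF Z] Z(1) by (simp add: formation_class_eq_iff[OF \<epsilon> X Z(1)]) (simp add: formation_class_def)
qed

lemma formation_class_rel: "is_formation \<epsilon> X \<Longrightarrow> formation_class \<epsilon> X = formation_rel \<epsilon> `` {X}"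
  by (auto simp: formation_class_def formation_rel_def)

lemma formation_class_carrier:
  fixes X :: "('r::ring_involution, 'm::ab_group_add) formation"
  assumes \<epsilon>: "is_sign \<epsilon>" and X: "is_formation \<epsilon> X"
  shows "formation_class \<epsilon> X \<in> carrier (formation_group \<epsilon>)"
proof -
  obtain Z :: "('r, 'r univ) formation" where Z: "is_formation \<epsilon> Z" "formation_class \<epsilon> X = formation_class \<epsilon> Z"
    by (rule formation_representative[OF assms]) blast
  show ?thesis
    unfolding Z(2) formation_class_rel[OF Z(1)] formation_group_def
    by (simp add: quotientI Z(1))
qed

lemma formation_group_elim:
  fixes A :: "('r::ring_involution, 'r univ) formation set"
  assumes "A \<in> carrier (formation_group \<epsilon>)"
  obtains X :: "('r, 'r univ) formation" where "is_formation \<epsilon> X" "A = formation_class \<epsilon> X"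
proof -
  from assms obtain X :: "('r, 'r univ) formation" where X: "is_formation \<epsilon> X" "A = formation_rel \<epsilon> `` {X}"
    by (auto simp: formation_group_def quotient_def)
  then show ?thesis using that[OF X(1)] by (simp add: formation_class_rel)
qed

text \<open>The union in the definition of the product runs over nonempty sets of representatives,
  all of which give the same class.\<close>

lemma formation_class_mult:
  fixes X :: "('r::ring_involution, 'm::ab_group_add) formation" and Y :: "('r, 'n::ab_group_add) formation"
  assumes \<epsilon>: "is_sign \<epsilon>" and X: "is_formation \<epsilon> X" and Y: "is_formation \<epsilon> Y"
  shows "formation_class \<epsilon> X \<otimes>\<^bsub>formation_group \<epsilon>\<^esub> formation_class \<epsilon> Y = formation_class \<epsilon> (formation_sum X Y)"
proof -
  have eq: "formation_class \<epsilon> (formation_sum X' Y') = formation_class \<epsilon> (formation_sum X Y)"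
    if "X' \<in> formation_class \<epsilon> X" "Y' \<in> formation_class \<epsilon> Y" for X' Y' :: "('r, 'r univ) formation"
  proof -
    have "is_formation \<epsilon> X'" "formation_equiv \<epsilon> X X'" "is_formation \<epsilon> Y'" "formation_equiv \<epsilon> Y Y'"
      using that by (auto simp: formation_class_def)
    then have "formation_class \<epsilon> (formation_sum X Y) = formation_class \<epsilon> (formation_sum X' Y')"
      using formation_equiv_sum[OF \<epsilon> X _ _ Y]
      by (simp add: formation_class_eq_iff[OF \<epsilon>] is_formation_sum X Y \<epsilon>)
    then show ?thesis by simp
  qed
  obtain Z :: "('r, 'r univ) formation" where Z: "Z \<in> formation_class \<epsilon> X"
    by (rule formation_representative[OF \<epsilon> X]) blast
  obtain W :: "('r, 'r univ) formation" where W: "W \<in> formation_class \<epsilon> Y"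
    by (rule formation_representative[OF \<epsilon> Y]) blast
  show ?thesis
    unfolding formation_group_def using eq Z W by auto
qed

lemma formation_class_iso:
  assumes "is_sign \<epsilon>" "formation_isomorphic X Y" "is_formation \<epsilon> X" "is_formation \<epsilon> Y"
  shows "formation_class \<epsilon> X = formation_class \<epsilon> Y"
  using formation_equiv_iso[OF assms(1,3,4,2)] by (simp add: formation_class_eq_iff assms)

lemma formation_class_inverse:
  assumes \<epsilon>: "is_sign \<epsilon>" and X: "is_formation \<epsilon> X"
  shows "formation_class \<epsilon> (formation_neg X) \<otimes>\<^bsub>formation_group \<epsilon>\<^esub> formation_class \<epsilon> X = \<one>\<^bsub>formation_group \<epsilon>\<^esub>"
proof -
  note F = is_formation_sum[OF _ _ \<epsilon>] is_formation_neg[OF _ \<epsilon>] X is_formation_zero[OF \<epsilon>]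
  have "null_formation \<epsilon> (formation_sum (formation_neg X) X)"
    by (rule null_formation_iso[OF \<epsilon> null_formation_diagonal[OF \<epsilon> X] formation_sum_commute])
      (simp_all add: F)
  then have "formation_equiv \<epsilon> (formation_sum (formation_neg X) X) (zero_formation \<epsilon>)"
    by (intro formation_equiv_zero[OF \<epsilon>]) (simp_all add: F)
  then show ?thesis
    by (simp add: formation_class_mult[OF \<epsilon>] F formation_group_def[THEN arg_cong[of _ _ one]]
        formation_class_eq_iff[OF \<epsilon>])
qed

lemma formation_group_one: "\<one>\<^bsub>formation_group \<epsilon>\<^esub> = formation_class \<epsilon> (zero_formation \<epsilon>)"
  by (simp add: formation_group_def)

lemma comm_group_formation_group:
  fixes \<epsilon> :: "'r::ring_involution"
  assumes \<epsilon>: "is_sign \<epsilon>"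
  shows "comm_group (formation_group \<epsilon>)"
proof (rule comm_groupI)
  note F = is_formation_sum[OF _ _ \<epsilon>] is_formation_neg[OF _ \<epsilon>] is_formation_zero[OF \<epsilon>]
  note M = formation_class_mult[OF \<epsilon>] and C = formation_class_carrier[OF \<epsilon>]
  show "\<one>\<^bsub>formation_group \<epsilon>\<^esub> \<in> carrier (formation_group \<epsilon>)"
    by (simp add: formation_group_one C F)
  fix x assume "x \<in> carrier (formation_group \<epsilon>)"
  then obtain X :: "('r, 'r univ) formation" where X: "is_formation \<epsilon> X" "x = formation_class \<epsilon> X"
    by (rule formation_group_elim)
  show "\<one>\<^bsub>formation_group \<epsilon>\<^esub> \<otimes>\<^bsub>formation_group \<epsilon>\<^esub> x = x"
  proof -
    have "formation_class \<epsilon> X = formation_class \<epsilon> (formation_sum (zero_formation \<epsilon>) X)"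
      by (rule formation_class_iso[OF \<epsilon> formation_isomorphic_trans[OF formation_sum_zero[OF \<epsilon> X(1)] formation_sum_commute]])
        (simp_all add: F X)
    from this[symmetric] show ?thesis unfolding formation_group_one M[OF F(3) X(1)] X(2) .
  qed
  show "\<exists>y\<in>carrier (formation_group \<epsilon>). y \<otimes>\<^bsub>formation_group \<epsilon>\<^esub> x = \<one>\<^bsub>formation_group \<epsilon>\<^esub>"
    using formation_class_inverse[OF \<epsilon> X(1)] C[OF is_formation_neg[OF X(1) \<epsilon>]] X(2) by blast
  fix y assume "y \<in> carrier (formation_group \<epsilon>)"
  then obtain Y :: "('r, 'r univ) formation" where Y: "is_formation \<epsilon> Y" "y = formation_class \<epsilon> Y"
    by (rule formation_group_elim)
  show "x \<otimes>\<^bsub>formation_group \<epsilon>\<^esub> y \<in> carrier (formation_group \<epsilon>)"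
    by (simp add: X Y M C F)
  show "x \<otimes>\<^bsub>formation_group \<epsilon>\<^esub> y = y \<otimes>\<^bsub>formation_group \<epsilon>\<^esub> x"
    using formation_class_iso[OF \<epsilon> formation_sum_commute, of X Y] by (simp add: X Y M F)
  fix z assume "z \<in> carrier (formation_group \<epsilon>)"
  then obtain Z :: "('r, 'r univ) formation" where Z: "is_formation \<epsilon> Z" "z = formation_class \<epsilon> Z"
    by (rule formation_group_elim)
  show "x \<otimes>\<^bsub>formation_group \<epsilon>\<^esub> y \<otimes>\<^bsub>formation_group \<epsilon>\<^esub> z = x \<otimes>\<^bsub>formation_group \<epsilon>\<^esub> (y \<otimes>\<^bsub>formation_group \<epsilon>\<^esub> z)"
    using formation_class_iso[OF \<epsilon> formation_sum_assoc, of X Y Z] by (simp add: X Y Z M F)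
qed

lemma formation_class_inv:
  assumes \<epsilon>: "is_sign \<epsilon>" and X: "is_formation \<epsilon> X"
  shows "inv\<^bsub>formation_group \<epsilon>\<^esub> (formation_class \<epsilon> X) = formation_class \<epsilon> (formation_neg X)"
  by (rule group.inv_equality[OF comm_group.axioms(2)[OF comm_group_formation_group[OF \<epsilon>]]
        formation_class_inverse[OF assms]])
    (simp_all add: formation_class_carrier \<epsilon> X is_formation_neg)

section \<open>Odd-dimensional complexes as formations\<close>

text \<open>By reflexivity a form on the dual is an operator from \<open>dual M\<close> to
  \<open>M\<close>. In this way splittings of even forms on duals become \<open>psi1\<close> and
  \<open>\<delta>\<psi>\<close>.\<close>

lemma sesquilinear_dual_represent:
  fixes M :: "('r::ring_involution, 'm::ab_group_add) lmodule"
  assumes M: "fg_free M" and \<chi>: "sesquilinear (dual M) \<chi>"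
  obtains \<psi> where "is_hom (dual M) M \<psi>"
    "\<And>f g. f \<in> carrier (dual M) \<Longrightarrow> g \<in> carrier (dual M) \<Longrightarrow> f (\<psi> g) = \<chi> f g"
proof -
  interpret M: left_module M using M fg_free_module by blast
  interpret D: left_module "dual M" by (rule left_module_dual[OF M.left_module_axioms])
  note S = sesquilinearD[OF \<chi>]
  have "\<forall>g\<in>carrier (dual M). \<exists>x. x \<in> carrier M \<and> (\<forall>f\<in>carrier (dual M). f x = \<chi> f g)"
  proof
    fix g assume g: "g \<in> carrier (dual M)"
    have "is_hom (dual M) ring_module (\<lambda>f. bar (\<chi> f g))"
      by (rule is_homI) (simp_all add: S g bar_simps del: scale_dual)
    from bidual_represent[OF M this] show "\<exists>x. x \<in> carrier M \<and> (\<forall>f\<in>carrier (dual M). f x = \<chi> f g)"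
      by (auto simp: bar_bar)
  qed
  from bchoice[OF this] obtain \<psi> where \<psi>: "\<And>g. g \<in> carrier (dual M) \<Longrightarrow> \<psi> g \<in> carrier M"
    "\<And>f g. f \<in> carrier (dual M) \<Longrightarrow> g \<in> carrier (dual M) \<Longrightarrow> f (\<psi> g) = \<chi> f g" by blast
  have "is_hom (dual M) M \<psi>"
  proof (rule is_homI)
    fix g h assume g: "g \<in> carrier (dual M)" and h: "h \<in> carrier (dual M)"
    show "\<psi> (g + h) = \<psi> g + \<psi> h"
      by (rule dual_separates[OF M])
        (use g h in \<open>simp_all add: D.closed M.closed \<psi> S dual_add[of _ M] del: plus_fun_apply\<close>)
  next
    fix a g assume g: "g \<in> carrier (dual M)"
    show "\<psi> (scale (dual M) a g) = scale M a (\<psi> g)"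
      by (rule dual_separates[OF M])
        (use g in \<open>simp_all add: D.closed M.closed \<psi> S dual_scale[of _ M] del: scale_dual\<close>)
  qed (rule \<psi>(1))
  with \<psi>(2) show ?thesis using that by blast
qed

text \<open>The conditions on a complex apart from the chain equivalence. The adjunction between the
  two maps of the cone already holds here, so it can be used while exactness is still being
  proved.\<close>

definition pre_complex :: "nat \<Rightarrow> ('r::ring_involution, 'm::ab_group_add) qcomplex \<Rightarrow> bool" where
  "pre_complex n C \<longleftrightarrow> fg_free (ctop C) \<and> fg_free (cbot C) \<and> is_hom (ctop C) (cbot C) (cd C) \<and>
     is_hom (dual (cbot C)) (ctop C) (psi0 C) \<and> is_hom (dual (cbot C)) (cbot C) (psi1 C) \<and>
     (\<forall>f\<in>carrier (dual (cbot C)).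
        cd C (psi0 C f) + psi1 C f
          + scale (cbot C) ((-1) ^ (n + 1)) (codual_map (cbot C) (psi1 C) f) = 0)"

text \<open>The composite \<open>dual (cbot C) \<rightarrow> ctop C \<oplus> dual (ctop C) \<rightarrow> cbot C\<close> is the mapping cone of the
  duality map; the chain equivalence condition says that it is a short exact sequence.\<close>

definition cone_in :: "('r::ring_involution, 'm::ab_group_add) qcomplex \<Rightarrow> ('m \<Rightarrow> 'r) \<Rightarrow> 'm \<times> ('m \<Rightarrow> 'r)" where
  "cone_in C = (\<lambda>f. (psi0 C f, dual_map (ctop C) (cd C) f))"

definition cone_out :: "nat \<Rightarrow> ('r::ring_involution, 'm::ab_group_add) qcomplex \<Rightarrow> 'm \<times> ('m \<Rightarrow> 'r) \<Rightarrow> 'm" where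
  "cone_out n C = (\<lambda>(x, f). cd C x + scale (cbot C) ((-1) ^ n) (codual_map (cbot C) (psi0 C) f))"

text \<open>That the image of \<open>cone_in\<close> lies in the kernel of \<open>cone_out\<close>
  is \<open>cone_out_in\<close>, a consequence of the relation for \<open>psi1\<close>.\<close>

definition exact_complex :: "nat \<Rightarrow> ('r::ring_involution, 'm::ab_group_add) qcomplex \<Rightarrow> bool" where
  "exact_complex n C \<longleftrightarrow> pre_complex n C \<and>
     (\<forall>g\<in>carrier (dual (cbot C)). cone_in C g = 0 \<longrightarrow> g = 0) \<and>
     (\<forall>z\<in>carrier (ctop C \<boxplus> dual (ctop C)). cone_out n C z = 0 \<longrightarrow>
        (\<exists>g\<in>carrier (dual (cbot C)). z = cone_in C g)) \<and>
     (\<forall>y\<in>carrier (cbot C). \<exists>z\<in>carrier (ctop C \<boxplus> dual (ctop C)). cone_out n C z = y)"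

lemma exact_complexD:
  assumes "exact_complex n C"
  shows "g \<in> carrier (dual (cbot C)) \<Longrightarrow> cone_in C g = 0 \<Longrightarrow> g = 0"
    "x \<in> carrier (ctop C) \<Longrightarrow> f \<in> carrier (dual (ctop C)) \<Longrightarrow> cone_out n C (x, f) = 0 \<Longrightarrow>
       \<exists>g\<in>carrier (dual (cbot C)). cone_in C g = (x, f)"
    "y \<in> carrier (cbot C) \<Longrightarrow> \<exists>x\<in>carrier (ctop C). \<exists>f\<in>carrier (dual (ctop C)). cone_out n C (x, f) = y"
  using assms by (auto simp: exact_complex_def) (metis)

locale qcomplex =
  fixes n :: nat and C :: "('r::ring_involution, 'm::ab_group_add) qcomplex" and \<epsilon> :: 'r
  assumes pre: "pre_complex n C" and eps: "\<epsilon> = (-1) ^ n"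
begin

abbreviation "T \<equiv> ctop C"
abbreviation "B \<equiv> cbot C"
abbreviation "d \<equiv> cd C"
abbreviation "p \<equiv> psi0 C"
abbreviation "dd \<equiv> dual_map (ctop C) (cd C)"
abbreviation "pd \<equiv> codual_map (cbot C) (psi0 C)"

lemma sign: "is_sign \<epsilon>"
  by (simp add: eps is_sign_power)

lemma T_free: "fg_free T" and B_free: "fg_free B" and d_hom: "is_hom T B d"
  and p_hom: "is_hom (dual B) T p" and psi1_hom: "is_hom (dual B) B (psi1 C)"
  using pre by (simp_all add: pre_complex_def)

sublocale T: left_module T using T_free fg_free_module by blast
sublocale B: left_module B using B_free fg_free_module by blast
sublocale DT: left_module "dual T" by (rule left_module_dual[OF T.left_module_axioms])
sublocale DB: left_module "dual B" by (rule left_module_dual[OF B.left_module_axioms])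

lemma T_module: "left_module T" and B_module: "left_module B"
  and DT_module: "left_module (dual T)" and DB_module: "left_module (dual B)"
  by unfold_locales

lemma dd_hom: "is_hom (dual B) (dual T) dd"
  by (rule dual_map_hom[OF T_module d_hom])

lemma pd_hom: "is_hom (dual T) B pd"
  by (rule codual_map_hom[OF B_free T_module p_hom])

lemma pd_apply: "f \<in> carrier (dual T) \<Longrightarrow> g \<in> carrier (dual B) \<Longrightarrow> g (pd f) = bar (f (p g))"
  by (rule codual_map_apply[OF B_free p_hom])

lemmas homs_closed = hom_closed[OF d_hom] hom_closed[OF p_hom] hom_closed[OF dd_hom] hom_closed[OF pd_hom]

text \<open>Tested on functionals, the relation for \<open>psi1\<close> writes the form
  \<open>g (d (p h))\<close> as minus the form of \<open>psi1\<close> plus \<open>\<epsilon>\<close>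
  times its conjugate transpose. So it is \<open>- \<epsilon>\<close>-symmetric and its diagonal
  values vanish in the quotient: the two halves of isotropy for the image of
  \<open>cone_in\<close>.\<close>

lemma d_psi0_apply:
  assumes g: "g \<in> carrier (dual B)" and h: "h \<in> carrier (dual B)"
  shows "g (d (p h)) = - g (psi1 C h) + \<epsilon> * bar (h (psi1 C g))"
proof -
  have "d (p h) + psi1 C h + scale B (- \<epsilon>) (codual_map B (psi1 C) h) = 0"
    using pre h by (simp add: pre_complex_def eps)
  then have "g (d (p h) + psi1 C h + scale B (- \<epsilon>) (codual_map B (psi1 C) h)) = 0"
    using dual_zero[OF B_module g] by simp
  then have "g (d (p h)) + g (psi1 C h) - \<epsilon> * bar (h (psi1 C g)) = 0"
    using g h codual_map_closed[OF B_free psi1_hom h] hom_closed[OF psi1_hom h]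
    by (simp add: dual_add[OF g] dual_scale[of _ B] B.closed homs_closed codual_map_apply[OF B_free psi1_hom h])
  then show ?thesis by (simp add: algebra_simps)
qed

lemma d_psi0_sym:
  assumes g: "g \<in> carrier (dual B)" and h: "h \<in> carrier (dual B)"
  shows "g (d (p h)) = - \<epsilon> * bar (h (d (p g)))"
  using sign by (auto simp: d_psi0_apply[OF g h] d_psi0_apply[OF h g] is_sign_def bar_simps)

lemma d_psi0_even:
  assumes g: "g \<in> carrier (dual B)"
  shows "Qcls \<epsilon> (g (d (p g))) = Qcls \<epsilon> 0"
proof -
  have "g (d (p g)) - 0 = (- g (psi1 C g)) - \<epsilon> * bar (- g (psi1 C g))"
    by (simp add: d_psi0_apply[OF g g] bar_minus)
  then show ?thesis unfolding Qcls_eq_iff by blast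
qed

text \<open>The chain map condition for the duality map, obtained here from the relation for
  \<open>psi1\<close>.\<close>

lemma d_psi0:
  assumes g: "g \<in> carrier (dual B)"
  shows "d (p g) = - scale B \<epsilon> (pd (dd g))"
proof (rule dual_separates[OF B_free])
  fix h assume h: "h \<in> carrier (dual B)"
  show "h (d (p g)) = h (- scale B \<epsilon> (pd (dd g)))"
    using g h d_psi0_sym[OF h g]
    by (simp add: dual_minus[OF B_module h] dual_scale[of _ B] B.closed homs_closed pd_apply)
qed (simp_all add: g homs_closed B.closed)

lemma cone_in_hom: "is_hom (dual B) (T \<boxplus> dual T) (cone_in C)"
  using p_hom dd_hom by (simp add: is_hom_def cone_in_def)

lemma cone_out_eq: "cone_out n C (x, f) = d x + scale B \<epsilon> (pd f)"
  by (simp add: cone_out_def eps)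

lemma cone_out_hom: "is_hom (T \<boxplus> dual T) B (cone_out n C)"
proof -
  have "is_hom (T \<boxplus> dual T) B (\<lambda>z. d (fst z))" "is_hom (T \<boxplus> dual T) B (\<lambda>z. scale B \<epsilon> (pd (snd z)))"
    using d_hom hom_sign[OF B_module sign pd_hom] by (auto simp: is_hom_def)
  note h = hom_plus[OF B_module this]
  have "cone_out n C = (\<lambda>z. d (fst z) + scale B \<epsilon> (pd (snd z)))"
    by (auto simp: cone_out_eq fun_eq_iff)
  with h show ?thesis by (simp only:)
qed

lemma cone_module: "left_module (T \<boxplus> dual T)"
  by (rule left_module_dsum[OF T_module DT_module])

lemma cone_out_in: "g \<in> carrier (dual B) \<Longrightarrow> cone_out n C (cone_in C g) = 0"
  by (simp add: cone_in_def cone_out_eq d_psi0)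

text \<open>\<open>cone_in\<close> and \<open>cone_out\<close> are adjoint under the hyperbolic form
  and evaluation. As functionals separate points, the orthogonal of the image of
  \<open>cone_in\<close> is the kernel of \<open>cone_out\<close>.\<close>

lemma hyperbolic_cone:
  assumes z: "z \<in> carrier (T \<boxplus> dual T)" and g: "g \<in> carrier (dual B)"
  shows "lam (hyperbolic \<epsilon> T) (cone_in C g) z = g (cone_out n C z)"
proof -
  obtain x f where [simp]: "z = (x, f)" by force
  have x: "x \<in> carrier T" and f: "f \<in> carrier (dual T)" using z by auto
  show ?thesis
    using x f g by (simp add: cone_in_def cone_out_eq dual_add[OF g] homs_closed B.closed dual_scale[of _ B] pd_apply)
qed

end

lemma is_qcomplex_pre: "is_qcomplex n C \<Longrightarrow> pre_complex n C"
  by (simp add: is_qcomplex_def pre_complex_def)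

text \<open>Injectivity and surjectivity at the ends come from the homotopies on
  \<open>dual (cbot C)\<close> and on \<open>cbot C\<close>. In the middle, an element of the kernel
  is first corrected by an element of the image to have zero second component; what remains is a
  cycle of \<open>d\<close>, which is reached through \<open>g1\<close>.\<close>

lemma is_qcomplex_exact:
  fixes C :: "('r::ring_involution, 'm::ab_group_add) qcomplex"
  assumes C: "is_qcomplex n C"
  shows "exact_complex n C"
proof -
  define \<epsilon> :: 'r where "\<epsilon> = (-1) ^ n"
  interpret qcomplex n C \<epsilon> by unfold_locales (use C is_qcomplex_pre \<epsilon>_def in auto)
  define s where "s = scale (dual T) \<epsilon>"
  define dA where "dA = (\<lambda>f. - s (dd f))"
  have sh: "is_hom (dual T) (dual T) s"
    unfolding s_def by (rule hom_sign[OF DT_module sign]) (simp add: is_hom_def)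
  have ss: "s (s f) = f" if "f \<in> carrier (dual T)" for f
    using that sign by (simp add: s_def DT.scale_scale sign_square DT.scale_one del: scale_dual)
  have sc: "s f \<in> carrier (dual T)" if "f \<in> carrier (dual T)" for f
    using hom_closed[OF sh that] .
  have "dA f = scale (dual T) ((-1) ^ (n + 1)) (dd f)" if "f \<in> carrier (dual B)" for f
    using that by (simp add: dA_def s_def \<epsilon>_def[symmetric] DT.scale_minus_left homs_closed del: scale_dual)
  moreover note C[unfolded is_qcomplex_def is_chain_equivalence_def is_chain_map_def]
  ultimately obtain g1 g0 h k where
    g1: "is_hom T (dual B) g1" and g0: "is_hom B (dual T) g0" and g: "\<And>x. x \<in> carrier T \<Longrightarrow> dA (g1 x) = g0 (d x)"
    and h: "is_hom (dual T) (dual B) h" and k: "is_hom B T k"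
    and e1: "\<And>x. x \<in> carrier (dual B) \<Longrightarrow> g1 (p x) - x = h (dA x)"
    and e2: "\<And>x. x \<in> carrier (dual T) \<Longrightarrow> g0 (pd x) - x = dA (h x)"
    and e3: "\<And>x. x \<in> carrier T \<Longrightarrow> p (g1 x) - x = k (d x)"
    and e4: "\<And>x. x \<in> carrier B \<Longrightarrow> pd (g0 x) - x = d (k x)"
    by (smt (verit) hom_closed)
  note cl = homs_closed hom_closed[OF g1] hom_closed[OF g0] hom_closed[OF h] hom_closed[OF k] sc
  show ?thesis
    unfolding exact_complex_def
  proof (intro conjI ballI impI pre)
    fix g assume g: "g \<in> carrier (dual B)" and "cone_in C g = 0"
    then have 0: "p g = 0" "dd g = 0" by (simp_all add: cone_in_def zero_prod_def)
    then have "dA g = 0" using hom_zero[OF DT_module sh] by (simp add: dA_def)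
    then show "g = 0"
      using e1[OF g] 0 hom_zero[OF T_module g1] hom_zero[OF DT_module h] by simp
  next
    fix y assume y: "y \<in> carrier B"
    \<comment> \<open>The homotopy on \<open>cbot C\<close> gives \<open>y\<close> as
      \<open>pd (g0 y) - d (k y)\<close>; \<open>s\<close> compensates the sign in
      \<open>cone_out\<close>.\<close>
    have "cone_out n C (- k y, s (g0 y)) = - d (k y) + scale B \<epsilon> (scale B \<epsilon> (pd (g0 y)))"
      using y by (simp add: cone_out_eq hom_minus[OF T_module d_hom] cl s_def hom_scale[OF pd_hom] del: scale_dual)
    also have "scale B \<epsilon> (scale B \<epsilon> (pd (g0 y))) = pd (g0 y)"
      using y by (simp add: B.scale_scale cl sign_square[OF sign] B.scale_one)
    also have "- d (k y) + pd (g0 y) = y"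
      using e4[OF y] by (simp add: algebra_simps)
    finally show "\<exists>z\<in>carrier (T \<boxplus> dual T). cone_out n C z = y"
      using y by (intro bexI[of _ "(- k y, s (g0 y))"]) (simp_all add: cl T.closed)
  next
    fix z assume z: "z \<in> carrier (T \<boxplus> dual T)" and 0: "cone_out n C z = 0"
    obtain x f where [simp]: "z = (x, f)" by force
    have x: "x \<in> carrier T" and f: "f \<in> carrier (dual T)" using z by auto
    define x' where "x' = - scale T \<epsilon> x"
    have x': "x' \<in> carrier T" using x by (simp add: x'_def T.closed)
    have pdf: "pd f = d x'"
    proof -
      have "scale B \<epsilon> (d x + scale B \<epsilon> (pd f)) = 0" using 0 by (simp add: cone_out_eq)
      then have "scale B \<epsilon> (d x) + pd f = 0"
        using x f by (simp add: B.scale_add_right B.scale_scale sign_square[OF sign] B.scale_one cl B.closed)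
      then show ?thesis
        using x by (simp add: x'_def hom_minus[OF T_module d_hom] hom_scale[OF d_hom] T.closed eq_neg_iff_add_eq_0 add.commute)
    qed
    \<comment> \<open>Since \<open>pd f\<close> is the boundary \<open>d x'\<close>, the homotopy
      \<open>e2\<close> and the chain map condition \<open>g\<close> give
      \<open>f = dA (g1 x') - dA (h f)\<close>, so \<open>a\<close> is a preimage of
      \<open>f\<close> under \<open>dA\<close>.\<close>
    define a where "a = g1 x' - h f"
    have a: "a \<in> carrier (dual B)" using x' f by (simp add: a_def cl DB.diff_closed)
    have "f = dA (g1 x') - dA (h f)"
      using e2[OF f] g[OF x'] pdf by (simp add: algebra_simps)
    also have "\<dots> = dA a"
      using x' f by (simp add: dA_def a_def hom_diff[OF DB_module dd_hom] hom_diff[OF DT_module sh] cl)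
    finally have fa: "f = - s (dd a)" by (simp add: dA_def)
    define a' where "a' = - scale (dual B) \<epsilon> a"
    have a': "a' \<in> carrier (dual B)" using a by (simp add: a'_def DB.closed del: scale_dual)
    have dda': "dd a' = f"
      using a by (simp add: a'_def fa s_def hom_minus[OF DB_module dd_hom] hom_scale[OF dd_hom] DB.closed del: scale_dual)
    define w where "w = x - p a'"
    have w: "w \<in> carrier T" using x a' by (simp add: w_def cl T.closed)
    have dw: "d w = 0"
      using 0 x a' by (simp add: w_def hom_diff[OF T_module d_hom] cl d_psi0 dda' cone_out_eq)
    have pw: "p (g1 w) = w" using e3[OF w] hom_zero[OF B_module k] by (simp add: dw)
    have "s (dd (g1 w)) = 0" using g[OF w] hom_zero[OF B_module g0] by (simp add: dw dA_def)
    then have ddw: "dd (g1 w) = 0"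
      using ss[of "dd (g1 w)"] w hom_zero[OF DT_module sh] by (simp add: cl)
    have xw: "x = p a' + w" by (simp add: w_def)
    show "\<exists>g\<in>carrier (dual B). z = cone_in C g"
      by (rule bexI[of _ "a' + g1 w"])
        (use a' w xw in \<open>simp_all add: cone_in_def hom_add[OF p_hom] hom_add[OF dd_hom] cl pw ddw dda' DB.closed\<close>)
  qed
qed

text \<open>As \<open>cbot C\<close> is free, the exact sequence splits by a section
  \<open>i\<close> and a retraction \<open>r\<close>. Their components, with signs, are the homotopy
  inverse and the two homotopies; the identities of the splitting become the homotopy
  identities.\<close>

lemma exact_is_qcomplex:
  fixes C :: "('r::ring_involution, 'm::ab_group_add) qcomplex"
  assumes ex: "exact_complex n C"
  shows "is_qcomplex n C"
proof -
  define \<epsilon> :: 'r where "\<epsilon> = (-1) ^ n"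
  interpret qcomplex n C \<epsilon> by unfold_locales (use ex \<epsilon>_def in \<open>auto simp: exact_complex_def\<close>)
  let ?M = "T \<boxplus> dual T"
  have inj: "g = 0" if "g \<in> carrier (dual B)" "cone_in C g = 0" for g
    using ex that by (simp add: exact_complex_def)
  have ker: "\<exists>g\<in>carrier (dual B). z = cone_in C g" if "z \<in> carrier ?M" "cone_out n C z = 0" for z
    using ex that by (auto simp: exact_complex_def)
  obtain i where i: "is_hom B ?M i" "\<And>y. y \<in> carrier B \<Longrightarrow> cone_out n C (i y) = y"
    by (rule hom_section[OF cone_module B_free cone_out_hom]) (use ex in \<open>auto simp: exact_complex_def\<close>)
  interpret M: left_module ?M by (rule cone_module)
  note ic = hom_closed[OF i(1)] and oc = hom_closed[OF cone_out_hom]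
  let ?I = "cone_in C ` carrier (dual B)"
  have in_iso: "is_iso (dual B) (submod ?M ?I) (cone_in C)"
    by (rule is_isoI[OF DB_module]) (use cone_in_hom inj in \<open>auto simp: is_hom_def\<close>)
  have qI: "z - i (cone_out n C z) \<in> ?I" if z: "z \<in> carrier ?M" for z
    using ker[of "z - i (cone_out n C z)"] M.diff_closed[OF z ic[OF oc[OF z]]]
      hom_diff[OF cone_module cone_out_hom z ic[OF oc[OF z]]] i(2)[OF oc[OF z]] by auto
  have "is_hom ?M ?M (\<lambda>z. z - i (cone_out n C z))"
    by (rule hom_subtract[OF cone_module _ hom_comp[OF cone_out_hom i(1)]]) (simp add: is_hom_def)
  then have q: "is_hom ?M (submod ?M ?I) (\<lambda>z. z - i (cone_out n C z))"
    using qI by (simp add: is_hom_def)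
  define r where "r z = inv_into (carrier (dual B)) (cone_in C) (z - i (cone_out n C z))" for z
  have rh: "is_hom ?M (dual B) r"
    using hom_comp[OF q iso_hom[OF iso_inv[OF DB_module in_iso]]] unfolding r_def .
  have ir: "cone_in C (r z) + i (cone_out n C z) = z" if "z \<in> carrier ?M" for z
    using qI[OF that] by (simp add: r_def f_inv_into_f)
  have ri: "r (cone_in C g) = g" if g: "g \<in> carrier (dual B)" for g
    using g in_iso hom_zero[OF B_module i(1)]
    by (simp add: r_def cone_out_in is_iso_def bij_betw_def)
  define p' s' where "p' y = fst (i y)" and "s' y = snd (i y)" for y
  have p': "is_hom B T p'" and s': "is_hom B (dual T) s'"
    using i(1) by (auto simp: is_hom_def p'_def s'_def mem_Times_iff dsum_def split: prod.splits)
  define r1 r2 where "r1 x = r (x, 0)" and "r2 f = r (0, f)" for x f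
  have r1: "is_hom T (dual B) r1"
    by (rule is_homI) (use hom_closed[OF rh] hom_add[OF rh, of "(_, 0)" "(_, 0)"] hom_scale[OF rh, of "(_, 0)"] in
        \<open>simp_all add: r1_def DT.zero_closed del: scale_dual\<close>)
  have r2: "is_hom (dual T) (dual B) r2"
    by (rule is_homI) (use hom_closed[OF rh] hom_add[OF rh, of "(0, _)" "(0, _)"] hom_scale[OF rh, of "(0, _)"] in
        \<open>simp_all add: r2_def T.zero_closed del: scale_dual\<close>)
  have rsum: "r (x, f) = r1 x + r2 f" if "x \<in> carrier T" "f \<in> carrier (dual T)" for x f
    using hom_add[OF rh, of "(x, 0)" "(0, f)"] that by (simp add: r1_def r2_def T.zero_closed DT.zero_closed)
  note cl = homs_closed hom_closed[OF r1] hom_closed[OF r2] hom_closed[OF p'] hom_closed[OF s']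
  have pd0: "pd 0 = 0" and d0: "d 0 = 0"
    using hom_zero[OF DT_module pd_hom] hom_zero[OF T_module d_hom] by auto
  \<comment> \<open>The splitting identities in components: \<open>T1\<close> and \<open>T2\<close>
    say that the image part and the section part add up to the identity, \<open>T3\<close> that
    \<open>r\<close> is a left inverse of \<open>cone_in\<close>, \<open>T4\<close> that
    \<open>i\<close> is a section of \<open>cone_out\<close>.\<close>
  have T1: "p (r1 x) + p' (d x) = x" "dd (r1 x) + s' (d x) = 0" if x: "x \<in> carrier T" for x
    using ir[of "(x, 0)"] x by (auto simp: cone_in_def cone_out_eq r1_def p'_def s'_def DT.zero_closed pd0 prod_eq_iff)
  have T2: "p (r2 f) + p' (scale B \<epsilon> (pd f)) = 0" "dd (r2 f) + s' (scale B \<epsilon> (pd f)) = f"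
    if f: "f \<in> carrier (dual T)" for f
    using ir[of "(0, f)"] f by (auto simp: cone_in_def cone_out_eq r2_def p'_def s'_def T.zero_closed d0 prod_eq_iff)
  have T3: "r1 (p g) + r2 (dd g) = g" if g: "g \<in> carrier (dual B)" for g
    using ri[OF g] g rsum[of "p g" "dd g"] by (simp add: cone_in_def cl)
  have T4: "d (p' y) + scale B \<epsilon> (pd (s' y)) = y" if y: "y \<in> carrier B" for y
    using i(2)[OF y] by (simp add: p'_def s'_def cone_out_eq[symmetric])
  let ?dA = "\<lambda>f. scale (dual T) ((-1) ^ (n + 1)) (dd f)"
  have dA: "?dA f = - scale (dual T) \<epsilon> (dd f)" if "f \<in> carrier (dual B)" for f
    using that by (simp add: \<epsilon>_def[symmetric] DT.scale_minus_left cl del: scale_dual)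
  have sT: "scale (dual T) \<epsilon> (scale (dual T) \<epsilon> y) = y" if "y \<in> carrier (dual T)" for y
    using that by (simp add: DT.scale_scale sign_square[OF sign] DT.scale_one del: scale_dual)
  have chain: "is_chain_map (dual B) (dual T) ?dA T B d p pd"
    unfolding is_chain_map_def
  proof (intro conjI ballI p_hom pd_hom)
    fix g assume g: "g \<in> carrier (dual B)"
    show "d (p g) = pd (?dA g)"
      unfolding dA[OF g] using g
      by (simp add: hom_minus[OF DT_module pd_hom] hom_scale[OF pd_hom] d_psi0 cl DT.closed del: scale_dual)
  qed
  have chain': "is_chain_map T B d (dual B) (dual T) ?dA r1 (\<lambda>y. scale (dual T) \<epsilon> (s' y))"
    unfolding is_chain_map_def
  proof (intro conjI ballI r1 hom_sign[OF DT_module sign s'])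
    fix x assume x: "x \<in> carrier T"
    have "s' (d x) = - dd (r1 x)" using T1(2)[OF x] by (simp add: eq_neg_iff_add_eq_0 add.commute)
    then show "?dA (r1 x) = scale (dual T) \<epsilon> (s' (d x))"
      unfolding dA[OF hom_closed[OF r1 x]] using x by (simp add: cl DT.scale_minus_right del: scale_dual)
  qed
  have "is_chain_equivalence (dual B) (dual T) ?dA T B d p pd"
    unfolding is_chain_equivalence_def
  proof (rule conjI[OF chain], rule exI[of _ r1], rule exI[of _ "\<lambda>y. scale (dual T) \<epsilon> (s' y)"],
      rule exI[of _ "\<lambda>f. scale (dual B) \<epsilon> (r2 f)"], rule exI[of _ "\<lambda>y. - p' y"], intro conjI chain'
      hom_sign[OF DB_module sign r2] hom_uminus[OF T_module p'] ballI)
    fix g assume g: "g \<in> carrier (dual B)"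
    have "scale (dual B) \<epsilon> (r2 (?dA g)) = r2 (scale (dual T) \<epsilon> (- scale (dual T) \<epsilon> (dd g)))"
      unfolding dA[OF g] using g by (simp add: hom_scale[OF r2] cl DT.closed del: scale_dual)
    also have "\<dots> = - r2 (dd g)"
      using g sT by (simp add: DT.scale_minus_right cl DT.closed hom_minus[OF DT_module r2] del: scale_dual)
    finally show "r1 (p g) - g = scale (dual B) \<epsilon> (r2 (?dA g))"
      using T3[OF g] by (simp add: algebra_simps del: scale_dual)
  next
    fix f assume f: "f \<in> carrier (dual T)"
    have e: "scale (dual B) \<epsilon> (r2 f) \<in> carrier (dual B)"
      by (rule DB.scale_closed[OF hom_closed[OF r2 f]])
    have "?dA (scale (dual B) \<epsilon> (r2 f)) = - dd (r2 f)"
      unfolding dA[OF e] using f sT by (simp add: hom_scale[OF dd_hom] cl DB.closed del: scale_dual)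
    moreover have "scale (dual T) \<epsilon> (s' (pd f)) = f - dd (r2 f)"
      using T2(2)[OF f] f by (simp add: hom_scale[OF s'] cl algebra_simps del: scale_dual)
    ultimately show "scale (dual T) \<epsilon> (s' (pd f)) - f = ?dA (scale (dual B) \<epsilon> (r2 f))"
      by (simp del: scale_dual)
  next
    fix x assume x: "x \<in> carrier T"
    show "p (r1 x) - x = - p' (d x)" using T1(1)[OF x] by (simp add: algebra_simps)
  next
    fix y assume y: "y \<in> carrier B"
    show "pd (scale (dual T) \<epsilon> (s' y)) - y = d (- p' y)"
      using T4[OF y] y by (simp add: hom_scale[OF pd_hom] hom_minus[OF T_module d_hom] cl algebra_simps del: scale_dual)
  qed
  then show ?thesis
    using pre by (simp add: is_qcomplex_def pre_complex_def)
qed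

section \<open>The formation of a complex and the converse construction\<close>

lemma is_qcomplex_iff_exact: "is_qcomplex n C \<longleftrightarrow> exact_complex n C"
  using is_qcomplex_exact exact_is_qcomplex by blast

lemma formation_of_eq:
  "formation_of n C = \<lparr>qf = hyperbolic ((-1) ^ n) (ctop C), lag1 = carrier (ctop C) \<times> {0},
     lag2 = cone_in C ` carrier (dual (cbot C))\<rparr>"
  by (simp add: formation_of_def cone_in_def)

text \<open>By adjunction the orthogonal of the image of \<open>cone_in\<close> is the kernel of
  \<open>cone_out\<close>, which exactness identifies with the image. A section of
  \<open>cone_out\<close> supplies a complementary summand, and the image is free as a copy of
  \<open>dual (cbot C)\<close>.\<close>

lemma is_formation_of:
  fixes C :: "('r::ring_involution, 'm::ab_group_add) qcomplex"
  assumes C: "is_qcomplex n C"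
  shows "is_formation ((-1) ^ n) (formation_of n C)"
proof -
  define \<epsilon> :: 'r where "\<epsilon> = (-1) ^ n"
  have ex: "exact_complex n C" using C by (simp add: is_qcomplex_iff_exact)
  interpret qcomplex n C \<epsilon> by unfold_locales (use ex \<epsilon>_def in \<open>auto simp: exact_complex_def\<close>)
  let ?M = "T \<boxplus> dual T" and ?G = "cone_in C ` carrier (dual B)" and ?H = "hyperbolic \<epsilon> T"
  have ker: "\<exists>g\<in>carrier (dual B). z = cone_in C g" if "z \<in> carrier ?M" "cone_out n C z = 0" for z
    using ex that by (auto simp: exact_complex_def)
  obtain i where i: "is_hom B ?M i" "\<And>y. y \<in> carrier B \<Longrightarrow> cone_out n C (i y) = y"
    by (rule hom_section[OF cone_module B_free cone_out_hom]) (use ex in \<open>auto simp: exact_complex_def\<close>)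
  interpret M: left_module ?M by (rule cone_module)
  note ic = hom_closed[OF i(1)] and oc = hom_closed[OF cone_out_hom]
  have Gsub: "is_submodule ?M ?G"
    by (rule submodule_image[OF DB_module cone_module cone_in_hom submodule_trivial(2)[OF DB_module]])
  have "complementary ?M ?G (i ` carrier B)"
  proof (rule complementaryI[OF cone_module Gsub])
    show "is_submodule ?M (i ` carrier B)"
      by (rule submodule_image[OF B_module cone_module i(1) submodule_trivial(2)[OF B_module]])
    show "x = 0" if x: "x \<in> ?G" "x \<in> i ` carrier B" for x
    proof -
      obtain g y where gy: "g \<in> carrier (dual B)" "x = cone_in C g" "y \<in> carrier B" "x = i y"
        using x by blast
      have "y = cone_out n C x" using i(2)[OF gy(3)] gy(4) by simp
      also have "\<dots> = 0" unfolding gy(2) by (rule cone_out_in[OF gy(1)])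
      finally show ?thesis using gy(4) hom_zero[OF B_module i(1)] by simp
    qed
    fix z assume z: "z \<in> carrier ?M"
    have "z - i (cone_out n C z) \<in> ?G"
      using ker[of "z - i (cone_out n C z)"] M.diff_closed[OF z ic[OF oc[OF z]]]
        hom_diff[OF cone_module cone_out_hom z ic[OF oc[OF z]]] i(2)[OF oc[OF z]] by auto
    moreover have "z = (z - i (cone_out n C z)) + i (cone_out n C z)" by simp
    ultimately show "\<exists>a\<in>?G. \<exists>b\<in>i ` carrier B. z = a + b" using oc[OF z] by blast
  qed
  then have summand: "direct_summand (fmod ?H) ?G" by (auto simp: direct_summand_iff)
  interpret Q: quadratic \<epsilon> ?H by (rule quadraticI[OF quadratic_form_hyperbolic[OF T_free sign] sign])
  have GM: "cone_in C g \<in> carrier ?M" if "g \<in> carrier (dual B)" for g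
    using hom_closed[OF cone_in_hom that] .
  have "mu ?H z = Qcls \<epsilon> 0" if "z \<in> ?G" for z
    using that by (auto simp: cone_in_def homs_closed d_psi0_even)
  moreover have "?G = {x \<in> carrier (fmod ?H). \<forall>y\<in>?G. lam ?H x y = 0}"
  proof (intro equalityI subsetI)
    fix z assume "z \<in> ?G"
    then obtain g where g: "g \<in> carrier (dual B)" "z = cone_in C g" by blast
    have "lam ?H z w = 0" if w: "w \<in> ?G" for w
    proof -
      obtain h where h: "h \<in> carrier (dual B)" "w = cone_in C h" using w by blast
      show ?thesis
        unfolding g(2) h(2) hyperbolic_cone[OF GM[OF h(1)] g(1)] cone_out_in[OF h(1)]
        by (rule dual_zero[OF B_module g(1)])
    qed
    then show "z \<in> {x \<in> carrier (fmod ?H). \<forall>y\<in>?G. lam ?H x y = 0}"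
      using GM[OF g(1)] g(2) by simp
  next
    fix z assume "z \<in> {x \<in> carrier (fmod ?H). \<forall>y\<in>?G. lam ?H x y = 0}"
    then have z: "z \<in> carrier ?M" and 0: "\<And>g. g \<in> carrier (dual B) \<Longrightarrow> lam ?H z (cone_in C g) = 0" by auto
    have "g (cone_out n C z) = g 0" if g: "g \<in> carrier (dual B)" for g
      using hyperbolic_cone[OF z g] Q.lam_sym_zero[OF _ _ 0[OF g]] GM[OF g] z dual_zero[OF B_module g] by simp
    then have "cone_out n C z = 0"
      by (intro dual_separates[OF B_free oc[OF z] B.zero_closed])
    then show "z \<in> ?G" using ker[OF z] by blast
  qed
  ultimately have lag: "lagrangian \<epsilon> ?H ?G" using summand unfolding lagrangian_def by blast
  have iso: "is_iso (dual B) (submod ?M ?G) (cone_in C)"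
    by (rule is_isoI[OF DB_module]) (use cone_in_hom ex in \<open>auto simp: is_hom_def exact_complex_def\<close>)
  have "fg_free (submod ?M ?G)"
    by (rule fg_free_iso[OF fg_free_dual[OF B_free] _ iso]) (use Gsub in \<open>simp add: is_submodule_def\<close>)
  with lag show ?thesis
    unfolding formation_of_eq is_formation_form
    using hyperbolic_lagrangians[OF T_free sign] quadratic_form_hyperbolic[OF T_free sign]
      nonsingular_hyperbolic[OF T_free sign] by (simp add: eps[symmetric])
qed

text \<open>The quadratic function vanishes on the second lagrangian, so its form there is a coboundary;
  \<open>psi1\<close> is a cochain witnessing this.\<close>

lemma formation_from_qcomplex:
  fixes X :: "('r::ring_involution, 'm::ab_group_add) formation"
  assumes X: "is_formation ((-1) ^ n) X"
  obtains C :: "('r, 'r univ) qcomplex" where "is_qcomplex n C" "formation_isomorphic X (formation_of n C)"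
proof -
  define \<epsilon> :: 'r where "\<epsilon> = (-1) ^ n"
  have sign: "is_sign \<epsilon>" by (simp add: \<epsilon>_def is_sign_power)
  note X' = X[folded \<epsilon>_def]
  note XD = is_formationD[OF X']
  interpret X: quadratic \<epsilon> "qf X" by (rule formation_quadratic[OF X' sign])
  obtain A where A: "lagrangian \<epsilon> (qf X) A" "complementary (fmod (qf X)) (lag1 X) A"
    by (rule X.complementary_lagrangian[OF XD(2,3,6)])
  obtain k u where u: "is_iso (std_module k :: ('r, 'r univ) lmodule) (submod (fmod (qf X)) (lag1 X)) u"
    and Tf: "fg_free (std_module k :: ('r, 'r univ) lmodule)"
    by (rule iso_std_module[OF XD(6)])
  let ?T = "std_module k :: ('r, 'r univ) lmodule"
  have T: "left_module ?T" by (rule left_module_std)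
  obtain \<Phi> where \<Phi>: "form_iso (qf X) (hyperbolic \<epsilon> ?T) \<Phi>" "\<Phi> ` lag1 X = carrier ?T \<times> {0}"
    by (rule hyperbolic_coordinates[OF XD(1,2) sign XD(3) A T u]) blast
  let ?Y = "\<lparr>qf = hyperbolic \<epsilon> ?T, lag1 = carrier ?T \<times> {0}, lag2 = \<Phi> ` lag2 X\<rparr>"
  have iY: "formation_isomorphic X ?Y"
    unfolding formation_isomorphic_def using \<Phi> by (intro exI[of _ \<Phi>]) simp
  have Y: "is_formation \<epsilon> ?Y"
    by (rule form_iso_formation[OF X' iY _ sign]) (simp add: quadratic_form_hyperbolic[OF Tf sign])
  define G where "G = \<Phi> ` lag2 X"
  note YD = is_formationD[OF Y, folded G_def, simplified]
  let ?M = "?T \<boxplus> dual ?T" and ?H = "hyperbolic \<epsilon> ?T"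
  interpret H: quadratic \<epsilon> ?H by (rule quadraticI[OF YD(1) sign])
  note GD = H.lagrangianD[OF YD(4), simplified]
  \<comment> \<open>The second lagrangian is parametrised by a dual module: the first component of
    \<open>j\<close> becomes \<open>psi0\<close>, the second the dual of the differential.\<close>
  obtain l j where j: "is_iso (dual (std_module l :: ('r, 'r univ) lmodule)) (submod ?M G) j"
    and Bf: "fg_free (std_module l :: ('r, 'r univ) lmodule)"
    by (rule dual_std_module_iso[OF YD(7)])
  let ?B = "std_module l :: ('r, 'r univ) lmodule"
  have B: "left_module ?B" by (rule left_module_std)
  interpret T: left_module ?T by (rule T)
  interpret B: left_module ?B by (rule B)
  interpret DT: left_module "dual ?T" by (rule left_module_dual[OF T])
  interpret DB: left_module "dual ?B" by (rule left_module_dual[OF B])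
  have M: "left_module ?M" by (rule left_module_dsum[OF T DT.left_module_axioms])
  note jh = iso_hom[OF j]
  have jG: "j g \<in> G" if "g \<in> carrier (dual ?B)" for g using hom_closed[OF jh that] by simp
  have jsurj: "\<exists>g\<in>carrier (dual ?B). j g = z" if "z \<in> G" for z using iso_surj[OF j] that by simp
  define p s where "p g = fst (j g)" and "s g = snd (j g)" for g
  have jps: "j g = (p g, s g)" for g by (simp add: p_def s_def)
  have jM: "j g \<in> carrier ?M" if "g \<in> carrier (dual ?B)" for g using GD(5) jG[OF that] by auto
  have p: "is_hom (dual ?B) ?T p" and s: "is_hom (dual ?B) (dual ?T) s"
    using jh jM by (auto simp: is_hom_def p_def s_def mem_Times_iff dsum_def split: prod.splits)
  have pc: "p g \<in> carrier ?T" and sc: "s g \<in> carrier (dual ?T)" if "g \<in> carrier (dual ?B)" for g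
    using jM[OF that] by (simp_all add: jps)
  \<comment> \<open>Reflexivity recovers the differential \<open>d\<close> from its prospective dual
    \<open>s\<close>.\<close>
  have "\<forall>x\<in>carrier ?T. \<exists>y. y \<in> carrier ?B \<and> (\<forall>g\<in>carrier (dual ?B). g y = s g x)"
  proof
    fix x assume x: "x \<in> carrier ?T"
    have "is_hom (dual ?B) ring_module (\<lambda>g. bar (s g x))"
    proof (rule is_homI)
      fix a g assume "g \<in> carrier (dual ?B)"
      from hom_scale[OF s this, of a] show "bar (s (scale (dual ?B) a g) x) = scale ring_module a (bar (s g x))"
        by (simp add: bar_simps fun_eq_iff)
    qed (simp_all add: hom_add[OF s] bar_simps)
    from bidual_represent[OF Bf this] show "\<exists>y. y \<in> carrier ?B \<and> (\<forall>g\<in>carrier (dual ?B). g y = s g x)"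
      by (auto simp: bar_bar)
  qed
  from bchoice[OF this] obtain d where dB: "\<And>x. x \<in> carrier ?T \<Longrightarrow> d x \<in> carrier ?B"
    and d: "\<And>x g. x \<in> carrier ?T \<Longrightarrow> g \<in> carrier (dual ?B) \<Longrightarrow> g (d x) = s g x" by blast
  have dh: "is_hom ?T ?B d"
  proof (rule is_homI)
    fix x y assume x: "x \<in> carrier ?T" and y: "y \<in> carrier ?T"
    show "d (x + y) = d x + d y"
      by (rule dual_separates[OF Bf])
        (use x y in \<open>simp_all add: dB d T.closed B.closed dual_add[of _ ?B] dual_add[OF sc]\<close>)
  next
    fix a x assume x: "x \<in> carrier ?T"
    show "d (scale ?T a x) = scale ?B a (d x)"
      by (rule dual_separates[OF Bf])
        (use x in \<open>simp_all add: dB d T.closed B.closed dual_scale[of _ ?B] dual_scale[OF sc]\<close>)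
  qed (rule dB)
  have dd: "dual_map ?T d g = s g" if g: "g \<in> carrier (dual ?B)" for g
    by (rule dual_eqI[OF dual_map_closed[OF T dh g] sc[OF g]]) (simp add: d g)
  let ?l = "\<lambda>g h. s g (p h)"
  have l: "sesquilinear (dual ?B) ?l"
    unfolding sesquilinear_def
    using hom_add[OF s] hom_add[OF p] hom_scale[OF s] hom_scale[OF p] pc dual_add[OF sc] dual_scale[OF sc]
    by simp
  have sym: "?l g h = - \<epsilon> * bar (?l h g)" if "g \<in> carrier (dual ?B)" "h \<in> carrier (dual ?B)" for g h
    using GD(3)[OF jG[OF that(1)] jG[OF that(2)]] that
    by (simp add: jps pc sc eq_neg_iff_add_eq_0)
  have even: "\<exists>a. ?l g g = a + - \<epsilon> * bar a" if "g \<in> carrier (dual ?B)" for g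
    using GD(2)[OF jG[OF that]] by (auto simp: jps Qcls_eq_iff)
  obtain \<chi> where \<chi>: "sesquilinear (dual ?B) \<chi>"
    "\<And>g h. g \<in> carrier (dual ?B) \<Longrightarrow> h \<in> carrier (dual ?B) \<Longrightarrow> ?l g h = \<chi> g h + - \<epsilon> * bar (\<chi> h g)"
    by (rule even_splitting[OF fg_free_dual[OF Bf] l is_sign_minus[OF sign] sym even]) blast+
  have "sesquilinear (dual ?B) (\<lambda>g h. - \<chi> g h)"
    using \<chi>(1) by (simp add: sesquilinear_def)
  then obtain \<psi> where \<psi>: "is_hom (dual ?B) ?B \<psi>"
    "\<And>g h. g \<in> carrier (dual ?B) \<Longrightarrow> h \<in> carrier (dual ?B) \<Longrightarrow> g (\<psi> h) = - \<chi> g h"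
    by (rule sesquilinear_dual_represent[OF Bf]) blast
  define C :: "('r, 'r univ) qcomplex" where
    "C = \<lparr>ctop = ?T, cbot = ?B, cd = d, psi0 = p, psi1 = \<psi>\<rparr>"
  have C: "ctop C = ?T" "cbot C = ?B" "cd C = d" "psi0 C = p" "psi1 C = \<psi>" by (simp_all add: C_def)
  have pre: "pre_complex n C"
    unfolding pre_complex_def C
  proof (intro conjI Tf Bf dh p \<psi>(1) ballI)
    fix h assume h: "h \<in> carrier (dual ?B)"
    have cod: "codual_map ?B \<psi> h \<in> carrier ?B" by (rule codual_map_closed[OF Bf \<psi>(1) h])
    show "d (p h) + \<psi> h + scale ?B ((- 1) ^ (n + 1)) (codual_map ?B \<psi> h) = 0"
    proof (rule dual_separates[OF Bf _ B.zero_closed])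
      fix g assume g: "g \<in> carrier (dual ?B)"
      show "g (d (p h) + \<psi> h + scale ?B ((- 1) ^ (n + 1)) (codual_map ?B \<psi> h)) = g 0"
        using g h \<chi>(2)[OF g h]
        by (simp add: dual_add[OF g] dual_scale[OF g] dual_zero[OF B g] B.closed dB pc cod hom_closed[OF \<psi>(1)]
            d \<psi>(2) codual_map_apply[OF Bf \<psi>(1) h g] \<epsilon>_def[symmetric] bar_minus)
    qed (simp add: h B.closed dB pc cod hom_closed[OF \<psi>(1)])
  qed
  interpret C: qcomplex n C \<epsilon> by unfold_locales (auto simp: pre \<epsilon>_def)
  have cin: "cone_in C g = j g" if "g \<in> carrier (dual ?B)" for g
    using dd[OF that] by (simp add: cone_in_def C jps)
  have hc: "lam ?H (j g) z = g (cone_out n C z)" if "z \<in> carrier ?M" "g \<in> carrier (dual ?B)" for z g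
    using C.hyperbolic_cone[of z g] that cin by (simp add: C)
  have oc: "cone_out n C z \<in> carrier ?B" if "z \<in> carrier ?M" for z
    using hom_closed[OF C.cone_out_hom, of z] that by (simp add: C)
  have "exact_complex n C"
    unfolding exact_complex_def
  proof (intro conjI pre ballI impI)
    fix g assume "g \<in> carrier (dual (cbot C))" "cone_in C g = 0"
    then show "g = 0" using cin iso_kernel[OF DB.left_module_axioms j] by (simp add: C)
  next
    fix z assume z: "z \<in> carrier (ctop C \<boxplus> dual (ctop C))" and 0: "cone_out n C z = 0"
    have "z \<in> G"
    proof (rule GD(4))
      show zM: "z \<in> carrier ?T \<times> carrier (dual ?T)" using z by (simp add: C)
      fix w assume "w \<in> G"
      then obtain g where g: "g \<in> carrier (dual ?B)" "j g = w" using jsurj by blast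
      have "lam ?H w z = 0" using hc[of z g] g zM 0 dual_zero[OF B g(1)] by simp
      then show "lam ?H z w = 0"
        using H.lam_sym_zero[of z w] zM jM[OF g(1)] g(2) by simp
    qed
    then obtain g where "g \<in> carrier (dual ?B)" "j g = z" using jsurj by blast
    then show "\<exists>g\<in>carrier (dual (cbot C)). z = cone_in C g"
      by (intro bexI[of _ g]) (simp_all add: cin C)
  next
    fix y assume "y \<in> carrier (cbot C)"
    then have y: "y \<in> carrier ?B" by (simp add: C)
    obtain R where R: "complementary ?M G R"
      using YD(4) by (auto simp: lagrangian_def direct_summand_iff)
    obtain q where q: "is_hom ?M (submod ?M G) q" "\<And>a b. a \<in> G \<Longrightarrow> b \<in> R \<Longrightarrow> q (a + b) = a"
      by (rule left_module.complementary_projection[OF M R]) blast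
    have qG: "q a = a" if "a \<in> G" for a
      using q(2)[OF that left_module.submodule_zero[OF M complementaryD(2)[OF R]]] by simp
    let ?v = "inv_into (carrier (dual ?B)) j"
    have vh: "is_hom (submod ?M G) (dual ?B) ?v" by (rule iso_hom[OF iso_inv[OF DB.left_module_axioms j]])
    have vj: "?v (j g) = g" if "g \<in> carrier (dual ?B)" for g
      using iso_bij[OF j] that by (auto simp: bij_betw_def)
    note vq = hom_comp[OF q(1) vh]
    \<comment> \<open>Surjectivity of \<open>cone_out\<close> is dual to the splitting of
      \<open>j\<close>: evaluation at \<open>y\<close>, pulled back along the projection to the
      lagrangian, is represented through the form by a preimage of \<open>y\<close>.\<close>
    have "is_hom ?M ring_module (\<lambda>z. bar (?v (q z) y) * \<epsilon>)"
    proof (rule is_homI)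
      fix a z assume "z \<in> carrier ?M"
      from fun_cong[OF hom_scale[OF vq this, of a], of y]
      show "bar (?v (q (scale ?M a z)) y) * \<epsilon> = scale ring_module a (bar (?v (q z) y) * \<epsilon>)"
        by (simp add: bar_simps mult.assoc)
    qed (simp_all add: hom_add[OF vq] bar_simps distrib_right del: scale_dsum)
    from nonsingular_represent[OF YD(1,2), unfolded hyperbolic_simps(1), OF this]
    obtain z where z: "z \<in> carrier ?M" "\<And>w. w \<in> carrier ?M \<Longrightarrow> lam ?H z w = bar (?v (q w) y) * \<epsilon>"
      by blast
    have "g (cone_out n C z) = g y" if g: "g \<in> carrier (dual ?B)" for g
    proof -
      have "lam ?H (j g) z = \<epsilon> * bar (lam ?H z (j g))"
        by (rule H.lam_sym) (use jM[OF g] z(1) in simp_all)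
      also have "\<dots> = g y"
        using z(2)[OF jM[OF g]] qG[OF jG[OF g]] vj[OF g] sign by (auto simp: is_sign_def bar_simps)
      finally show ?thesis using hc[OF z(1) g] by simp
    qed
    then have "cone_out n C z = y" by (rule dual_separates[OF Bf oc[OF z(1)] y])
    then show "\<exists>z\<in>carrier (ctop C \<boxplus> dual (ctop C)). cone_out n C z = y"
      using z(1) by (auto simp: C)
  qed
  then have CQ: "is_qcomplex n C" by (simp add: is_qcomplex_iff_exact)
  have "cone_in C ` carrier (dual (cbot C)) = G"
    using cin jG jsurj by (force simp: C)
  then have "formation_of n C = ?Y"
    unfolding formation_of_eq by (simp add: C G_def \<epsilon>_def)
  with CQ iY show ?thesis using that by simp
qed

section \<open>Sums and negatives of complexes\<close>

definition dual_pair :: "('r::ring_involution, 'm::ab_group_add) lmodule \<Rightarrow> ('r, 'n::ab_group_add) lmodule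
    \<Rightarrow> ('m \<Rightarrow> 'r) \<Rightarrow> ('n \<Rightarrow> 'r) \<Rightarrow> 'm \<times> 'n \<Rightarrow> 'r" where
  "dual_pair M N f g = zero_outside (carrier (M \<boxplus> N)) (\<lambda>(x, y). f x + g y)"

context
  fixes M :: "('r::ring_involution, 'm::ab_group_add) lmodule" and N :: "('r, 'n::ab_group_add) lmodule"
  assumes M: "left_module M" and N: "left_module N"
begin

interpretation M: left_module M by (rule M)
interpretation N: left_module N by (rule N)

lemma dual_fst: "\<phi> \<in> carrier (dual (M \<boxplus> N)) \<Longrightarrow> (\<lambda>x. \<phi> (x, 0)) \<in> carrier (dual M)"
  using dual_add[of \<phi> "M \<boxplus> N" "(_, 0)" "(_, 0)"] dual_scale[of \<phi> "M \<boxplus> N" "(_, 0)"]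
    dual_outside[of \<phi> "M \<boxplus> N" "(_, 0)"]
  by (simp add: carrier_dual[of _ M] is_hom_def N.zero_closed)

lemma dual_snd: "\<phi> \<in> carrier (dual (M \<boxplus> N)) \<Longrightarrow> (\<lambda>y. \<phi> (0, y)) \<in> carrier (dual N)"
  using dual_add[of \<phi> "M \<boxplus> N" "(0, _)" "(0, _)"] dual_scale[of \<phi> "M \<boxplus> N" "(0, _)"]
    dual_outside[of \<phi> "M \<boxplus> N" "(0, _)"]
  by (simp add: carrier_dual[of _ N] is_hom_def M.zero_closed)

lemma dual_split: "\<phi> \<in> carrier (dual (M \<boxplus> N)) \<Longrightarrow> x \<in> carrier M \<Longrightarrow> y \<in> carrier N \<Longrightarrow>
    \<phi> (x, y) = \<phi> (x, 0) + \<phi> (0, y)"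
  using dual_add[of \<phi> "M \<boxplus> N" "(x, 0)" "(0, y)"] by (simp add: M.zero_closed N.zero_closed)

lemma dual_pair_apply [simp]: "x \<in> carrier M \<Longrightarrow> y \<in> carrier N \<Longrightarrow> dual_pair M N f g (x, y) = f x + g y"
  by (simp add: dual_pair_def)

lemma dual_pair_closed:
  assumes "f \<in> carrier (dual M)" "g \<in> carrier (dual N)"
  shows "dual_pair M N f g \<in> carrier (dual (M \<boxplus> N))"
  unfolding dual_pair_def
  by (rule zero_outside_dual[OF left_module_dsum[OF M N]], rule is_homI)
    (auto simp: dual_add[OF assms(1)] dual_add[OF assms(2)] dual_scale[OF assms(1)] dual_scale[OF assms(2)] distrib_left)

lemma dual_pair_fst:
  assumes "f \<in> carrier (dual M)" "g \<in> carrier (dual N)"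
  shows "(\<lambda>x. dual_pair M N f g (x, 0)) = f"
proof
  fix x show "dual_pair M N f g (x, 0) = f x"
    using dual_outside[OF assms(1), of x] dual_zero[OF N assms(2)]
    by (cases "x \<in> carrier M") (simp_all add: dual_pair_def N.zero_closed)
qed

lemma dual_pair_snd:
  assumes "f \<in> carrier (dual M)" "g \<in> carrier (dual N)"
  shows "(\<lambda>y. dual_pair M N f g (0, y)) = g"
proof
  fix y show "dual_pair M N f g (0, y) = g y"
    using dual_outside[OF assms(2), of y] dual_zero[OF M assms(1)]
    by (cases "y \<in> carrier N") (simp_all add: dual_pair_def M.zero_closed)
qed

lemma dual_pair_split:
  assumes "\<phi> \<in> carrier (dual (M \<boxplus> N))"
  shows "dual_pair M N (\<lambda>x. \<phi> (x, 0)) (\<lambda>y. \<phi> (0, y)) = \<phi>"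
  by (rule dual_eqI[OF dual_pair_closed[OF dual_fst[OF assms] dual_snd[OF assms]] assms])
    (auto simp: dual_split[OF assms, symmetric])

lemma dual_dsum_zero:
  assumes "\<phi> \<in> carrier (dual (M \<boxplus> N))" "(\<lambda>x. \<phi> (x, 0)) = 0" "(\<lambda>y. \<phi> (0, y)) = 0"
  shows "\<phi> = 0"
proof (rule dual_eqI[OF assms(1)])
  show "0 \<in> carrier (dual (M \<boxplus> N))"
    by (rule left_module.zero_closed[OF left_module_dual[OF left_module_dsum[OF M N]]])
  fix z assume "z \<in> carrier (M \<boxplus> N)"
  then obtain x y where z: "z = (x, y)" "x \<in> carrier M" "y \<in> carrier N" by auto
  show "\<phi> z = 0 z"
    using dual_split[OF assms(1) z(2,3)] fun_cong[OF assms(2), of x] fun_cong[OF assms(3), of y] z(1) by simp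
qed

lemma dual_fst_hom: "is_hom (dual (M \<boxplus> N)) (dual M) (\<lambda>\<phi> x. \<phi> (x, 0))"
  using dual_fst by (auto simp: is_hom_def fun_eq_iff)

lemma dual_snd_hom: "is_hom (dual (M \<boxplus> N)) (dual N) (\<lambda>\<phi> y. \<phi> (0, y))"
  using dual_snd by (auto simp: is_hom_def fun_eq_iff)

end

lemma hom_Pair: "is_hom M N f \<Longrightarrow> is_hom M P g \<Longrightarrow> is_hom M (N \<boxplus> P) (\<lambda>x. (f x, g x))"
  by (simp add: is_hom_def)

lemma codual_map_dsum:
  fixes M :: "('r::ring_involution, 'm::ab_group_add) lmodule" and M' :: "('r, 'k::ab_group_add) lmodule"
    and N :: "('r, 'n::ab_group_add) lmodule" and N' :: "('r, 'l::ab_group_add) lmodule"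
  assumes M: "fg_free M" "fg_free M'" and N: "left_module N" "left_module N'"
    and p: "is_hom (dual M) N p" "is_hom (dual M') N' p'"
  shows "is_hom (dual (M \<boxplus> M')) (N \<boxplus> N') (\<lambda>f. (p (\<lambda>x. f (x, 0)), p' (\<lambda>y. f (0, y))))"
    "\<phi> \<in> carrier (dual (N \<boxplus> N')) \<Longrightarrow>
      codual_map (M \<boxplus> M') (\<lambda>f. (p (\<lambda>x. f (x, 0)), p' (\<lambda>y. f (0, y)))) \<phi>
      = (codual_map M p (\<lambda>x. \<phi> (x, 0)), codual_map M' p' (\<lambda>y. \<phi> (0, y)))"
proof -
  note m = fg_free_module[OF M(1)] fg_free_module[OF M(2)]
  note f1 = dual_fst_hom[OF m] and f2 = dual_snd_hom[OF m]
  show h: "is_hom (dual (M \<boxplus> M')) (N \<boxplus> N') (\<lambda>f. (p (\<lambda>x. f (x, 0)), p' (\<lambda>y. f (0, y))))"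
    by (rule hom_Pair[OF hom_comp[OF f1 p(1)] hom_comp[OF f2 p(2)]])
  assume \<phi>: "\<phi> \<in> carrier (dual (N \<boxplus> N'))"
  note \<phi>1 = dual_fst[OF N \<phi>] and \<phi>2 = dual_snd[OF N \<phi>]
  show "codual_map (M \<boxplus> M') (\<lambda>f. (p (\<lambda>x. f (x, 0)), p' (\<lambda>y. f (0, y)))) \<phi>
      = (codual_map M p (\<lambda>x. \<phi> (x, 0)), codual_map M' p' (\<lambda>y. \<phi> (0, y)))"
  proof (rule codual_map_eqI[OF fg_free_dsum[OF M] h \<phi>])
    show "(codual_map M p (\<lambda>x. \<phi> (x, 0)), codual_map M' p' (\<lambda>y. \<phi> (0, y))) \<in> carrier (M \<boxplus> M')"
      using codual_map_closed[OF M(1) p(1) \<phi>1] codual_map_closed[OF M(2) p(2) \<phi>2] by simp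
    fix f assume f: "f \<in> carrier (dual (M \<boxplus> M'))"
    note g1 = dual_fst[OF m f] and g2 = dual_snd[OF m f]
    show "f (codual_map M p (\<lambda>x. \<phi> (x, 0)), codual_map M' p' (\<lambda>y. \<phi> (0, y)))
        = bar (\<phi> (p (\<lambda>x. f (x, 0)), p' (\<lambda>y. f (0, y))))"
      using dual_split[OF m f codual_map_closed[OF M(1) p(1) \<phi>1] codual_map_closed[OF M(2) p(2) \<phi>2]]
        codual_map_apply[OF M(1) p(1) \<phi>1 g1] codual_map_apply[OF M(2) p(2) \<phi>2 g2]
        dual_split[OF N \<phi> hom_closed[OF p(1) g1] hom_closed[OF p(2) g2]]
      by (simp add: bar_add)
  qed
qed

lemma dual_map_dsum:
  assumes "left_module M" "left_module M'" "is_hom M N f" "is_hom M' N' g"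
    "left_module N" "left_module N'" "\<phi> \<in> carrier (dual (N \<boxplus> N'))"
  shows "(\<lambda>x. dual_map (M \<boxplus> M') (\<lambda>(x, y). (f x, g y)) \<phi> (x, 0)) = dual_map M f (\<lambda>x. \<phi> (x, 0))"
    "(\<lambda>y. dual_map (M \<boxplus> M') (\<lambda>(x, y). (f x, g y)) \<phi> (0, y)) = dual_map M' g (\<lambda>y. \<phi> (0, y))"
  using assms hom_zero[of M N f] hom_zero[of M' N' g]
  by (auto simp: dual_map_def zero_outside_def fun_eq_iff left_module.zero_closed)

text \<open>Exactness of the cone is checked summand by summand, which avoids adding up
  homotopies.\<close>

lemma is_qcomplex_sum:
  fixes C :: "('r::ring_involution, 'm::ab_group_add) qcomplex" and C' :: "('r, 'n::ab_group_add) qcomplex"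
  assumes C: "is_qcomplex n C" and C': "is_qcomplex n C'"
  shows "is_qcomplex n (qcomplex_sum C C')"
proof -
  define \<epsilon> :: 'r where "\<epsilon> = (-1) ^ n"
  have ex: "exact_complex n C" "exact_complex n C'" using C C' by (simp_all add: is_qcomplex_iff_exact)
  interpret C: qcomplex n C \<epsilon> by unfold_locales (use ex \<epsilon>_def in \<open>auto simp: exact_complex_def\<close>)
  interpret C': qcomplex n C' \<epsilon> by unfold_locales (use ex \<epsilon>_def in \<open>auto simp: exact_complex_def\<close>)
  let ?E = "qcomplex_sum C C'"
  have E: "ctop ?E = C.T \<boxplus> C'.T" "cbot ?E = C.B \<boxplus> C'.B" "cd ?E = (\<lambda>(x, y). (C.d x, C'.d y))"
    "psi0 ?E = (\<lambda>f. (C.p (\<lambda>x. f (x, 0)), C'.p (\<lambda>y. f (0, y))))"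
    "psi1 ?E = (\<lambda>f. (psi1 C (\<lambda>x. f (x, 0)), psi1 C' (\<lambda>y. f (0, y))))"
    by (simp_all add: qcomplex_sum_def)
  note mB = C.B_module C'.B_module and mT = C.T_module C'.T_module
  have dh: "is_hom (C.T \<boxplus> C'.T) (C.B \<boxplus> C'.B) (\<lambda>(x, y). (C.d x, C'.d y))"
    using C.d_hom C'.d_hom by (auto simp: is_hom_def)
  note p = codual_map_dsum[OF C.B_free C'.B_free mT C.p_hom C'.p_hom]
    and q = codual_map_dsum[OF C.B_free C'.B_free mB C.psi1_hom C'.psi1_hom]
  have pre: "pre_complex n ?E"
    unfolding pre_complex_def E
  proof (intro conjI ballI fg_free_dsum C.T_free C'.T_free C.B_free C'.B_free dh p(1) q(1))
    fix f assume f: "f \<in> carrier (dual (C.B \<boxplus> C'.B))"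
    show "(\<lambda>(x, y). (C.d x, C'.d y)) (C.p (\<lambda>x. f (x, 0)), C'.p (\<lambda>y. f (0, y)))
        + (psi1 C (\<lambda>x. f (x, 0)), psi1 C' (\<lambda>y. f (0, y)))
        + scale (C.B \<boxplus> C'.B) ((- 1) ^ (n + 1)) (codual_map (C.B \<boxplus> C'.B)
            (\<lambda>f. (psi1 C (\<lambda>x. f (x, 0)), psi1 C' (\<lambda>y. f (0, y)))) f) = 0"
      unfolding q(2)[OF f]
      using C.pre C'.pre dual_fst[OF mB f] dual_snd[OF mB f] by (simp add: pre_complex_def zero_prod_def)
  qed
  interpret E: qcomplex n ?E \<epsilon> by unfold_locales (auto simp: pre \<epsilon>_def)
  have out: "cone_out n ?E ((x, x'), \<phi>) = (cone_out n C (x, \<lambda>x. \<phi> (x, 0)), cone_out n C' (x', \<lambda>y. \<phi> (0, y)))"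
    if "\<phi> \<in> carrier (dual (C.T \<boxplus> C'.T))" for x x' \<phi>
    using p(2)[OF that] by (simp add: E.cone_out_eq C.cone_out_eq C'.cone_out_eq E)
  have dd: "(\<lambda>x. dual_map (C.T \<boxplus> C'.T) (\<lambda>(x, y). (C.d x, C'.d y)) \<phi> (x, 0)) = C.dd (\<lambda>x. \<phi> (x, 0))"
    "(\<lambda>y. dual_map (C.T \<boxplus> C'.T) (\<lambda>(x, y). (C.d x, C'.d y)) \<phi> (0, y)) = C'.dd (\<lambda>y. \<phi> (0, y))"
    if "\<phi> \<in> carrier (dual (C.B \<boxplus> C'.B))" for \<phi>
    using dual_map_dsum[OF mT C.d_hom C'.d_hom mB that] .
  have "exact_complex n ?E"
    unfolding exact_complex_def
  proof (intro conjI pre ballI impI)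
    fix \<phi> assume "\<phi> \<in> carrier (dual (cbot ?E))" and 0: "cone_in ?E \<phi> = 0"
    then have \<phi>: "\<phi> \<in> carrier (dual (C.B \<boxplus> C'.B))" by (simp add: E)
    have 1: "C.p (\<lambda>x. \<phi> (x, 0)) = 0" "C'.p (\<lambda>y. \<phi> (0, y)) = 0"
      and 2: "dual_map (C.T \<boxplus> C'.T) (\<lambda>(x, y). (C.d x, C'.d y)) \<phi> = 0"
      using 0 by (simp_all add: cone_in_def E zero_prod_def)
    have "cone_in C (\<lambda>x. \<phi> (x, 0)) = 0" "cone_in C' (\<lambda>y. \<phi> (0, y)) = 0"
      using dd[OF \<phi>] unfolding 2 by (simp_all add: cone_in_def 1 zero_prod_def zero_fun_def)
    then have "(\<lambda>x. \<phi> (x, 0)) = 0" "(\<lambda>y. \<phi> (0, y)) = 0"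
      using ex dual_fst[OF mB \<phi>] dual_snd[OF mB \<phi>] by (simp_all add: exact_complex_def)
    then show "\<phi> = 0" by (rule dual_dsum_zero[OF mB \<phi>])
  next
    fix z assume "z \<in> carrier (ctop ?E \<boxplus> dual (ctop ?E))" and 0: "cone_out n ?E z = 0"
    then obtain x x' \<phi> where z: "z = ((x, x'), \<phi>)" "x \<in> carrier C.T" "x' \<in> carrier C'.T"
      "\<phi> \<in> carrier (dual (C.T \<boxplus> C'.T))" by (auto simp: E)
    note \<phi>1 = dual_fst[OF mT z(4)] and \<phi>2 = dual_snd[OF mT z(4)]
    have "cone_out n C (x, \<lambda>x. \<phi> (x, 0)) = 0" "cone_out n C' (x', \<lambda>y. \<phi> (0, y)) = 0"
      using 0 out[OF z(4)] by (simp_all add: z(1) zero_prod_def)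
    then obtain g g' where g: "g \<in> carrier (dual C.B)" "cone_in C g = (x, \<lambda>x. \<phi> (x, 0))"
      and g': "g' \<in> carrier (dual C'.B)" "cone_in C' g' = (x', \<lambda>y. \<phi> (0, y))"
      using exact_complexD(2)[OF ex(1) z(2) \<phi>1] exact_complexD(2)[OF ex(2) z(3) \<phi>2] by blast
    let ?g = "dual_pair C.B C'.B g g'"
    have gc: "?g \<in> carrier (dual (C.B \<boxplus> C'.B))" by (rule dual_pair_closed[OF mB g(1) g'(1)])
    note gf = dual_pair_fst[OF mB g(1) g'(1)] and gs = dual_pair_snd[OF mB g(1) g'(1)]
    let ?d = "dual_map (C.T \<boxplus> C'.T) (\<lambda>(x, y). (C.d x, C'.d y)) ?g"
    have "?d = \<phi>"
    proof -
      have dc: "?d \<in> carrier (dual (C.T \<boxplus> C'.T))"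
        by (rule dual_map_closed[OF left_module_dsum[OF mT] dh gc])
      have e: "(\<lambda>x. ?d (x, 0)) = (\<lambda>x. \<phi> (x, 0))" "(\<lambda>y. ?d (0, y)) = (\<lambda>y. \<phi> (0, y))"
        using g(2) g'(2) unfolding dd[OF gc] gf gs by (simp_all add: cone_in_def)
      show ?thesis
        by (rule trans[OF dual_pair_split[OF mT dc, symmetric, unfolded e] dual_pair_split[OF mT z(4)]])
    qed
    then have "z = cone_in ?E ?g"
      using g(2) g'(2) by (simp add: cone_in_def E gf gs z(1))
    then show "\<exists>g\<in>carrier (dual (cbot ?E)). z = cone_in ?E g" using gc by (auto simp: E)
  next
    fix y assume "y \<in> carrier (cbot ?E)"
    then obtain b b' where b: "y = (b, b')" "b \<in> carrier C.B" "b' \<in> carrier C'.B" by (auto simp: E)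
    obtain x f where xf: "x \<in> carrier C.T" "f \<in> carrier (dual C.T)" "cone_out n C (x, f) = b"
      using exact_complexD(3)[OF ex(1) b(2)] by blast
    obtain x' f' where xf': "x' \<in> carrier C'.T" "f' \<in> carrier (dual C'.T)" "cone_out n C' (x', f') = b'"
      using exact_complexD(3)[OF ex(2) b(3)] by blast
    have fc: "dual_pair C.T C'.T f f' \<in> carrier (dual (C.T \<boxplus> C'.T))"
      by (rule dual_pair_closed[OF mT xf(2) xf'(2)])
    show "\<exists>z\<in>carrier (ctop ?E \<boxplus> dual (ctop ?E)). cone_out n ?E z = y"
      by (rule bexI[of _ "((x, x'), dual_pair C.T C'.T f f')"])
        (use xf xf' b fc in \<open>simp_all add: out[OF fc] dual_pair_fst[OF mT] dual_pair_snd[OF mT] E\<close>)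
  qed
  then show ?thesis by (simp add: is_qcomplex_iff_exact)
qed

lemma codual_map_uminus:
  fixes M :: "('r::ring_involution, 'm::ab_group_add) lmodule" and N :: "('r, 'n::ab_group_add) lmodule"
  assumes M: "fg_free M" and N: "left_module N" and p: "is_hom (dual M) N p" and f: "f \<in> carrier (dual N)"
  shows "codual_map M (\<lambda>g. - p g) f = - codual_map M p f"
proof -
  have m: "left_module M" by (rule fg_free_module[OF M])
  note c = codual_map_closed[OF M p f]
  show ?thesis
    by (rule codual_map_eqI[OF M hom_uminus[OF N p] f])
      (simp_all add: left_module.uminus_closed[OF m c] dual_minus[OF m _ c] dual_minus[OF N f]
        hom_closed[OF p] codual_map_apply[OF M p f] bar_minus)
qed

lemma is_qcomplex_neg:
  fixes C :: "('r::ring_involution, 'm::ab_group_add) qcomplex"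
  assumes C: "is_qcomplex n C"
  shows "is_qcomplex n (qcomplex_neg C)"
proof -
  define \<epsilon> :: 'r where "\<epsilon> = (-1) ^ n"
  have ex: "exact_complex n C" using C by (simp add: is_qcomplex_iff_exact)
  interpret C: qcomplex n C \<epsilon> by unfold_locales (use ex \<epsilon>_def in \<open>auto simp: exact_complex_def\<close>)
  let ?E = "qcomplex_neg C"
  have E: "ctop ?E = C.T" "cbot ?E = C.B" "cd ?E = C.d" "psi0 ?E = (\<lambda>f. - C.p f)"
    "psi1 ?E = (\<lambda>f. - psi1 C f)"
    by (simp_all add: qcomplex_neg_def)
  have pre: "pre_complex n ?E"
    unfolding pre_complex_def E
  proof (intro conjI ballI C.T_free C.B_free C.d_hom hom_uminus[OF C.T_module C.p_hom]
      hom_uminus[OF C.B_module C.psi1_hom])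
    fix f assume f: "f \<in> carrier (dual C.B)"
    have "C.d (C.p f) + psi1 C f + scale C.B ((- 1) ^ (n + 1)) (codual_map C.B (psi1 C) f) = 0"
      using C.pre f by (simp add: pre_complex_def)
    then have "- (C.d (C.p f) + psi1 C f + scale C.B ((- 1) ^ (n + 1)) (codual_map C.B (psi1 C) f)) = 0"
      by simp
    then show "C.d (- C.p f) + - psi1 C f + scale C.B ((- 1) ^ (n + 1)) (codual_map C.B (\<lambda>f. - psi1 C f) f) = 0"
      unfolding codual_map_uminus[OF C.B_free C.B_module C.psi1_hom f]
        C.B.scale_minus_right[OF codual_map_closed[OF C.B_free C.psi1_hom f]]
        hom_minus[OF C.T_module C.d_hom hom_closed[OF C.p_hom f]]
      by (simp add: algebra_simps)
  qed
  interpret E: qcomplex n ?E \<epsilon> by unfold_locales (auto simp: pre \<epsilon>_def)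
  have out: "cone_out n ?E (x, f) = - cone_out n C (- x, f)" if "x \<in> carrier C.T" "f \<in> carrier (dual C.T)" for x f
    using that by (simp add: E.cone_out_eq C.cone_out_eq E C.homs_closed hom_minus[OF C.T_module C.d_hom]
        codual_map_uminus[OF C.B_free C.T_module C.p_hom] C.B.scale_minus_right)
  have "exact_complex n ?E"
    unfolding exact_complex_def E
  proof (intro conjI pre ballI impI)
    fix g assume "g \<in> carrier (dual C.B)" "cone_in ?E g = 0"
    then show "g = 0" using ex by (simp add: exact_complex_def cone_in_def E zero_prod_def)
  next
    fix z assume "z \<in> carrier (C.T \<boxplus> dual C.T)" "cone_out n ?E z = 0"
    then obtain x f where z: "z = (x, f)" "x \<in> carrier C.T" "f \<in> carrier (dual C.T)" "cone_out n C (- x, f) = 0"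
      using out by auto
    then obtain g where "g \<in> carrier (dual C.B)" "cone_in C g = (- x, f)"
      using exact_complexD(2)[OF ex C.T.uminus_closed[OF z(2)]] by blast
    then show "\<exists>g\<in>carrier (dual C.B). z = cone_in ?E g"
      using z by (intro bexI[of _ g]) (auto simp: cone_in_def E)
  next
    fix y assume y: "y \<in> carrier C.B"
    obtain x f where xf: "x \<in> carrier C.T" "f \<in> carrier (dual C.T)" "cone_out n C (x, f) = - y"
      using exact_complexD(3)[OF ex C.B.uminus_closed[OF y]] by blast
    then show "\<exists>z\<in>carrier (C.T \<boxplus> dual C.T). cone_out n ?E z = y"
      by (intro bexI[of _ "(- x, f)"]) (simp_all add: out C.T.closed)
  qed
  then show ?thesis by (simp add: is_qcomplex_iff_exact)
qed

text \<open>Negating the first component turns the hyperbolic form into its negative, preserves the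
  first lagrangian, and compensates the sign of \<open>psi0\<close> in the second.\<close>

lemma formation_of_neg:
  fixes C :: "('r::ring_involution, 'm::ab_group_add) qcomplex"
  assumes C: "is_qcomplex n C"
  shows "formation_isomorphic (formation_of n (qcomplex_neg C)) (formation_neg (formation_of n C))"
proof -
  define \<epsilon> :: 'r where "\<epsilon> = (-1) ^ n"
  have ex: "exact_complex n C" using C by (simp add: is_qcomplex_iff_exact)
  interpret C: qcomplex n C \<epsilon> by unfold_locales (use ex \<epsilon>_def in \<open>auto simp: exact_complex_def\<close>)
  let ?f = "\<lambda>(x :: 'm, f :: 'm \<Rightarrow> 'r). (- x, f)" and ?H = "hyperbolic \<epsilon> C.T"
  have "is_iso (C.T \<boxplus> dual C.T) (C.T \<boxplus> dual C.T) ?f"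
  proof (rule is_isoI[OF C.cone_module])
    show "is_hom (C.T \<boxplus> dual C.T) (C.T \<boxplus> dual C.T) ?f"
      by (auto simp: is_hom_def C.T.closed C.T.scale_minus_right)
    fix y assume "y \<in> carrier (C.T \<boxplus> dual C.T)"
    then show "\<exists>x\<in>carrier (C.T \<boxplus> dual C.T). ?f x = y"
      by (intro bexI[of _ "?f y"]) (auto simp: C.T.closed)
  qed (auto simp: zero_prod_def)
  then have "form_iso ?H (form_neg ?H) ?f"
    unfolding form_iso_def
    by (auto simp: C.T.closed dual_minus[OF C.T_module] bar_minus Qcls_uminus)
  moreover have "?f ` (carrier C.T \<times> {0}) = carrier C.T \<times> {0}"
  proof (intro equalityI subsetI)
    fix z assume "z \<in> carrier C.T \<times> {0 :: 'm \<Rightarrow> 'r}"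
    then show "z \<in> ?f ` (carrier C.T \<times> {0})"
      by (intro image_eqI[of _ _ "?f z"]) (auto simp: C.T.closed)
  qed (auto simp: C.T.closed)
  moreover have "?f ` cone_in (qcomplex_neg C) ` carrier (dual C.B) = cone_in C ` carrier (dual C.B)"
    by (simp add: image_image cone_in_def qcomplex_neg_def)
  ultimately show ?thesis
    unfolding formation_isomorphic_def formation_of_eq
    by (intro exI[of _ ?f]) (simp add: qcomplex_neg_def \<epsilon>_def)
qed

lemma formation_of_sum:
  fixes C :: "('r::ring_involution, 'm::ab_group_add) qcomplex" and C' :: "('r, 'n::ab_group_add) qcomplex"
  assumes C: "is_qcomplex n C" and C': "is_qcomplex n C'"
  shows "formation_isomorphic (formation_of n (qcomplex_sum C C'))
    (formation_sum (formation_of n C) (formation_of n C'))"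
proof -
  define \<epsilon> :: 'r where "\<epsilon> = (-1) ^ n"
  have ex: "exact_complex n C" "exact_complex n C'" using C C' by (simp_all add: is_qcomplex_iff_exact)
  interpret C: qcomplex n C \<epsilon> by unfold_locales (use ex \<epsilon>_def in \<open>auto simp: exact_complex_def\<close>)
  interpret C': qcomplex n C' \<epsilon> by unfold_locales (use ex \<epsilon>_def in \<open>auto simp: exact_complex_def\<close>)
  let ?E = "qcomplex_sum C C'"
  have E: "ctop ?E = C.T \<boxplus> C'.T" "cbot ?E = C.B \<boxplus> C'.B" "cd ?E = (\<lambda>(x, y). (C.d x, C'.d y))"
    "psi0 ?E = (\<lambda>f. (C.p (\<lambda>x. f (x, 0)), C'.p (\<lambda>y. f (0, y))))"
    by (simp_all add: qcomplex_sum_def)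
  note mB = C.B_module C'.B_module and mT = C.T_module C'.T_module
  let ?T = "C.T \<boxplus> C'.T" and ?f = "\<lambda>((x, y), \<phi>). ((x, \<lambda>x. \<phi> (x, 0)), (y, \<lambda>y. \<phi> (0, y)))"
  have mTT: "left_module ?T" by (rule left_module_dsum[OF mT])
  have iso: "is_iso (?T \<boxplus> dual ?T) ((C.T \<boxplus> dual C.T) \<boxplus> (C'.T \<boxplus> dual C'.T)) ?f"
  proof (rule is_isoI[OF left_module_dsum[OF mTT left_module_dual[OF mTT]]])
    show "is_hom (?T \<boxplus> dual ?T) ((C.T \<boxplus> dual C.T) \<boxplus> (C'.T \<boxplus> dual C'.T)) ?f"
      by (auto simp: is_hom_def dual_fst[OF mT] dual_snd[OF mT] fun_eq_iff)
  next
    fix z assume "z \<in> carrier (?T \<boxplus> dual ?T)" "?f z = 0"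
    then show "z = 0" using dual_dsum_zero[OF mT] by (auto simp: zero_prod_def)
  next
    fix y assume "y \<in> carrier ((C.T \<boxplus> dual C.T) \<boxplus> (C'.T \<boxplus> dual C'.T))"
    then obtain a f b g where y: "y = ((a, f), (b, g))" "a \<in> carrier C.T" "f \<in> carrier (dual C.T)"
      "b \<in> carrier C'.T" "g \<in> carrier (dual C'.T)" by auto
    show "\<exists>z\<in>carrier (?T \<boxplus> dual ?T). ?f z = y"
      by (rule bexI[of _ "((a, b), dual_pair C.T C'.T f g)"])
        (use y in \<open>simp_all add: dual_pair_closed[OF mT] dual_pair_fst[OF mT] dual_pair_snd[OF mT]\<close>)
  qed
  have "form_iso (hyperbolic \<epsilon> ?T) (form_sum (hyperbolic \<epsilon> C.T) (hyperbolic \<epsilon> C'.T)) ?f"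
    unfolding form_iso_def
  proof (intro conjI ballI)
    show "is_iso (fmod (hyperbolic \<epsilon> ?T)) (fmod (form_sum (hyperbolic \<epsilon> C.T) (hyperbolic \<epsilon> C'.T))) ?f"
      using iso by simp
  next
    fix z w assume "z \<in> carrier (fmod (hyperbolic \<epsilon> ?T))" "w \<in> carrier (fmod (hyperbolic \<epsilon> ?T))"
    then obtain a b \<phi> a' b' \<phi>' where z: "z = ((a, b), \<phi>)" "a \<in> carrier C.T" "b \<in> carrier C'.T" "\<phi> \<in> carrier (dual ?T)"
      and w: "w = ((a', b'), \<phi>')" "a' \<in> carrier C.T" "b' \<in> carrier C'.T" "\<phi>' \<in> carrier (dual ?T)" by auto
    have "lam (form_sum (hyperbolic \<epsilon> C.T) (hyperbolic \<epsilon> C'.T)) (?f z) (?f w)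
        = (\<phi> (a', 0) + \<epsilon> * bar (\<phi>' (a, 0))) + (\<phi> (0, b') + \<epsilon> * bar (\<phi>' (0, b)))"
      using z w by (simp add: dual_fst[OF mT] dual_snd[OF mT])
    also have "\<dots> = \<phi> (a', b') + \<epsilon> * bar (\<phi>' (a, b))"
      unfolding dual_split[OF mT z(4) w(2,3)] dual_split[OF mT w(4) z(2,3)]
      by (simp add: bar_add distrib_left)
    finally show "lam (form_sum (hyperbolic \<epsilon> C.T) (hyperbolic \<epsilon> C'.T)) (?f z) (?f w) = lam (hyperbolic \<epsilon> ?T) z w"
      using z w by simp
  next
    fix z assume "z \<in> carrier (fmod (hyperbolic \<epsilon> ?T))"
    then obtain a b \<phi> where z: "z = ((a, b), \<phi>)" "a \<in> carrier C.T" "b \<in> carrier C'.T" "\<phi> \<in> carrier (dual ?T)"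
      by auto
    show "mu (form_sum (hyperbolic \<epsilon> C.T) (hyperbolic \<epsilon> C'.T)) (?f z) = mu (hyperbolic \<epsilon> ?T) z"
      using z dual_split[OF mT z(4) z(2,3)] by (simp add: Qcls_add)
  qed
  moreover have "?f ` (carrier ?T \<times> {0}) = (carrier C.T \<times> {0}) \<times> (carrier C'.T \<times> {0})"
    by (auto simp: image_def zero_fun_def)
  moreover have "?f ` cone_in ?E ` carrier (dual (C.B \<boxplus> C'.B))
      = (cone_in C ` carrier (dual C.B)) \<times> (cone_in C' ` carrier (dual C'.B))"
  proof -
    have e: "?f (cone_in ?E \<phi>) = (cone_in C (\<lambda>x. \<phi> (x, 0)), cone_in C' (\<lambda>y. \<phi> (0, y)))"
      if "\<phi> \<in> carrier (dual (C.B \<boxplus> C'.B))" for \<phi>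
      using dual_map_dsum[OF mT C.d_hom C'.d_hom mB that] by (simp add: cone_in_def E)
    show ?thesis
    proof (intro equalityI subsetI)
      fix z assume "z \<in> ?f ` cone_in ?E ` carrier (dual (C.B \<boxplus> C'.B))"
      then obtain \<phi> where \<phi>: "\<phi> \<in> carrier (dual (C.B \<boxplus> C'.B))" "z = ?f (cone_in ?E \<phi>)" by blast
      show "z \<in> (cone_in C ` carrier (dual C.B)) \<times> (cone_in C' ` carrier (dual C'.B))"
        unfolding \<phi>(2) e[OF \<phi>(1)] using dual_fst[OF mB \<phi>(1)] dual_snd[OF mB \<phi>(1)] by blast
    next
      fix z assume "z \<in> (cone_in C ` carrier (dual C.B)) \<times> (cone_in C' ` carrier (dual C'.B))"
      then obtain g g' where g: "g \<in> carrier (dual C.B)" "g' \<in> carrier (dual C'.B)" "z = (cone_in C g, cone_in C' g')"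
        by blast
      have "z = ?f (cone_in ?E (dual_pair C.B C'.B g g'))"
        unfolding e[OF dual_pair_closed[OF mB g(1,2)]] dual_pair_fst[OF mB g(1,2)] dual_pair_snd[OF mB g(1,2)]
        by (rule g(3))
      then show "z \<in> ?f ` cone_in ?E ` carrier (dual (C.B \<boxplus> C'.B))"
        using dual_pair_closed[OF mB g(1,2)] by blast
    qed
  qed
  ultimately show ?thesis
    unfolding formation_isomorphic_def formation_of_eq
    by (intro exI[of _ ?f]) (simp add: E \<epsilon>_def)
qed

section \<open>Cobordism of complexes and null formations\<close>

text \<open>\<open>inj\<close> and \<open>lift\<close> make \<open>A2\<close> the pullback of
  \<open>f1\<close> and \<open>v\<close>, and with \<open>onto\<close> the square is also a pushout,
  so \<open>f1\<close> and \<open>f2\<close> have the same kernel and cokernel. This compares two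
  matrices of different shape, that of a cobordism and that of the associated null
  cobordism.\<close>

lemma bicartesian_iso_iff:
  assumes A1: "left_module A1" and A2: "left_module A2"
    and f1: "is_hom A1 B1 f1" and f2: "is_hom A2 B2 f2" and u: "is_hom A2 A1 u" and v: "is_hom B2 B1 v"
    and B2: "left_module B2"
    and comm: "\<And>a. a \<in> carrier A2 \<Longrightarrow> f1 (u a) = v (f2 a)"
    and inj: "\<And>a. a \<in> carrier A2 \<Longrightarrow> u a = 0 \<Longrightarrow> f2 a = 0 \<Longrightarrow> a = 0"
    and lift: "\<And>a b. a \<in> carrier A1 \<Longrightarrow> b \<in> carrier B2 \<Longrightarrow> f1 a = v b \<Longrightarrow> \<exists>c\<in>carrier A2. u c = a \<and> f2 c = b"
    and onto: "\<And>y. y \<in> carrier B1 \<Longrightarrow> \<exists>a\<in>carrier A1. \<exists>b\<in>carrier B2. y = f1 a + v b"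
  shows "is_iso A2 B2 f2 \<longleftrightarrow> is_iso A1 B1 f1"
proof
  have v0: "v 0 = 0" and u0: "u 0 = 0" using hom_zero[OF B2 v] hom_zero[OF A2 u] by auto
  {
    assume i: "is_iso A2 B2 f2"
    show "is_iso A1 B1 f1"
    proof (rule is_isoI[OF A1 f1])
      fix a assume "a \<in> carrier A1" "f1 a = 0"
      then obtain c where "c \<in> carrier A2" "u c = a" "f2 c = 0"
        using lift[of a 0] v0 left_module.zero_closed[OF B2] by auto
      then show "a = 0" using iso_kernel[OF A2 i] u0 by metis
    next
      fix y assume "y \<in> carrier B1"
      then obtain a b where ab: "a \<in> carrier A1" "b \<in> carrier B2" "y = f1 a + v b" using onto by blast
      obtain c where c: "c \<in> carrier A2" "f2 c = b" using iso_surj[OF i ab(2)] by blast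
      have "f1 (a + u c) = y" using ab c comm hom_add[OF f1 ab(1) hom_closed[OF u c(1)]] by simp
      then show "\<exists>x\<in>carrier A1. f1 x = y"
        using left_module.add_closed[OF A1 ab(1) hom_closed[OF u c(1)]] by blast
    qed
  next
    assume i: "is_iso A1 B1 f1"
    show "is_iso A2 B2 f2"
    proof (rule is_isoI[OF A2 f2])
      fix c assume c: "c \<in> carrier A2" "f2 c = 0"
      then have "u c = 0" using comm v0 iso_kernel[OF A1 i hom_closed[OF u]] by simp
      then show "c = 0" using inj c by blast
    next
      fix b assume b: "b \<in> carrier B2"
      obtain a where "a \<in> carrier A1" "f1 a = v b" using iso_surj[OF i hom_closed[OF v b]] by blast
      then show "\<exists>x\<in>carrier A2. f2 x = b" using lift b by blast
    qed
  }
qed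

text \<open>For \<open>\<epsilon> = (-1) ^ n\<close>, the matrix of a cobordism whose second end is
  zero.\<close>

definition null_map :: "'r::ring_involution \<Rightarrow> ('r, 'm::ab_group_add) qcomplex \<Rightarrow> ('r, 'd::ab_group_add) lmodule
    \<Rightarrow> ('m \<Rightarrow> 'd) \<Rightarrow> (('d \<Rightarrow> 'r) \<Rightarrow> 'd) \<Rightarrow> 'm \<times> ('d \<Rightarrow> 'r) \<Rightarrow> 'm \<times> 'd" where
  "null_map \<epsilon> E D j \<delta> = (\<lambda>(x, t). (cd E x + codual_map (cbot E) (psi0 E) (dual_map (ctop E) j t),
     scale D (- \<epsilon>) (j x) + (\<delta> t + scale D (- \<epsilon>) (codual_map D \<delta> t))))"

definition is_null_cobordism :: "'r::ring_involution \<Rightarrow> ('r, 'm::ab_group_add) qcomplex \<Rightarrow>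
    ('r, 'd::ab_group_add) lmodule \<Rightarrow> ('m \<Rightarrow> 'd) \<Rightarrow> (('d \<Rightarrow> 'r) \<Rightarrow> 'd) \<Rightarrow> bool" where
  "is_null_cobordism \<epsilon> E D j \<delta> \<longleftrightarrow> fg_free D \<and> is_hom (ctop E) D j \<and> is_hom (dual D) D \<delta> \<and>
     is_iso (ctop E \<boxplus> dual D) (cbot E \<boxplus> D) (null_map \<epsilon> E D j \<delta>)"

lemma dual_map_add_apply:
  assumes "is_hom M D j" "is_hom M' D j'" "left_module M" "left_module M'" "g \<in> carrier (dual D)"
  shows "(\<lambda>x. dual_map (M \<boxplus> M') (\<lambda>(x, y). j x + j' y) g (x, 0)) = dual_map M j g"
    "(\<lambda>y. dual_map (M \<boxplus> M') (\<lambda>(x, y). j x + j' y) g (0, y)) = dual_map M' j' g"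
  using assms hom_zero[of M D j] hom_zero[of M' D j']
  by (auto simp: dual_map_def zero_outside_def fun_eq_iff left_module.zero_closed)

text \<open>The square of \<open>bicartesian_iso_iff\<close> consists of identities and of the
  duality map of \<open>C'\<close>: \<open>\<epsilon>\<close> times \<open>psi0\<close> on
  \<open>dual (cbot C')\<close> and minus the dual of \<open>psi0\<close> on
  \<open>dual (ctop C')\<close>. Exactness of the cone of \<open>C'\<close> makes it
  bicartesian.\<close>

lemma is_cobordism_iff_null:
  fixes C :: "('r::ring_involution, 'm::ab_group_add) qcomplex" and C' :: "('r, 'n::ab_group_add) qcomplex"
    and D :: "('r, 'd::ab_group_add) lmodule"
  assumes C: "is_qcomplex n C" and C': "is_qcomplex n C'" and D: "fg_free D"
    and j: "is_hom (ctop C) D j" and j': "is_hom (ctop C') D j'" and \<delta>: "is_hom (dual D) D \<delta>"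
  shows "is_cobordism n C C' D j j' \<delta> \<longleftrightarrow>
    is_null_cobordism ((-1) ^ n) (qcomplex_sum C (qcomplex_neg C')) D (\<lambda>(x, y). j x + j' y) \<delta>"
proof -
  define \<epsilon> :: 'r where "\<epsilon> = (-1) ^ n"
  have ex: "exact_complex n C" "exact_complex n C'" using C C' by (simp_all add: is_qcomplex_iff_exact)
  interpret C: qcomplex n C \<epsilon> by unfold_locales (use ex \<epsilon>_def in \<open>auto simp: exact_complex_def\<close>)
  interpret C': qcomplex n C' \<epsilon> by unfold_locales (use ex \<epsilon>_def in \<open>auto simp: exact_complex_def\<close>)
  note sign = C.sign
  let ?E = "qcomplex_sum C (qcomplex_neg C')"
  have E: "ctop ?E = C.T \<boxplus> C'.T" "cbot ?E = C.B \<boxplus> C'.B" "cd ?E = (\<lambda>(x, y). (C.d x, C'.d y))"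
    "psi0 ?E = (\<lambda>f. (C.p (\<lambda>x. f (x, 0)), - C'.p (\<lambda>y. f (0, y))))"
    by (simp_all add: qcomplex_sum_def qcomplex_neg_def)
  have EQ: "is_qcomplex n ?E" by (rule is_qcomplex_sum[OF C is_qcomplex_neg[OF C']])
  interpret E: qcomplex n ?E \<epsilon>
    by unfold_locales (use EQ is_qcomplex_pre \<epsilon>_def in auto)
  note mT = C.T_module C'.T_module
  have mD: "left_module D" by (rule fg_free_module[OF D])
  have mDD: "left_module (dual D)" by (rule left_module_dual[OF mD])
  interpret D: left_module D by (rule mD)
  interpret DD: left_module "dual D" by (rule mDD)
  let ?J = "\<lambda>(x, y). j x + j' y"
  have J: "is_hom (C.T \<boxplus> C'.T) D ?J"
    by (auto simp: is_hom_def hom_add[OF j] hom_add[OF j'] hom_scale[OF j] hom_scale[OF j']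
        hom_closed[OF j] hom_closed[OF j'] D.closed D.scale_add_right algebra_simps)
  have dj: "dual_map C.T j g \<in> carrier (dual C.T)" and dj': "dual_map C'.T j' g \<in> carrier (dual C'.T)"
    if "g \<in> carrier (dual D)" for g
    using dual_map_closed[OF C.T_module j that] dual_map_closed[OF C'.T_module j' that] by auto
  define w where "w g = \<delta> g + scale D (- \<epsilon>) (codual_map D \<delta> g)" for g
  have wh: "is_hom (dual D) D w"
    unfolding w_def
    by (rule hom_plus[OF mD \<delta> hom_sign[OF mD is_sign_minus[OF sign] codual_map_hom[OF D mD \<delta>]]])
  define f1 where "f1 = null_map \<epsilon> ?E D ?J \<delta>"
  have f1: "f1 ((x, x'), t) = ((C.d x + C.pd (dual_map C.T j t), C'.d x' - C'.pd (dual_map C'.T j' t)),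
      - scale D \<epsilon> (j x + j' x') + w t)"
    if "x \<in> carrier C.T" "x' \<in> carrier C'.T" "t \<in> carrier (dual D)" for x x' t
  proof -
    have c: "dual_map (C.T \<boxplus> C'.T) ?J t \<in> carrier (dual (C.T \<boxplus> C'.T))"
      by (rule dual_map_closed[OF left_module_dsum[OF mT] J that(3)])
    show ?thesis
      unfolding f1_def null_map_def E
      using codual_map_dsum(2)[OF C.B_free C'.B_free mT C.p_hom hom_uminus[OF C'.T_module C'.p_hom] c]
        dual_map_add_apply[OF j j' mT that(3)]
        codual_map_uminus[OF C'.B_free C'.T_module C'.p_hom dj'[OF that(3)]] that
      by (simp add: D.scale_minus_left D.closed hom_closed[OF j] hom_closed[OF j'] w_def)
  qed
  define f2 where "f2 = cobordism_map n C C' D j j' \<delta>"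
  have f2: "f2 (x, g, t) = (C.d x + C.pd (dual_map C.T j t), C'.dd g + dual_map C'.T j' t,
      - scale D \<epsilon> (j x) - j' (C'.p g) + w t)" if "x \<in> carrier C.T" for x g t
    using that by (simp add: f2_def cobordism_map_def w_def D.scale_minus_left hom_closed[OF j] \<epsilon>_def[symmetric])
  let ?A1 = "(C.T \<boxplus> C'.T) \<boxplus> dual D" and ?B1 = "(C.B \<boxplus> C'.B) \<boxplus> D"
    and ?A2 = "C.T \<boxplus> dual C'.B \<boxplus> dual D" and ?B2 = "C.B \<boxplus> dual C'.T \<boxplus> D"
  have mA1: "left_module ?A1" by (intro left_module_dsum mT mDD)
  have mA2: "left_module ?A2" by (intro left_module_dsum C.T_module C'.DB_module mDD)
  have mB2: "left_module ?B2" by (intro left_module_dsum C.B_module C'.DT_module mD)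
  define u where "u = (\<lambda>(x, g, t :: 'd \<Rightarrow> 'r). ((x :: 'm, scale C'.T \<epsilon> (C'.p g)), t))"
  define v where "v = (\<lambda>(y, f, z). ((y :: 'm, - C'.pd f), z :: 'd))"
  have uh: "is_hom ?A2 ?A1 u"
    using hom_sign[OF C'.T_module sign C'.p_hom] by (auto simp: is_hom_def u_def)
  have vh: "is_hom ?B2 ?B1 v"
    using hom_uminus[OF C'.B_module C'.pd_hom] by (auto simp: is_hom_def v_def)
  have p1: "is_hom ?A1 C.T (\<lambda>z. fst (fst z))" "is_hom ?A1 C'.T (\<lambda>z. snd (fst z))" "is_hom ?A1 (dual D) snd"
    and p2: "is_hom ?A2 C.T fst" "is_hom ?A2 (dual C'.B) (\<lambda>z. fst (snd z))" "is_hom ?A2 (dual D) (\<lambda>z. snd (snd z))"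
    by (auto simp: is_hom_def)
  note jd = hom_comp[OF dual_map_hom[OF C.T_module j] C.pd_hom]
    and jd' = hom_comp[OF dual_map_hom[OF C'.T_module j'] C'.pd_hom]
  have f1h: "is_hom ?A1 ?B1 f1"
  proof (rule hom_cong[OF _ mA1])
    show "is_hom ?A1 ?B1 (\<lambda>z. ((C.d (fst (fst z)) + C.pd (dual_map C.T j (snd z)),
        C'.d (snd (fst z)) - C'.pd (dual_map C'.T j' (snd z))),
        - scale D \<epsilon> (j (fst (fst z)) + j' (snd (fst z))) + w (snd z)))"
      by (intro hom_Pair hom_plus[OF C.B_module] hom_plus[OF mD] hom_subtract[OF C'.B_module]
          hom_uminus[OF mD] hom_sign[OF mD sign] hom_comp[OF p1(1) C.d_hom] hom_comp[OF p1(2) C'.d_hom]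
          hom_comp[OF p1(3) jd] hom_comp[OF p1(3) jd'] hom_comp[OF p1(1) j] hom_comp[OF p1(2) j'] hom_comp[OF p1(3) wh])
  qed (auto simp: f1)
  have f2h: "is_hom ?A2 ?B2 f2"
  proof (rule hom_cong[OF _ mA2])
    show "is_hom ?A2 ?B2 (\<lambda>z. (C.d (fst z) + C.pd (dual_map C.T j (snd (snd z))),
        C'.dd (fst (snd z)) + dual_map C'.T j' (snd (snd z)),
        - scale D \<epsilon> (j (fst z)) - j' (C'.p (fst (snd z))) + w (snd (snd z))))"
      by (intro hom_Pair hom_plus[OF C.B_module] hom_plus[OF C'.DT_module] hom_plus[OF mD] hom_subtract[OF mD]
          hom_uminus[OF mD] hom_sign[OF mD sign] hom_comp[OF p2(1) C.d_hom] hom_comp[OF p2(3) jd]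
          hom_comp[OF p2(2) C'.dd_hom] hom_comp[OF p2(3) dual_map_hom[OF C'.T_module j']]
          hom_comp[OF p2(1) j] hom_comp[OF p2(2) hom_comp[OF C'.p_hom j']] hom_comp[OF p2(3) wh])
  qed (auto simp: f2)
  have sT: "scale C'.T \<epsilon> (scale C'.T \<epsilon> x) = x" if "x \<in> carrier C'.T" for x
    using that by (simp add: C'.T.scale_scale sign_square[OF sign] C'.T.scale_one)
  have sB: "scale C'.B \<epsilon> (scale C'.B \<epsilon> x) = x" if "x \<in> carrier C'.B" for x
    using that by (simp add: C'.B.scale_scale sign_square[OF sign] C'.B.scale_one)
  have sD: "scale D \<epsilon> (scale D \<epsilon> x) = x" if "x \<in> carrier D" for x
    using that by (simp add: D.scale_scale sign_square[OF sign] D.scale_one)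
  have "is_iso ?A2 ?B2 f2 \<longleftrightarrow> is_iso ?A1 ?B1 f1"
  proof (rule bicartesian_iso_iff[OF mA1 mA2 f1h f2h uh vh mB2])
    fix a assume "a \<in> carrier ?A2"
    then obtain x g t where a: "a = (x, g, t)" "x \<in> carrier C.T" "g \<in> carrier (dual C'.B)" "t \<in> carrier (dual D)"
      by auto
    have x': "scale C'.T \<epsilon> (C'.p g) \<in> carrier C'.T" using a by (simp add: C'.T.closed C'.homs_closed)
    have "C'.d (scale C'.T \<epsilon> (C'.p g)) = - C'.pd (C'.dd g)"
      using a by (simp add: hom_scale[OF C'.d_hom] C'.homs_closed C'.d_psi0 C'.B.scale_minus_right C'.B.closed sB)
    moreover have "scale D \<epsilon> (j' (scale C'.T \<epsilon> (C'.p g))) = j' (C'.p g)"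
      using a by (simp add: hom_scale[OF j'] hom_closed[OF j'] C'.homs_closed sD)
    ultimately show "f1 (u a) = v (f2 a)"
      using a x' by (simp add: u_def v_def f1 f2 hom_add[OF C'.pd_hom] C'.homs_closed dj' D.scale_add_right
          hom_closed[OF j] hom_closed[OF j'])
  next
    fix a assume "a \<in> carrier ?A2" and 0: "u a = 0" "f2 a = 0"
    then obtain x g t where a: "a = (x, g, t)" "x \<in> carrier C.T" "g \<in> carrier (dual C'.B)" "t \<in> carrier (dual D)"
      by auto
    have x: "x = 0" "t = 0" and "scale C'.T \<epsilon> (C'.p g) = 0"
      using 0(1) by (simp_all add: a(1) u_def zero_prod_def)
    then have pg: "C'.p g = 0" using sT[of "C'.p g"] a by (simp add: C'.homs_closed)
    have "C'.dd g + dual_map C'.T j' 0 = 0"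
      using 0(2) a(2) by (simp add: a(1) f2 zero_prod_def x(2))
    then have "C'.dd g = 0" using hom_zero[OF mDD dual_map_hom[OF C'.T_module j']] by simp
    then have "g = 0"
      using exact_complexD(1)[OF ex(2) a(3)] pg by (simp add: cone_in_def zero_prod_def)
    then show "a = 0" using a(1) x by (simp add: zero_prod_def)
  next
    fix a b assume "a \<in> carrier ?A1" "b \<in> carrier ?B2" and eq: "f1 a = v b"
    then obtain x x' t y f z where a: "a = ((x, x'), t)" "x \<in> carrier C.T" "x' \<in> carrier C'.T" "t \<in> carrier (dual D)"
      and b: "b = (y, f, z)" "y \<in> carrier C.B" "f \<in> carrier (dual C'.T)" "z \<in> carrier D" by auto
    have y: "C.d x + C.pd (dual_map C.T j t) = y"
      and f: "C'.d x' - C'.pd (dual_map C'.T j' t) = - C'.pd f"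
      and z: "- scale D \<epsilon> (j x + j' x') + w t = z"
      using eq a(2-4) by (simp_all add: a(1) b(1) v_def f1)
    let ?f = "f - dual_map C'.T j' t"
    have fT: "?f \<in> carrier (dual C'.T)" by (rule C'.DT.diff_closed[OF b(3) dj'[OF a(4)]])
    have "C'.d x' = - C'.pd ?f"
      using f by (simp add: hom_diff[OF C'.DT_module C'.pd_hom b(3) dj'[OF a(4)]] algebra_simps)
    \<comment> \<open>Equality of the entries in \<open>C'.B\<close> puts this element into the
      kernel of \<open>cone_out\<close>; its preimage \<open>g\<close> under \<open>cone_in\<close>
      is the missing component of the lift.\<close>
    then have "cone_out n C' (scale C'.T \<epsilon> x', ?f) = 0"
      using a(3) fT by (simp add: C'.cone_out_eq hom_scale[OF C'.d_hom] C'.B.scale_minus_right C'.homs_closed)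
    then obtain g where g: "g \<in> carrier (dual C'.B)" "cone_in C' g = (scale C'.T \<epsilon> x', ?f)"
      using exact_complexD(2)[OF ex(2) C'.T.scale_closed[OF a(3)] fT] by blast
    have pg: "C'.p g = scale C'.T \<epsilon> x'" and ddg: "C'.dd g = ?f" using g(2) by (simp_all add: cone_in_def)
    have "- scale D \<epsilon> (j x) - j' (C'.p g) + w t = z"
      using z a by (simp add: pg hom_scale[OF j'] D.scale_add_right hom_closed[OF j] hom_closed[OF j'])
    then show "\<exists>c\<in>carrier ?A2. u c = a \<and> f2 c = b"
      by (intro bexI[of _ "(x, g, t)"] conjI) (use a b g(1) y in \<open>simp_all add: u_def f2 pg sT ddg\<close>)
  next
    fix y assume "y \<in> carrier ?B1"
    then obtain b b' z where y: "y = ((b, b'), z)" "b \<in> carrier C.B" "b' \<in> carrier C'.B" "z \<in> carrier D" by auto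
    obtain x f where xf: "x \<in> carrier C'.T" "f \<in> carrier (dual C'.T)" "cone_out n C' (x, f) = b'"
      using exact_complexD(3)[OF ex(2) y(3)] by blast
    have 0: "C.d 0 = 0" "C.pd (dual_map C.T j 0) = 0" "C'.pd (dual_map C'.T j' 0) = 0" "j 0 = 0" "w 0 = 0"
      using hom_zero[OF C.T_module C.d_hom] hom_zero[OF mDD jd] hom_zero[OF mDD jd'] hom_zero[OF C.T_module j]
        hom_zero[OF mDD wh] by auto
    \<comment> \<open>Through \<open>v\<close> the middle entry contributes the term that completes
      \<open>C'.d x\<close> to \<open>b'\<close>; the last entry compensates the term with
      \<open>j' x\<close> in \<open>f1\<close>.\<close>
    let ?b = "(b, - scale (dual C'.T) \<epsilon> f, z + scale D \<epsilon> (j' x))"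
    have "f1 ((0, x), 0) + v ?b = y"
      using xf y(2-4)
      by (simp add: f1 0 C.T.zero_closed DD.zero_closed y(1) v_def hom_minus[OF C'.DT_module C'.pd_hom]
          hom_scale[OF C'.pd_hom] C'.DT.closed C'.cone_out_eq del: scale_dual)
    moreover have "?b \<in> carrier ?B2"
      using xf y by (simp add: C'.DT.closed D.closed hom_closed[OF j'] del: scale_dual)
    moreover have "((0, x), 0) \<in> carrier ?A1" using xf by (simp add: C.T.zero_closed DD.zero_closed)
    ultimately show "\<exists>a\<in>carrier ?A1. \<exists>b\<in>carrier ?B2. y = f1 a + v b" by metis
  qed
  then show ?thesis
    unfolding is_cobordism_def is_null_cobordism_def
    using D j j' \<delta> J by (simp add: E f1_def f2_def \<epsilon>_def)
qed

text \<open>\<open>cobordant\<close> quantifies over modules in \<open>'r univ\<close>, whereas the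
  module built from a null formation lives over a product type. The matrix is composed with the
  isomorphisms that a change of \<open>D\<close> induces on \<open>D\<close> and on its
  dual.\<close>

lemma null_cobordism_transport:
  fixes D :: "('r::ring_involution, 'd::ab_group_add) lmodule" and E :: "('r, 'm::ab_group_add) qcomplex"
  assumes E: "fg_free (ctop E)" "left_module (cbot E)" and \<epsilon>: "is_sign \<epsilon>" and N: "is_null_cobordism \<epsilon> E D j \<delta>"
  obtains D' :: "('r, 'r univ) lmodule" and j' \<delta>' where "is_null_cobordism \<epsilon> E D' j' \<delta>'"
proof -
  have D: "fg_free D" and j: "is_hom (ctop E) D j" and \<delta>: "is_hom (dual D) D \<delta>"
    and iso: "is_iso (ctop E \<boxplus> dual D) (cbot E \<boxplus> D) (null_map \<epsilon> E D j \<delta>)"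
    using N by (simp_all add: is_null_cobordism_def)
  obtain k f where f: "is_iso (std_module k :: ('r, 'r univ) lmodule) D f"
    and D': "fg_free (std_module k :: ('r, 'r univ) lmodule)"
    by (rule iso_std_module[OF D])
  let ?D = "std_module k :: ('r, 'r univ) lmodule"
  have mD: "left_module D" and mD': "left_module ?D" and mT: "left_module (ctop E)"
    using D D' E fg_free_module by auto
  interpret D': left_module ?D by (rule mD')
  interpret D: left_module D by (rule mD)
  define w where "w = inv_into (carrier ?D) f"
  have wi: "is_iso D ?D w" unfolding w_def by (rule iso_inv[OF mD' f])
  note wh = iso_hom[OF wi]
  define t where "t = dual_map D w"
  have th: "is_hom (dual ?D) (dual D) t" unfolding t_def by (rule dual_map_hom[OF mD wh])
  have fw: "f (w x) = x" if "x \<in> carrier D" for x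
    using iso_bij[OF f] that by (auto simp: w_def bij_betw_def f_inv_into_f)
  have wf: "w (f x) = x" if "x \<in> carrier ?D" for x
    using iso_bij[OF f] that by (auto simp: w_def bij_betw_def)
  have ti: "is_iso (dual ?D) (dual D) t"
  proof (rule is_isoI[OF left_module_dual[OF mD'] th])
    fix g assume g: "g \<in> carrier (dual ?D)" "t g = 0"
    have "g x = 0" if x: "x \<in> carrier ?D" for x
      using fun_cong[OF g(2), of "f x"] hom_closed[OF iso_hom[OF f] x] wf[OF x] by (simp add: t_def)
    then show "g = 0"
      by (intro dual_eqI[OF g(1) left_module.zero_closed[OF left_module_dual[OF mD']]]) simp
  next
    fix g assume g: "g \<in> carrier (dual D)"
    show "\<exists>h\<in>carrier (dual ?D). t h = g"
    proof (rule bexI)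
      show c: "dual_map ?D f g \<in> carrier (dual ?D)" by (rule dual_map_closed[OF mD' iso_hom[OF f] g])
      show "t (dual_map ?D f g) = g"
        by (rule dual_eqI[OF hom_closed[OF th c] g]) (simp add: t_def hom_closed[OF wh] fw)
    qed
  qed
  define \<delta>' where "\<delta>' g = w (\<delta> (t g))" for g
  have \<delta>': "is_hom (dual ?D) ?D \<delta>'" unfolding \<delta>'_def by (rule hom_comp[OF hom_comp[OF th \<delta>] wh])
  have j': "is_hom (ctop E) ?D (\<lambda>x. w (j x))" by (rule hom_comp[OF j wh])
  have cod: "codual_map ?D \<delta>' g = w (codual_map D \<delta> (t g))" if g: "g \<in> carrier (dual ?D)" for g
  proof (rule codual_map_eqI[OF D' \<delta>' g])
    note tg = hom_closed[OF th g] note c = codual_map_closed[OF D \<delta> tg]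
    show "w (codual_map D \<delta> (t g)) \<in> carrier ?D" by (rule hom_closed[OF wh c])
    fix h assume h: "h \<in> carrier (dual ?D)"
    have "h (w (codual_map D \<delta> (t g))) = t h (codual_map D \<delta> (t g))" using c by (simp add: t_def)
    also have "\<dots> = bar (t g (\<delta> (t h)))" by (rule codual_map_apply[OF D \<delta> tg hom_closed[OF th h]])
    also have "\<dots> = bar (g (\<delta>' h))" using hom_closed[OF \<delta> hom_closed[OF th h]] by (simp add: t_def \<delta>'_def)
    finally show "h (w (codual_map D \<delta> (t g))) = bar (g (\<delta>' h))" .
  qed
  have dj: "dual_map (ctop E) (\<lambda>x. w (j x)) g = dual_map (ctop E) j (t g)" for g
    by (auto simp: dual_map_def zero_outside_def t_def fun_eq_iff hom_closed[OF j])
  have "is_iso (ctop E \<boxplus> dual ?D) (cbot E \<boxplus> ?D)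
      (\<lambda>z. (\<lambda>(x, y). (x, w y)) (null_map \<epsilon> E D j \<delta> ((\<lambda>(x, g). (x, t g)) z)))"
  proof (rule iso_comp[OF iso_comp[OF _ iso]])
    have id: "is_iso M M (\<lambda>x. x)" for M :: "('r, 'x::ab_group_add) lmodule"
      by (auto simp: is_iso_def is_hom_def bij_betw_def)
    show "is_iso (ctop E \<boxplus> dual ?D) (ctop E \<boxplus> dual D) (\<lambda>(x, g). (x, t g))" by (rule iso_dsum[OF id ti])
    show "is_iso (cbot E \<boxplus> D) (cbot E \<boxplus> ?D) (\<lambda>(x, y). (x, w y))" by (rule iso_dsum[OF id wi])
  qed
  moreover have "(\<lambda>(x, y). (x, w y)) (null_map \<epsilon> E D j \<delta> ((\<lambda>(x, g). (x, t g)) z)) = null_map \<epsilon> E ?D (\<lambda>x. w (j x)) \<delta>' z"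
    if "z \<in> carrier (ctop E \<boxplus> dual ?D)" for z
  proof -
    obtain x g where z: "z = (x, g)" "x \<in> carrier (ctop E)" "g \<in> carrier (dual ?D)" using \<open>z \<in> _\<close> by auto
    note c = codual_map_closed[OF D \<delta> hom_closed[OF th z(3)]]
    show ?thesis
      using z(2,3) c
      by (simp add: z(1) null_map_def dj cod \<delta>'_def hom_add[OF wh] hom_scale[OF wh] hom_closed[OF j]
          hom_closed[OF \<delta>] hom_closed[OF th] D.closed)
  qed
  ultimately have "is_iso (ctop E \<boxplus> dual ?D) (cbot E \<boxplus> ?D) (null_map \<epsilon> E ?D (\<lambda>x. w (j x)) \<delta>')"
    by (rule iso_cong[OF _ left_module_dsum[OF mT left_module_dual[OF mD']]])
  then have "is_null_cobordism \<epsilon> E ?D (\<lambda>x. w (j x)) \<delta>'"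
    using D' j' \<delta>' by (simp add: is_null_cobordism_def)
  then show ?thesis by (rule that)
qed

text \<open>A null cobordism is a lagrangian complementary to \<open>dual (ctop E) \<oplus> D\<close> and to
  \<open>G \<oplus> dual D\<close>, where \<open>G\<close> is the second lagrangian of the formation of \<open>E\<close>; the first lagrangian
  \<open>ctop E\<close> is recovered from its complement \<open>dual (ctop E)\<close> by a swap.\<close>

lemma null_cobordism_null_formation:
  fixes E :: "('r::ring_involution, 'm::ab_group_add) qcomplex" and D :: "('r, 'd::ab_group_add) lmodule"
  assumes EQ: "is_qcomplex n E" and N: "is_null_cobordism ((-1) ^ n) E D j \<delta>"
  shows "null_formation ((-1) ^ n) (formation_of n E)"
proof -
  define \<epsilon> :: 'r where "\<epsilon> = (-1) ^ n"
  have ex: "exact_complex n E" using EQ by (simp add: is_qcomplex_iff_exact)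
  interpret E: qcomplex n E \<epsilon> by unfold_locales (use ex \<epsilon>_def in \<open>auto simp: exact_complex_def\<close>)
  note sign = E.sign
  have D: "fg_free D" and j: "is_hom E.T D j" and \<delta>: "is_hom (dual D) D \<delta>"
    and iso: "is_iso (E.T \<boxplus> dual D) (E.B \<boxplus> D) (null_map \<epsilon> E D j \<delta>)"
    using N by (simp_all add: is_null_cobordism_def \<epsilon>_def)
  have mD: "left_module D" by (rule fg_free_module[OF D])
  have mDD: "left_module (dual D)" by (rule left_module_dual[OF mD])
  interpret D: left_module D by (rule mD)
  interpret DD: left_module "dual D" by (rule mDD)
  let ?G = "cone_in E ` carrier (dual E.B)" and ?TH = "{0} \<times> carrier (dual E.T)" and ?T0 = "carrier E.T \<times> {0}"
  let ?HT = "hyperbolic \<epsilon> E.T" and ?HD = "hyperbolic \<epsilon> D"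
  let ?Y = "\<lparr>qf = ?HT, lag1 = ?TH, lag2 = ?G\<rparr>"
  have FE: "is_formation \<epsilon> \<lparr>qf = ?HT, lag1 = ?T0, lag2 = ?G\<rparr>"
    using is_formation_of[OF EQ] by (simp add: formation_of_eq \<epsilon>_def)
  note FD = is_formationD[OF FE, simplified]
  note L = hyperbolic_lagrangians[OF E.T_free sign]
  have Y: "is_formation \<epsilon> ?Y" using FD L by (simp add: is_formation_form)
  have TD: "trivial_formation \<epsilon> (hyperbolic_formation \<epsilon> D)" by (rule trivial_hyperbolic[OF D sign])
  let ?M = "(E.T \<boxplus> dual E.T) \<boxplus> (D \<boxplus> dual D)"
  have mM: "left_module ?M" by (intro left_module_dsum E.cone_module mD mDD)
  have mS: "left_module (E.T \<boxplus> dual D)" by (rule left_module_dsum[OF E.T_module mDD])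
  define w where "w g = \<delta> g + scale D (- \<epsilon>) (codual_map D \<delta> g)" for g
  have wh: "is_hom (dual D) D w"
    unfolding w_def
    by (rule hom_plus[OF mD \<delta> hom_sign[OF mD is_sign_minus[OF sign] codual_map_hom[OF D mD \<delta>]]])
  define a where "a t = scale (dual E.T) \<epsilon> (dual_map E.T j t)" for t
  have ah: "is_hom (dual D) (dual E.T) a"
    unfolding a_def by (rule hom_sign[OF E.DT_module sign dual_map_hom[OF E.T_module j]])
  have a_apply: "a t x = \<epsilon> * t (j x)" if "x \<in> carrier E.T" for t x
    using that sign by (auto simp: a_def is_sign_def bar_simps)
  define b where "b x t = - scale D \<epsilon> (j x) + w t" for x t
  \<comment> \<open>The complement is a graph over \<open>E.T \<boxplus> dual D\<close>:
    \<open>a\<close> is \<open>\<epsilon>\<close> times the dual of \<open>j\<close>, the sign that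
    makes the graph isotropic, and \<open>b\<close> is the last row of
    \<open>null_map\<close>.\<close>
  define s where "s = (\<lambda>(x, t). ((x, a t), (b x t, t)))"
  have sh: "is_hom (E.T \<boxplus> dual D) ?M s"
  proof -
    have q: "is_hom (E.T \<boxplus> dual D) E.T fst" "is_hom (E.T \<boxplus> dual D) (dual D) snd" by (auto simp: is_hom_def)
    have "is_hom (E.T \<boxplus> dual D) ?M (\<lambda>z. ((fst z, a (snd z)), (- scale D \<epsilon> (j (fst z)) + w (snd z), snd z)))"
      by (intro hom_Pair q hom_comp[OF q(2) ah] hom_plus[OF mD] hom_uminus[OF mD] hom_sign[OF mD sign]
          hom_comp[OF q(1) j] hom_comp[OF q(2) wh])
    moreover have "s = (\<lambda>z. ((fst z, a (snd z)), (- scale D \<epsilon> (j (fst z)) + w (snd z), snd z)))"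
      by (auto simp: s_def b_def fun_eq_iff)
    ultimately show ?thesis by (simp only:)
  qed
  let ?H = "s ` carrier (E.T \<boxplus> dual D)"
  have Hsub: "is_submodule ?M ?H"
    by (rule submodule_image[OF mS mM sh submodule_trivial(2)[OF mS]])
  have HE: "\<exists>x\<in>carrier E.T. \<exists>t\<in>carrier (dual D). z = ((x, a t), (b x t, t))" if "z \<in> ?H" for z
    using that by (auto simp: s_def)
  have HI: "((x, a t), (b x t, t)) \<in> ?H" if "x \<in> carrier E.T" "t \<in> carrier (dual D)" for x t
    by (rule image_eqI[of _ _ "(x, t)"]) (use that in \<open>simp_all add: s_def\<close>)
  have ac: "a t \<in> carrier (dual E.T)" if "t \<in> carrier (dual D)" for t by (rule hom_closed[OF ah that])
  have bc: "b x t \<in> carrier D" if "x \<in> carrier E.T" "t \<in> carrier (dual D)" for x t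
    using that by (simp add: b_def D.closed hom_closed[OF j] hom_closed[OF wh])
  \<comment> \<open>Modulo \<open>?G\<close> and \<open>dual D\<close>, an element of the ambient
    module is given by its value under \<open>cone_out\<close> and its component in
    \<open>D\<close>. On the graph these two form \<open>null_map\<close>, so bijectivity of
    \<open>null_map\<close> is complementarity to the second lagrangian.\<close>
  have out: "null_map \<epsilon> E D j \<delta> (x, t) = (cone_out n E (x, a t), b x t)"
    if "x \<in> carrier E.T" "t \<in> carrier (dual D)" for x t
  proof -
    have dj: "dual_map E.T j t \<in> carrier (dual E.T)" by (rule dual_map_closed[OF E.T_module j that(2)])
    have "scale E.B \<epsilon> (E.pd (a t)) = E.pd (dual_map E.T j t)"
      using dj by (simp add: a_def hom_scale[OF E.pd_hom] E.B.scale_scale E.homs_closed sign_square[OF sign]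
          E.B.scale_one del: scale_dual)
    then show ?thesis
      using that by (simp add: null_map_def E.cone_out_eq b_def w_def D.scale_minus_left hom_closed[OF j])
  qed
  have b0: "b 0 0 = 0" and a0: "a 0 = 0"
    using hom_zero[OF E.T_module j] hom_zero[OF mDD wh] hom_zero[OF mDD ah] by (simp_all add: b_def)
  have tb: "t (b x t') = - (\<epsilon> * t (j x)) + (t (\<delta> t') - \<epsilon> * bar (t' (\<delta> t)))"
    if "x \<in> carrier E.T" "t \<in> carrier (dual D)" "t' \<in> carrier (dual D)" for x t t'
  proof -
    note c = codual_map_closed[OF D \<delta> that(3)] hom_closed[OF \<delta> that(3)] hom_closed[OF j that(1)]
    show ?thesis
      unfolding b_def w_def
        dual_add[OF that(2) D.uminus_closed[OF D.scale_closed[OF c(3)]] D.add_closed[OF c(2) D.scale_closed[OF c(1)]]]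
        dual_add[OF that(2) c(2) D.scale_closed[OF c(1)]] dual_minus[OF mD that(2) D.scale_closed[OF c(3)]]
        dual_scale[OF that(2) c(3)] dual_scale[OF that(2) c(1)] codual_map_apply[OF D \<delta> that(3,2)]
      by simp
  qed
  have c1: "complementary ?M ?H (?TH \<times> (carrier D \<times> {0}))"
  proof (rule complementaryI[OF mM Hsub])
    show "is_submodule ?M (?TH \<times> (carrier D \<times> {0}))"
      by (intro submodule_dsum E.cone_module left_module_dsum mD mDD E.T_module E.DT_module
          submodule_trivial[OF E.T_module] submodule_trivial[OF E.DT_module] submodule_trivial[OF mD] submodule_trivial[OF mDD])
    fix z assume "z \<in> ?H" "z \<in> ?TH \<times> (carrier D \<times> {0})"
    then obtain t where "z = ((0, a t), (b 0 t, t))" "t = 0" using HE by fastforce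
    then show "z = 0" by (simp add: a0 b0 zero_prod_def)
  next
    fix z assume "z \<in> carrier ?M"
    then obtain x f y t where z: "z = ((x, f), (y, t))" "x \<in> carrier E.T" "f \<in> carrier (dual E.T)"
      "y \<in> carrier D" "t \<in> carrier (dual D)" by auto
    have "z = ((x, a t), (b x t, t)) + ((0, f - a t), (y - b x t, 0))" by (simp add: z(1))
    moreover have "((0, f - a t), (y - b x t, 0)) \<in> ?TH \<times> (carrier D \<times> {0})"
      using z ac bc by (simp add: E.DT.diff_closed D.diff_closed)
    ultimately show "\<exists>h\<in>?H. \<exists>l\<in>?TH \<times> (carrier D \<times> {0}). z = h + l" using HI[OF z(2,5)] by blast
  qed
  have c2: "complementary ?M ?H (?G \<times> ({0} \<times> carrier (dual D)))"
  proof (rule complementaryI[OF mM Hsub])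
    show "is_submodule ?M (?G \<times> ({0} \<times> carrier (dual D)))"
      by (intro submodule_dsum E.cone_module left_module_dsum mD mDD submodule_trivial[OF mD] submodule_trivial[OF mDD]
          submodule_image[OF E.DB_module E.cone_module E.cone_in_hom submodule_trivial(2)[OF E.DB_module]])
    fix z assume "z \<in> ?H" and z: "z \<in> ?G \<times> ({0} \<times> carrier (dual D))"
    then obtain x t where xt: "x \<in> carrier E.T" "t \<in> carrier (dual D)" "z = ((x, a t), (b x t, t))" using HE by blast
    then have "(x, a t) \<in> ?G" "b x t = 0" using z by auto
    then have "null_map \<epsilon> E D j \<delta> (x, t) = 0"
      using out[OF xt(1,2)] E.cone_out_in by (auto simp: zero_prod_def)
    then have "(x, t) = 0" by (rule iso_kernel[OF mS iso, rotated]) (use xt in simp)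
    then show "z = 0" using xt(3) by (simp add: zero_prod_def a0 b0)
  next
    fix z assume "z \<in> carrier ?M"
    then obtain x f y t where z: "z = ((x, f), (y, t))" "x \<in> carrier E.T" "f \<in> carrier (dual E.T)"
      "y \<in> carrier D" "t \<in> carrier (dual D)" by auto
    have "(cone_out n E (x, f), y) \<in> carrier (E.B \<boxplus> D)"
      using hom_closed[OF E.cone_out_hom, of "(x, f)"] z by simp
    then obtain q where "q \<in> carrier (E.T \<boxplus> dual D)" "null_map \<epsilon> E D j \<delta> q = (cone_out n E (x, f), y)"
      using iso_surj[OF iso] by blast
    then obtain x0 t0 where xt: "x0 \<in> carrier E.T" "t0 \<in> carrier (dual D)"
      "cone_out n E (x0, a t0) = cone_out n E (x, f)" "b x0 t0 = y"
      using out by auto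
    have "cone_out n E ((x, f) - (x0, a t0)) = 0"
      by (subst hom_diff[OF E.cone_module E.cone_out_hom]) (use z xt ac in simp_all)
    then obtain g where g: "g \<in> carrier (dual E.B)" "cone_in E g = (x - x0, f - a t0)"
      using exact_complexD(2)[OF ex E.T.diff_closed[OF z(2) xt(1)] E.DT.diff_closed[OF z(3) ac[OF xt(2)]]] by auto
    have "z = ((x0, a t0), (b x0 t0, t0)) + (cone_in E g, (0, t - t0))"
      by (simp add: z(1) g(2) xt(4))
    moreover have "(cone_in E g, (0, t - t0)) \<in> ?G \<times> ({0} \<times> carrier (dual D))"
      using g(1) z xt by (simp add: DD.diff_closed)
    ultimately show "\<exists>h\<in>?H. \<exists>l\<in>?G \<times> ({0} \<times> carrier (dual D)). z = h + l" using HI[OF xt(1,2)] by blast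
  qed
  have m: "mu (form_sum ?HT ?HD) z = Qcls \<epsilon> 0" if "z \<in> ?H" for z
  proof -
    obtain x t where xt: "x \<in> carrier E.T" "t \<in> carrier (dual D)" "z = ((x, a t), (b x t, t))" using HE \<open>z \<in> ?H\<close> by blast
    have "mu (form_sum ?HT ?HD) z = Qcls \<epsilon> (a t x + t (b x t))" using xt(3) by (simp add: Qcls_add)
    \<comment> \<open>The two terms with \<open>j x\<close> cancel; the rest is
      \<open>t (\<delta> t)\<close> minus \<open>\<epsilon>\<close> times its conjugate.\<close>
    also have "a t x + t (b x t) = t (\<delta> t) - \<epsilon> * bar (t (\<delta> t))"
      using tb[OF xt(1,2,2)] a_apply[OF xt(1)] by simp
    also have "Qcls \<epsilon> \<dots> = Qcls \<epsilon> 0" unfolding Qcls_eq_iff by auto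
    finally show ?thesis .
  qed
  have l: "lam (form_sum ?HT ?HD) z z' = 0" if "z \<in> ?H" "z' \<in> ?H" for z z'
  proof -
    obtain x t where xt: "x \<in> carrier E.T" "t \<in> carrier (dual D)" "z = ((x, a t), (b x t, t))" using HE \<open>z \<in> ?H\<close> by blast
    obtain x' t' where xt': "x' \<in> carrier E.T" "t' \<in> carrier (dual D)" "z' = ((x', a t'), (b x' t', t'))" using HE \<open>z' \<in> ?H\<close> by blast
    have "lam (form_sum ?HT ?HD) z z' = (a t x' + \<epsilon> * bar (a t' x)) + (t (b x' t') + \<epsilon> * bar (t' (b x t)))"
      using xt xt' ac bc by simp
    also have "\<dots> = 0"
      unfolding a_apply[OF xt(1)] a_apply[OF xt'(1)] tb[OF xt'(1) xt(2) xt'(2)] tb[OF xt(1) xt'(2) xt(2)]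
      using sign by (auto simp: is_sign_def bar_simps)
    finally show ?thesis .
  qed
  have "common_complement \<epsilon> (formation_sum ?Y (hyperbolic_formation \<epsilon> D))"
    unfolding common_complement_def
    by (intro exI[of _ ?H] conjI ballI) (simp_all only: formation_sum_simps hyperbolic_formation_def
        formation.select_convs form_sum_simps(1) hyperbolic_simps(1) c1 c2 m l)
  then have n: "null_formation \<epsilon> ?Y" by (rule null_formationI[OF sign Y TD])
  note F = is_formation_sum[OF _ _ sign] Y FE is_formation_zero[OF sign]
  let ?Z = "zero_formation \<epsilon>"
  have nZ: "null_formation \<epsilon> (formation_sum ?Z ?Y)"
    by (rule null_formation_sum[OF sign is_formation_zero[OF sign]
          null_formation_trivial[OF sign trivial_zero[OF sign]] Y n])
  have cT: "complementary (fmod ?HT) ?TH ?T0"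
    using complementary_sym[OF hyperbolic_complementary[OF E.T_module]] by simp
  have "null_formation \<epsilon> (formation_sum ?Z \<lparr>qf = ?HT, lag1 = ?T0, lag2 = ?G\<rparr>)"
    by (rule null_formation_swap1(2)[OF sign is_formation_zero[OF sign] Y L(1) cT nZ])
  then have "null_formation \<epsilon> (formation_sum \<lparr>qf = ?HT, lag1 = ?T0, lag2 = ?G\<rparr> ?Z)"
    by (rule null_formation_iso[OF sign _ formation_sum_commute]) (simp_all add: F)
  then show ?thesis
    unfolding formation_of_eq \<epsilon>_def[symmetric]
    by (rule null_formation_cancel_trivial[OF sign FE trivial_zero[OF sign]])
qed

text \<open>Let \<open>D\<close> be \<open>ctop E \<boxplus> L\<close>, the first lagrangian of the
  stabilised formation, and \<open>j\<close> the inclusion of \<open>ctop E\<close>. A common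
  complement is a graph over the dual of \<open>D\<close>, hence an operator \<open>\<Delta>\<close>
  from \<open>dual D\<close> to \<open>D\<close>. Isotropy makes \<open>\<Delta>\<close> even, which
  yields \<open>\<delta>\<psi>\<close>; complementarity to the second lagrangian makes the matrix an
  isomorphism.\<close>

lemma null_formation_null_cobordism:
  fixes E :: "('r::ring_involution, 'm::ab_group_add) qcomplex"
  assumes EQ: "is_qcomplex n E" and N: "null_formation ((-1) ^ n) (formation_of n E)"
  obtains D :: "('r, 'r univ) lmodule" and j \<delta> where "is_null_cobordism ((-1) ^ n) E D j \<delta>"
proof -
  define \<epsilon> :: 'r where "\<epsilon> = (-1) ^ n"
  have ex: "exact_complex n E" using EQ by (simp add: is_qcomplex_iff_exact)
  interpret E: qcomplex n E \<epsilon> by unfold_locales (use ex \<epsilon>_def in \<open>auto simp: exact_complex_def\<close>)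
  note sign = E.sign
  have FE: "is_formation \<epsilon> (formation_of n E)" using is_formation_of[OF EQ] by (simp add: \<epsilon>_def)
  obtain T :: "('r, 'r univ) formation" where T: "trivial_formation \<epsilon> T"
    "common_complement \<epsilon> (formation_sum (formation_of n E) T)"
    using N by (auto simp: null_formation_def \<epsilon>_def)
  obtain L :: "('r, 'r univ) lmodule" where L: "fg_free L" "formation_isomorphic T (hyperbolic_formation \<epsilon> L)"
    using T(1) by (auto simp: trivial_formation_def hyperbolic_formation_def)
  have cc: "common_complement \<epsilon> (formation_sum (formation_of n E) (hyperbolic_formation \<epsilon> L))"
    by (rule common_complement_iso[OF T(2) formation_isomorphic_sum[OF formation_isomorphic_refl L(2)]])
      (simp_all add: is_formation_sum FE trivial_formation[OF T(1)] sign is_formation_hyperbolic L(1))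
  have mL: "left_module L" by (rule fg_free_module[OF L(1)])
  have mDL: "left_module (dual L)" by (rule left_module_dual[OF mL])
  interpret L: left_module L by (rule mL)
  interpret DL: left_module "dual L" by (rule mDL)
  let ?M = "(E.T \<boxplus> dual E.T) \<boxplus> (L \<boxplus> dual L)" and ?G = "cone_in E ` carrier (dual E.B)"
  let ?Q = "form_sum (hyperbolic \<epsilon> E.T) (hyperbolic \<epsilon> L)"
  have mM: "left_module ?M" by (intro left_module_dsum E.cone_module mL mDL)
  interpret M: left_module ?M by (rule mM)
  obtain H where H1: "complementary ?M H ((carrier E.T \<times> {0}) \<times> (carrier L \<times> {0}))"
    and H2: "complementary ?M H (?G \<times> ({0} \<times> carrier (dual L)))"
    and Hmu: "\<forall>z\<in>H. mu ?Q z = Qcls \<epsilon> 0" and Hlam: "\<forall>z\<in>H. \<forall>w\<in>H. lam ?Q z w = 0"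
    using cc unfolding common_complement_def
    by (simp only: formation_sum_simps formation_of_eq hyperbolic_formation_def formation.select_convs
        form_sum_simps(1) hyperbolic_simps(1) \<epsilon>_def[symmetric]) blast
  note C1 = complementaryD[OF H1] and C2 = complementaryD[OF H2]
  have HM: "z \<in> carrier ?M" if "z \<in> H" for z using C1(1) that M.submodule_subset by blast
  have HS: "0 \<in> H" "\<And>x y. x \<in> H \<Longrightarrow> y \<in> H \<Longrightarrow> x + y \<in> H" "\<And>a x. x \<in> H \<Longrightarrow> scale ?M a x \<in> H"
    "\<And>x y. x \<in> H \<Longrightarrow> y \<in> H \<Longrightarrow> x - y \<in> H"
    using M.submodule_zero[OF C1(1)] M.submodule_add[OF C1(1)] M.submodule_scale[OF C1(1)] M.submodule_diff[OF C1(1)]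
    by blast+
  \<comment> \<open>The difference of two such elements lies in the first lagrangian, hence
    vanishes: \<open>H\<close> is a graph over the duals.\<close>
  have uniq: "x = x' \<and> y = y'" if "((x, f), (y, t)) \<in> H" "((x', f), (y', t)) \<in> H" for x f y t x' y'
  proof -
    have h: "((x - x', 0), (y - y', 0)) \<in> H" using HS(4)[OF that] by simp
    then have "((x - x', 0), (y - y', 0)) \<in> (carrier E.T \<times> {0}) \<times> (carrier L \<times> {0})" using HM by force
    then have "((x - x', 0 :: 'm \<Rightarrow> 'r), (y - y', 0 :: 'r univ \<Rightarrow> 'r)) = 0" using C1(3)[OF h] by blast
    then show ?thesis by (simp add: zero_prod_def)
  qed
  have "\<exists>x y. ((x, f), (y, t)) \<in> H" if "f \<in> carrier (dual E.T)" "t \<in> carrier (dual L)" for f t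
  proof -
    have "((0, f), (0, t)) \<in> carrier ?M" using that by (simp add: E.T.zero_closed L.zero_closed)
    then obtain h l where hl: "h \<in> H" "l \<in> (carrier E.T \<times> {0}) \<times> (carrier L \<times> {0})" "((0, f), (0, t)) = h + l"
      using C1(4) by blast
    obtain x y where l: "l = ((x, 0), (y, 0))" using hl(2) by auto
    have "h = ((- x, f), (- y, t))" using hl(3) unfolding l by (cases h) (auto simp: eq_neg_iff_add_eq_0)
    then show ?thesis using hl(1) by blast
  qed
  then obtain \<delta>1 \<delta>2 where \<delta>: "\<And>f t. f \<in> carrier (dual E.T) \<Longrightarrow> t \<in> carrier (dual L) \<Longrightarrow>
      ((\<delta>1 f t, f), (\<delta>2 f t, t)) \<in> H" by metis
  let ?D = "E.T \<boxplus> L"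
  note mm = E.T_module mL
  have D: "fg_free ?D" by (rule fg_free_dsum[OF E.T_free L(1)])
  have mD: "left_module ?D" by (rule left_module_dsum[OF mm])
  interpret D: left_module ?D by (rule mD)
  interpret DD: left_module "dual ?D" by (rule left_module_dual[OF mD])
  define \<Delta> where "\<Delta> \<phi> = (\<delta>1 (\<lambda>x. \<phi> (x, 0)) (\<lambda>y. \<phi> (0, y)), \<delta>2 (\<lambda>x. \<phi> (x, 0)) (\<lambda>y. \<phi> (0, y)))" for \<phi>
  have \<Delta>H: "((fst (\<Delta> \<phi>), \<lambda>x. \<phi> (x, 0)), (snd (\<Delta> \<phi>), \<lambda>y. \<phi> (0, y))) \<in> H" if "\<phi> \<in> carrier (dual ?D)" for \<phi>
    using \<delta>[OF dual_fst[OF mm that] dual_snd[OF mm that]] by (simp add: \<Delta>_def)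
  have \<Delta>eq: "\<Delta> \<phi> = (x, y)" if "\<phi> \<in> carrier (dual ?D)" "((x, \<lambda>x. \<phi> (x, 0)), (y, \<lambda>y. \<phi> (0, y))) \<in> H" for \<phi> x y
    using uniq[OF \<Delta>H[OF that(1)] that(2)] by (simp add: prod_eq_iff)
  have \<Delta>c: "\<Delta> \<phi> \<in> carrier ?D" if "\<phi> \<in> carrier (dual ?D)" for \<phi>
    using HM[OF \<Delta>H[OF that]] by (simp add: mem_Times_iff)
  have \<Delta>h: "is_hom (dual ?D) ?D \<Delta>"
  proof (rule is_homI)
    fix \<phi> \<psi> assume \<phi>: "\<phi> \<in> carrier (dual ?D)" and \<psi>: "\<psi> \<in> carrier (dual ?D)"
    have "\<Delta> (\<phi> + \<psi>) = (fst (\<Delta> \<phi>) + fst (\<Delta> \<psi>), snd (\<Delta> \<phi>) + snd (\<Delta> \<psi>))"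
      by (rule \<Delta>eq[OF DD.add_closed[OF \<phi> \<psi>]])
        (use HS(2)[OF \<Delta>H[OF \<phi>] \<Delta>H[OF \<psi>]] in \<open>simp add: plus_fun_def\<close>)
    then show "\<Delta> (\<phi> + \<psi>) = \<Delta> \<phi> + \<Delta> \<psi>" by (simp add: prod_eq_iff)
  next
    fix r \<phi> assume \<phi>: "\<phi> \<in> carrier (dual ?D)"
    have e: "scale (dual M) r f = (\<lambda>x. f x * bar r)" for M :: "('r, 'x::ab_group_add) lmodule" and f
      by (simp add: fun_eq_iff)
    have "\<Delta> (scale (dual ?D) r \<phi>) = (scale E.T r (fst (\<Delta> \<phi>)), scale L r (snd (\<Delta> \<phi>)))"
      by (rule \<Delta>eq[OF DD.scale_closed[OF \<phi>]]) (use HS(3)[OF \<Delta>H[OF \<phi>], of r] in \<open>simp add: e\<close>)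
    then show "\<Delta> (scale (dual ?D) r \<phi>) = scale ?D r (\<Delta> \<phi>)" by (cases "\<Delta> \<phi>") simp
  qed (rule \<Delta>c)
  have ap: "\<phi> (\<Delta> \<psi>) = \<phi> (fst (\<Delta> \<psi>), 0) + \<phi> (0, snd (\<Delta> \<psi>))"
    if "\<phi> \<in> carrier (dual ?D)" "\<psi> \<in> carrier (dual ?D)" for \<phi> \<psi>
    using dual_split[OF mm that(1), of "fst (\<Delta> \<psi>)" "snd (\<Delta> \<psi>)"] \<Delta>c[OF that(2)] by (simp add: mem_Times_iff)
  let ?l = "\<lambda>\<phi> \<psi>. \<phi> (\<Delta> \<psi>)"
  have l: "sesquilinear (dual ?D) ?l"
    unfolding sesquilinear_def
    by (simp add: hom_add[OF \<Delta>h] hom_scale[OF \<Delta>h] dual_add[of _ ?D] dual_scale[of _ ?D] \<Delta>c del: carrier_dsum)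
  have sym: "?l \<phi> \<psi> = - \<epsilon> * bar (?l \<psi> \<phi>)" if \<phi>: "\<phi> \<in> carrier (dual ?D)" and \<psi>: "\<psi> \<in> carrier (dual ?D)" for \<phi> \<psi>
  proof -
    have "0 = lam ?Q ((fst (\<Delta> \<phi>), \<lambda>x. \<phi> (x, 0)), (snd (\<Delta> \<phi>), \<lambda>y. \<phi> (0, y)))
        ((fst (\<Delta> \<psi>), \<lambda>x. \<psi> (x, 0)), (snd (\<Delta> \<psi>), \<lambda>y. \<psi> (0, y)))"
      using Hlam \<Delta>H[OF \<phi>] \<Delta>H[OF \<psi>] by metis
    also have "\<dots> = (\<phi> (fst (\<Delta> \<psi>), 0) + \<epsilon> * bar (\<psi> (fst (\<Delta> \<phi>), 0))) + (\<phi> (0, snd (\<Delta> \<psi>)) + \<epsilon> * bar (\<psi> (0, snd (\<Delta> \<phi>))))"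
      using dual_fst[OF mm \<psi>] dual_snd[OF mm \<psi>] \<Delta>c[OF \<psi>] by (simp add: mem_Times_iff)
    also have "\<dots> = ?l \<phi> \<psi> + \<epsilon> * bar (?l \<psi> \<phi>)"
      unfolding ap[OF \<phi> \<psi>] ap[OF \<psi> \<phi>] by (simp add: bar_add distrib_left)
    finally show ?thesis by (simp add: eq_neg_iff_add_eq_0)
  qed
  have even: "\<exists>c. ?l \<phi> \<phi> = c + - \<epsilon> * bar c" if \<phi>: "\<phi> \<in> carrier (dual ?D)" for \<phi>
  proof -
    have "Qcls \<epsilon> (\<phi> (fst (\<Delta> \<phi>), 0) + \<phi> (0, snd (\<Delta> \<phi>))) = Qcls \<epsilon> 0"
      using Hmu[rule_format, OF \<Delta>H[OF \<phi>]] by (simp add: Qcls_add)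
    then show ?thesis unfolding ap[OF \<phi> \<phi>, symmetric] by (auto simp: Qcls_eq_iff)
  qed
  obtain \<chi> where \<chi>: "sesquilinear (dual ?D) \<chi>"
    "\<And>\<phi> \<psi>. \<phi> \<in> carrier (dual ?D) \<Longrightarrow> \<psi> \<in> carrier (dual ?D) \<Longrightarrow> ?l \<phi> \<psi> = \<chi> \<phi> \<psi> + - \<epsilon> * bar (\<chi> \<psi> \<phi>)"
  proof -
    define m :: "('m \<times> 'r univ \<Rightarrow> 'r) \<Rightarrow> ('m \<times> 'r univ \<Rightarrow> 'r) \<Rightarrow> 'r" where "m = ?l"
    have m: "sesquilinear (dual ?D) m" using l by (simp only: m_def)
    have m_sym: "m \<phi> \<psi> = - \<epsilon> * bar (m \<psi> \<phi>)" if "\<phi> \<in> carrier (dual ?D)" "\<psi> \<in> carrier (dual ?D)" for \<phi> \<psi>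
      unfolding m_def by (rule sym[OF that])
    have m_even: "\<exists>c. m \<phi> \<phi> = c + - \<epsilon> * bar c" if "\<phi> \<in> carrier (dual ?D)" for \<phi>
      unfolding m_def by (rule even[OF that])
    obtain \<chi> where c: "sesquilinear (dual ?D) \<chi>" "\<And>\<phi> \<psi>. \<phi> \<in> carrier (dual ?D) \<Longrightarrow>
        \<psi> \<in> carrier (dual ?D) \<Longrightarrow> m \<phi> \<psi> = \<chi> \<phi> \<psi> + - \<epsilon> * bar (\<chi> \<psi> \<phi>)"
      by (rule even_splitting[OF fg_free_dual[OF D] m is_sign_minus[OF sign] m_sym m_even]) blast+
    show ?thesis by (rule that[OF c(1) c(2)[unfolded m_def]])
  qed
  obtain \<delta>\<psi> where \<delta>\<psi>: "is_hom (dual ?D) ?D \<delta>\<psi>"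
    "\<And>\<phi> \<psi>. \<phi> \<in> carrier (dual ?D) \<Longrightarrow> \<psi> \<in> carrier (dual ?D) \<Longrightarrow> \<phi> (\<delta>\<psi> \<psi>) = \<chi> \<phi> \<psi>"
    by (rule sesquilinear_dual_represent[OF D \<chi>(1)]) blast
  \<comment> \<open>The symmetrisation of \<open>\<delta>\<psi>\<close> that occurs in
    \<open>null_map\<close> is \<open>\<Delta>\<close> itself.\<close>
  have \<Delta>\<psi>: "\<delta>\<psi> \<psi> + scale ?D (- \<epsilon>) (codual_map ?D \<delta>\<psi> \<psi>) = \<Delta> \<psi>" if \<psi>: "\<psi> \<in> carrier (dual ?D)" for \<psi>
  proof (rule dual_separates[OF D])
    note c = codual_map_closed[OF D \<delta>\<psi>(1) \<psi>] note c' = hom_closed[OF \<delta>\<psi>(1) \<psi>]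
    show "\<delta>\<psi> \<psi> + scale ?D (- \<epsilon>) (codual_map ?D \<delta>\<psi> \<psi>) \<in> carrier ?D" by (rule D.add_closed[OF c' D.scale_closed[OF c]])
    show "\<Delta> \<psi> \<in> carrier ?D" by (rule \<Delta>c[OF \<psi>])
    fix \<phi> assume \<phi>: "\<phi> \<in> carrier (dual ?D)"
    show "\<phi> (\<delta>\<psi> \<psi> + scale ?D (- \<epsilon>) (codual_map ?D \<delta>\<psi> \<psi>)) = \<phi> (\<Delta> \<psi>)"
      unfolding dual_add[OF \<phi> c' D.scale_closed[OF c]] dual_scale[OF \<phi> c]
        codual_map_apply[OF D \<delta>\<psi>(1) \<psi> \<phi>] \<delta>\<psi>(2)[OF \<phi> \<psi>] \<delta>\<psi>(2)[OF \<psi> \<phi>] \<chi>(2)[OF \<phi> \<psi>] ..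
  qed
  define j where "j = (\<lambda>x :: 'm. (x, 0 :: 'r univ))"
  have j: "is_hom E.T ?D j" by (auto simp: is_hom_def j_def L.zero_closed)
  have dj: "dual_map E.T j \<phi> = (\<lambda>x. \<phi> (x, 0))" if \<phi>: "\<phi> \<in> carrier (dual ?D)" for \<phi>
    using dual_outside[OF dual_fst[OF mm \<phi>]] by (auto simp: dual_map_def zero_outside_def j_def fun_eq_iff)
  let ?N = "null_map \<epsilon> E ?D j \<delta>\<psi>"
  have N: "?N (x, \<phi>) = (E.d x + E.pd (\<lambda>x. \<phi> (x, 0)), (- scale E.T \<epsilon> x + fst (\<Delta> \<phi>), snd (\<Delta> \<phi>)))"
    if "x \<in> carrier E.T" "\<phi> \<in> carrier (dual ?D)" for x \<phi>
    using \<Delta>\<psi>[OF that(2)] dj[OF that(2)] that(1)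
    by (simp add: null_map_def prod_eq_iff j_def E.T.scale_minus_left)
  have sT: "scale E.T \<epsilon> (scale E.T \<epsilon> x) = x" if "x \<in> carrier E.T" for x
    using that by (simp add: E.T.scale_scale sign_square[OF sign] E.T.scale_one)
  have sB: "scale E.B \<epsilon> (scale E.B \<epsilon> x) = x" if "x \<in> carrier E.B" for x
    using that by (simp add: E.B.scale_scale sign_square[OF sign] E.B.scale_one)
  have mS: "left_module (E.T \<boxplus> dual ?D)" by (rule left_module_dsum[OF E.T_module DD.left_module_axioms])
  have iso: "is_iso (E.T \<boxplus> dual ?D) (E.B \<boxplus> ?D) ?N"
  proof (rule is_isoI[OF mS])
    have q: "is_hom (E.T \<boxplus> dual ?D) E.T fst" "is_hom (E.T \<boxplus> dual ?D) (dual ?D) snd" by (auto simp: is_hom_def)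
    have q': "is_hom ?D E.T fst" "is_hom ?D L snd" by (auto simp: is_hom_def)
    show "is_hom (E.T \<boxplus> dual ?D) (E.B \<boxplus> ?D) ?N"
    proof (rule hom_cong[OF _ mS])
      show "is_hom (E.T \<boxplus> dual ?D) (E.B \<boxplus> ?D) (\<lambda>z. (E.d (fst z) + E.pd (\<lambda>x. snd z (x, 0)),
          (- scale E.T \<epsilon> (fst z) + fst (\<Delta> (snd z)), snd (\<Delta> (snd z)))))"
        by (intro hom_Pair hom_plus[OF E.B_module] hom_plus[OF E.T_module] hom_uminus[OF E.T_module]
            hom_sign[OF E.T_module sign q(1)] hom_comp[OF q(1) E.d_hom]
            hom_comp[OF hom_comp[OF q(2) dual_fst_hom[OF mm]] E.pd_hom]
            hom_comp[OF hom_comp[OF q(2) \<Delta>h] q'(1)] hom_comp[OF hom_comp[OF q(2) \<Delta>h] q'(2)])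
    qed (auto simp: N)
  next
    fix z assume "z \<in> carrier (E.T \<boxplus> dual ?D)" and 0: "?N z = 0"
    then obtain x \<phi> where z: "z = (x, \<phi>)" "x \<in> carrier E.T" "\<phi> \<in> carrier (dual ?D)" by auto
    note f = dual_fst[OF mm z(3)] and t = dual_snd[OF mm z(3)]
    have 1: "E.d x + E.pd (\<lambda>x. \<phi> (x, 0)) = 0" and 2: "fst (\<Delta> \<phi>) = scale E.T \<epsilon> x" and 3: "snd (\<Delta> \<phi>) = 0"
      using 0 unfolding z(1) N[OF z(2,3)] by (simp_all add: zero_prod_def)
    \<comment> \<open>Up to sign this is the first row of the matrix, so its vanishing puts the pair
      into \<open>?G\<close>. The other rows say that the element of \<open>H\<close> over
      \<open>\<phi>\<close> has \<open>scale E.T \<epsilon> x\<close> as its entry in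
      \<open>E.T\<close> and zero in \<open>L\<close>; hence that element lies in the second
      lagrangian as well and is zero.\<close>
    have "cone_out n E (scale E.T \<epsilon> x, \<lambda>x. \<phi> (x, 0)) = scale E.B \<epsilon> (E.d x + E.pd (\<lambda>x. \<phi> (x, 0)))"
      using z(2) f by (simp add: E.cone_out_eq hom_scale[OF E.d_hom] E.B.scale_add_right E.homs_closed)
    then have "(scale E.T \<epsilon> x, \<lambda>x. \<phi> (x, 0)) \<in> ?G"
      using exact_complexD(2)[OF ex E.T.scale_closed[OF z(2)] f] 1 by (metis E.B.scale_zero_right imageI)
    then have "((scale E.T \<epsilon> x, \<lambda>x. \<phi> (x, 0)), (0, \<lambda>y. \<phi> (0, y))) \<in> ?G \<times> ({0} \<times> carrier (dual L))"
      using t by simp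
    moreover have "((scale E.T \<epsilon> x, \<lambda>x. \<phi> (x, 0)), (0, \<lambda>y. \<phi> (0, y))) \<in> H"
      using \<Delta>H[OF z(3)] unfolding 2 3 .
    ultimately have e: "((scale E.T \<epsilon> x, \<lambda>x. \<phi> (x, 0)), (0 :: 'r univ, \<lambda>y. \<phi> (0, y))) = 0"
      using C2(3) by blast
    then have "x = 0" using sT[OF z(2)] by (simp add: zero_prod_def)
    moreover have "\<phi> = 0" by (rule dual_dsum_zero[OF mm z(3)]) (use e in \<open>simp_all add: zero_prod_def\<close>)
    ultimately show "z = 0" using z(1) by (simp add: zero_prod_def)
  next
    fix w assume "w \<in> carrier (E.B \<boxplus> ?D)"
    then obtain b x y where w: "w = (b, (x, y))" "b \<in> carrier E.B" "x \<in> carrier E.T" "y \<in> carrier L" by auto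
    have "scale E.B \<epsilon> b + E.d x \<in> carrier E.B" using w by (simp add: E.B.closed E.homs_closed)
    then obtain a f0 where a: "a \<in> carrier E.T" "f0 \<in> carrier (dual E.T)" "cone_out n E (a, f0) = scale E.B \<epsilon> b + E.d x"
      using exact_complexD(3)[OF ex] by blast
    have "((a, f0), (y, 0)) \<in> carrier ?M" using a w by (simp add: DL.zero_closed)
    then obtain h g s where hgs: "h \<in> H" "g \<in> carrier (dual E.B)" "s \<in> carrier (dual L)"
      "((a, f0), (y, 0)) = h + (cone_in E g, (0, s))" using C2(4) by blast
    obtain a' f y' t where h: "h = ((a', f), (y', t))" by (metis prod.exhaust)
    have y': "y' = y" and af: "(a, f0) = (a', f) + cone_in E g" using hgs(4) by (simp_all add: h)
    have hM: "a' \<in> carrier E.T" "f \<in> carrier (dual E.T)" "t \<in> carrier (dual L)" using HM[OF hgs(1)] by (simp_all add: h)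
    have ca: "cone_out n E (a', f) = scale E.B \<epsilon> b + E.d x"
      using a(3) E.cone_out_in[OF hgs(2)] hom_add[OF E.cone_out_hom, of "(a', f)" "cone_in E g"]
        hom_closed[OF E.cone_in_hom hgs(2)] hM unfolding af by simp
    define \<phi> where "\<phi> = dual_pair E.T L f t"
    have \<phi>: "\<phi> \<in> carrier (dual ?D)" unfolding \<phi>_def by (rule dual_pair_closed[OF mm hM(2,3)])
    have \<phi>1: "(\<lambda>x. \<phi> (x, 0)) = f" and \<phi>2: "(\<lambda>y. \<phi> (0, y)) = t"
      unfolding \<phi>_def using dual_pair_fst[OF mm hM(2,3)] dual_pair_snd[OF mm hM(2,3)] .
    have D\<phi>: "\<Delta> \<phi> = (a', y)" by (rule \<Delta>eq[OF \<phi>]) (use hgs(1) in \<open>simp only: \<phi>1 \<phi>2 h y'\<close>)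
    define x0 where "x0 = scale E.T \<epsilon> (a' - x)"
    have x0: "x0 \<in> carrier E.T" using hM w by (simp add: x0_def E.T.closed)
    have sx0: "scale E.T \<epsilon> x0 = a' - x" unfolding x0_def by (rule sT[OF E.T.diff_closed[OF hM(1) w(3)]])
    have "E.d a' + scale E.B \<epsilon> (E.pd f) = scale E.B \<epsilon> b + E.d x" using ca by (simp add: E.cone_out_eq)
    then have "scale E.B \<epsilon> (E.d a' + scale E.B \<epsilon> (E.pd f)) = scale E.B \<epsilon> (scale E.B \<epsilon> b + E.d x)" by simp
    then have "scale E.B \<epsilon> (E.d a') + E.pd f = b + scale E.B \<epsilon> (E.d x)"
      using hM w by (simp add: E.B.scale_add_right E.homs_closed E.B.closed sB)
    then have "E.d x0 + E.pd f = b"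
      using hM w by (simp add: x0_def hom_scale[OF E.d_hom] hom_diff[OF E.T_module E.d_hom] E.T.closed
          E.B.scale_diff_right E.homs_closed algebra_simps)
    then have "?N (x0, \<phi>) = w" unfolding N[OF x0 \<phi>] \<phi>1 D\<phi> sx0 by (simp add: w(1))
    then show "\<exists>z\<in>carrier (E.T \<boxplus> dual ?D). ?N z = w" using x0 \<phi> by (intro bexI[of _ "(x0, \<phi>)"]) simp_all
  qed
  have "is_null_cobordism \<epsilon> E ?D j \<delta>\<psi>"
    unfolding is_null_cobordism_def using D j \<delta>\<psi>(1) iso by blast
  from null_cobordism_transport[OF E.T_free E.B_module sign this] show ?thesis
    using that unfolding \<epsilon>_def by blast
qed

lemma cobordant_iff_formation_equiv:
  fixes C :: "('r::ring_involution, 'm::ab_group_add) qcomplex" and C' :: "('r, 'n::ab_group_add) qcomplex"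
  assumes C: "is_qcomplex n C" and C': "is_qcomplex n C'"
  shows "cobordant n C C' \<longleftrightarrow> formation_equiv ((-1) ^ n) (formation_of n C) (formation_of n C')"
proof -
  define \<epsilon> :: 'r where "\<epsilon> = (-1) ^ n"
  have sign: "is_sign \<epsilon>" by (simp add: \<epsilon>_def is_sign_power)
  let ?E = "qcomplex_sum C (qcomplex_neg C')"
  note N' = is_qcomplex_neg[OF C']
  have E: "is_qcomplex n ?E" by (rule is_qcomplex_sum[OF C N'])
  note F = is_formation_of[OF C, folded \<epsilon>_def] is_formation_of[OF C', folded \<epsilon>_def]
    is_formation_of[OF N', folded \<epsilon>_def] is_formation_of[OF E, folded \<epsilon>_def]
    is_formation_sum[OF _ _ sign] is_formation_neg[OF _ sign]
  have i: "formation_isomorphic (formation_of n ?E) (formation_sum (formation_of n C) (formation_neg (formation_of n C')))"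
    by (rule formation_isomorphic_trans[OF formation_of_sum[OF C N']
          formation_isomorphic_sum[OF formation_isomorphic_refl formation_of_neg[OF C']]])
  have i': "formation_isomorphic (formation_sum (formation_of n C) (formation_neg (formation_of n C'))) (formation_of n ?E)"
    by (rule is_formation_isomorphic_sym[OF i F(4)])
  have "formation_equiv \<epsilon> (formation_of n C) (formation_of n C') \<longleftrightarrow>
      null_formation \<epsilon> (formation_sum (formation_of n C) (formation_neg (formation_of n C')))"
    by (rule formation_equiv_iff_null[OF sign F(1,2)])
  also have "\<dots> \<longleftrightarrow> null_formation \<epsilon> (formation_of n ?E)"
    using null_formation_iso[OF sign _ i] null_formation_iso[OF sign _ i'] F by blast
  also have "\<dots> \<longleftrightarrow> cobordant n C C'"
  proof
    assume "null_formation \<epsilon> (formation_of n ?E)"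
    then obtain D :: "('r, 'r univ) lmodule" and J \<delta> where N: "is_null_cobordism \<epsilon> ?E D J \<delta>"
      using null_formation_null_cobordism[OF E] unfolding \<epsilon>_def by blast
    have J: "is_hom (ctop C \<boxplus> ctop C') D J" and D: "fg_free D" and \<delta>: "is_hom (dual D) D \<delta>"
      and iso: "is_iso (ctop ?E \<boxplus> dual D) (cbot ?E \<boxplus> D) (null_map \<epsilon> ?E D J \<delta>)"
      using N by (simp_all add: is_null_cobordism_def qcomplex_sum_def qcomplex_neg_def)
    have m: "left_module (ctop C)" "left_module (ctop C')"
      using C C' fg_free_module by (auto simp: is_qcomplex_def)
    note z = left_module.zero_closed[OF m(1)] left_module.zero_closed[OF m(2)]
    \<comment> \<open>A null cobordism of the sum comes with a single map on
      \<open>ctop C \<boxplus> ctop C'\<close>; its restrictions to the two summands are the maps of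
      the cobordism.\<close>
    have j: "is_hom (ctop C) D (\<lambda>x. J (x, 0))"
      by (rule is_homI) (use hom_closed[OF J] hom_add[OF J, of "(_, 0)" "(_, 0)"] hom_scale[OF J, of "(_, 0)"] in
          \<open>simp_all add: z left_module.scale_zero_right[OF m(2)]\<close>)
    have j': "is_hom (ctop C') D (\<lambda>y. J (0, y))"
      by (rule is_homI) (use hom_closed[OF J] hom_add[OF J, of "(0, _)" "(0, _)"] hom_scale[OF J, of "(0, _)"] in
          \<open>simp_all add: z left_module.scale_zero_right[OF m(1)]\<close>)
    let ?J = "\<lambda>(x, y). J (x, 0) + J (0, y)"
    have JJ: "?J z = J z" if "z \<in> carrier (ctop C \<boxplus> ctop C')" for z
      using that hom_add[OF J, of "(fst z, 0)" "(0, snd z)"] by (auto simp: z)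
    have eq: "null_map \<epsilon> ?E D ?J \<delta> w = null_map \<epsilon> ?E D J \<delta> w" if w: "w \<in> carrier (ctop ?E \<boxplus> dual D)" for w
    proof -
      have T: "ctop ?E = ctop C \<boxplus> ctop C'" by (simp add: qcomplex_sum_def qcomplex_neg_def)
      have "dual_map (ctop ?E) ?J g = dual_map (ctop ?E) J g" for g
      proof
        fix z show "dual_map (ctop ?E) ?J g z = dual_map (ctop ?E) J g z"
          by (cases "z \<in> carrier (ctop C \<boxplus> ctop C')")
            (simp_all add: T dual_map_def JJ del: carrier_dsum)
      qed
      moreover obtain x t where "w = (x, t)" "x \<in> carrier (ctop C \<boxplus> ctop C')"
        using w by (auto simp: qcomplex_sum_def qcomplex_neg_def)
      ultimately show ?thesis by (simp only: null_map_def prod.case JJ)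
    qed
    have mE: "left_module (ctop ?E \<boxplus> dual D)"
      using left_module_dsum[OF left_module_dsum[OF m] left_module_dual[OF fg_free_module[OF D]]]
      by (simp add: qcomplex_sum_def qcomplex_neg_def)
    have "is_iso (ctop ?E \<boxplus> dual D) (cbot ?E \<boxplus> D) (null_map \<epsilon> ?E D ?J \<delta>)"
      by (rule iso_cong[OF iso mE eq[symmetric]])
    moreover have "is_hom (ctop ?E) D ?J"
      using hom_cong[OF J left_module_dsum[OF m] JJ[symmetric]] by (simp add: qcomplex_sum_def qcomplex_neg_def)
    ultimately have "is_null_cobordism \<epsilon> ?E D ?J \<delta>"
      using D \<delta> by (simp add: is_null_cobordism_def)
    then have "is_cobordism n C C' D (\<lambda>x. J (x, 0)) (\<lambda>y. J (0, y)) \<delta>"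
      using is_cobordism_iff_null[OF C C' D j j' \<delta>] by (simp add: \<epsilon>_def)
    then show "cobordant n C C'" unfolding cobordant_def by blast
  next
    assume "cobordant n C C'"
    then obtain D :: "('r, 'r univ) lmodule" and j j' \<delta> where cob: "is_cobordism n C C' D j j' \<delta>"
      by (auto simp: cobordant_def)
    then have "is_null_cobordism ((-1) ^ n) ?E D (\<lambda>(x, y). j x + j' y) \<delta>"
      using is_cobordism_iff_null[OF C C', of D j j' \<delta>] by (simp add: is_cobordism_def)
    then show "null_formation \<epsilon> (formation_of n ?E)"
      unfolding \<epsilon>_def by (rule null_cobordism_null_formation[OF E])
  qed
  finally show ?thesis unfolding \<epsilon>_def by blast
qed

section \<open>The cobordism group\<close>

text \<open>From here on cobordism is equality of an invariant. That it is an equivalence relation,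
  compatible with sums, is then inherited from the formation group.\<close>

lemma cobordant_iff_class:
  assumes "is_qcomplex n C" "is_qcomplex n C'"
  shows "cobordant n C C' \<longleftrightarrow>
    formation_class ((-1) ^ n) (formation_of n C) = formation_class ((-1) ^ n) (formation_of n C')"
  using cobordant_iff_formation_equiv[OF assms]
    formation_class_eq_iff[OF is_sign_power is_formation_of[OF assms(1)] is_formation_of[OF assms(2)]] by simp

text \<open>Serves twice: for surjectivity on classes, and to show that the class of a complex over
  another type contains a complex over \<open>'r univ\<close>.\<close>

lemma qcomplex_representative:
  fixes X :: "('r::ring_involution, 'm::ab_group_add) formation"
  assumes "is_formation ((-1) ^ n) X"
  obtains Z :: "('r, 'r univ) qcomplex" where "is_qcomplex n Z"
    "formation_class ((-1) ^ n) (formation_of n Z) = formation_class ((-1) ^ n) X"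
proof -
  obtain Z :: "('r, 'r univ) qcomplex" where Z: "is_qcomplex n Z" "formation_isomorphic X (formation_of n Z)"
    using formation_from_qcomplex[OF assms] .
  show ?thesis
    by (rule that[OF Z(1) formation_class_iso[OF is_sign_power Z(2) assms is_formation_of[OF Z(1)], symmetric]])
qed

lemma equiv_cobordism_rel: "equiv (Collect (is_qcomplex n)) (cobordism_rel n)"
proof (rule equivI)
  show "refl_on (Collect (is_qcomplex n)) (cobordism_rel n)"
    by (auto simp: refl_on_def cobordism_rel_def cobordant_iff_class)
  show "sym (cobordism_rel n)"
    by (auto simp: sym_def cobordism_rel_def cobordant_iff_class)
  show "trans (cobordism_rel n)"
    by (auto simp: trans_def cobordism_rel_def cobordant_iff_class)
qed (auto simp: cobordism_rel_def)

lemma cobordism_class_rel: "is_qcomplex n C \<Longrightarrow> cobordism_class n C = cobordism_rel n `` {C}"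
  by (auto simp: cobordism_class_def cobordism_rel_def)

lemma cobordism_class_mem:
  fixes C :: "('r::ring_involution, 'm::ab_group_add) qcomplex"
  assumes "is_qcomplex n C"
  shows "Z \<in> cobordism_class n C \<longleftrightarrow> is_qcomplex n Z \<and>
    formation_class ((-1) ^ n) (formation_of n Z) = formation_class ((-1) ^ n) (formation_of n C)"
  using cobordant_iff_class[OF assms, of Z] by (auto simp: cobordism_class_def)

lemma cobordism_class_nonempty:
  fixes C :: "('r::ring_involution, 'm::ab_group_add) qcomplex"
  assumes C: "is_qcomplex n C"
  obtains Z where "Z \<in> cobordism_class n C"
proof -
  obtain Z :: "('r, 'r univ) qcomplex" where "is_qcomplex n Z"
    "formation_class ((-1) ^ n) (formation_of n Z) = formation_class ((-1) ^ n) (formation_of n C)"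
    by (rule qcomplex_representative[OF is_formation_of[OF C]])
  then show ?thesis using that cobordism_class_mem[OF C] by blast
qed

lemma cobordism_class_eq_iff:
  fixes C :: "('r::ring_involution, 'm::ab_group_add) qcomplex" and C' :: "('r, 'n::ab_group_add) qcomplex"
  assumes C: "is_qcomplex n C" and C': "is_qcomplex n C'"
  shows "cobordism_class n C = cobordism_class n C' \<longleftrightarrow> cobordant n C C'"
proof
  assume eq: "cobordism_class n C = cobordism_class n C'"
  obtain Z where Z: "Z \<in> cobordism_class n C" using cobordism_class_nonempty[OF C] .
  then have "Z \<in> cobordism_class n C'" by (simp only: eq)
  with Z show "cobordant n C C'"
    by (simp add: cobordism_class_mem[OF C] cobordism_class_mem[OF C'] cobordant_iff_class[OF C C'])
next
  assume "cobordant n C C'"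
  then show "cobordism_class n C = cobordism_class n C'"
    by (auto simp: cobordism_class_mem[OF C] cobordism_class_mem[OF C'] cobordant_iff_class[OF C C'])
qed

lemma cobordism_class_carrier:
  fixes C :: "('r::ring_involution, 'm::ab_group_add) qcomplex"
  assumes C: "is_qcomplex n C"
  shows "cobordism_class n C \<in> carrier (L_odd n)"
proof -
  obtain Z where Z: "Z \<in> cobordism_class n C" using cobordism_class_nonempty[OF C] .
  then have "is_qcomplex n Z" "cobordant n C Z" by (simp_all add: cobordism_class_def)
  moreover from this have "cobordism_class n C = cobordism_class n Z"
    by (simp add: cobordism_class_eq_iff[OF C])
  ultimately show ?thesis
    by (simp add: L_odd_def cobordism_class_rel quotientI)
qed

lemma L_odd_elim:
  fixes A :: "('r::ring_involution, 'r univ) qcomplex set"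
  assumes "A \<in> carrier (L_odd n)"
  obtains C :: "('r, 'r univ) qcomplex" where "is_qcomplex n C" "A = cobordism_class n C"
proof -
  from assms obtain C :: "('r, 'r univ) qcomplex" where C: "is_qcomplex n C" "A = cobordism_rel n `` {C}"
    by (auto simp: L_odd_def quotient_def)
  then show ?thesis using that[OF C(1)] by (simp add: cobordism_class_rel)
qed

lemma formation_class_of_sum:
  assumes C: "is_qcomplex n C" and C': "is_qcomplex n C'"
  shows "formation_class ((-1) ^ n) (formation_of n (qcomplex_sum C C'))
    = formation_class ((-1) ^ n) (formation_of n C)
        \<otimes>\<^bsub>formation_group ((-1) ^ n)\<^esub> formation_class ((-1) ^ n) (formation_of n C')"
  unfolding formation_class_mult[OF is_sign_power is_formation_of[OF C] is_formation_of[OF C']]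
  by (rule formation_class_iso[OF is_sign_power formation_of_sum[OF C C'] is_formation_of[OF is_qcomplex_sum[OF C C']]
        is_formation_sum[OF is_formation_of[OF C] is_formation_of[OF C'] is_sign_power]])

lemma cobordism_class_mult:
  fixes C :: "('r::ring_involution, 'm::ab_group_add) qcomplex" and C' :: "('r, 'n::ab_group_add) qcomplex"
  assumes C: "is_qcomplex n C" and C': "is_qcomplex n C'"
  shows "cobordism_class n C \<otimes>\<^bsub>L_odd n\<^esub> cobordism_class n C' = cobordism_class n (qcomplex_sum C C')"
proof -
  have eq: "cobordism_class n (qcomplex_sum Z Z') = cobordism_class n (qcomplex_sum C C')"
    if "Z \<in> cobordism_class n C" "Z' \<in> cobordism_class n C'" for Z Z'
  proof -
    have Z: "is_qcomplex n Z" "is_qcomplex n Z'"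
      and e: "formation_class ((-1) ^ n) (formation_of n Z) = formation_class ((-1) ^ n) (formation_of n C)"
        "formation_class ((-1) ^ n) (formation_of n Z') = formation_class ((-1) ^ n) (formation_of n C')"
      using that by (simp_all add: cobordism_class_mem[OF C] cobordism_class_mem[OF C'])
    have "cobordant n (qcomplex_sum Z Z') (qcomplex_sum C C')"
      unfolding cobordant_iff_class[OF is_qcomplex_sum[OF Z] is_qcomplex_sum[OF C C']]
      by (simp only: formation_class_of_sum[OF Z] formation_class_of_sum[OF C C'] e)
    then show ?thesis
      unfolding cobordism_class_eq_iff[OF is_qcomplex_sum[OF Z] is_qcomplex_sum[OF C C']] .
  qed
  obtain Z where Z: "Z \<in> cobordism_class n C" using cobordism_class_nonempty[OF C] .
  obtain Z' where Z': "Z' \<in> cobordism_class n C'" using cobordism_class_nonempty[OF C'] .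
  show ?thesis
    unfolding L_odd_def using eq Z Z' by auto
qed

lemma formation_class_map_class:
  fixes C :: "('r::ring_involution, 'm::ab_group_add) qcomplex"
  assumes C: "is_qcomplex n C"
  shows "formation_class_map n (cobordism_class n C) = formation_class ((-1) ^ n) (formation_of n C)"
proof -
  obtain Z where "Z \<in> cobordism_class n C" using cobordism_class_nonempty[OF C] .
  then show ?thesis
    unfolding formation_class_map_def using cobordism_class_mem[OF C] by auto
qed

lemma formation_class_map_inj:
  fixes A B :: "('r::ring_involution, 'r univ) qcomplex set"
  assumes "A \<in> carrier (L_odd n)" "B \<in> carrier (L_odd n)"
    and "formation_class_map n A = formation_class_map n B"
  shows "A = B"
proof -
  obtain C :: "('r, 'r univ) qcomplex" where C: "is_qcomplex n C" "A = cobordism_class n C"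
    using L_odd_elim[OF assms(1)] .
  obtain C' :: "('r, 'r univ) qcomplex" where C': "is_qcomplex n C'" "B = cobordism_class n C'"
    using L_odd_elim[OF assms(2)] .
  show ?thesis
    using assms(3) unfolding C(2) C'(2) cobordism_class_eq_iff[OF C(1) C'(1)]
    by (simp add: formation_class_map_class[OF C(1)] formation_class_map_class[OF C'(1)] cobordant_iff_class[OF C(1) C'(1)])
qed

lemma L_odd_closed:
  assumes "A \<in> carrier (L_odd n)" "B \<in> carrier (L_odd n)"
  shows "A \<otimes>\<^bsub>L_odd n\<^esub> B \<in> carrier (L_odd n)"
    and "formation_class_map n (A \<otimes>\<^bsub>L_odd n\<^esub> B)
      = formation_class_map n A \<otimes>\<^bsub>formation_group ((-1) ^ n)\<^esub> formation_class_map n B"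
proof -
  obtain C :: "('a, 'a univ) qcomplex" where C: "is_qcomplex n C" "A = cobordism_class n C"
    using L_odd_elim[OF assms(1)] .
  obtain C' :: "('a, 'a univ) qcomplex" where C': "is_qcomplex n C'" "B = cobordism_class n C'"
    using L_odd_elim[OF assms(2)] .
  note S = is_qcomplex_sum[OF C(1) C'(1)]
  show "A \<otimes>\<^bsub>L_odd n\<^esub> B \<in> carrier (L_odd n)"
    unfolding C(2) C'(2) cobordism_class_mult[OF C(1) C'(1)] by (rule cobordism_class_carrier[OF S])
  show "formation_class_map n (A \<otimes>\<^bsub>L_odd n\<^esub> B)
      = formation_class_map n A \<otimes>\<^bsub>formation_group ((-1) ^ n)\<^esub> formation_class_map n B"
    unfolding C(2) C'(2) cobordism_class_mult[OF C(1) C'(1)] formation_class_map_class[OF S]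
      formation_class_map_class[OF C(1)] formation_class_map_class[OF C'(1)]
    by (rule formation_class_of_sum[OF C(1) C'(1)])
qed

lemma formation_class_map_carrier:
  assumes "A \<in> carrier (L_odd n)"
  shows "formation_class_map n A \<in> carrier (formation_group ((-1) ^ n))"
proof -
  obtain C :: "('a, 'a univ) qcomplex" where C: "is_qcomplex n C" "A = cobordism_class n C"
    using L_odd_elim[OF assms] .
  show ?thesis
    unfolding C(2) formation_class_map_class[OF C(1)]
    by (rule formation_class_carrier[OF is_sign_power is_formation_of[OF C(1)]])
qed

lemma formation_class_map_surj:
  fixes y :: "('r::ring_involution, 'r univ) formation set"
  assumes "y \<in> carrier (formation_group ((-1) ^ n))"
  shows "\<exists>A\<in>carrier (L_odd n). formation_class_map n A = y"
proof -
  obtain X :: "('r, 'r univ) formation" where X: "is_formation ((-1) ^ n) X" "y = formation_class ((-1) ^ n) X"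
    using formation_group_elim[OF assms] .
  obtain Z :: "('r, 'r univ) qcomplex" where Z: "is_qcomplex n Z"
    "formation_class ((-1) ^ n) (formation_of n Z) = formation_class ((-1) ^ n) X"
    using qcomplex_representative[OF X(1)] .
  show ?thesis
    using cobordism_class_carrier[OF Z(1)] formation_class_map_class[OF Z(1)] Z(2) X(2) by metis
qed

lemma zero_qcomplex:
  shows "is_qcomplex n (zero_qcomplex :: ('r::ring_involution, 'r univ) qcomplex)"
    and "formation_class ((-1) ^ n) (formation_of n (zero_qcomplex :: ('r, 'r univ) qcomplex))
      = \<one>\<^bsub>formation_group ((-1) ^ n)\<^esub>"
proof -
  let ?Z = "zero_qcomplex :: ('r, 'r univ) qcomplex" and ?M = "zero_module :: ('r, 'r univ) lmodule"
  have Z: "ctop ?Z = ?M" "cbot ?Z = ?M" "cd ?Z = (\<lambda>x. 0)" "psi0 ?Z = (\<lambda>f. 0)" "psi1 ?Z = (\<lambda>f. 0)"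
    by (simp_all add: zero_qcomplex_def)
  have pre: "pre_complex n ?Z"
    by (simp add: pre_complex_def Z fg_free_zero is_hom_def)
  have dm: "dual_map ?M (\<lambda>x. 0) f = 0" if "f \<in> carrier (dual ?M)" for f
    using that by (auto simp: carrier_dual_zero dual_map_def zero_outside_def fun_eq_iff)
  have "exact_complex n ?Z"
    unfolding exact_complex_def
    using pre dm by (auto simp: Z carrier_dual_zero cone_in_def cone_out_def zero_prod_def)
  then show C: "is_qcomplex n ?Z" by (simp add: is_qcomplex_iff_exact)
  note F = is_formation_of[OF C]
  have sign: "is_sign ((-1) ^ n :: 'r)" by (rule is_sign_power)
  have "trivial_formation ((-1) ^ n) (formation_of n ?Z)"
    unfolding trivial_formation_iff[OF sign]
    using F complementary_trivial(1)[OF formation_module[OF F]] dm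
    by (simp add: formation_of_def Z carrier_dual_zero zero_prod_def)
  from formation_equiv_zero[OF sign F null_formation_trivial[OF sign this]]
  show "formation_class ((-1) ^ n) (formation_of n ?Z) = \<one>\<^bsub>formation_group ((-1) ^ n)\<^esub>"
    by (simp add: formation_group_one formation_class_eq_iff[OF sign F is_formation_zero[OF sign]])
qed

lemma L_odd_one:
  "\<one>\<^bsub>L_odd n\<^esub> \<in> carrier (L_odd n :: ('r::ring_involution, 'r univ) qcomplex set monoid)"
  "formation_class_map n \<one>\<^bsub>L_odd n :: ('r, 'r univ) qcomplex set monoid\<^esub> = \<one>\<^bsub>formation_group ((-1) ^ n)\<^esub>"
proof -
  have one: "\<one>\<^bsub>L_odd n\<^esub> = cobordism_class n (zero_qcomplex :: ('r, 'r univ) qcomplex)"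
    by (simp add: L_odd_def)
  show "\<one>\<^bsub>L_odd n\<^esub> \<in> carrier (L_odd n :: ('r, 'r univ) qcomplex set monoid)"
    unfolding one by (rule cobordism_class_carrier[OF zero_qcomplex(1)])
  show "formation_class_map n \<one>\<^bsub>L_odd n :: ('r, 'r univ) qcomplex set monoid\<^esub> = \<one>\<^bsub>formation_group ((-1) ^ n)\<^esub>"
    unfolding one formation_class_map_class[OF zero_qcomplex(1)] by (rule zero_qcomplex(2))
qed

text \<open>\<open>formation_class_map\<close> is injective, multiplicative and preserves the unit,
  so associativity, commutativity and the unit law are pulled back from the formation group.
  Surjectivity provides inverses.\<close>

lemma comm_group_L_odd: "comm_group (L_odd n :: ('r::ring_involution, 'r univ) qcomplex set monoid)"
proof -
  let ?L = "L_odd n :: ('r, 'r univ) qcomplex set monoid"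
  interpret G: comm_group "formation_group ((-1) ^ n) :: ('r, 'r univ) formation set monoid"
    by (rule comm_group_formation_group[OF is_sign_power])
  note S = L_odd_closed and O = L_odd_one and c = formation_class_map_carrier
  show ?thesis
  proof (rule comm_groupI)
    fix x y z assume "x \<in> carrier ?L" "y \<in> carrier ?L" "z \<in> carrier ?L"
    then show "x \<otimes>\<^bsub>?L\<^esub> y \<otimes>\<^bsub>?L\<^esub> z = x \<otimes>\<^bsub>?L\<^esub> (y \<otimes>\<^bsub>?L\<^esub> z)"
      by (intro formation_class_map_inj[of _ n]) (simp_all add: S c G.m_assoc)
  next
    fix x y assume "x \<in> carrier ?L" "y \<in> carrier ?L"
    then show "x \<otimes>\<^bsub>?L\<^esub> y = y \<otimes>\<^bsub>?L\<^esub> x"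
      by (intro formation_class_map_inj[of _ n]) (simp_all add: S c G.m_comm)
  next
    fix x assume x: "x \<in> carrier ?L"
    then show "\<one>\<^bsub>?L\<^esub> \<otimes>\<^bsub>?L\<^esub> x = x"
      by (intro formation_class_map_inj[of _ n]) (simp_all add: S O c)
    obtain y where y: "y \<in> carrier ?L"
      "formation_class_map n y = inv\<^bsub>formation_group ((-1) ^ n)\<^esub> (formation_class_map n x)"
      using formation_class_map_surj[OF G.inv_closed[OF c[OF x]]] by blast
    have "y \<otimes>\<^bsub>?L\<^esub> x = \<one>\<^bsub>?L\<^esub>"
      by (rule formation_class_map_inj[of _ n]) (use x y in \<open>simp_all add: S O c\<close>)
    with y(1) show "\<exists>y\<in>carrier ?L. y \<otimes>\<^bsub>?L\<^esub> x = \<one>\<^bsub>?L\<^esub>" by blast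
  qed (simp_all add: S O)
qed

lemma cobordism_class_inv:
  fixes C :: "('r::ring_involution, 'm::ab_group_add) qcomplex"
  assumes C: "is_qcomplex n C"
  shows "inv\<^bsub>L_odd n\<^esub> (cobordism_class n C) = cobordism_class n (qcomplex_neg C)"
proof -
  have N: "is_qcomplex n (qcomplex_neg C)" by (rule is_qcomplex_neg[OF C])
  note F = is_formation_of[OF C] is_formation_of[OF N] is_formation_neg[OF is_formation_of[OF C] is_sign_power]
  note c = cobordism_class_carrier[OF C] cobordism_class_carrier[OF N]
  have e: "formation_class ((-1) ^ n) (formation_of n (qcomplex_neg C))
      = formation_class ((-1) ^ n) (formation_neg (formation_of n C))"
    by (rule formation_class_iso[OF is_sign_power formation_of_neg[OF C] F(2,3)])
  have "cobordism_class n (qcomplex_neg C) \<otimes>\<^bsub>L_odd n\<^esub> cobordism_class n C = \<one>\<^bsub>L_odd n\<^esub>"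
    by (rule formation_class_map_inj[OF L_odd_closed(1)[OF c(2,1)] L_odd_one(1)])
      (simp add: L_odd_closed(2)[OF c(2,1)] L_odd_one(2) formation_class_map_class[OF C]
        formation_class_map_class[OF N] e formation_class_inverse[OF is_sign_power F(1)])
  then show ?thesis
    by (rule group.inv_equality[OF comm_group.axioms(2)[OF comm_group_L_odd] _ c])
qed

lemma formation_class_map_iso:
  "formation_class_map n \<in> iso (L_odd n :: ('r::ring_involution, 'r univ) qcomplex set monoid)
     (formation_group ((-1) ^ n))"
proof (rule isoI)
  show "formation_class_map n \<in> hom (L_odd n :: ('r, 'r univ) qcomplex set monoid) (formation_group ((-1) ^ n))"
    by (rule homI) (simp_all add: formation_class_map_carrier L_odd_closed)
  show "bij_betw (formation_class_map n) (carrier (L_odd n :: ('r, 'r univ) qcomplex set monoid))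
      (carrier (formation_group ((-1) ^ n)))"
  proof (rule bij_betw_imageI)
    show "inj_on (formation_class_map n) (carrier (L_odd n :: ('r, 'r univ) qcomplex set monoid))"
      by (rule inj_onI) (rule formation_class_map_inj)
    show "formation_class_map n ` carrier (L_odd n :: ('r, 'r univ) qcomplex set monoid)
        = carrier (formation_group ((-1) ^ n))"
    proof (intro equalityI subsetI)
      fix y :: "('r, 'r univ) formation set"
      assume "y \<in> carrier (formation_group ((-1) ^ n))"
      from formation_class_map_surj[OF this]
      show "y \<in> formation_class_map n ` carrier (L_odd n)" by blast
    qed (auto simp: formation_class_map_carrier)
  qed
qed

text \<open>Complexes and formations over arbitrary types are included because a direct sum lives
  over a product type, while the elements of both groups are sets over \<open>'r univ\<close>. The
  clauses on classes describe addition and inverses by representatives, and the last one says that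
  the isomorphism is induced by the correspondence from complexes to formations.\<close>

theorem proposition9p11:
  fixes n :: nat and \<epsilon> :: "'r::ring_involution"
  assumes rank: "rank_well_defined TYPE('r)"
    and eps: "\<epsilon> = (-1) ^ n"
  shows
    "equiv (Collect (is_qcomplex n)) (cobordism_rel n :: (('r, 'r univ) qcomplex \<times> _) set)
     \<and> comm_group (L_odd n :: ('r, 'r univ) qcomplex set monoid)
     \<and> (\<forall>(C :: ('r, 'a::ab_group_add) qcomplex) (C' :: ('r, 'b::ab_group_add) qcomplex).
          is_qcomplex n C \<longrightarrow> is_qcomplex n C' \<longrightarrow>
            cobordism_class n C \<in> carrier (L_odd n)
          \<and> (cobordism_class n C = cobordism_class n C' \<longleftrightarrow> cobordant n C C')
          \<and> cobordism_class n C \<otimes>\<^bsub>L_odd n\<^esub> cobordism_class n C'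
              = cobordism_class n (qcomplex_sum C C')
          \<and> inv\<^bsub>L_odd n\<^esub> (cobordism_class n C) = cobordism_class n (qcomplex_neg C))
     \<and> equiv (Collect (is_formation \<epsilon>)) (formation_rel \<epsilon>)
     \<and> comm_group (formation_group \<epsilon>)
     \<and> (\<forall>(X :: ('r, 'p::ab_group_add) formation) (Y :: ('r, 'q::ab_group_add) formation).
          is_formation \<epsilon> X \<longrightarrow> is_formation \<epsilon> Y \<longrightarrow>
            formation_class \<epsilon> X \<in> carrier (formation_group \<epsilon>)
          \<and> (formation_class \<epsilon> X = formation_class \<epsilon> Y \<longleftrightarrow> formation_equiv \<epsilon> X Y)
          \<and> formation_class \<epsilon> X \<otimes>\<^bsub>formation_group \<epsilon>\<^esub> formation_class \<epsilon> Y
              = formation_class \<epsilon> (formation_sum X Y)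
          \<and> inv\<^bsub>formation_group \<epsilon>\<^esub> (formation_class \<epsilon> X) = formation_class \<epsilon> (formation_neg X))
     \<and> formation_class_map n \<in> iso (L_odd n) (formation_group \<epsilon>)
     \<and> (\<forall>C :: ('r, 'a) qcomplex. is_qcomplex n C \<longrightarrow>
            is_formation \<epsilon> (formation_of n C)
          \<and> formation_class_map n (cobordism_class n C) = formation_class \<epsilon> (formation_of n C))"
proof (intro conjI allI impI)
  have sign: "is_sign \<epsilon>" by (simp add: eps is_sign_power)
  show "equiv (Collect (is_qcomplex n)) (cobordism_rel n :: (('r, 'r univ) qcomplex \<times> _) set)"
    by (rule equiv_cobordism_rel)
  show "comm_group (L_odd n :: ('r, 'r univ) qcomplex set monoid)"
    by (rule comm_group_L_odd)
  show "equiv (Collect (is_formation \<epsilon>)) (formation_rel \<epsilon>)"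
    by (rule equiv_formation_rel[OF sign])
  show "comm_group (formation_group \<epsilon>)"
    by (rule comm_group_formation_group[OF sign])
  show "formation_class_map n \<in> iso (L_odd n) (formation_group \<epsilon>)"
    unfolding eps by (rule formation_class_map_iso)
  {
    fix C :: "('r, 'a) qcomplex" and C' :: "('r, 'b) qcomplex"
    assume C: "is_qcomplex n C" and C': "is_qcomplex n C'"
    show "cobordism_class n C \<in> carrier (L_odd n)"
      by (rule cobordism_class_carrier[OF C])
    show "cobordism_class n C = cobordism_class n C' \<longleftrightarrow> cobordant n C C'"
      by (rule cobordism_class_eq_iff[OF C C'])
    show "cobordism_class n C \<otimes>\<^bsub>L_odd n\<^esub> cobordism_class n C' = cobordism_class n (qcomplex_sum C C')"
      by (rule cobordism_class_mult[OF C C'])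
    show "inv\<^bsub>L_odd n\<^esub> (cobordism_class n C) = cobordism_class n (qcomplex_neg C)"
      by (rule cobordism_class_inv[OF C])
  next
    fix X :: "('r, 'p) formation" and Y :: "('r, 'q) formation"
    assume X: "is_formation \<epsilon> X" and Y: "is_formation \<epsilon> Y"
    show "formation_class \<epsilon> X \<in> carrier (formation_group \<epsilon>)"
      by (rule formation_class_carrier[OF sign X])
    show "formation_class \<epsilon> X = formation_class \<epsilon> Y \<longleftrightarrow> formation_equiv \<epsilon> X Y"
      by (rule formation_class_eq_iff[OF sign X Y])
    show "formation_class \<epsilon> X \<otimes>\<^bsub>formation_group \<epsilon>\<^esub> formation_class \<epsilon> Y = formation_class \<epsilon> (formation_sum X Y)"
      by (rule formation_class_mult[OF sign X Y])
    show "inv\<^bsub>formation_group \<epsilon>\<^esub> (formation_class \<epsilon> X) = formation_class \<epsilon> (formation_neg X)"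
      by (rule formation_class_inv[OF sign X])
  next
    fix C :: "('r, 'a) qcomplex"
    assume C: "is_qcomplex n C"
    show "is_formation \<epsilon> (formation_of n C)"
      unfolding eps by (rule is_formation_of[OF C])
    show "formation_class_map n (cobordism_class n C) = formation_class \<epsilon> (formation_of n C)"
      unfolding eps by (rule formation_class_map_class[OF C])
  }
qed

end
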